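(* Let $p$ be a prime, let $G$ be a compact semisimple $p$-adic analytic Lie group, and let $D$ be an invariant Hilbert–Smith group. Then every group homomorphism $f:G\to D$ (not assumed to be continuous) has finite image. In particular, if $\dim G\geq 1$, then $f$ cannot be a monomorphism.
   Context: A separable topological group $D$ is called invariant if its topology is induced by a bi-invariant metric. A topological group $D$ is called Hilbert–Smith if it does not admit a continuous monomorphism (injective group homomorphism) from the group $\mathbb{Z}_p$ of $p$-adic integers with its $p$-adic topology. An invariant Hilbert–Smith group is a group with both properties. A $p$-adic analytic Lie group $G$ is a $p$-adic analytic manifold (over $\mathbb{Q}_p$) equipped with $p$-adic analytic group operations; $\dim G$ is its dimension as such a manifold. Its Lie algebra $\mathfrak{g}$ is the tangent space at the identity with the Lie bracket, a Lie algebra over $\mathbb{Q}_p$. $G$ is called (semi)simple if $\mathfrak{g}$ is (semi)simple, where a Lie algebra is simple if it is non-abelian and has no non-trivial ideals, and semisimple if it is a direct sum of simple Lie algebras. *)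

theory Defs
  imports
    "HOL-Analysis.Analysis"
    "HOL-Algebra.Group"
    "HOL-Library.Function_Algebras"
    "Berlekamp_Zassenhaus.Finite_Field"
begin

section \<open>The field of $p$-adic numbers\<close>

subsection \<open>The $p$-adic absolute value on the rationals\<close>

definition padic_val :: "nat \<Rightarrow> rat \<Rightarrow> int" where
  "padic_val p x =
     int (multiplicity (int p) (fst (quotient_of x))) - int (multiplicity (int p) (snd (quotient_of x)))"

definition padic_abs :: "nat \<Rightarrow> rat \<Rightarrow> real" where
  "padic_abs p x = (if x = 0 then 0 else real p powi (- padic_val p x))"

lemma padic_abs_0 [simp]: "padic_abs p 0 = 0"
  by (simp add: padic_abs_def)

lemma padic_val_quotient:
  assumes p: "prime p" and a: "a \<noteq> 0" and b: "b \<noteq> 0"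
  shows "padic_val p (of_int a / of_int b) = int (multiplicity (int p) a) - int (multiplicity (int p) b)"
proof -
  obtain c d where cd: "quotient_of (of_int a / of_int b) = (c, d)" by fastforce
  have d: "d > 0" using quotient_of_denom_pos[OF cd] .
  have eq: "(of_int a / of_int b :: rat) = of_int c / of_int d"
    using quotient_of_div[OF cd] .
  with a b d have c: "c \<noteq> 0" by auto
  from eq a b d have "(of_int (a * d) :: rat) = of_int (c * b)"
    by (simp add: field_simps)
  hence "a * d = c * b" by linarith
  hence "multiplicity (int p) (a * d) = multiplicity (int p) (c * b)" by simp
  hence "multiplicity (int p) a + multiplicity (int p) d = multiplicity (int p) c + multiplicity (int p) b"
    using p a b c d by (simp add: prime_elem_multiplicity_mult_distrib)
  thus ?thesis unfolding padic_val_def cd by simp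
qed

lemma rat_common_denom:
  fixes x y :: rat
  obtains a b d where "d \<noteq> 0" "x = of_int a / of_int d" "y = of_int b / of_int d"
proof -
  obtain a1 d1 where 1: "quotient_of x = (a1, d1)" by fastforce
  obtain a2 d2 where 2: "quotient_of y = (a2, d2)" by fastforce
  have d: "d1 > 0" "d2 > 0"
    using quotient_of_denom_pos[OF 1] quotient_of_denom_pos[OF 2] by auto
  have "x = of_int a1 / of_int d1" "y = of_int a2 / of_int d2"
    using quotient_of_div[OF 1] quotient_of_div[OF 2] by auto
  with d have "x = of_int (a1 * d2) / of_int (d1 * d2)" "y = of_int (a2 * d1) / of_int (d1 * d2)"
    by (auto simp: field_simps)
  with d show ?thesis by (intro that[of "d1 * d2" "a1 * d2" "a2 * d1"]) auto
qed

context
  fixes p :: nat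
  assumes p: "prime p"
begin

lemma padic_abs_nonneg: "padic_abs p x \<ge> 0"
  by (simp add: padic_abs_def)

lemma padic_abs_eq_0_iff: "padic_abs p x = 0 \<longleftrightarrow> x = 0"
  using p by (auto simp: padic_abs_def prime_gt_0_nat)

lemma padic_abs_1: "padic_abs p 1 = 1"
  by (simp add: padic_abs_def padic_val_def)

lemma padic_abs_mult: "padic_abs p (x * y) = padic_abs p x * padic_abs p y"
proof (cases "x = 0 \<or> y = 0")
  case True
  thus ?thesis by auto
next
  case False
  obtain a b d where d: "d \<noteq> 0" and x: "x = of_int a / of_int d" and y: "y = of_int b / of_int d"
    by (rule rat_common_denom)
  have ab: "a \<noteq> 0" "b \<noteq> 0" using False x y by auto
  have xy: "x * y = of_int (a * b) / of_int (d * d)" by (simp add: x y)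
  let ?m = "\<lambda>k. int (multiplicity (int p) k)"
  have v: "padic_val p x = ?m a - ?m d" "padic_val p y = ?m b - ?m d"
    unfolding x y by (rule padic_val_quotient[OF p]; fact ab d)+
  have "padic_val p (x * y) = ?m (a * b) - ?m (d * d)"
    unfolding xy using ab d by (intro padic_val_quotient[OF p]) auto
  also have "\<dots> = (?m a + ?m b) - (?m d + ?m d)"
    using p ab d by (simp add: prime_elem_multiplicity_mult_distrib)
  finally have "padic_val p (x * y) = padic_val p x + padic_val p y"
    using v by linarith
  thus ?thesis
    using False prime_gt_0_nat[OF p] power_int_add[of "real p" "- padic_val p x" "- padic_val p y"]
    by (simp add: padic_abs_def del: power_int_minus)
qed

lemma padic_abs_minus: "padic_abs p (- x) = padic_abs p x"
proof -
  have "padic_abs p (-1) ^ 2 = 1"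
    using padic_abs_mult[of "-1" "-1"] by (simp add: power2_eq_square padic_abs_1)
  hence "padic_abs p (-1) = 1"
    using padic_abs_nonneg[of "-1"] by (simp add: power2_eq_1_iff)
  thus ?thesis using padic_abs_mult[of "-1" x] by simp
qed

lemma padic_abs_ultra: "padic_abs p (x + y) \<le> max (padic_abs p x) (padic_abs p y)"
proof (cases "x = 0 \<or> y = 0 \<or> x + y = 0")
  case True
  thus ?thesis using padic_abs_nonneg[of x] padic_abs_nonneg[of y] by auto
next
  case False
  obtain a b d where d: "d \<noteq> 0" and x: "x = of_int a / of_int d" and y: "y = of_int b / of_int d"
    by (rule rat_common_denom)
  have xy: "x + y = of_int (a + b) / of_int d" by (simp add: x y add_divide_distrib)
  have ab: "a \<noteq> 0" "b \<noteq> 0" "a + b \<noteq> 0" using False x y xy by auto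
  let ?m = "multiplicity (int p)"
  let ?k = "min (?m a) (?m b)"
  have nu: "\<not> is_unit (int p)" using p by (metis not_prime_unit prime_nat_int_transfer)
  have "int p ^ ?k dvd a" "int p ^ ?k dvd b"
    by (auto intro: multiplicity_dvd')
  hence "int p ^ ?k dvd a + b" by simp
  hence "?k \<le> ?m (a + b)"
    using ab(3) nu by (intro multiplicity_geI)
  moreover have "padic_val p x = int (?m a) - int (?m d)" "padic_val p y = int (?m b) - int (?m d)"
    unfolding x y by (rule padic_val_quotient[OF p]; fact ab d)+
  moreover have "padic_val p (x + y) = int (?m (a + b)) - int (?m d)"
    unfolding xy by (rule padic_val_quotient[OF p ab(3) d])
  ultimately have "min (padic_val p x) (padic_val p y) \<le> padic_val p (x + y)"
    by linarith
  hence "- padic_val p (x + y) \<le> - padic_val p x \<or> - padic_val p (x + y) \<le> - padic_val p y"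
    by linarith
  moreover have "real p \<ge> 1" using prime_gt_0_nat[OF p] by simp
  ultimately have "padic_abs p (x + y) \<le> padic_abs p x \<or> padic_abs p (x + y) \<le> padic_abs p y"
    using False by (auto simp: padic_abs_def simp del: power_int_minus intro: power_int_increasing)
  thus ?thesis by auto
qed

lemma padic_abs_triangle: "padic_abs p (x + y) \<le> padic_abs p x + padic_abs p y"
  using padic_abs_ultra[of x y] padic_abs_nonneg[of x] padic_abs_nonneg[of y] by linarith

lemma padic_abs_diff_commute: "padic_abs p (x - y) = padic_abs p (y - x)"
  using padic_abs_minus[of "x - y"] by simp

lemma padic_abs_reverse: "\<bar>padic_abs p x - padic_abs p y\<bar> \<le> padic_abs p (x - y)"
  using padic_abs_triangle[of "x - y" y] padic_abs_triangle[of "y - x" x] padic_abs_diff_commute[of x y]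
  by simp

lemma padic_abs_inverse: "padic_abs p (inverse x) = inverse (padic_abs p x)"
proof (cases "x = 0")
  case False
  hence "padic_abs p x * padic_abs p (inverse x) = 1"
    using padic_abs_mult[of x "inverse x"] by (simp add: padic_abs_1)
  thus ?thesis by (metis inverse_unique)
qed auto

end


subsection \<open>Cauchy sequences\<close>

definition padic_cauchy :: "nat \<Rightarrow> (nat \<Rightarrow> rat) \<Rightarrow> bool" where
  "padic_cauchy p X \<longleftrightarrow> (\<forall>e>0. \<exists>N. \<forall>m\<ge>N. \<forall>n\<ge>N. padic_abs p (X m - X n) < e)"

definition padic_null :: "nat \<Rightarrow> (nat \<Rightarrow> rat) \<Rightarrow> bool" where
  "padic_null p X \<longleftrightarrow> (\<lambda>n. padic_abs p (X n)) \<longlonglongrightarrow> 0"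

definition padic_rel :: "nat \<Rightarrow> (nat \<Rightarrow> rat) \<Rightarrow> (nat \<Rightarrow> rat) \<Rightarrow> bool" where
  "padic_rel p X Y \<longleftrightarrow> padic_cauchy p X \<and> padic_cauchy p Y \<and> padic_null p (\<lambda>n. X n - Y n)"

lemma padic_cauchy_const [simp]: "padic_cauchy p (\<lambda>n. c)"
  by (simp add: padic_cauchy_def)

lemma padic_null_0 [simp]: "padic_null p (\<lambda>n. 0)"
  by (simp add: padic_null_def)

context
  fixes p :: nat
  assumes p: "prime p"
begin

lemma padic_nullI:
  assumes "\<forall>\<^sub>F n in sequentially. padic_abs p (X n) \<le> f n" "f \<longlonglongrightarrow> 0"
  shows "padic_null p X"
  unfolding padic_null_def
  by (rule real_tendsto_sandwich[OF _ assms(1) tendsto_const assms(2)])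
     (simp add: padic_abs_nonneg[OF p])

lemma padic_null_add:
  assumes "padic_null p X" "padic_null p Y"
  shows "padic_null p (\<lambda>n. X n + Y n)"
proof (rule padic_nullI)
  show "(\<lambda>n. padic_abs p (X n) + padic_abs p (Y n)) \<longlonglongrightarrow> 0"
    using tendsto_add[OF assms[unfolded padic_null_def]] by simp
qed (simp add: padic_abs_triangle[OF p])

lemma padic_null_minus: "padic_null p X \<Longrightarrow> padic_null p (\<lambda>n. - X n)"
  by (simp add: padic_null_def padic_abs_minus[OF p])

lemma padic_null_diff_commute: "padic_null p (\<lambda>n. X n - Y n) \<Longrightarrow> padic_null p (\<lambda>n. Y n - X n)"
  using padic_null_minus by fastforce

lemma padic_cauchy_abs_convergent:
  assumes "padic_cauchy p X"
  shows "convergent (\<lambda>n. padic_abs p (X n))"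
proof -
  have "Cauchy (\<lambda>n. padic_abs p (X n))"
    unfolding Cauchy_def
  proof (intro allI impI)
    fix e :: real
    assume "e > 0"
    then obtain N where "\<forall>m\<ge>N. \<forall>n\<ge>N. padic_abs p (X m - X n) < e"
      using assms by (auto simp: padic_cauchy_def)
    hence "\<forall>m\<ge>N. \<forall>n\<ge>N. dist (padic_abs p (X m)) (padic_abs p (X n)) < e"
      unfolding dist_real_def by (blast intro: le_less_trans[OF padic_abs_reverse[OF p]])
    thus "\<exists>M. \<forall>m\<ge>M. \<forall>n\<ge>M. dist (padic_abs p (X m)) (padic_abs p (X n)) < e" by blast
  qed
  thus ?thesis by (simp add: Cauchy_convergent_iff)
qed

lemma padic_cauchy_bounded:
  assumes "padic_cauchy p X"
  obtains B where "B > 0" "\<And>n. padic_abs p (X n) \<le> B"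
proof -
  have "Bseq (\<lambda>n. padic_abs p (X n))"
    using padic_cauchy_abs_convergent[OF assms] by (rule convergent_imp_Bseq)
  thus ?thesis using that by (auto simp: Bseq_def abs_le_iff)
qed

lemma padic_null_mult_bounded:
  assumes "padic_null p X" "\<And>n. padic_abs p (Y n) \<le> B"
  shows "padic_null p (\<lambda>n. X n * Y n)"
proof (rule padic_nullI)
  show "(\<lambda>n. padic_abs p (X n) * B) \<longlonglongrightarrow> 0"
    using tendsto_mult[OF assms(1)[unfolded padic_null_def] tendsto_const[of B]] by simp
qed (simp add: padic_abs_mult[OF p] mult_left_mono[OF assms(2)] padic_abs_nonneg[OF p])

lemma padic_cauchy_add:
  assumes "padic_cauchy p X" "padic_cauchy p Y"
  shows "padic_cauchy p (\<lambda>n. X n + Y n)"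
  unfolding padic_cauchy_def
proof (intro allI impI)
  fix e :: real
  assume e: "e > 0"
  obtain M where M: "\<forall>m\<ge>M. \<forall>n\<ge>M. padic_abs p (X m - X n) < e"
    using assms(1) e by (auto simp: padic_cauchy_def)
  obtain N where N: "\<forall>m\<ge>N. \<forall>n\<ge>N. padic_abs p (Y m - Y n) < e"
    using assms(2) e by (auto simp: padic_cauchy_def)
  have "padic_abs p (X m + Y m - (X n + Y n)) < e" if "m \<ge> max M N" "n \<ge> max M N" for m n
  proof -
    have "padic_abs p (X m - X n) < e" "padic_abs p (Y m - Y n) < e" using M N that by auto
    thus ?thesis
      using padic_abs_ultra[OF p, of "X m - X n" "Y m - Y n"] by (simp add: add_diff_add)
  qed
  thus "\<exists>K. \<forall>m\<ge>K. \<forall>n\<ge>K. padic_abs p (X m + Y m - (X n + Y n)) < e" by blast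
qed

lemma padic_cauchy_minus: "padic_cauchy p X \<Longrightarrow> padic_cauchy p (\<lambda>n. - X n)"
  unfolding padic_cauchy_def by (simp only: minus_diff_minus padic_abs_minus[OF p])

lemma padic_cauchy_mult:
  assumes "padic_cauchy p X" "padic_cauchy p Y"
  shows "padic_cauchy p (\<lambda>n. X n * Y n)"
  unfolding padic_cauchy_def
proof (intro allI impI)
  fix e :: real
  assume e: "e > 0"
  obtain A where A: "A > 0" "\<And>n. padic_abs p (X n) \<le> A" by (rule padic_cauchy_bounded[OF assms(1)]) blast
  obtain B where B: "B > 0" "\<And>n. padic_abs p (Y n) \<le> B" by (rule padic_cauchy_bounded[OF assms(2)]) blast
  obtain M where M: "\<forall>m\<ge>M. \<forall>n\<ge>M. padic_abs p (X m - X n) < e / B"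
    using assms(1) divide_pos_pos[OF e B(1)] unfolding padic_cauchy_def by blast
  obtain N where N: "\<forall>m\<ge>N. \<forall>n\<ge>N. padic_abs p (Y m - Y n) < e / A"
    using assms(2) divide_pos_pos[OF e A(1)] unfolding padic_cauchy_def by blast
  have "padic_abs p (X m * Y m - X n * Y n) < e" if "m \<ge> max M N" "n \<ge> max M N" for m n
  proof -
    have "padic_abs p (X m * (Y m - Y n)) \<le> A * padic_abs p (Y m - Y n)"
      by (simp add: padic_abs_mult[OF p] mult_right_mono A padic_abs_nonneg[OF p])
    also have "\<dots> < e" using N that A by (simp add: field_simps)
    finally have 1: "padic_abs p (X m * (Y m - Y n)) < e" .
    have "padic_abs p ((X m - X n) * Y n) \<le> padic_abs p (X m - X n) * B"
      by (simp add: padic_abs_mult[OF p] mult_left_mono B padic_abs_nonneg[OF p])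
    also have "\<dots> < e" using M that B by (simp add: field_simps)
    finally have 2: "padic_abs p ((X m - X n) * Y n) < e" .
    have "X m * Y m - X n * Y n = X m * (Y m - Y n) + (X m - X n) * Y n"
      by (simp add: algebra_simps)
    with 1 2 show ?thesis
      using padic_abs_ultra[OF p, of "X m * (Y m - Y n)" "(X m - X n) * Y n"] by simp
  qed
  thus "\<exists>K. \<forall>m\<ge>K. \<forall>n\<ge>K. padic_abs p (X m * Y m - X n * Y n) < e" by blast
qed

lemma padic_cauchy_not_null:
  assumes "padic_cauchy p X" "\<not> padic_null p X"
  obtains b N where "b > 0" "\<And>n. n \<ge> N \<Longrightarrow> b < padic_abs p (X n)"
proof -
  obtain L where L: "(\<lambda>n. padic_abs p (X n)) \<longlonglongrightarrow> L"
    using padic_cauchy_abs_convergent[OF assms(1)] by (auto simp: convergent_def)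
  have "L \<ge> 0" using L by (rule LIMSEQ_le_const) (auto simp: padic_abs_nonneg[OF p])
  moreover have "L \<noteq> 0" using L assms(2) by (auto simp: padic_null_def)
  ultimately have "L > 0" by simp
  hence "\<forall>\<^sub>F n in sequentially. L / 2 < padic_abs p (X n)"
    using order_tendstoD(1)[OF L, of "L / 2"] by simp
  thus ?thesis using that[of "L / 2"] \<open>L > 0\<close> by (auto simp: eventually_sequentially)
qed

lemma padic_abs_inverse_diff:
  assumes "b > 0" "b < padic_abs p x" "b < padic_abs p y"
  shows "padic_abs p (inverse x - inverse y) \<le> padic_abs p (x - y) / b\<^sup>2"
proof -
  have nz: "x \<noteq> 0" "y \<noteq> 0" using assms by auto
  have "inverse x - inverse y = (y - x) * inverse (x * y)"
    using nz by (simp add: field_simps)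
  hence "padic_abs p (inverse x - inverse y) = padic_abs p (x - y) / (padic_abs p x * padic_abs p y)"
    by (simp add: padic_abs_mult[OF p] padic_abs_inverse[OF p] padic_abs_diff_commute[OF p, of x y] divide_inverse)
  also have "\<dots> \<le> padic_abs p (x - y) / b\<^sup>2"
    unfolding power2_eq_square
    by (intro divide_left_mono mult_mono mult_pos_pos) (use assms padic_abs_nonneg[OF p] in auto)
  finally show ?thesis .
qed

lemma padic_cauchy_inverse:
  assumes "padic_cauchy p X" "\<not> padic_null p X"
  shows "padic_cauchy p (\<lambda>n. inverse (X n))"
  unfolding padic_cauchy_def
proof (intro allI impI)
  fix e :: real
  assume e: "e > 0"
  obtain b M where b: "b > 0" and M: "\<And>n. n \<ge> M \<Longrightarrow> b < padic_abs p (X n)"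
    using padic_cauchy_not_null[OF assms] by blast
  obtain N where N: "\<forall>m\<ge>N. \<forall>n\<ge>N. padic_abs p (X m - X n) < e * b\<^sup>2"
    using assms(1) mult_pos_pos[OF e zero_less_power[OF b, of 2]] unfolding padic_cauchy_def by blast
  have "padic_abs p (inverse (X m) - inverse (X n)) < e" if "m \<ge> max M N" "n \<ge> max M N" for m n
  proof -
    have "padic_abs p (inverse (X m) - inverse (X n)) \<le> padic_abs p (X m - X n) / b\<^sup>2"
      using that by (intro padic_abs_inverse_diff b M) auto
    also have "\<dots> < e" using N that b by (simp add: field_simps)
    finally show ?thesis .
  qed
  thus "\<exists>K. \<forall>m\<ge>K. \<forall>n\<ge>K. padic_abs p (inverse (X m) - inverse (X n)) < e" by blast
qed

lemma padic_null_diff_inverse: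
  assumes "padic_cauchy p X" "\<not> padic_null p X" "padic_cauchy p Y" "\<not> padic_null p Y"
    and XY: "padic_null p (\<lambda>n. X n - Y n)"
  shows "padic_null p (\<lambda>n. inverse (X n) - inverse (Y n))"
proof -
  obtain a M where a: "a > 0" and M: "\<And>n. n \<ge> M \<Longrightarrow> a < padic_abs p (X n)"
    using padic_cauchy_not_null[OF assms(1,2)] by blast
  obtain b N where b: "b > 0" and N: "\<And>n. n \<ge> N \<Longrightarrow> b < padic_abs p (Y n)"
    using padic_cauchy_not_null[OF assms(3,4)] by blast
  define c where "c = min a b"
  have c: "c > 0" using a b by (simp add: c_def)
  have ev: "padic_abs p (inverse (X n) - inverse (Y n)) \<le> padic_abs p (X n - Y n) / c\<^sup>2"
    if "n \<ge> max M N" for n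
    using that M[of n] N[of n] by (intro padic_abs_inverse_diff c) (auto simp: c_def)
  show ?thesis
  proof (rule padic_nullI)
    show "\<forall>\<^sub>F n in sequentially.
        padic_abs p (inverse (X n) - inverse (Y n)) \<le> padic_abs p (X n - Y n) / c\<^sup>2"
      using ev unfolding eventually_sequentially by blast
    show "(\<lambda>n. padic_abs p (X n - Y n) / c\<^sup>2) \<longlonglongrightarrow> 0"
      using tendsto_divide[OF XY[unfolded padic_null_def] tendsto_const[of "c\<^sup>2"]] c by simp
  qed
qed

lemma padic_rel_null_iff:
  assumes "padic_rel p X Y"
  shows "padic_null p X \<longleftrightarrow> padic_null p Y"
proof -
  have XY: "padic_null p (\<lambda>n. X n - Y n)" using assms by (simp add: padic_rel_def)
  show ?thesis
    using padic_null_add[OF XY, of Y] padic_null_add[OF padic_null_diff_commute[OF XY], of X] by auto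
qed

lemma padic_rel_abs_lim:
  assumes "padic_rel p X Y"
  shows "lim (\<lambda>n. padic_abs p (X n)) = lim (\<lambda>n. padic_abs p (Y n))"
proof -
  obtain L where L: "(\<lambda>n. padic_abs p (Y n)) \<longlonglongrightarrow> L"
    using padic_cauchy_abs_convergent assms by (auto simp: convergent_def padic_rel_def)
  have "(\<lambda>n. padic_abs p (X n) - padic_abs p (Y n)) \<longlonglongrightarrow> 0"
    by (rule Lim_null_comparison[of _ "\<lambda>n. padic_abs p (X n - Y n)"])
       (use assms padic_abs_reverse[OF p] in \<open>auto simp: padic_rel_def padic_null_def\<close>)
  from tendsto_add[OF this L] have "(\<lambda>n. padic_abs p (X n)) \<longlonglongrightarrow> L" by simp
  with L show ?thesis by (simp add: limI)
qed

lemma part_equivp_padic_rel: "part_equivp (padic_rel p)"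
proof (rule part_equivpI)
  show "\<exists>X. padic_rel p X X" by (rule exI[of _ "\<lambda>_. 0"]) (simp add: padic_rel_def)
  show "symp (padic_rel p)"
    by (rule sympI) (auto simp: padic_rel_def intro: padic_null_diff_commute)
  show "transp (padic_rel p)"
  proof (rule transpI)
    fix X Y Z
    assume "padic_rel p X Y" "padic_rel p Y Z"
    thus "padic_rel p X Z"
      using padic_null_add[of "\<lambda>n. X n - Y n" "\<lambda>n. Y n - Z n"] by (auto simp: padic_rel_def)
  qed
qed

end


subsection \<open>The completion\<close>

text \<open>
  The prime \<open>p\<close> is the cardinality of the index type \<open>'p\<close>: the type \<open>'p padic\<close> is the field
  \<open>\<rat>\<^sub>p\<close> for \<open>p = CARD('p)\<close>, constructed as the completion of \<open>\<rat>\<close>.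
\<close>

typedef (overloaded) 'p padic =
  "{C. \<exists>X. padic_rel CARD('p::prime_card) X X \<and> C = Collect (padic_rel CARD('p) X)}"
  by (rule exI[of _ "Collect (padic_rel CARD('p) (\<lambda>n. 0))"], rule CollectI, rule exI[of _ "\<lambda>n. 0"])
     (simp add: padic_rel_def)

definition padic_of_seq :: "(nat \<Rightarrow> rat) \<Rightarrow> 'p::prime_card padic" where
  "padic_of_seq X = Abs_padic (Collect (padic_rel CARD('p) X))"

definition seq_of_padic :: "'p::prime_card padic \<Rightarrow> nat \<Rightarrow> rat" where
  "seq_of_padic x = (SOME X. X \<in> Rep_padic x)"

definition cr_padic :: "(nat \<Rightarrow> rat) \<Rightarrow> 'p::prime_card padic \<Rightarrow> bool" where
  "cr_padic X x \<longleftrightarrow> padic_rel CARD('p) X X \<and> padic_of_seq X = x"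

lemma Quotient_padic:
  "Quotient (padic_rel CARD('p::prime_card)) padic_of_seq seq_of_padic (cr_padic :: _ \<Rightarrow> 'p padic \<Rightarrow> bool)"
proof -
  let ?R = "padic_rel CARD('p)"
  have pe: "part_equivp ?R" by (rule part_equivp_padic_rel[OF prime_card])
  interpret quot_type ?R "Abs_padic :: _ \<Rightarrow> 'p padic" Rep_padic
  proof
    show "part_equivp ?R" by (fact pe)
    fix x y :: "'p padic" and C :: "(nat \<Rightarrow> rat) set"
    show "\<exists>X. ?R X X \<and> Rep_padic y = Collect (?R X)" using Rep_padic[of y] by blast
    show "Abs_padic (Rep_padic x) = x" by (rule Rep_padic_inverse)
    show "(Rep_padic x = Rep_padic y) = (x = y)" by (rule Rep_padic_inject)
    assume "\<exists>X. ?R X X \<and> C = Collect (?R X)"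
    thus "Rep_padic (Abs_padic C :: 'p padic) = C" by (intro Abs_padic_inverse) blast
  qed
  have "abs = padic_of_seq" "rep = seq_of_padic"
    by (simp_all add: fun_eq_iff abs_def rep_def padic_of_seq_def seq_of_padic_def)
  with Quotient have "Quotient3 ?R padic_of_seq (seq_of_padic :: 'p padic \<Rightarrow> _)" by simp
  thus ?thesis by (rule Quotient3_to_Quotient) (simp add: fun_eq_iff atomize_eq cr_padic_def)
qed

setup_lifting Quotient_padic

instantiation padic :: (prime_card) field
begin

lift_definition zero_padic :: "'a padic" is "\<lambda>n. 0"
  by (simp add: padic_rel_def)

lift_definition one_padic :: "'a padic" is "\<lambda>n. 1"
  by (simp add: padic_rel_def)

lift_definition plus_padic :: "'a padic \<Rightarrow> 'a padic \<Rightarrow> 'a padic" is "\<lambda>X Y n. X n + Y n"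
  using padic_null_add[OF prime_card[where 'a = 'a]]
  by (auto simp: padic_rel_def add_diff_add intro!: padic_cauchy_add[OF prime_card[where 'a = 'a]])

lift_definition uminus_padic :: "'a padic \<Rightarrow> 'a padic" is "\<lambda>X n. - X n"
  unfolding padic_rel_def minus_diff_minus
  by (elim conjE) (intro conjI padic_cauchy_minus[OF prime_card[where 'a = 'a]]
      padic_null_minus[OF prime_card[where 'a = 'a]]; assumption)

lift_definition times_padic :: "'a padic \<Rightarrow> 'a padic \<Rightarrow> 'a padic" is "\<lambda>X Y n. X n * Y n"
proof -
  fix X X' Y Y' :: "nat \<Rightarrow> rat"
  note pr = prime_card[where 'a = 'a]
  assume rel: "padic_rel CARD('a) X X'" "padic_rel CARD('a) Y Y'"
  hence c: "padic_cauchy CARD('a) X" "padic_cauchy CARD('a) X'"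
      "padic_cauchy CARD('a) Y" "padic_cauchy CARD('a) Y'"
    and n: "padic_null CARD('a) (\<lambda>n. X n - X' n)" "padic_null CARD('a) (\<lambda>n. Y n - Y' n)"
    by (auto simp: padic_rel_def)
  obtain A where A: "\<And>n. padic_abs CARD('a) (X' n) \<le> A" using padic_cauchy_bounded[OF pr c(2)] by blast
  obtain B where B: "\<And>n. padic_abs CARD('a) (Y n) \<le> B" using padic_cauchy_bounded[OF pr c(3)] by blast
  have "padic_null CARD('a) (\<lambda>n. (X n - X' n) * Y n + (Y n - Y' n) * X' n)"
    by (intro padic_null_add[OF pr] padic_null_mult_bounded[OF pr n(1) B]
        padic_null_mult_bounded[OF pr n(2) A])
  also have "(\<lambda>n. (X n - X' n) * Y n + (Y n - Y' n) * X' n) = (\<lambda>n. X n * Y n - X' n * Y' n)"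
    by (simp add: fun_eq_iff algebra_simps)
  finally show "padic_rel CARD('a) (\<lambda>n. X n * Y n) (\<lambda>n. X' n * Y' n)"
    using c by (simp add: padic_rel_def padic_cauchy_mult[OF pr])
qed

lift_definition inverse_padic :: "'a padic \<Rightarrow> 'a padic"
  is "\<lambda>X. if padic_null CARD('a) X then (\<lambda>n. 0) else (\<lambda>n. inverse (X n))"
proof -
  fix X Y :: "nat \<Rightarrow> rat"
  note pr = prime_card[where 'a = 'a]
  assume rel: "padic_rel CARD('a) X Y"
  show "padic_rel CARD('a) (if padic_null CARD('a) X then (\<lambda>n. 0) else (\<lambda>n. inverse (X n)))
     (if padic_null CARD('a) Y then (\<lambda>n. 0) else (\<lambda>n. inverse (Y n)))"
    using rel padic_rel_null_iff[OF pr rel]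
    by (auto simp: padic_rel_def padic_cauchy_inverse[OF pr] padic_null_diff_inverse[OF pr])
qed

definition minus_padic :: "'a padic \<Rightarrow> 'a padic \<Rightarrow> 'a padic" where
  "minus_padic x y = x + - y"

definition divide_padic :: "'a padic \<Rightarrow> 'a padic \<Rightarrow> 'a padic" where
  "divide_padic x y = x * inverse y"

instance
proof
  note pr = prime_card[where 'a = 'a]
  note c = padic_rel_def padic_cauchy_add[OF pr] padic_cauchy_mult[OF pr] padic_cauchy_minus[OF pr]
  fix a b c :: "'a padic"
  show "a + b = b + a" by transfer (simp add: c ac_simps)
  show "(a + b) + c = a + (b + c)" by transfer (simp add: c ac_simps)
  show "0 + a = a" by transfer (simp add: c)
  show "- a + a = 0" by transfer (simp add: c)
  show "a - b = a + - b" by (rule minus_padic_def)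
  show "(a * b) * c = a * (b * c)" by transfer (simp add: c ac_simps)
  show "a * b = b * a" by transfer (simp add: c ac_simps)
  show "1 * a = a" by transfer (simp add: c)
  show "(a + b) * c = a * c + b * c" by transfer (simp add: c distrib_right)
  show "(0 :: 'a padic) \<noteq> 1"
    by transfer (simp add: padic_rel_def padic_null_def padic_abs_minus[OF pr] padic_abs_1[OF pr] LIMSEQ_const_iff)
  show "inverse a * a = 1" if "a \<noteq> 0"
    using that
  proof transfer
    fix X :: "nat \<Rightarrow> rat"
    assume "padic_rel CARD('a) X X" and "\<not> padic_rel CARD('a) X (\<lambda>n. 0)"
    hence X: "padic_cauchy CARD('a) X" "\<not> padic_null CARD('a) X" by (auto simp: padic_rel_def)
    obtain b N where b: "b > 0" and N: "\<And>n. n \<ge> N \<Longrightarrow> b < padic_abs CARD('a) (X n)"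
      using padic_cauchy_not_null[OF pr X] by blast
    have "inverse (X n) * X n - 1 = 0" if "n \<ge> N" for n
    proof -
      have "X n \<noteq> 0" using N[OF that] b by auto
      thus ?thesis by simp
    qed
    hence "\<forall>\<^sub>F n in sequentially. padic_abs CARD('a) (inverse (X n) * X n - 1) \<le> 0"
      unfolding eventually_sequentially by (intro exI[of _ N] allI impI) simp
    hence "padic_null CARD('a) (\<lambda>n. inverse (X n) * X n - 1)"
      by (rule padic_nullI[OF pr]) simp
    thus "padic_rel CARD('a) (\<lambda>n. (if padic_null CARD('a) X then \<lambda>n. 0 else (\<lambda>n. inverse (X n))) n * X n) (\<lambda>n. 1)"
      using X by (simp add: padic_rel_def padic_cauchy_mult[OF pr] padic_cauchy_inverse[OF pr])
  qed
  show "a div b = a * inverse b" by (rule divide_padic_def)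
  show "inverse (0 :: 'a padic) = 0" by transfer (simp add: padic_rel_def)
qed

end

lift_definition padic_norm :: "'p::prime_card padic \<Rightarrow> real" is "\<lambda>X. lim (\<lambda>n. padic_abs CARD('p) (X n))"
  by (rule padic_rel_abs_lim[OF prime_card])

lemma padic_abs_LIMSEQ:
  assumes "padic_cauchy CARD('p::prime_card) X"
  shows "(\<lambda>n. padic_abs CARD('p) (X n)) \<longlonglongrightarrow> lim (\<lambda>n. padic_abs CARD('p) (X n))"
  using padic_cauchy_abs_convergent[OF prime_card assms] by (simp add: convergent_LIMSEQ_iff)

lemma padic_norm_eq_0_iff: "padic_norm (x :: 'p::prime_card padic) = 0 \<longleftrightarrow> x = 0"
proof transfer
  fix X :: "nat \<Rightarrow> rat"
  assume "padic_rel CARD('p) X X"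
  hence X: "padic_cauchy CARD('p) X" by (simp add: padic_rel_def)
  show "lim (\<lambda>n. padic_abs CARD('p) (X n)) = 0 \<longleftrightarrow> padic_rel CARD('p) X (\<lambda>n. 0)"
  proof
    assume "lim (\<lambda>n. padic_abs CARD('p) (X n)) = 0"
    hence "padic_null CARD('p) X"
      using padic_abs_LIMSEQ[OF X] unfolding padic_null_def by (rule subst)
    thus "padic_rel CARD('p) X (\<lambda>n. 0)" using X by (simp add: padic_rel_def)
  next
    assume "padic_rel CARD('p) X (\<lambda>n. 0)"
    hence "(\<lambda>n. padic_abs CARD('p) (X n)) \<longlonglongrightarrow> 0" by (simp add: padic_rel_def padic_null_def)
    thus "lim (\<lambda>n. padic_abs CARD('p) (X n)) = 0" by (rule limI)
  qed
qed

lemma padic_norm_minus: "padic_norm (- x) = padic_norm (x :: 'p::prime_card padic)"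
  by transfer (simp add: padic_abs_minus[OF prime_card])

lemma padic_norm_triangle: "padic_norm (x + y) \<le> padic_norm x + padic_norm (y :: 'p::prime_card padic)"
proof transfer
  fix X Y :: "nat \<Rightarrow> rat"
  assume "padic_rel CARD('p) X X" "padic_rel CARD('p) Y Y"
  hence c: "padic_cauchy CARD('p) X" "padic_cauchy CARD('p) Y" by (auto simp: padic_rel_def)
  show "lim (\<lambda>n. padic_abs CARD('p) (X n + Y n))
      \<le> lim (\<lambda>n. padic_abs CARD('p) (X n)) + lim (\<lambda>n. padic_abs CARD('p) (Y n))"
    using padic_abs_LIMSEQ[OF padic_cauchy_add[OF prime_card c]]
      tendsto_add[OF padic_abs_LIMSEQ[OF c(1)] padic_abs_LIMSEQ[OF c(2)]]
    by (rule LIMSEQ_le) (auto simp: padic_abs_triangle[OF prime_card])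
qed

instantiation padic :: (prime_card) metric_space
begin

definition dist_padic :: "'a padic \<Rightarrow> 'a padic \<Rightarrow> real" where
  "dist_padic x y = padic_norm (x - y)"

definition uniformity_padic :: "('a padic \<times> 'a padic) filter" where
  "uniformity_padic = (INF e\<in>{0 <..}. principal {(x, y). dist x y < e})"

definition open_padic :: "'a padic set \<Rightarrow> bool" where
  "open_padic U \<longleftrightarrow> (\<forall>x\<in>U. \<forall>\<^sub>F (x', y) in uniformity. x' = x \<longrightarrow> y \<in> U)"

instance
proof
  fix x y z :: "'a padic"
  show "dist x y = 0 \<longleftrightarrow> x = y" by (simp add: dist_padic_def padic_norm_eq_0_iff)
  show "dist x y \<le> dist x z + dist y z"
    using padic_norm_triangle[of "x - z" "z - y"] padic_norm_minus[of "z - y"]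
    by (simp add: dist_padic_def)
qed (simp_all add: uniformity_padic_def open_padic_def)

end


section \<open>$p$-adic analytic manifolds\<close>

text \<open>The space \<open>\<rat>\<^sub>p\<^sup>n\<close>, represented in the same way as \<open>Euclidean_space\<close>.\<close>

definition padic_space :: "nat \<Rightarrow> (nat \<Rightarrow> 'p::prime_card padic) topology" where
  "padic_space n = top_of_set {x. \<forall>i\<ge>n. x i = 0}"

definition multi_indices :: "nat \<Rightarrow> (nat \<Rightarrow> nat) set" where
  "multi_indices n = {\<alpha>. \<forall>i\<ge>n. \<alpha> i = 0}"

definition padic_analytic_on ::
    "nat \<Rightarrow> ((nat \<Rightarrow> 'p::prime_card padic) \<Rightarrow> 'p padic) \<Rightarrow> (nat \<Rightarrow> 'p padic) set \<Rightarrow> bool" where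
  "padic_analytic_on n f U \<longleftrightarrow>
     openin (padic_space n) U \<and>
     (\<forall>a\<in>U. \<exists>r>0. \<exists>c. \<forall>x\<in>U. (\<forall>i<n. dist (x i) (a i) < r) \<longrightarrow>
        ((\<lambda>\<alpha>. c \<alpha> * (\<Prod>i<n. (x i - a i) ^ \<alpha> i)) has_sum f x) (multi_indices n))"

record ('a, 'p) padic_atlas =
  mfd_top :: "'a topology"
  mfd_dim :: nat
  mfd_charts :: "('a set \<times> ('a \<Rightarrow> nat \<Rightarrow> 'p padic)) set"

definition padic_manifold :: "('a, 'p::prime_card) padic_atlas \<Rightarrow> bool" where
  "padic_manifold M \<longleftrightarrow>
     Hausdorff_space (mfd_top M) \<and>
     topspace (mfd_top M) = (\<Union>(U, \<phi>)\<in>mfd_charts M. U) \<and>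
     (\<forall>(U, \<phi>)\<in>mfd_charts M.
        openin (mfd_top M) U \<and> openin (padic_space (mfd_dim M)) (\<phi> ` U) \<and>
        homeomorphic_map (subtopology (mfd_top M) U) (subtopology (padic_space (mfd_dim M)) (\<phi> ` U)) \<phi>) \<and>
     (\<forall>(U, \<phi>)\<in>mfd_charts M. \<forall>(V, \<psi>)\<in>mfd_charts M. \<forall>k<mfd_dim M.
        padic_analytic_on (mfd_dim M) (\<lambda>v. \<psi> (inv_into U \<phi> v) k) (\<phi> ` (U \<inter> V)))"

definition analytic_map ::
    "('a, 'p::prime_card) padic_atlas \<Rightarrow> ('b, 'p) padic_atlas \<Rightarrow> ('a \<Rightarrow> 'b) \<Rightarrow> bool" where
  "analytic_map M N F \<longleftrightarrow>
     continuous_map (mfd_top M) (mfd_top N) F \<and>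
     (\<forall>(U, \<phi>)\<in>mfd_charts M. \<forall>(V, \<psi>)\<in>mfd_charts N. \<forall>k<mfd_dim N.
        padic_analytic_on (mfd_dim M) (\<lambda>v. \<psi> (F (inv_into U \<phi> v)) k) (\<phi> ` {x \<in> U. F x \<in> V}))"

definition prod_mfd ::
    "('a, 'p::prime_card) padic_atlas \<Rightarrow> ('b, 'p) padic_atlas \<Rightarrow> ('a \<times> 'b, 'p) padic_atlas" where
  "prod_mfd M N =
     \<lparr>mfd_top = prod_topology (mfd_top M) (mfd_top N),
      mfd_dim = mfd_dim M + mfd_dim N,
      mfd_charts = {(U \<times> V, \<lambda>(x, y) i. if i < mfd_dim M then \<phi> x i else \<psi> y (i - mfd_dim M)) | U \<phi> V \<psi>.
        (U, \<phi>) \<in> mfd_charts M \<and> (V, \<psi>) \<in> mfd_charts N}\<rparr>"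

text \<open>The algebra of analytic functions \<open>M \<rightarrow> \<rat>\<^sub>p\<close>, extended by zero off the manifold.\<close>

definition analytic_functions :: "('a, 'p::prime_card) padic_atlas \<Rightarrow> ('a \<Rightarrow> 'p padic) set" where
  "analytic_functions M =
     {f. (\<forall>x. x \<notin> topspace (mfd_top M) \<longrightarrow> f x = 0) \<and>
         (\<forall>(U, \<phi>)\<in>mfd_charts M. padic_analytic_on (mfd_dim M) (\<lambda>v. f (inv_into U \<phi> v)) (\<phi> ` U))}"

text \<open>
  Tangent vectors at \<open>a\<close> are the point derivations at \<open>a\<close>. Globally defined functions suffice in
  place of germs, since a point of a \<open>p\<close>-adic manifold has arbitrarily small clopen neighbourhoods
  in a chart and germs extend by zero. Outside the analytic functions a tangent vector is
  normalised to be zero.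
\<close>

definition tangent_space ::
    "('a, 'p::prime_card) padic_atlas \<Rightarrow> 'a \<Rightarrow> (('a \<Rightarrow> 'p padic) \<Rightarrow> 'p padic) set" where
  "tangent_space M a =
     {X. (\<forall>f\<in>analytic_functions M. \<forall>g\<in>analytic_functions M. X (f + g) = X f + X g) \<and>
         (\<forall>c. \<forall>f\<in>analytic_functions M. X (\<lambda>x. c * f x) = c * X f) \<and>
         (\<forall>f\<in>analytic_functions M. \<forall>g\<in>analytic_functions M. X (f * g) = X f * g a + f a * X g) \<and>
         (\<forall>f. f \<notin> analytic_functions M \<longrightarrow> X f = 0)}"


section \<open>Lie algebras\<close>

text \<open>
  A Lie algebra is given by a scalar multiplication and a bracket on an ambient type, and a
  subspace \<open>L\<close> closed under the bracket.
\<close>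

definition lie_ideal ::
    "('k::field \<Rightarrow> 'v::ab_group_add \<Rightarrow> 'v) \<Rightarrow> ('v \<Rightarrow> 'v \<Rightarrow> 'v) \<Rightarrow> 'v set \<Rightarrow> 'v set \<Rightarrow> bool" where
  "lie_ideal smul br L I \<longleftrightarrow>
     module.subspace smul I \<and> I \<subseteq> L \<and> (\<forall>x\<in>L. \<forall>y\<in>I. br x y \<in> I)"

definition simple_lie_algebra ::
    "('k::field \<Rightarrow> 'v::ab_group_add \<Rightarrow> 'v) \<Rightarrow> ('v \<Rightarrow> 'v \<Rightarrow> 'v) \<Rightarrow> 'v set \<Rightarrow> bool" where
  "simple_lie_algebra smul br L \<longleftrightarrow>
     (\<exists>x\<in>L. \<exists>y\<in>L. br x y \<noteq> 0) \<and> (\<forall>I. lie_ideal smul br L I \<longrightarrow> I = {0} \<or> I = L)"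

text \<open>
  Internal direct sum of finitely many simple ideals (distinct summands commute, as their bracket
  lies in the intersection). The empty sum is allowed: the zero Lie algebra is semisimple.
\<close>

definition semisimple_lie_algebra ::
    "('k::field \<Rightarrow> 'v::ab_group_add \<Rightarrow> 'v) \<Rightarrow> ('v \<Rightarrow> 'v \<Rightarrow> 'v) \<Rightarrow> 'v set \<Rightarrow> bool" where
  "semisimple_lie_algebra smul br L \<longleftrightarrow>
     (\<exists>S. finite S \<and>
        (\<forall>I\<in>S. lie_ideal smul br L I \<and> simple_lie_algebra smul br I) \<and>
        (\<forall>x\<in>L. \<exists>!c. c \<in> (\<Pi>\<^sub>E I\<in>S. I) \<and> x = (\<Sum>I\<in>S. c I)))"


section \<open>$p$-adic analytic Lie groups\<close>

definition padic_lie_group :: "'a monoid \<Rightarrow> ('a, 'p::prime_card) padic_atlas \<Rightarrow> bool" where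
  "padic_lie_group G M \<longleftrightarrow>
     group G \<and> padic_manifold M \<and> topspace (mfd_top M) = carrier G \<and>
     analytic_map (prod_mfd M M) M (\<lambda>(x, y). x \<otimes>\<^bsub>G\<^esub> y) \<and>
     analytic_map M M (\<lambda>x. inv\<^bsub>G\<^esub> x)"

text \<open>
  The left-invariant vector field with value \<open>X\<close> at the identity, acting on functions:
  at the point \<open>s\<close> it applies \<open>X\<close> to the left translate \<open>t \<mapsto> f (s t)\<close>.
\<close>

definition left_invariant_field ::
    "'a monoid \<Rightarrow> (('a \<Rightarrow> 'p padic) \<Rightarrow> 'p padic) \<Rightarrow> ('a \<Rightarrow> 'p::prime_card padic) \<Rightarrow> ('a \<Rightarrow> 'p padic)" where
  "left_invariant_field G X f =
     (\<lambda>s. if s \<in> carrier G then X (\<lambda>t. if t \<in> carrier G then f (s \<otimes>\<^bsub>G\<^esub> t) else 0) else 0)"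

text \<open>The value at the identity of the commutator of left-invariant vector fields.\<close>

definition lie_bracket ::
    "'a monoid \<Rightarrow> ('a, 'p::prime_card) padic_atlas \<Rightarrow>
     (('a \<Rightarrow> 'p padic) \<Rightarrow> 'p padic) \<Rightarrow> (('a \<Rightarrow> 'p padic) \<Rightarrow> 'p padic) \<Rightarrow> (('a \<Rightarrow> 'p padic) \<Rightarrow> 'p padic)" where
  "lie_bracket G M X Y =
     (\<lambda>f. if f \<in> analytic_functions M
          then X (left_invariant_field G Y f) - Y (left_invariant_field G X f) else 0)"

abbreviation functional_smul :: "'k::field \<Rightarrow> ('b \<Rightarrow> 'k) \<Rightarrow> ('b \<Rightarrow> 'k)" where
  "functional_smul \<equiv> \<lambda>c X f. c * X f"

lemma vector_space_functional_smul: "vector_space functional_smul"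
  by unfold_locales (auto simp: distrib_left distrib_right mult.assoc)

definition semisimple_lie_group :: "'a monoid \<Rightarrow> ('a, 'p::prime_card) padic_atlas \<Rightarrow> bool" where
  "semisimple_lie_group G M \<longleftrightarrow>
     semisimple_lie_algebra functional_smul (lie_bracket G M) (tangent_space M \<one>\<^bsub>G\<^esub>)"


section \<open>Invariant Hilbert--Smith groups\<close>

definition topological_group :: "'a monoid \<Rightarrow> 'a topology \<Rightarrow> bool" where
  "topological_group D T \<longleftrightarrow>
     group D \<and> topspace T = carrier D \<and>
     continuous_map (prod_topology T T) T (\<lambda>(x, y). x \<otimes>\<^bsub>D\<^esub> y) \<and>
     continuous_map T T (\<lambda>x. inv\<^bsub>D\<^esub> x)"

definition invariant_group :: "'a monoid \<Rightarrow> 'a topology \<Rightarrow> bool" where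
  "invariant_group D T \<longleftrightarrow>
     topological_group D T \<and> separable_space T \<and>
     (\<exists>d. Metric_space (carrier D) d \<and> Metric_space.mtopology (carrier D) d = T \<and>
        (\<forall>x\<in>carrier D. \<forall>y\<in>carrier D. \<forall>z\<in>carrier D.
           d (z \<otimes>\<^bsub>D\<^esub> x) (z \<otimes>\<^bsub>D\<^esub> y) = d x y \<and> d (x \<otimes>\<^bsub>D\<^esub> z) (y \<otimes>\<^bsub>D\<^esub> z) = d x y))"

text \<open>
  The additive group \<open>\<int>\<^sub>q\<close> as the inverse limit of the groups \<open>\<int>/q\<^sup>n\<close>. Here \<open>q\<close> is a term rather
  than a type, so that one can quantify over all primes. In the subspace topology of the product
  of discrete spaces, the cosets \<open>{y. y n = x n}\<close> of \<open>q\<^sup>n\<int>\<^sub>q\<close> form a basis of the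
  neighbourhoods of \<open>x\<close>; this is the \<open>q\<close>-adic topology.
\<close>

definition padic_integers :: "nat \<Rightarrow> (nat \<Rightarrow> int) monoid" where
  "padic_integers q =
     \<lparr>carrier = {x. \<forall>n. x n \<in> {0..<int q ^ n} \<and> x (Suc n) mod int q ^ n = x n},
      mult = \<lambda>x y n. (x n + y n) mod int q ^ n,
      one = \<lambda>n. 0\<rparr>"

definition padic_integers_top :: "nat \<Rightarrow> (nat \<Rightarrow> int) topology" where
  "padic_integers_top q =
     subtopology (product_topology (\<lambda>n. discrete_topology UNIV) UNIV) (carrier (padic_integers q))"

definition hilbert_smith :: "'a monoid \<Rightarrow> 'a topology \<Rightarrow> bool" where
  "hilbert_smith D T \<longleftrightarrow>
     (\<forall>q. prime q \<longrightarrow>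
        \<not> (\<exists>h. h \<in> hom (padic_integers q) D \<and> inj_on h (carrier (padic_integers q)) \<and>
               continuous_map (padic_integers_top q) T h))"

end

theory Submission
  imports Defs "HOL-Number_Theory.Cong"
begin

text \<open>
  Semisimplicity gives that the brackets span the Lie algebra, so near the identity, in suitably
  rescaled coordinates, a fixed number of commutators with one free factor each multiply to a map
  whose linear part is onto; Newton's method makes this map onto a ball. By Baire's theorem and
  the separability of \<open>D\<close>, the elements of \<open>G\<close> with image near the identity are dense near the
  identity. As the metric is bi-invariant, a commutator has small image as soon as one of its two
  entries has, hence \<open>f\<close> is continuous. Every one-parameter subgroup is a copy of \<open>\<int>\<^sub>p\<close>, on which the
  continuous \<open>f\<close> cannot be injective; so the kernel contains a power of each coordinate
  direction and is open, and compactness gives a finite image.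
\<close>

section \<open>The ultrametric field\<close>

text \<open>\<open>f\<close> carries no regularity, and Baire's theorem gives only density: the
  elements with small image need not fill a neighbourhood. Exact surjectivity of a product of
  commutators closes this gap, because in \<open>[x, y] = x (y x^-1 y^-1)\<close> the second factor
  is a conjugate of \<open>x^-1\<close>, of the same length as \<open>x\<close> under a bi-invariant
  metric, whatever \<open>y\<close> is. Only the \<open>x\<close> entries need small image, and they
  can merely be placed near prescribed vectors; so the derivative of the product map is known up to
  an error, and the form of Newton's method used here asks for no more than an approximate
  derivative. Rescaling by a power of \<open>p\<close> makes the group law addition plus a term
  divisible by \<open>p\<close> squared; translations then become isometries and every error is
  dominated by a linear term, so that no logarithm or Campbell-Hausdorff series is required. A
  one-parameter subgroup is built from limits of ordinary powers. If \<open>g^x\<close> and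
  \<open>g^y\<close> have equal images and \<open>x - y\<close> has valuation \<open>m\<close>,
  ordinary powers of \<open>g^(x-y)\<close> come arbitrarily close to \<open>g^(p^m)\<close>, and
  continuity puts the latter into the kernel.\<close>

lemma padic_norm_nonneg [simp]: "padic_norm (x :: 'p::prime_card padic) \<ge> 0"
proof transfer
  fix X :: "nat \<Rightarrow> rat"
  assume "padic_rel CARD('p) X X"
  then have "padic_cauchy CARD('p) X" by (simp add: padic_rel_def)
  from padic_abs_LIMSEQ[OF this] show "0 \<le> lim (\<lambda>n. padic_abs CARD('p) (X n))"
    by (rule LIMSEQ_le_const) (auto simp: padic_abs_nonneg[OF prime_card])
qed

lemma padic_norm_0 [simp]: "padic_norm (0 :: 'p::prime_card padic) = 0"
  by (simp add: padic_norm_eq_0_iff)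

declare padic_norm_eq_0_iff [simp] padic_norm_minus [simp]

lemma padic_norm_le_0_iff [simp]: "padic_norm (x :: 'p::prime_card padic) \<le> 0 \<longleftrightarrow> x = 0"
  using padic_norm_nonneg[of x] padic_norm_eq_0_iff[of x] by linarith

lemma padic_norm_gt_0_iff [simp]: "0 < padic_norm (x :: 'p::prime_card padic) \<longleftrightarrow> x \<noteq> 0"
  using padic_norm_le_0_iff[of x] by linarith

lemma padic_norm_mult: "padic_norm (x * y) = padic_norm x * padic_norm (y :: 'p::prime_card padic)"
proof transfer
  fix X Y :: "nat \<Rightarrow> rat"
  assume "padic_rel CARD('p) X X" "padic_rel CARD('p) Y Y"
  then have c: "padic_cauchy CARD('p) X" "padic_cauchy CARD('p) Y" by (auto simp: padic_rel_def)
  show "lim (\<lambda>n. padic_abs CARD('p) (X n * Y n))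
      = lim (\<lambda>n. padic_abs CARD('p) (X n)) * lim (\<lambda>n. padic_abs CARD('p) (Y n))"
    using tendsto_mult[OF padic_abs_LIMSEQ[OF c(1)] padic_abs_LIMSEQ[OF c(2)]]
    by (intro limI) (simp add: padic_abs_mult[OF prime_card])
qed

lemma padic_norm_ultra: "padic_norm (x + y) \<le> max (padic_norm x) (padic_norm (y :: 'p::prime_card padic))"
proof transfer
  fix X Y :: "nat \<Rightarrow> rat"
  assume "padic_rel CARD('p) X X" "padic_rel CARD('p) Y Y"
  then have c: "padic_cauchy CARD('p) X" "padic_cauchy CARD('p) Y" by (auto simp: padic_rel_def)
  show "lim (\<lambda>n. padic_abs CARD('p) (X n + Y n))
      \<le> max (lim (\<lambda>n. padic_abs CARD('p) (X n))) (lim (\<lambda>n. padic_abs CARD('p) (Y n)))"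
    using padic_abs_LIMSEQ[OF padic_cauchy_add[OF prime_card c]]
      tendsto_max[OF padic_abs_LIMSEQ[OF c(1)] padic_abs_LIMSEQ[OF c(2)]]
    by (rule LIMSEQ_le) (auto simp: padic_abs_ultra[OF prime_card])
qed

lemma padic_norm_1 [simp]: "padic_norm (1 :: 'p::prime_card padic) = 1"
proof -
  have "padic_norm (1 :: 'p padic) * padic_norm (1 :: 'p padic) = padic_norm (1 :: 'p padic)"
    by (simp flip: padic_norm_mult)
  then show ?thesis by (simp add: padic_norm_eq_0_iff)
qed

lemma padic_norm_power: "padic_norm (x ^ k) = padic_norm (x :: 'p::prime_card padic) ^ k"
  by (induction k) (auto simp: padic_norm_mult)

lemma padic_norm_inverse: "padic_norm (inverse x) = inverse (padic_norm (x :: 'p::prime_card padic))"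
proof (cases "x = 0")
  case False
  then have "padic_norm x * padic_norm (inverse x) = 1"
    using padic_norm_mult[of x "inverse x"] by simp
  then show ?thesis by (metis inverse_unique)
qed auto

lemma padic_norm_divide: "padic_norm (x / y) = padic_norm x / padic_norm (y :: 'p::prime_card padic)"
  by (simp add: divide_inverse padic_norm_mult padic_norm_inverse)

lemma padic_norm_add_le: "padic_norm x \<le> r \<Longrightarrow> padic_norm y \<le> r \<Longrightarrow> padic_norm (x + y :: 'p::prime_card padic) \<le> r"
  using padic_norm_ultra[of x y] by linarith

lemma padic_norm_diff_le: "padic_norm x \<le> r \<Longrightarrow> padic_norm y \<le> r \<Longrightarrow> padic_norm (x - y :: 'p::prime_card padic) \<le> r"
  using padic_norm_add_le[of x r "- y"] by simp

lemma padic_norm_add_less: "padic_norm x < r \<Longrightarrow> padic_norm y < r \<Longrightarrow> padic_norm (x + y :: 'p::prime_card padic) < r"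
  using padic_norm_ultra[of x y] by linarith

lemma padic_norm_diff_commute: "padic_norm (x - y) = padic_norm (y - x :: 'p::prime_card padic)"
  using padic_norm_minus[of "x - y"] by simp

lemma padic_norm_sum_le:
  assumes "\<And>a. a \<in> A \<Longrightarrow> padic_norm (f a :: 'p::prime_card padic) \<le> r" "0 \<le> r"
  shows "padic_norm (sum f A) \<le> r"
  using assms by (induction A rule: infinite_finite_induct) (auto intro: padic_norm_add_le)

lemma padic_norm_prod: "padic_norm (prod f A) = (\<Prod>a\<in>A. padic_norm (f a :: 'p::prime_card padic))"
  by (induction A rule: infinite_finite_induct) (auto simp: padic_norm_mult)

lemma padic_norm_of_nat_le: "padic_norm (of_nat m :: 'p::prime_card padic) \<le> 1"
  by (induction m) (auto intro: padic_norm_add_le)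

lemma padic_norm_of_int_le: "padic_norm (of_int m :: 'p::prime_card padic) \<le> 1"
proof (cases "m \<ge> 0")
  case True
  then have "(of_int m :: 'p padic) = of_nat (nat m)" by simp
  then show ?thesis by (simp only: padic_norm_of_nat_le)
next
  case False
  then have "(of_int m :: 'p padic) = - of_nat (nat (- m))" by simp
  then show ?thesis by (simp only: padic_norm_of_nat_le padic_norm_minus)
qed

section \<open>The rationals in the p-adic field, and completeness\<close>

lift_definition padic_of_rat :: "rat \<Rightarrow> 'p::prime_card padic" is "\<lambda>r n. r"
  by (simp add: padic_rel_def)

lemma padic_norm_of_rat: "padic_norm (padic_of_rat r :: 'p::prime_card padic) = padic_abs CARD('p) r"
  by transfer simp

lemma padic_of_rat_simps:
  "padic_of_rat 0 = (0 :: 'p::prime_card padic)" "padic_of_rat 1 = (1 :: 'p::prime_card padic)"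
  "padic_of_rat (r + s) = (padic_of_rat r + padic_of_rat s :: 'p::prime_card padic)"
  "padic_of_rat (r * s) = (padic_of_rat r * padic_of_rat s :: 'p::prime_card padic)"
  "padic_of_rat (- r) = (- padic_of_rat r :: 'p::prime_card padic)"
  by (transfer; simp add: padic_rel_def)+

lemma padic_of_rat_diff: "padic_of_rat (r - s) = (padic_of_rat r - padic_of_rat s :: 'p::prime_card padic)"
  using padic_of_rat_simps(3)[of r "- s"] by (simp add: padic_of_rat_simps)

lemma padic_of_rat_of_nat: "padic_of_rat (of_nat m) = (of_nat m :: 'p::prime_card padic)"
  by (induction m) (simp_all add: padic_of_rat_simps)

lemma padic_of_rat_of_int: "padic_of_rat (of_int m) = (of_int m :: 'p::prime_card padic)"
  by (cases m rule: int_cases2) (simp_all add: padic_of_rat_simps padic_of_rat_of_nat)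

lemma padic_norm_prime: "padic_norm (of_nat CARD('p) :: 'p::prime_card padic) = 1 / real CARD('p)"
proof -
  have p: "prime CARD('p)" by (rule prime_card)
  have "padic_val CARD('p) (of_int (int CARD('p)) / of_int 1) = int (multiplicity (int CARD('p)) (int CARD('p)))
      - int (multiplicity (int CARD('p)) 1)"
    by (rule padic_val_quotient[OF p]) (use prime_gt_0_nat[OF p] in auto)
  moreover have "\<not> is_unit (int CARD('p))" using p by (metis not_prime_unit prime_nat_int_transfer)
  ultimately have v: "padic_val CARD('p) (of_nat CARD('p)) = 1"
    using prime_gt_0_nat[OF p] multiplicity_self[of "int CARD('p)"] by simp
  have "padic_norm (of_nat CARD('p) :: 'p padic) = padic_abs CARD('p) (of_nat CARD('p))"
    by (simp only: padic_norm_of_rat flip: padic_of_rat_of_nat)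
  also have "\<dots> = 1 / real CARD('p)"
    unfolding padic_abs_def v using prime_gt_0_nat[OF p] by (simp add: divide_inverse)
  finally show ?thesis .
qed

lemma padic_cases:
  obtains X where "padic_cauchy CARD('p) X" "x = (padic_of_seq X :: 'p::prime_card padic)"
proof -
  have "padic_rel CARD('p) (seq_of_padic x) (seq_of_padic x)" "x = padic_of_seq (seq_of_padic x)"
    using Quotient_rep_reflp[OF Quotient_padic] Quotient_abs_rep[OF Quotient_padic] by metis+
  then show ?thesis using that[of "seq_of_padic x"] by (simp add: padic_rel_def)
qed

lemma padic_norm_seq_diff:
  assumes "padic_cauchy CARD('p) X"
  shows "padic_norm (padic_of_seq X - padic_of_rat r :: 'p::prime_card padic) = lim (\<lambda>n. padic_abs CARD('p) (X n - r))"
proof -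
  have "padic_cauchy CARD('p) (\<lambda>n. X n + - r)"
    by (rule padic_cauchy_add[OF prime_card assms]) simp
  then have "padic_rel CARD('p) X X" "padic_rel CARD('p) (\<lambda>n. - r) (\<lambda>n. - r)"
      "padic_rel CARD('p) (\<lambda>n. X n + - r) (\<lambda>n. X n + - r)" "padic_rel CARD('p) (\<lambda>n. r) (\<lambda>n. r)"
    using assms by (simp_all add: padic_rel_def)
  then show ?thesis
    by (simp add: minus_padic_def padic_of_rat.abs_eq uminus_padic.abs_eq plus_padic.abs_eq padic_norm.abs_eq)
qed

text \<open>By the Cauchy condition all late values of \<open>padic_abs\<close> on
  \<open>X n - X k\<close> are below \<open>e\<close>, and the norm of the difference is their
  limit. Density of the rationals and completeness both rest on this.\<close>

lemma padic_of_seq_approx: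
  assumes "padic_cauchy CARD('p) X" "e > 0"
  shows "\<exists>N. \<forall>k\<ge>N. padic_norm (padic_of_seq X - padic_of_rat (X k) :: 'p::prime_card padic) \<le> e"
proof -
  obtain N where N: "\<forall>m\<ge>N. \<forall>n\<ge>N. padic_abs CARD('p) (X m - X n) < e"
    using assms unfolding padic_cauchy_def by blast
  have "padic_norm (padic_of_seq X - padic_of_rat (X k) :: 'p padic) \<le> e" if "k \<ge> N" for k
  proof -
    have "padic_cauchy CARD('p) (\<lambda>n. X n + - X k)"
      by (rule padic_cauchy_add[OF prime_card assms(1)]) simp
    then have "padic_cauchy CARD('p) (\<lambda>n. X n - X k)" by simp
    from padic_abs_LIMSEQ[OF this] have "lim (\<lambda>n. padic_abs CARD('p) (X n - X k)) \<le> e"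
      by (rule LIMSEQ_le_const2) (use N that in \<open>auto intro!: exI[of _ N] less_imp_le\<close>)
    then show ?thesis by (simp add: padic_norm_seq_diff[OF assms(1)])
  qed
  then show ?thesis by blast
qed

lemma padic_approx_rat:
  assumes "e > 0"
  obtains r where "padic_norm (x - padic_of_rat r :: 'p::prime_card padic) \<le> e"
proof -
  obtain X where X: "padic_cauchy CARD('p) X" "x = padic_of_seq X" by (rule padic_cases)
  then show ?thesis using padic_of_seq_approx[OF X(1) assms] that by blast
qed

lemma dist_padic: "dist x y = padic_norm (x - y :: 'p::prime_card padic)"
  by (rule dist_padic_def)

text \<open>Each term is replaced by a rational within \<open>1 / Suc k\<close> of it. The resulting
  rational sequence is Cauchy, so it represents an element of the completion, and that element is
  the limit.\<close>

instance padic :: (prime_card) complete_space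
proof
  fix x :: "nat \<Rightarrow> 'a padic"
  assume C: "Cauchy x"
  have "\<exists>r. padic_norm (x k - padic_of_rat r) \<le> 1 / real (Suc k)" for k
    using padic_approx_rat[of "1 / real (Suc k)" "x k"] by auto
  then obtain r where r: "\<And>k. padic_norm (x k - padic_of_rat (r k)) \<le> 1 / real (Suc k)"
    by metis
  have small: "\<exists>N. \<forall>k\<ge>N. padic_norm (x k - padic_of_rat (r k)) < e" if "e > 0" for e
  proof -
    obtain N where N: "1 / real (Suc N) < e" using nat_approx_posE[OF \<open>e > 0\<close>] by metis
    have "padic_norm (x k - padic_of_rat (r k)) < e" if "k \<ge> N" for k
    proof -
      have "1 / real (Suc k) \<le> 1 / real (Suc N)" using that by (simp add: field_simps)
      then show ?thesis using r[of k] N by linarith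
    qed
    then show ?thesis by blast
  qed
  have cr: "padic_cauchy CARD('a) r"
    unfolding padic_cauchy_def
  proof (intro allI impI)
    fix e :: real assume e: "e > 0"
    obtain N where N: "\<And>k. k \<ge> N \<Longrightarrow> padic_norm (x k - padic_of_rat (r k)) < e"
      using small[OF e] by blast
    obtain N' where N': "\<And>k l. k \<ge> N' \<Longrightarrow> l \<ge> N' \<Longrightarrow> padic_norm (x k - x l) < e"
      using C e unfolding Cauchy_def dist_padic by blast
    have "padic_abs CARD('a) (r k - r l) < e" if "k \<ge> max N N'" "l \<ge> max N N'" for k l
    proof -
      have "padic_abs CARD('a) (r k - r l) = padic_norm (padic_of_rat (r k - r l) :: 'a padic)"
        by (simp add: padic_norm_of_rat)
      also have "padic_of_rat (r k - r l) = - (x k - padic_of_rat (r k)) + (x k - x l) + (x l - padic_of_rat (r l))"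
        by (simp add: padic_of_rat_diff)
      also have "padic_norm \<dots> < e"
        using N[of k] N[of l] N'[of k l] that by (intro padic_norm_add_less) (simp_all add: padic_norm_diff_commute)
      finally show ?thesis .
    qed
    then show "\<exists>M. \<forall>m\<ge>M. \<forall>n\<ge>M. padic_abs CARD('a) (r m - r n) < e" by blast
  qed
  obtain y :: "'a padic" where y: "\<And>e. e > 0 \<Longrightarrow> \<exists>N. \<forall>k\<ge>N. padic_norm (y - padic_of_rat (r k)) \<le> e"
    using padic_of_seq_approx[OF cr] by metis
  have "x \<longlonglongrightarrow> y"
    unfolding LIMSEQ_def dist_padic
  proof (intro allI impI)
    fix e :: real assume e: "e > 0"
    obtain N where N: "\<And>k. k \<ge> N \<Longrightarrow> padic_norm (x k - padic_of_rat (r k)) < e"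
      using small[OF e] by blast
    obtain N' where N': "\<And>k. k \<ge> N' \<Longrightarrow> padic_norm (y - padic_of_rat (r k)) \<le> e / 2"
      using y[of "e / 2"] e by auto
    have "padic_norm (x k - y) < e" if "k \<ge> max N N'" for k
    proof -
      have "padic_norm ((x k - padic_of_rat (r k)) + - (y - padic_of_rat (r k))) < e"
        using N[of k] N'[of k] that e by (intro padic_norm_add_less) (simp_all add: padic_norm_diff_commute)
      then show ?thesis by simp
    qed
    then show "\<exists>M. \<forall>k\<ge>M. padic_norm (x k - y) < e" by blast
  qed
  then show "convergent x" by (auto simp: convergent_def)
qed


section \<open>Topological ring structure and the uniformizer\<close>

lemma tendsto_padic_iff: "(f \<longlongrightarrow> l) F \<longleftrightarrow> ((\<lambda>x. padic_norm (f x - l :: 'p::prime_card padic)) \<longlongrightarrow> 0) F"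
  by (subst tendsto_dist_iff) (simp add: dist_padic)

lemma padic_tendstoI:
  assumes "(g \<longlongrightarrow> 0) F" "\<And>x. padic_norm (f x - l :: 'p::prime_card padic) \<le> g x"
  shows "(f \<longlongrightarrow> l) F"
  unfolding tendsto_padic_iff
  by (rule tendsto_sandwich[OF _ _ tendsto_const assms(1)]) (use assms(2) in auto)

text \<open>Together with the multiplicative instance that follows, this makes the general rules for
  limits and for \<open>has_sum\<close> of sums and products available.\<close>

instance padic :: (prime_card) topological_ab_group_add
proof
  fix a b :: "'a padic"
  have *: "((\<lambda>x. padic_norm (fst x - a) + padic_norm (snd x - b)) \<longlongrightarrow> 0 + 0) (nhds a \<times>\<^sub>F nhds b)"
    by (intro tendsto_add tendsto_padic_iff[THEN iffD1] filterlim_fst filterlim_snd)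
  show "((\<lambda>x. fst x + snd x) \<longlongrightarrow> a + b) (nhds a \<times>\<^sub>F nhds b)"
  proof (rule padic_tendstoI)
    show "((\<lambda>x. padic_norm (fst x - a) + padic_norm (snd x - b)) \<longlongrightarrow> 0) (nhds a \<times>\<^sub>F nhds b)"
      using * by simp
    show "padic_norm (fst x + snd x - (a + b)) \<le> padic_norm (fst x - a) + padic_norm (snd x - b)" for x
      using padic_norm_triangle[of "fst x - a" "snd x - b"] by (simp add: algebra_simps)
  qed
  show "(uminus \<longlongrightarrow> - a) (nhds a)"
  proof (rule padic_tendstoI)
    show "((\<lambda>x. padic_norm (x - a)) \<longlongrightarrow> 0) (nhds a)"
      by (rule tendsto_padic_iff[THEN iffD1]) (rule filterlim_ident)
    show "padic_norm (- x - - a) \<le> padic_norm (x - a)" for x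
      using padic_norm_diff_commute[of x a] by simp
  qed
qed

instance padic :: (prime_card) topological_semigroup_mult
proof
  fix a b :: "'a padic"
  let ?F = "nhds a \<times>\<^sub>F nhds b"
  have *: "((\<lambda>x. padic_norm (fst x - a)) \<longlongrightarrow> 0) ?F" "((\<lambda>x. padic_norm (snd x - b)) \<longlongrightarrow> 0) ?F"
    by (intro tendsto_padic_iff[THEN iffD1] filterlim_fst filterlim_snd)+
  have 2: "((\<lambda>x. padic_norm (fst x - a) * padic_norm (snd x - b) + padic_norm a * padic_norm (snd x - b)
      + padic_norm (fst x - a) * padic_norm b) \<longlongrightarrow> 0 * 0 + padic_norm a * 0 + 0 * padic_norm b) ?F"
    by (intro tendsto_intros *)
  show "((\<lambda>x. fst x * snd x) \<longlongrightarrow> a * b) ?F"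
  proof (rule padic_tendstoI)
    show "((\<lambda>x. padic_norm (fst x - a) * padic_norm (snd x - b) + padic_norm a * padic_norm (snd x - b)
      + padic_norm (fst x - a) * padic_norm b) \<longlongrightarrow> 0) ?F" using 2 by simp
    show "padic_norm (fst x * snd x - a * b) \<le> padic_norm (fst x - a) * padic_norm (snd x - b) + padic_norm a * padic_norm (snd x - b)
      + padic_norm (fst x - a) * padic_norm b" for x
    proof -
      have "fst x * snd x - a * b = (fst x - a) * (snd x - b) + a * (snd x - b) + (fst x - a) * b"
        by (simp add: algebra_simps)
      then show ?thesis
        using padic_norm_triangle[of "(fst x - a) * (snd x - b) + a * (snd x - b)" "(fst x - a) * b"]
          padic_norm_triangle[of "(fst x - a) * (snd x - b)" "a * (snd x - b)"]
        by (simp add: padic_norm_mult)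
    qed
  qed
qed

text \<open>The prime itself. Whenever a radius has to be the norm of a field element, in particular
  for rescaling, a power of the norm of \<open>\<pi>\<close> is taken.\<close>

definition uniformizer :: "'p::prime_card padic" ("\<pi>") where
  "\<pi> = of_nat CARD('p)"

lemma uniformizer_norm: "padic_norm (\<pi> :: 'p::prime_card padic) = 1 / real CARD('p)"
  by (simp add: uniformizer_def padic_norm_prime)

lemma uniformizer_norm_less_1 [simp]: "padic_norm (\<pi> :: 'p::prime_card padic) < 1"
  using prime_gt_1_nat[OF prime_card[where 'a = 'p]] by (simp add: uniformizer_norm)

lemma uniformizer_nonzero [simp]: "(\<pi> :: 'p::prime_card padic) \<noteq> 0"
  using prime_gt_0_nat[OF prime_card[where 'a = 'p]]
  by (metis divide_pos_pos of_nat_0_less_iff padic_norm_gt_0_iff uniformizer_norm zero_less_one)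

lemma uniformizer_power_small:
  assumes "e > 0"
  obtains k where "padic_norm (\<pi> :: 'p::prime_card padic) ^ k < e"
  using real_arch_pow_inv[OF assms uniformizer_norm_less_1] by blast

lemma uniformizer_power_null: "(\<lambda>k. padic_norm (\<pi> :: 'p::prime_card padic) ^ k) \<longlonglongrightarrow> 0"
  by (rule LIMSEQ_realpow_zero) simp_all

text \<open>The residue field is the integers modulo \<open>p\<close>: a close rational has a
  denominator prime to \<open>p\<close>, which Bezout's identity inverts modulo \<open>p\<close>.
  Applied digit by digit in \<open>lev_subset_subgroup_mult\<close>.\<close>

lemma padic_approx_int:
  assumes "padic_norm (x :: 'p::prime_card padic) \<le> 1"
  obtains a :: int where "padic_norm (x - of_int a) \<le> 1 / real CARD('p)"
proof -
  let ?p = "CARD('p)"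
  have p: "prime ?p" by (rule prime_card)
  have p0: "1 / real ?p > 0" using prime_gt_0_nat[OF p] by simp
  have p1: "1 / real ?p < 1" using prime_gt_1_nat[OF p] by simp
  obtain r where r: "padic_norm (x - padic_of_rat r) \<le> 1 / real ?p" by (rule padic_approx_rat[OF p0])
  have "padic_norm (padic_of_rat r :: 'p padic) \<le> 1"
    using padic_norm_diff_le[OF assms, of "x - padic_of_rat r"] r p1 by simp
  moreover obtain c d where cd: "quotient_of r = (c, d)" by fastforce
  have d: "d > 0" using quotient_of_denom_pos[OF cd] .
  have rcd: "r = of_int c / of_int d" using quotient_of_div[OF cd] .
  have cop: "coprime c d" using quotient_of_coprime[OF cd] .
  \<comment> \<open>If \<open>p\<close> divided the denominator, the numerator would be prime to
    \<open>p\<close> and the norm of the rational would be at least \<open>p\<close>, although it is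
    at most 1.\<close>
  have nprime: "\<exists>u v. d * u + int ?p * v = 1"
  proof -
    have "\<not> int ?p dvd d"
    proof
      assume pd: "int ?p dvd d"
      then have "\<not> int ?p dvd c" using cop p
        by (metis coprime_common_divisor not_prime_unit prime_nat_int_transfer)
      then have "multiplicity (int ?p) c = 0" by (rule not_dvd_imp_multiplicity_0)
      moreover have "multiplicity (int ?p) d \<ge> 1"
        using pd d p by (intro multiplicity_geI) (auto simp: prime_nat_int_transfer dest: not_prime_unit)
      moreover have "c \<noteq> 0" using \<open>\<not> int ?p dvd c\<close> by auto
      ultimately have "padic_val ?p r \<le> -1"
        using padic_val_quotient[OF p, of c d] d rcd by simp
      moreover have "r \<noteq> 0" using \<open>c \<noteq> 0\<close> d rcd by simp
      ultimately have "padic_abs ?p r \<ge> real ?p powi 1"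
        unfolding padic_abs_def using prime_gt_0_nat[OF p] power_int_increasing[of 1 "- padic_val ?p r" "real ?p"]
        by (simp del: power_int_minus)
      then have "padic_norm (padic_of_rat r :: 'p padic) \<ge> real ?p" by (simp add: padic_norm_of_rat)
      then show False using \<open>padic_norm (padic_of_rat r :: 'p padic) \<le> 1\<close> prime_gt_1_nat[OF p] by simp
    qed
    then have "coprime (int ?p) d" using p by (simp add: prime_imp_coprime)
    then have "gcd d (int ?p) = 1" by (simp add: coprime_iff_gcd_eq_1 gcd.commute)
    then show ?thesis using bezout_int[of d "int ?p"] by (metis mult.commute)
  qed
  then obtain u v where uv: "d * u + int ?p * v = 1" by blast
  have "r - of_int (c * u) = r * of_int (int ?p * v)"
  proof -
    have "r - of_int (c * u) = r * of_int (1 - d * u)" using d by (simp add: rcd field_simps)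
    also have "1 - d * u = int ?p * v" using uv by simp
    finally show ?thesis .
  qed
  then have "padic_of_rat r - of_int (c * u) = (padic_of_rat r * (of_nat ?p * of_int v) :: 'p padic)"
    by (simp flip: padic_of_rat_of_int padic_of_rat_of_nat padic_of_rat_simps padic_of_rat_diff)
  then have "padic_norm (padic_of_rat r - of_int (c * u) :: 'p padic)
      = padic_norm (padic_of_rat r :: 'p padic) * (1 / real ?p * padic_norm (of_int v :: 'p padic))"
    by (simp add: padic_norm_mult padic_norm_prime)
  also have "\<dots> \<le> 1 * (1 / real ?p * 1)"
    using \<open>padic_norm (padic_of_rat r :: 'p padic) \<le> 1\<close>
    by (intro mult_mono padic_norm_of_int_le) auto
  finally have "padic_norm (padic_of_rat r - of_int (c * u) :: 'p padic) \<le> 1 / real ?p" by simp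
  then have "padic_norm (x - of_int (c * u)) \<le> 1 / real ?p"
    using padic_norm_add_le[OF r, of "padic_of_rat r - of_int (c * u)"] by simp
  then show ?thesis by (rule that)
qed

section \<open>Unconditional sums\<close>

text \<open>Over a complete ultrametric field this is exactly unconditional summability: see
  \<open>null_family_summable\<close> and \<open>has_sum_imp_null_family\<close>.\<close>

definition null_family :: "('a \<Rightarrow> 'p::prime_card padic) \<Rightarrow> 'a set \<Rightarrow> bool" where
  "null_family f A \<longleftrightarrow> (\<forall>e>0. finite {a \<in> A. padic_norm (f a) \<ge> e})"

text \<open>\<open>d\<close> plays the part of a degree: geometric decay in the degree suffices
  because a bound on the degree leaves only finitely many indices. Dividing by \<open>K + 1\<close>
  instead of \<open>K\<close> in the proof covers \<open>K = 0\<close>.\<close>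

lemma null_familyI_geometric:
  assumes bound: "\<And>a. a \<in> A \<Longrightarrow> padic_norm (f a :: 'p::prime_card padic) \<le> K * q ^ d a"
    and q: "0 \<le> q" "q < 1" and K: "0 \<le> K" and fin: "\<And>k. finite {a \<in> A. d a \<le> k}"
  shows "null_family f A"
  unfolding null_family_def
proof (intro allI impI)
  fix e :: real assume e: "e > 0"
  obtain k where k: "q ^ k < e / (K + 1)"
    using real_arch_pow_inv[OF _ q(2), of "e / (K + 1)"] e K by auto
  have "d a \<le> k" if "a \<in> A" "padic_norm (f a) \<ge> e" for a
  proof (rule ccontr)
    assume "\<not> d a \<le> k"
    then have "q ^ d a \<le> q ^ k" using q by (intro power_decreasing) auto
    then have "padic_norm (f a) \<le> K * q ^ k"
      using bound[OF that(1)] K by (meson mult_left_mono order_trans)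
    also have "\<dots> \<le> (K + 1) * q ^ k" using q by (intro mult_right_mono) auto
    also have "\<dots> < e" using k K by (simp add: field_simps)
    finally show False using that(2) by simp
  qed
  then have "{a \<in> A. padic_norm (f a) \<ge> e} \<subseteq> {a \<in> A. d a \<le> k}" by auto
  then show "finite {a \<in> A. e \<le> padic_norm (f a)}" using fin finite_subset by blast
qed

text \<open>An ultrametric sum is no larger than its largest term. Beyond the finite set
  \<open>S k\<close> of terms of norm at least \<open>(1/2)^k\<close>, any number of further terms
  changes a partial sum by at most \<open>(1/2)^k\<close>.\<close>

lemma null_family_summable:
  assumes "null_family f A"
  shows "f summable_on (A :: 'a set)"
proof -
  let ?r = "\<lambda>k. (1 / 2 :: real) ^ k"
  define S where "S k = {a \<in> A. padic_norm (f a) \<ge> ?r k}" for k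
  have fin: "finite (S k)" for k using assms by (auto simp: S_def null_family_def)
  have tail: "padic_norm (sum f F - sum f (S k)) \<le> ?r k" if "finite F" "S k \<subseteq> F" "F \<subseteq> A" for F k
  proof -
    have "sum f F - sum f (S k) = sum f (F - S k)" using that by (simp add: sum_diff)
    also have "padic_norm \<dots> \<le> ?r k"
      using that by (intro padic_norm_sum_le) (auto simp: S_def subset_iff not_le intro: less_imp_le)
    finally show ?thesis .
  qed
  have S_mono: "S k \<subseteq> S l" if "k \<le> l" for k l
  proof -
    have "?r l \<le> ?r k" using that by (intro power_decreasing) auto
    then show ?thesis unfolding S_def using order_trans[of "?r l" "?r k"] by blast
  qed
  have pow: "\<exists>k. ?r k < e" if "e > 0" for e :: real
    using real_arch_pow_inv[OF that, of "1/2"] by auto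
  have "Cauchy (\<lambda>k. sum f (S k))"
    unfolding Cauchy_altdef dist_padic
  proof (intro allI impI)
    fix e :: real assume "e > 0"
    then obtain k where k: "?r k < e" using pow by blast
    have "padic_norm (sum f (S m) - sum f (S n)) < e" if "m \<ge> k" "n > m" for m n
    proof -
      have "S m \<subseteq> A" "S n \<subseteq> A" by (auto simp: S_def)
      then have "padic_norm ((sum f (S m) - sum f (S k)) - (sum f (S n) - sum f (S k))) \<le> ?r k"
        using that by (intro padic_norm_diff_le tail fin S_mono) auto
      then show ?thesis using k by simp
    qed
    then show "\<exists>M. \<forall>m\<ge>M. \<forall>n>m. padic_norm (sum f (S m) - sum f (S n)) < e" by blast
  qed
  then obtain L where L: "(\<lambda>k. sum f (S k)) \<longlonglongrightarrow> L"
    by (auto simp: Cauchy_convergent_iff convergent_def)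
  have "(f has_sum L) A"
    unfolding has_sum_def tendsto_iff eventually_finite_subsets_at_top dist_padic
  proof (intro allI impI)
    fix e :: real assume e: "e > 0"
    then obtain k where k: "?r k < e" using pow by blast
    obtain M where M: "\<And>m. m \<ge> M \<Longrightarrow> padic_norm (sum f (S m) - L) < e"
      using L e unfolding LIMSEQ_def dist_padic by blast
    define l where "l = max k M"
    have "padic_norm (sum f F - L) < e" if "finite F" "S l \<subseteq> F" "F \<subseteq> A" for F
    proof -
      have "?r l \<le> ?r k" by (rule power_decreasing) (auto simp: l_def)
      then have "padic_norm ((sum f F - sum f (S l)) + (sum f (S l) - L)) < e"
        using tail[OF that] k M[of l] by (intro padic_norm_add_less) (linarith, simp add: l_def)
      then show ?thesis by simp
    qed
    moreover have "S l \<subseteq> A" by (auto simp: S_def)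
    ultimately show "\<exists>X. finite X \<and> X \<subseteq> A \<and> (\<forall>Y. finite Y \<and> X \<subseteq> Y \<and> Y \<subseteq> A \<longrightarrow> padic_norm (sum f Y - L) < e)"
      using fin by blast
  qed
  then show ?thesis by (auto simp: summable_on_def)
qed

lemma has_sum_padic_norm_le:
  assumes "(f has_sum s) A" "\<And>a. a \<in> A \<Longrightarrow> padic_norm (f a :: 'p::prime_card padic) \<le> r" "0 \<le> r"
  shows "padic_norm s \<le> r"
proof (rule field_le_epsilon)
  fix e :: real assume e: "e > 0"
  obtain F where F: "finite F" "F \<subseteq> A" "dist (sum f F) s \<le> e"
    using has_sum_finite_approximation[OF assms(1) e] by blast
  have "padic_norm s \<le> padic_norm (sum f F) + padic_norm (s - sum f F)"
    using padic_norm_triangle[of "sum f F" "s - sum f F"] by simp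
  also have "padic_norm (sum f F) \<le> r" using F assms by (intro padic_norm_sum_le) auto
  also have "padic_norm (s - sum f F) \<le> e" using F by (simp add: dist_padic padic_norm_diff_commute)
  finally show "padic_norm s \<le> r + e" by simp
qed

text \<open>Two finite partial sums that are both close to \<open>s\<close> and differ by one index
  show that the term at this index is small.\<close>

lemma has_sum_imp_null_family:
  assumes "(f has_sum (s :: 'p::prime_card padic)) A"
  shows "null_family f A"
  unfolding null_family_def
proof (intro allI impI)
  fix e :: real assume e: "e > 0"
  obtain X where X: "finite X" "X \<subseteq> A" "\<And>Y. finite Y \<Longrightarrow> X \<subseteq> Y \<Longrightarrow> Y \<subseteq> A \<Longrightarrow> padic_norm (sum f Y - s) < e"
    using assms e unfolding has_sum_def tendsto_iff eventually_finite_subsets_at_top dist_padic by metis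
  have "padic_norm (f a) < e" if "a \<in> A" "a \<notin> X" for a
  proof -
    have "padic_norm ((sum f (insert a X) - s) + - (sum f X - s)) < e"
      using X(1,2) that X(3)[of "insert a X"] X(3)[of X]
      by (intro padic_norm_add_less) (auto simp: padic_norm_diff_commute)
    moreover have "(sum f (insert a X) - s) + - (sum f X - s) = f a" using X that by simp
    ultimately show ?thesis by simp
  qed
  then have "{a \<in> A. e \<le> padic_norm (f a)} \<subseteq> X" by force
  then show "finite {a \<in> A. e \<le> padic_norm (f a)}" using X(1) finite_subset by blast
qed

text \<open>Fubini for null families: nullity of the whole double family gives summability over the
  product and along every column, so the order of summation may be exchanged. Cauchy products use
  the first conclusion, infinite sums of power series the second.\<close>

lemma null_family_double_sum:
  fixes f :: "'a \<Rightarrow> 'b \<Rightarrow> 'p::prime_card padic"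
  assumes null: "null_family (\<lambda>(a, b). f a b) (A \<times> B)"
    and rows: "\<And>a. a \<in> A \<Longrightarrow> (f a has_sum r a) B" and total: "(r has_sum s) A"
  shows "((\<lambda>(a, b). f a b) has_sum s) (A \<times> B)"
    and "((\<lambda>b. infsum (\<lambda>a. f a b) A) has_sum s) B"
proof -
  show *: "((\<lambda>(a, b). f a b) has_sum s) (A \<times> B)"
    by (rule has_sum_SigmaI[where g = r]) (use rows total null_family_summable[OF null] in auto)
  then have swapped: "((\<lambda>(b, a). f a b) has_sum s) (B \<times> A)"
    by (subst (asm) has_sum_swap) (simp add: case_prod_unfold)
  have "(\<lambda>a. f a b) summable_on A" if "b \<in> B" for b
  proof (rule null_family_summable)
    show "null_family (\<lambda>a. f a b) A"
      unfolding null_family_def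
    proof (intro allI impI)
      fix e :: real assume "e > 0"
      then have "finite (fst ` {x \<in> A \<times> B. e \<le> padic_norm (case x of (a, b) \<Rightarrow> f a b)})"
        using null by (auto simp: null_family_def)
      then show "finite {a \<in> A. e \<le> padic_norm (f a b)}"
        by (rule rev_finite_subset) (use that in force)
    qed
  qed
  then show "((\<lambda>b. infsum (\<lambda>a. f a b) A) has_sum s) B"
    by (intro has_sum_SigmaD[OF swapped]) (auto intro: has_sum_infsum)
qed


section \<open>The spaces \<open>\<rat>\<^sub>p\<^sup>n\<close>\<close>

definition vspace :: "nat \<Rightarrow> (nat \<Rightarrow> 'p::prime_card padic) set" where
  "vspace n = {x. \<forall>i\<ge>n. x i = 0}"

text \<open>The inserted 0 serves the case \<open>n = 0\<close>. On arbitrary functions this is only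
  a seminorm; on \<open>vspace n\<close> it is a norm.\<close>

definition vnorm :: "nat \<Rightarrow> (nat \<Rightarrow> 'p::prime_card padic) \<Rightarrow> real" where
  "vnorm n x = Max (insert 0 ((\<lambda>i. padic_norm (x i)) ` {..<n}))"

lemma vspaceD: "x \<in> vspace n \<Longrightarrow> i \<ge> n \<Longrightarrow> x i = 0"
  by (simp add: vspace_def)

lemma vspace_simps [simp]: "0 \<in> vspace n" "(\<lambda>i. 0) \<in> vspace n"
  by (auto simp: vspace_def)

lemma vspace_add: "x \<in> vspace n \<Longrightarrow> y \<in> vspace n \<Longrightarrow> x + y \<in> vspace n"
  and vspace_diff: "x \<in> vspace n \<Longrightarrow> y \<in> vspace n \<Longrightarrow> x - y \<in> vspace n"
  and vspace_minus: "x \<in> vspace n \<Longrightarrow> - x \<in> vspace n"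
  and vspace_scale: "x \<in> vspace n \<Longrightarrow> (\<lambda>i. c * x i) \<in> vspace n"
  by (auto simp: vspace_def)

lemma vnorm_le_iff: "vnorm n x \<le> r \<longleftrightarrow> 0 \<le> r \<and> (\<forall>i<n. padic_norm (x i) \<le> r)"
  unfolding vnorm_def by (subst Max_le_iff) auto

lemma vnorm_less_iff: "vnorm n x < r \<longleftrightarrow> 0 < r \<and> (\<forall>i<n. padic_norm (x i) < r)"
  unfolding vnorm_def by (subst Max_less_iff) auto

lemma vnorm_nonneg [simp]: "0 \<le> vnorm n x"
  using vnorm_le_iff[of n x "vnorm n x"] by simp

lemma padic_norm_le_vnorm: "i < n \<Longrightarrow> padic_norm (x i) \<le> vnorm n x"
  using vnorm_le_iff[of n x "vnorm n x"] by simp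

lemma vnorm_0 [simp]: "vnorm n 0 = 0" "vnorm n (\<lambda>i. 0) = 0"
  by (rule antisym; simp add: vnorm_le_iff)+

lemma vnorm_eq_0: "x \<in> vspace n \<Longrightarrow> vnorm n x = 0 \<longleftrightarrow> x = 0"
proof
  assume x: "x \<in> vspace n" "vnorm n x = 0"
  then have "\<forall>i<n. padic_norm (x i) \<le> 0" using vnorm_le_iff[of n x 0] by simp
  then show "x = 0" using x by (auto simp: fun_eq_iff vspace_def) (meson not_le)
qed simp

lemma vnorm_minus [simp]: "vnorm n (- x) = vnorm n x"
  by (simp add: vnorm_def)

lemma vnorm_diff_commute: "vnorm n (x - y) = vnorm n (y - x)"
  using vnorm_minus[of n "x - y"] by simp

lemma vnorm_add_le: "vnorm n x \<le> r \<Longrightarrow> vnorm n y \<le> r \<Longrightarrow> vnorm n (x + y) \<le> r"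
  by (auto simp: vnorm_le_iff intro: padic_norm_add_le)

lemma vnorm_diff_le: "vnorm n x \<le> r \<Longrightarrow> vnorm n y \<le> r \<Longrightarrow> vnorm n (x - y) \<le> r"
  by (auto simp: vnorm_le_iff intro: padic_norm_diff_le)

lemma vnorm_add_less: "vnorm n x < r \<Longrightarrow> vnorm n y < r \<Longrightarrow> vnorm n (x + y) < r"
  by (auto simp: vnorm_less_iff intro: padic_norm_add_less)

lemma vnorm_sum_le:
  assumes "\<And>a. a \<in> A \<Longrightarrow> vnorm n (f a) \<le> r" "0 \<le> r"
  shows "vnorm n (sum f A) \<le> r"
  using assms by (induction A rule: infinite_finite_induct) (auto intro: vnorm_add_le)

lemma vnorm_scale: "vnorm n (\<lambda>i. c * x i) = padic_norm c * vnorm n x"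
proof (rule antisym)
  show "vnorm n (\<lambda>i. c * x i) \<le> padic_norm c * vnorm n x"
    by (auto simp: vnorm_le_iff padic_norm_mult intro!: mult_left_mono padic_norm_le_vnorm)
  show "padic_norm c * vnorm n x \<le> vnorm n (\<lambda>i. c * x i)"
  proof (cases "c = 0")
    case False
    have "vnorm n x \<le> vnorm n (\<lambda>i. c * x i) / padic_norm c"
      using False padic_norm_le_vnorm[of _ n "\<lambda>i. c * x i"]
      by (auto simp: vnorm_le_iff padic_norm_mult field_simps)
    then show ?thesis using False by (simp add: field_simps)
  qed auto
qed


section \<open>Power series in several variables\<close>

abbreviation mdeg :: "nat \<Rightarrow> (nat \<Rightarrow> nat) \<Rightarrow> nat" where
  "mdeg n \<alpha> \<equiv> (\<Sum>i<n. \<alpha> i)"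

abbreviation mpow :: "nat \<Rightarrow> (nat \<Rightarrow> 'p::prime_card padic) \<Rightarrow> (nat \<Rightarrow> nat) \<Rightarrow> 'p padic" where
  "mpow n x \<alpha> \<equiv> (\<Prod>i<n. x i ^ \<alpha> i)"

lemma zero_multi_index [simp]: "(\<lambda>i. 0) \<in> multi_indices n" "0 \<in> multi_indices n"
  by (auto simp: multi_indices_def)

lemma finite_multi_indices_deg_le: "finite {\<alpha> \<in> multi_indices n. mdeg n \<alpha> \<le> k}"
proof -
  have "{\<alpha> \<in> multi_indices n. mdeg n \<alpha> \<le> k} \<subseteq> {f. \<forall>i. (i \<in> {..<n} \<longrightarrow> f i \<in> {..k}) \<and> (i \<notin> {..<n} \<longrightarrow> f i = 0)}"
  proof (intro subsetI CollectI allI conjI impI)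
    fix \<alpha> i assume a: "\<alpha> \<in> {\<alpha> \<in> multi_indices n. mdeg n \<alpha> \<le> k}"
    show "\<alpha> i \<in> {..k}" if "i \<in> {..<n}"
      using member_le_sum[OF that, of \<alpha>] a by simp
    show "\<alpha> i = 0" if "i \<notin> {..<n}" using a that by (simp add: multi_indices_def)
  qed
  then show ?thesis by (rule finite_subset) (intro finite_set_of_finite_funs; simp)
qed

lemma mpow_norm_le: "padic_norm (mpow n x \<alpha>) \<le> vnorm n x ^ mdeg n \<alpha>"
proof -
  have "padic_norm (mpow n x \<alpha>) = (\<Prod>i<n. padic_norm (x i) ^ \<alpha> i)"
    by (simp add: padic_norm_prod padic_norm_power)
  also have "\<dots> \<le> (\<Prod>i<n. vnorm n x ^ \<alpha> i)"
    by (intro prod_mono) (auto intro: power_mono padic_norm_le_vnorm)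
  finally show ?thesis by (simp add: power_sum)
qed

definition pcoeffs :: "nat \<Rightarrow> ((nat \<Rightarrow> nat) \<Rightarrow> 'p::prime_card padic) \<Rightarrow> real \<Rightarrow> real \<Rightarrow> bool" where
  "pcoeffs n c \<rho> C \<longleftrightarrow> (\<forall>\<alpha>\<in>multi_indices n. padic_norm (c \<alpha>) * \<rho> ^ mdeg n \<alpha> \<le> C)"

text \<open>Here \<open>C\<close> bounds the Gauss norm of the series.\<close>

definition pser :: "nat \<Rightarrow> ((nat \<Rightarrow> 'p::prime_card padic) \<Rightarrow> 'p padic) \<Rightarrow> real \<Rightarrow> real \<Rightarrow> bool" where
  "pser n f \<rho> C \<longleftrightarrow> \<rho> > 0 \<and> (\<exists>c. pcoeffs n c \<rho> C \<and>
     (\<forall>x\<in>vspace n. vnorm n x < \<rho> \<longrightarrow> ((\<lambda>\<alpha>. c \<alpha> * mpow n x \<alpha>) has_sum f x) (multi_indices n)))"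

lemma pcoeffs_nonneg: "pcoeffs n c \<rho> C \<Longrightarrow> 0 \<le> C"
  unfolding pcoeffs_def by (drule bspec[of _ _ "\<lambda>i. 0"]) (auto intro: order_trans[OF padic_norm_nonneg])

lemma pcoeffs_term_le:
  assumes "pcoeffs n c \<rho> C" "\<rho> > 0" "\<alpha> \<in> multi_indices n"
  shows "padic_norm (c \<alpha> * mpow n x \<alpha>) \<le> C * (vnorm n x / \<rho>) ^ mdeg n \<alpha>"
proof -
  have "padic_norm (c \<alpha> * mpow n x \<alpha>) \<le> padic_norm (c \<alpha>) * vnorm n x ^ mdeg n \<alpha>"
    unfolding padic_norm_mult by (intro mult_left_mono mpow_norm_le) simp
  also have "\<dots> = padic_norm (c \<alpha>) * \<rho> ^ mdeg n \<alpha> * (vnorm n x / \<rho>) ^ mdeg n \<alpha>"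
    using assms(2) by (simp add: power_divide)
  also have "\<dots> \<le> C * (vnorm n x / \<rho>) ^ mdeg n \<alpha>"
    using assms by (intro mult_right_mono) (auto simp: pcoeffs_def)
  finally show ?thesis .
qed

lemma pcoeffs_null_family:
  assumes "pcoeffs n c \<rho> C" "vnorm n x < \<rho>" "\<rho> > 0"
  shows "null_family (\<lambda>\<alpha>. c \<alpha> * mpow n x \<alpha>) (multi_indices n)"
  using pcoeffs_nonneg[OF assms(1)] assms
  by (intro null_familyI_geometric[where q = "vnorm n x / \<rho>" and d = "mdeg n" and K = C]
      pcoeffs_term_le[OF assms(1)] finite_multi_indices_deg_le) (auto simp: field_simps)

lemma pserE:
  assumes "pser n f \<rho> C"
  obtains c where "\<rho> > 0" "pcoeffs n c \<rho> C"
    "\<And>x. x \<in> vspace n \<Longrightarrow> vnorm n x < \<rho> \<Longrightarrow> ((\<lambda>\<alpha>. c \<alpha> * mpow n x \<alpha>) has_sum f x) (multi_indices n)"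
  using assms unfolding pser_def by blast

lemma pser_pos: "pser n f \<rho> C \<Longrightarrow> \<rho> > 0" and pser_nonneg: "pser n f \<rho> C \<Longrightarrow> 0 \<le> C"
  by (auto simp: pser_def dest: pcoeffs_nonneg)

lemma pser_bound:
  assumes "pser n f \<rho> C" "x \<in> vspace n" "vnorm n x < \<rho>"
  shows "padic_norm (f x) \<le> C"
proof -
  obtain c where c: "\<rho> > 0" "pcoeffs n c \<rho> C" "((\<lambda>\<alpha>. c \<alpha> * mpow n x \<alpha>) has_sum f x) (multi_indices n)"
    using pserE[OF assms(1)] assms(2,3) by blast
  have "C * (vnorm n x / \<rho>) ^ k \<le> C * 1" for k
    using assms c pcoeffs_nonneg[OF c(2)] by (intro mult_left_mono power_le_one) (auto simp: field_simps)
  then show ?thesis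
    using pcoeffs_term_le[OF c(2,1)] pcoeffs_nonneg[OF c(2)]
    by (intro has_sum_padic_norm_le[OF c(3)]) (auto intro: order_trans)
qed

lemma pser_cong:
  assumes "pser n f \<rho> C" "\<And>x. x \<in> vspace n \<Longrightarrow> vnorm n x < \<rho> \<Longrightarrow> g x = f x"
  shows "pser n g \<rho> C"
  using assms unfolding pser_def by metis

lemma pser_mono:
  assumes "pser n f \<rho> C" "0 < \<rho>'" "\<rho>' \<le> \<rho>" "C \<le> C'"
  shows "pser n f \<rho>' C'"
proof -
  obtain c where c: "\<rho> > 0" "pcoeffs n c \<rho> C"
    "\<And>x. x \<in> vspace n \<Longrightarrow> vnorm n x < \<rho> \<Longrightarrow> ((\<lambda>\<alpha>. c \<alpha> * mpow n x \<alpha>) has_sum f x) (multi_indices n)"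
    using pserE[OF assms(1)] by blast
  have "padic_norm (c \<alpha>) * \<rho>' ^ mdeg n \<alpha> \<le> C'" if "\<alpha> \<in> multi_indices n" for \<alpha>
  proof -
    have "padic_norm (c \<alpha>) * \<rho>' ^ mdeg n \<alpha> \<le> padic_norm (c \<alpha>) * \<rho> ^ mdeg n \<alpha>"
      using assms by (intro mult_left_mono power_mono) auto
    then show ?thesis using c(2) that assms(4) unfolding pcoeffs_def by fastforce
  qed
  then have "pcoeffs n c \<rho>' C'" by (simp add: pcoeffs_def)
  then show ?thesis using c(3) assms(2,3) unfolding pser_def
    by (intro conjI exI[of _ c]) (auto intro: less_le_trans)
qed

lemma pser_add:
  assumes "pser n f \<rho> C" "pser n g \<rho> C"
  shows "pser n (\<lambda>x. f x + g x) \<rho> C"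
proof -
  obtain c where c: "\<rho> > 0" "pcoeffs n c \<rho> C"
    "\<And>x. x \<in> vspace n \<Longrightarrow> vnorm n x < \<rho> \<Longrightarrow> ((\<lambda>\<alpha>. c \<alpha> * mpow n x \<alpha>) has_sum f x) (multi_indices n)"
    using pserE[OF assms(1)] by blast
  obtain d where d: "pcoeffs n d \<rho> C"
    "\<And>x. x \<in> vspace n \<Longrightarrow> vnorm n x < \<rho> \<Longrightarrow> ((\<lambda>\<alpha>. d \<alpha> * mpow n x \<alpha>) has_sum g x) (multi_indices n)"
    using pserE[OF assms(2)] by blast
  have "pcoeffs n (\<lambda>\<alpha>. c \<alpha> + d \<alpha>) \<rho> C"
    unfolding pcoeffs_def
  proof
    fix \<alpha> assume \<alpha>: "\<alpha> \<in> multi_indices n"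
    have "padic_norm (c \<alpha>) \<le> C / \<rho> ^ mdeg n \<alpha>" "padic_norm (d \<alpha>) \<le> C / \<rho> ^ mdeg n \<alpha>"
      using c d \<alpha> by (auto simp: pcoeffs_def field_simps)
    from padic_norm_add_le[OF this] show "padic_norm (c \<alpha> + d \<alpha>) * \<rho> ^ mdeg n \<alpha> \<le> C"
      using c(1) by (simp add: field_simps)
  qed
  moreover have "((\<lambda>\<alpha>. (c \<alpha> + d \<alpha>) * mpow n x \<alpha>) has_sum f x + g x) (multi_indices n)"
    if "x \<in> vspace n" "vnorm n x < \<rho>" for x
    using has_sum_add[OF c(3)[OF that] d(2)[OF that]] by (simp add: distrib_right)
  ultimately show ?thesis unfolding pser_def using c(1) by blast
qed

text \<open>The Cauchy product. The ultrametric inequality makes the Gauss norm submultiplicative,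
  without a factor for the number of summands of a coefficient.\<close>

lemma pser_mult:
  assumes "pser n f \<rho> C" "pser n g \<rho> D"
  shows "pser n (\<lambda>x. f x * g x) \<rho> (C * D)"
proof -
  let ?M = "multi_indices n"
  obtain c where c: "\<rho> > 0" "pcoeffs n c \<rho> C"
    "\<And>x. x \<in> vspace n \<Longrightarrow> vnorm n x < \<rho> \<Longrightarrow> ((\<lambda>\<alpha>. c \<alpha> * mpow n x \<alpha>) has_sum f x) ?M"
    using pserE[OF assms(1)] by blast
  obtain d where d: "pcoeffs n d \<rho> D"
    "\<And>x. x \<in> vspace n \<Longrightarrow> vnorm n x < \<rho> \<Longrightarrow> ((\<lambda>\<alpha>. d \<alpha> * mpow n x \<alpha>) has_sum g x) ?M"
    using pserE[OF assms(2)] by blast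
  have CD: "C \<ge> 0" "D \<ge> 0" using assms by (auto dest: pser_nonneg)
  \<comment> \<open>The exponents \<open>\<alpha>\<close> componentwise below
    \<open>\<gamma>\<close>, that is the splittings
    \<open>\<gamma> = \<alpha> + (\<gamma> - \<alpha>)\<close>; for these the truncated subtraction
    of naturals is exact.\<close>
  define L where "L \<gamma> = {\<alpha> \<in> ?M. \<alpha> \<le> \<gamma>}" for \<gamma> :: "nat \<Rightarrow> nat"
  define e where "e \<gamma> = (\<Sum>\<alpha>\<in>L \<gamma>. c \<alpha> * d (\<gamma> - \<alpha>))" for \<gamma>
  have deg_add: "mdeg n \<gamma> = mdeg n \<alpha> + mdeg n (\<gamma> - \<alpha>)" if "\<alpha> \<le> \<gamma>" for \<alpha> \<gamma>
    using that by (simp add: le_fun_def flip: sum.distrib)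
  have L_fin: "finite (L \<gamma>)" for \<gamma>
  proof (rule finite_subset[OF _ finite_multi_indices_deg_le[of n "mdeg n \<gamma>"]])
    show "L \<gamma> \<subseteq> {\<alpha> \<in> ?M. mdeg n \<alpha> \<le> mdeg n \<gamma>}"
      unfolding L_def by (auto intro!: sum_mono simp: le_fun_def)
  qed
  have diff_M: "\<gamma> - \<alpha> \<in> ?M" if "\<gamma> \<in> ?M" for \<alpha> \<gamma> using that by (simp add: multi_indices_def)
  have "pcoeffs n e \<rho> (C * D)"
    unfolding pcoeffs_def
  proof
    fix \<gamma> assume \<gamma>: "\<gamma> \<in> ?M"
    have "padic_norm (e \<gamma>) \<le> C * D / \<rho> ^ mdeg n \<gamma>"
      unfolding e_def
    proof (rule padic_norm_sum_le)
      fix \<alpha> assume \<alpha>: "\<alpha> \<in> L \<gamma>"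
      have "padic_norm (c \<alpha>) * \<rho> ^ mdeg n \<alpha> * (padic_norm (d (\<gamma> - \<alpha>)) * \<rho> ^ mdeg n (\<gamma> - \<alpha>)) \<le> C * D"
        using c d(1) \<alpha> diff_M[OF \<gamma>, of \<alpha>] CD unfolding pcoeffs_def L_def by (intro mult_mono) (blast, blast, auto)
      then show "padic_norm (c \<alpha> * d (\<gamma> - \<alpha>)) \<le> C * D / \<rho> ^ mdeg n \<gamma>"
        using \<alpha> c(1) deg_add[of \<alpha> \<gamma>] by (simp add: L_def padic_norm_mult power_add field_simps)
    qed (use CD c in auto)
    then show "padic_norm (e \<gamma>) * \<rho> ^ mdeg n \<gamma> \<le> C * D" using c(1) by (simp add: field_simps)
  qed
  moreover have "((\<lambda>\<gamma>. e \<gamma> * mpow n x \<gamma>) has_sum f x * g x) ?M"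
    if x: "x \<in> vspace n" "vnorm n x < \<rho>" for x
  proof -
    define t where "t \<alpha> \<beta> = (c \<alpha> * mpow n x \<alpha>) * (d \<beta> * mpow n x \<beta>)" for \<alpha> \<beta>
    have "null_family (\<lambda>(\<alpha>, \<beta>). t \<alpha> \<beta>) (?M \<times> ?M)"
    proof (rule null_familyI_geometric[where q = "vnorm n x / \<rho>" and K = "C * D"
          and d = "\<lambda>(\<alpha>, \<beta>). mdeg n \<alpha> + mdeg n \<beta>"])
      fix ab assume ab: "ab \<in> ?M \<times> ?M"
      obtain \<alpha> \<beta> where ab': "ab = (\<alpha>, \<beta>)" by fastforce
      have "padic_norm (t \<alpha> \<beta>) \<le> (C * (vnorm n x / \<rho>) ^ mdeg n \<alpha>) * (D * (vnorm n x / \<rho>) ^ mdeg n \<beta>)"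
        unfolding t_def padic_norm_mult[of "c \<alpha> * _"] using ab ab' CD c(1)
        by (intro mult_mono pcoeffs_term_le[OF c(2,1)] pcoeffs_term_le[OF d(1) c(1)]) auto
      then show "padic_norm (case ab of (\<alpha>, \<beta>) \<Rightarrow> t \<alpha> \<beta>)
          \<le> C * D * (vnorm n x / \<rho>) ^ (case ab of (\<alpha>, \<beta>) \<Rightarrow> mdeg n \<alpha> + mdeg n \<beta>)"
        by (simp add: ab' power_add field_simps)
    next
      fix k
      have "{ab \<in> ?M \<times> ?M. (case ab of (\<alpha>, \<beta>) \<Rightarrow> mdeg n \<alpha> + mdeg n \<beta>) \<le> k}
          \<subseteq> {\<alpha> \<in> ?M. mdeg n \<alpha> \<le> k} \<times> {\<alpha> \<in> ?M. mdeg n \<alpha> \<le> k}" by auto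
      then show "finite {ab \<in> ?M \<times> ?M. (case ab of (\<alpha>, \<beta>) \<Rightarrow> mdeg n \<alpha> + mdeg n \<beta>) \<le> k}"
        by (rule finite_subset) (intro finite_cartesian_product finite_multi_indices_deg_le)
    qed (use CD x c(1) in \<open>auto simp: field_simps\<close>)
    from null_family_double_sum(1)[OF this, where r = "\<lambda>\<alpha>. c \<alpha> * mpow n x \<alpha> * g x" and s = "f x * g x"]
    have "((\<lambda>(\<alpha>, \<beta>). t \<alpha> \<beta>) has_sum f x * g x) (?M \<times> ?M)"
      unfolding t_def using has_sum_cmult_right[OF d(2)[OF x]] has_sum_cmult_left[OF c(3)[OF x]] by blast
    also have "((\<lambda>(\<alpha>, \<beta>). t \<alpha> \<beta>) has_sum f x * g x) (?M \<times> ?M) \<longleftrightarrow>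
        ((\<lambda>(\<gamma>, \<alpha>). t \<alpha> (\<gamma> - \<alpha>)) has_sum f x * g x) (Sigma ?M L)"
      by (rule has_sum_reindex_bij_witness[where i = "\<lambda>(\<gamma>, \<alpha>). (\<alpha>, \<gamma> - \<alpha>)" and j = "\<lambda>(\<alpha>, \<beta>). (\<alpha> + \<beta>, \<alpha>)"])
        (auto simp: L_def multi_indices_def le_fun_def fun_eq_iff)
    finally have "((\<lambda>(\<gamma>, \<alpha>). t \<alpha> (\<gamma> - \<alpha>)) has_sum f x * g x) (Sigma ?M L)" .
    then have "((\<lambda>\<gamma>. \<Sum>\<alpha>\<in>L \<gamma>. t \<alpha> (\<gamma> - \<alpha>)) has_sum f x * g x) ?M"
      by (rule has_sum_SigmaD) (auto intro: has_sum_finite L_fin)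
    also have "((\<lambda>\<gamma>. \<Sum>\<alpha>\<in>L \<gamma>. t \<alpha> (\<gamma> - \<alpha>)) has_sum f x * g x) ?M \<longleftrightarrow> ?thesis"
    proof (rule has_sum_cong)
      fix \<gamma> assume "\<gamma> \<in> ?M"
      have "t \<alpha> (\<gamma> - \<alpha>) = c \<alpha> * d (\<gamma> - \<alpha>) * mpow n x \<gamma>" if "\<alpha> \<in> L \<gamma>" for \<alpha>
      proof -
        have "mpow n x \<gamma> = mpow n x \<alpha> * mpow n x (\<gamma> - \<alpha>)"
          using that by (simp add: L_def le_fun_def flip: prod.distrib power_add)
        then show ?thesis by (simp add: t_def)
      qed
      then show "(\<Sum>\<alpha>\<in>L \<gamma>. t \<alpha> (\<gamma> - \<alpha>)) = e \<gamma> * mpow n x \<gamma>"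
        by (simp add: e_def sum_distrib_right)
    qed
    finally show ?thesis .
  qed
  ultimately show ?thesis unfolding pser_def using c(1) by blast
qed

lemma pser_const: "\<rho> > 0 \<Longrightarrow> pser n (\<lambda>x. a) \<rho> (padic_norm a)"
proof -
  assume \<rho>: "\<rho> > 0"
  let ?c = "\<lambda>\<alpha> :: nat \<Rightarrow> nat. if \<alpha> = (\<lambda>i. 0) then a else 0"
  have "((\<lambda>\<alpha>. ?c \<alpha> * mpow n x \<alpha>) has_sum a) (multi_indices n)" for x
    by (rule has_sum_finite_neutralI[of "{\<lambda>i. 0}"]) auto
  moreover have "pcoeffs n ?c \<rho> (padic_norm a)" by (simp add: pcoeffs_def)
  ultimately show ?thesis unfolding pser_def using \<rho> by blast
qed

lemma pser_coord: "\<rho> > 0 \<Longrightarrow> i < n \<Longrightarrow> pser n (\<lambda>x. x i) \<rho> \<rho>"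
proof -
  assume \<rho>: "\<rho> > 0" and i: "i < n"
  let ?e = "\<lambda>j. if j = i then 1 else 0 :: nat"
  let ?c = "\<lambda>\<alpha> :: nat \<Rightarrow> nat. if \<alpha> = ?e then 1 else 0"
  have e: "?e \<in> multi_indices n" "mdeg n ?e = 1" using i by (auto simp: multi_indices_def)
  have "((\<lambda>\<alpha>. ?c \<alpha> * mpow n x \<alpha>) has_sum x i) (multi_indices n)" for x :: "nat \<Rightarrow> 'a padic"
  proof (rule has_sum_finite_neutralI[of "{?e}"])
    have "(\<Prod>j<n. x j ^ ?e j) = (\<Prod>j\<in>{i}. x j)"
      by (rule prod.mono_neutral_cong_right) (use i in auto)
    then show "x i = (\<Sum>\<alpha>\<in>{?e}. ?c \<alpha> * mpow n x \<alpha>)" by simp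
  qed (use e in auto)
  moreover have "pcoeffs n ?c \<rho> \<rho>" using e \<rho> by (auto simp: pcoeffs_def)
  ultimately show ?thesis unfolding pser_def using \<rho> by blast
qed

lemma pser_power: "pser n f \<rho> C \<Longrightarrow> pser n (\<lambda>x. f x ^ k) \<rho> (C ^ k)"
proof (induction k)
  case 0
  then show ?case using pser_const[of \<rho> n 1] by (simp add: pser_pos)
next
  case (Suc k)
  then show ?case using pser_mult[of n f \<rho> C "\<lambda>x. f x ^ k" "C ^ k"] by simp
qed

lemma pser_prod:
  assumes "finite I" "\<And>i. i \<in> I \<Longrightarrow> pser n (f i) \<rho> (C i)" "\<rho> > 0"
  shows "pser n (\<lambda>x. \<Prod>i\<in>I. f i x) \<rho> (\<Prod>i\<in>I. C i)"
  using assms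
proof (induction I rule: finite_induct)
  case empty
  then show ?case using pser_const[of \<rho> n 1] by simp
qed (simp add: pser_mult)

lemma pser_cmult: "pser n f \<rho> C \<Longrightarrow> pser n (\<lambda>x. a * f x) \<rho> (padic_norm a * C)"
  using pser_mult[OF pser_const] pser_pos by blast

text \<open>\<open>B k\<close> bounds the Gauss norm of \<open>f k\<close> and tends to zero along
  \<open>A\<close>. Hence the double family of all monomials of all \<open>f k\<close> is null, and
  the coefficients may be summed over \<open>k\<close> first.\<close>

lemma pser_infsum:
  assumes f: "\<And>k. k \<in> A \<Longrightarrow> pser n (f k) \<rho> (B k)" and \<rho>: "\<rho> > 0"
    and C: "\<And>k. k \<in> A \<Longrightarrow> B k \<le> C" "0 \<le> C"
    and B: "\<And>e. e > 0 \<Longrightarrow> finite {k \<in> A. B k \<ge> e}"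
    and g: "\<And>x. x \<in> vspace n \<Longrightarrow> vnorm n x < \<rho> \<Longrightarrow> ((\<lambda>k. f k x) has_sum g x) A"
  shows "pser n g \<rho> C"
proof -
  let ?M = "multi_indices n"
  have "\<forall>k\<in>A. \<exists>c. pcoeffs n c \<rho> (B k) \<and>
     (\<forall>x\<in>vspace n. vnorm n x < \<rho> \<longrightarrow> ((\<lambda>\<alpha>. c \<alpha> * mpow n x \<alpha>) has_sum f k x) ?M)"
    using f unfolding pser_def by blast
  from bchoice[OF this] obtain c where c: "\<And>k. k \<in> A \<Longrightarrow> pcoeffs n (c k) \<rho> (B k)"
    "\<And>k x. k \<in> A \<Longrightarrow> x \<in> vspace n \<Longrightarrow> vnorm n x < \<rho> \<Longrightarrow> ((\<lambda>\<alpha>. c k \<alpha> * mpow n x \<alpha>) has_sum f k x) ?M"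
    by blast
  define d where "d \<alpha> = infsum (\<lambda>k. c k \<alpha>) A" for \<alpha>
  have c_le: "padic_norm (c k \<alpha>) \<le> B k / \<rho> ^ mdeg n \<alpha>" if "k \<in> A" "\<alpha> \<in> ?M" for k \<alpha>
    using c(1)[OF that(1)] that(2) \<rho> by (simp add: pcoeffs_def field_simps)
  have d: "((\<lambda>k. c k \<alpha>) has_sum d \<alpha>) A" if \<alpha>: "\<alpha> \<in> ?M" for \<alpha>
    unfolding d_def
  proof (rule has_sum_infsum[OF null_family_summable])
    show "null_family (\<lambda>k. c k \<alpha>) A"
      unfolding null_family_def
    proof (intro allI impI)
      fix e :: real assume "e > 0"
      then have "finite {k \<in> A. B k \<ge> e * \<rho> ^ mdeg n \<alpha>}" using B \<rho> by simp
      then show "finite {k \<in> A. e \<le> padic_norm (c k \<alpha>)}"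
      proof (rule rev_finite_subset, safe)
        fix k assume "k \<in> A" "e \<le> padic_norm (c k \<alpha>)"
        then have "e \<le> B k / \<rho> ^ mdeg n \<alpha>" using c_le \<alpha> by fastforce
        then show "e * \<rho> ^ mdeg n \<alpha> \<le> B k" using \<rho> by (simp add: field_simps)
      qed
    qed
  qed
  have "pcoeffs n d \<rho> C"
    unfolding pcoeffs_def
  proof
    fix \<alpha> assume \<alpha>: "\<alpha> \<in> ?M"
    have "padic_norm (d \<alpha>) \<le> C / \<rho> ^ mdeg n \<alpha>"
    proof (rule has_sum_padic_norm_le[OF d[OF \<alpha>]])
      fix k assume k: "k \<in> A"
      have "B k / \<rho> ^ mdeg n \<alpha> \<le> C / \<rho> ^ mdeg n \<alpha>" using C(1)[OF k] \<rho> by (intro divide_right_mono) auto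
      then show "padic_norm (c k \<alpha>) \<le> C / \<rho> ^ mdeg n \<alpha>" using c_le[OF k \<alpha>] by simp
    qed (use C \<rho> in auto)
    then show "padic_norm (d \<alpha>) * \<rho> ^ mdeg n \<alpha> \<le> C" using \<rho> by (simp add: field_simps)
  qed
  moreover have "((\<lambda>\<alpha>. d \<alpha> * mpow n x \<alpha>) has_sum g x) ?M" if x: "x \<in> vspace n" "vnorm n x < \<rho>" for x
  proof -
    define q where "q = vnorm n x / \<rho>"
    have q: "0 \<le> q" "q < 1" using x \<rho> by (auto simp: q_def)
    have t_le: "padic_norm (c k \<alpha> * mpow n x \<alpha>) \<le> B k * q ^ mdeg n \<alpha>" if "k \<in> A" "\<alpha> \<in> ?M" for k \<alpha>
      unfolding q_def by (rule pcoeffs_term_le[OF c(1) \<rho>]) (use that in auto)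
    have "null_family (\<lambda>(k, \<alpha>). c k \<alpha> * mpow n x \<alpha>) (A \<times> ?M)"
      unfolding null_family_def
    proof (intro allI impI)
      fix e :: real assume e: "e > 0"
      obtain K where K: "q ^ K < e / (C + 1)"
        using real_arch_pow_inv[OF _ q(2), of "e / (C + 1)"] e C(2) by auto
      have "B k \<ge> e" "mdeg n \<alpha> \<le> K" if "k \<in> A" "\<alpha> \<in> ?M" "e \<le> padic_norm (c k \<alpha> * mpow n x \<alpha>)" for k \<alpha>
      proof -
        have e': "e \<le> B k * q ^ mdeg n \<alpha>" using t_le that by fastforce
        have "0 \<le> B k" using c(1)[OF that(1)] pcoeffs_nonneg by blast
        then have "B k * q ^ mdeg n \<alpha> \<le> B k * 1" using q by (intro mult_left_mono power_le_one) auto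
        then show "B k \<ge> e" using e' by simp
        show "mdeg n \<alpha> \<le> K"
        proof (rule ccontr)
          assume "\<not> mdeg n \<alpha> \<le> K"
          then have "B k * q ^ mdeg n \<alpha> \<le> (C + 1) * q ^ K"
            using C(1)[OF that(1)] q \<open>0 \<le> B k\<close> by (intro mult_mono power_decreasing) auto
          also have "\<dots> < e" using K C(2) by (simp add: field_simps)
          finally show False using e' by simp
        qed
      qed
      then have "{k \<in> A \<times> ?M. e \<le> padic_norm (case k of (k, \<alpha>) \<Rightarrow> c k \<alpha> * mpow n x \<alpha>)}
          \<subseteq> {k \<in> A. B k \<ge> e} \<times> {\<alpha> \<in> ?M. mdeg n \<alpha> \<le> K}" by auto
      then show "finite {k \<in> A \<times> ?M. e \<le> padic_norm (case k of (k, \<alpha>) \<Rightarrow> c k \<alpha> * mpow n x \<alpha>)}"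
        by (rule finite_subset) (intro finite_cartesian_product finite_multi_indices_deg_le B e)
    qed
    from null_family_double_sum(2)[OF this c(2)[OF _ x] g[OF x]]
    have "((\<lambda>\<alpha>. infsum (\<lambda>k. c k \<alpha> * mpow n x \<alpha>) A) has_sum g x) ?M" by simp
    also have "?this \<longleftrightarrow> ?thesis"
      by (intro has_sum_cong infsumI has_sum_cmult_left d)
    finally show ?thesis .
  qed
  ultimately show ?thesis unfolding pser_def using \<rho> by blast
qed

text \<open>Each monomial of the outer series becomes a product of inner series. As
  \<open>R'\<close> is strictly less than \<open>R\<close>, the Gauss norms of these products decay
  geometrically in the degree, which is what \<open>pser_infsum\<close> asks for.\<close>

lemma pser_compose:
  assumes f: "pser m f R C" and u: "\<And>i. i < m \<Longrightarrow> pser n (\<lambda>x. u x i) \<rho> R'" and R': "0 \<le> R'" "R' < R"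
    and \<rho>: "\<rho> > 0" and um: "\<And>x. x \<in> vspace n \<Longrightarrow> vnorm n x < \<rho> \<Longrightarrow> u x \<in> vspace m"
  shows "pser n (\<lambda>x. f (u x)) \<rho> C"
proof -
  let ?M = "multi_indices m"
  obtain c where c: "R > 0" "pcoeffs m c R C"
    "\<And>x. x \<in> vspace m \<Longrightarrow> vnorm m x < R \<Longrightarrow> ((\<lambda>\<alpha>. c \<alpha> * mpow m x \<alpha>) has_sum f x) ?M"
    using pserE[OF f] by blast
  have C: "0 \<le> C" using f by (rule pser_nonneg)
  have B: "padic_norm (c \<alpha>) * R' ^ mdeg m \<alpha> \<le> C * (R' / R) ^ mdeg m \<alpha>" if "\<alpha> \<in> ?M" for \<alpha>
  proof -
    have "padic_norm (c \<alpha>) * R' ^ mdeg m \<alpha> = padic_norm (c \<alpha>) * R ^ mdeg m \<alpha> * (R' / R) ^ mdeg m \<alpha>"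
      using c(1) by (simp add: power_divide)
    also have "\<dots> \<le> C * (R' / R) ^ mdeg m \<alpha>"
      using c that R' by (intro mult_right_mono) (auto simp: pcoeffs_def)
    finally show ?thesis .
  qed
  have q: "0 \<le> R' / R" "R' / R < 1" using R' c(1) by auto
  show ?thesis
  proof (rule pser_infsum[where f = "\<lambda>\<alpha> x. c \<alpha> * mpow m (u x) \<alpha>" and A = ?M
        and B = "\<lambda>\<alpha>. padic_norm (c \<alpha>) * R' ^ mdeg m \<alpha>"])
    show "pser n (\<lambda>x. c \<alpha> * mpow m (u x) \<alpha>) \<rho> (padic_norm (c \<alpha>) * R' ^ mdeg m \<alpha>)" if "\<alpha> \<in> ?M" for \<alpha>
      unfolding power_sum by (intro pser_cmult pser_prod pser_power u \<rho>) auto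
    show "padic_norm (c \<alpha>) * R' ^ mdeg m \<alpha> \<le> C" if "\<alpha> \<in> ?M" for \<alpha>
    proof -
      have "C * (R' / R) ^ mdeg m \<alpha> \<le> C * 1" using q C by (intro mult_left_mono power_le_one) auto
      then show ?thesis using B[OF that] by simp
    qed
    show "finite {k \<in> ?M. e \<le> padic_norm (c k) * R' ^ mdeg m k}" if e: "e > 0" for e
    proof -
      obtain K where K: "(R' / R) ^ K < e / (C + 1)"
        using real_arch_pow_inv[OF _ q(2), of "e / (C + 1)"] e C by auto
      have "mdeg m k \<le> K" if "k \<in> ?M" "e \<le> padic_norm (c k) * R' ^ mdeg m k" for k
      proof (rule ccontr)
        assume "\<not> mdeg m k \<le> K"
        then have "C * (R' / R) ^ mdeg m k \<le> (C + 1) * (R' / R) ^ K"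
          using q C by (intro mult_mono power_decreasing) auto
        also have "\<dots> < e" using K C by (simp add: field_simps)
        finally show False using B[OF that(1)] that(2) by simp
      qed
      then show ?thesis by (intro finite_subset[OF _ finite_multi_indices_deg_le[of m K]]) auto
    qed
    show "((\<lambda>\<alpha>. c \<alpha> * mpow m (u x) \<alpha>) has_sum f (u x)) ?M" if x: "x \<in> vspace n" "vnorm n x < \<rho>" for x
    proof (rule c(3)[OF um[OF x]])
      have "vnorm m (u x) \<le> R'" using pser_bound[OF u x] R' by (auto simp: vnorm_le_iff)
      then show "vnorm m (u x) < R" using R' by simp
    qed
  qed (use \<rho> C in auto)
qed

text \<open>Every nonconstant monomial shrinks at least by the factor
  \<open>\<rho>' / \<rho>\<close>. In \<open>lser_compose\<close> this makes the inner functions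
  small enough for substitution.\<close>

lemma pser_shrink:
  assumes "pser n f \<rho> C" "0 < \<rho>'" "\<rho>' \<le> \<rho>"
  shows "pser n f \<rho>' (max (padic_norm (f 0)) (C * (\<rho>' / \<rho>)))"
proof -
  obtain c where c: "\<rho> > 0" "pcoeffs n c \<rho> C"
    "\<And>x. x \<in> vspace n \<Longrightarrow> vnorm n x < \<rho> \<Longrightarrow> ((\<lambda>\<alpha>. c \<alpha> * mpow n x \<alpha>) has_sum f x) (multi_indices n)"
    using pserE[OF assms(1)] by blast
  have "((\<lambda>\<alpha>. c \<alpha> * mpow n 0 \<alpha>) has_sum c 0) (multi_indices n)"
  proof (rule has_sum_finite_neutralI[of "{0}"])
    show "c \<alpha> * mpow n 0 \<alpha> = 0" if "\<alpha> \<in> multi_indices n - {0}" for \<alpha>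
    proof -
      have "\<exists>i<n. \<alpha> i \<noteq> 0"
      proof (rule ccontr)
        assume "\<not> (\<exists>i<n. \<alpha> i \<noteq> 0)"
        then have "\<alpha> = 0" using that by (auto simp: multi_indices_def fun_eq_iff) (metis leI)
        then show False using that by simp
      qed
      then show ?thesis by (auto intro!: prod_zero)
    qed
  qed auto
  then have c0: "c 0 = f 0" using c(3)[of 0] c(1) has_sum_unique by auto
  have "pcoeffs n c \<rho>' (max (padic_norm (f 0)) (C * (\<rho>' / \<rho>)))"
    unfolding pcoeffs_def
  proof
    fix \<alpha> assume \<alpha>: "\<alpha> \<in> multi_indices n"
    show "padic_norm (c \<alpha>) * \<rho>' ^ mdeg n \<alpha> \<le> max (padic_norm (f 0)) (C * (\<rho>' / \<rho>))"
    proof (cases "mdeg n \<alpha> = 0")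
      case True
      then have "\<alpha> i = 0" for i using \<alpha> by (cases "i < n") (auto simp: multi_indices_def)
      then have "\<alpha> = 0" by (simp add: fun_eq_iff)
      then show ?thesis using c0 by simp
    next
      case False
      have "padic_norm (c \<alpha>) * \<rho>' ^ mdeg n \<alpha> = padic_norm (c \<alpha>) * \<rho> ^ mdeg n \<alpha> * (\<rho>' / \<rho>) ^ mdeg n \<alpha>"
        using c(1) by (simp add: power_divide)
      also have "\<dots> \<le> C * (\<rho>' / \<rho>) ^ 1"
      proof (intro mult_mono power_decreasing)
        show "1 \<le> mdeg n \<alpha>" using False by linarith
      qed (use c \<alpha> assms pser_nonneg[OF assms(1)] in \<open>auto simp: pcoeffs_def\<close>)
      finally show ?thesis by simp
    qed
  qed
  then show ?thesis using c(3) assms(2,3) unfolding pser_def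
    by (intro conjI exI[of _ c]) (auto intro: less_le_trans)
qed

text \<open>An ultrametric ball is stable under translation by its own elements, so recentring is
  the substitution of \<open>b + y\<close>. The loss from \<open>\<rho>\<close> to
  \<open>\<rho>'\<close> is the strictness demanded by \<open>pser_compose\<close>.\<close>

lemma pser_recenter:
  assumes f: "pser n f \<rho> C" and b: "b \<in> vspace n" "vnorm n b < \<rho>'" and \<rho>': "\<rho>' < \<rho>"
  shows "pser n (\<lambda>y. f (b + y)) \<rho>' C"
proof -
  have pos: "\<rho>' > 0" using b vnorm_nonneg[of n b] by linarith
  show ?thesis
  proof (rule pser_compose[OF f, where R' = \<rho>'])
    show "pser n (\<lambda>x. (b + x) i) \<rho>' \<rho>'" if "i < n" for i
    proof -
      have "padic_norm (b i) \<le> \<rho>'" using b padic_norm_le_vnorm[OF that, of b] by linarith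
      then have "pser n (\<lambda>x. b i) \<rho>' \<rho>'" using pser_mono[OF pser_const[OF pos]] pos by blast
      then show ?thesis using pser_add pser_coord[OF pos that] by auto
    qed
  qed (use pos \<rho>' b in \<open>auto intro: vspace_add\<close>)
qed

text \<open>Division with remainder by the variable \<open>x k\<close>: the monomials with
  \<open>\<alpha> k = 0\<close> form the remainder, the others are \<open>x k\<close> times a series
  whose exponents are lowered by one. Removing the variable divides the Gauss norm bound by
  \<open>\<rho>\<close>.\<close>

lemma pser_split:
  assumes f: "pser n f \<rho> C" and k: "k < n"
  obtains g where "pser n g \<rho> (C / \<rho>)" "pser n (\<lambda>x. f (x(k := 0))) \<rho> C"
    "\<And>x. x \<in> vspace n \<Longrightarrow> vnorm n x < \<rho> \<Longrightarrow> f x = f (x(k := 0)) + x k * g x"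
proof -
  let ?M = "multi_indices n"
  obtain c where c: "\<rho> > 0" "pcoeffs n c \<rho> C"
    "\<And>x. x \<in> vspace n \<Longrightarrow> vnorm n x < \<rho> \<Longrightarrow> ((\<lambda>\<alpha>. c \<alpha> * mpow n x \<alpha>) has_sum f x) ?M"
    using pserE[OF f] by blast
  define s where "s \<alpha> = \<alpha>(k := Suc (\<alpha> k))" for \<alpha> :: "nat \<Rightarrow> nat"
  define d where "d \<alpha> = c (s \<alpha>)" for \<alpha>
  define c0 where "c0 \<alpha> = (if \<alpha> k = 0 then c \<alpha> else 0)" for \<alpha>
  define g where "g x = infsum (\<lambda>\<alpha>. d \<alpha> * mpow n x \<alpha>) ?M" for x
  have sM: "s \<alpha> \<in> ?M" if "\<alpha> \<in> ?M" for \<alpha> using that k by (auto simp: s_def multi_indices_def)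
  have s_deg: "mdeg n (s \<alpha>) = Suc (mdeg n \<alpha>)" for \<alpha>
    using k by (simp add: s_def sum.remove[of "{..<n}" k])
  have s_mono: "mpow n x (s \<alpha>) = x k * mpow n x \<alpha>" for x \<alpha>
    using k by (simp add: s_def prod.remove[of "{..<n}" k])
  have dC: "pcoeffs n d \<rho> (C / \<rho>)"
    unfolding pcoeffs_def
  proof
    fix \<alpha> assume "\<alpha> \<in> ?M"
    then have "padic_norm (c (s \<alpha>)) * \<rho> ^ mdeg n (s \<alpha>) \<le> C" using c(2) sM unfolding pcoeffs_def by blast
    then show "padic_norm (d \<alpha>) * \<rho> ^ mdeg n \<alpha> \<le> C / \<rho>" using c(1) by (simp add: d_def s_deg field_simps)
  qed
  have g: "((\<lambda>\<alpha>. d \<alpha> * mpow n x \<alpha>) has_sum g x) ?M" if "x \<in> vspace n" "vnorm n x < \<rho>" for x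
    unfolding g_def by (rule has_sum_infsum[OF null_family_summable[OF pcoeffs_null_family[OF dC that(2) c(1)]]])
  have c0: "((\<lambda>\<alpha>. c0 \<alpha> * mpow n x \<alpha>) has_sum f (x(k := 0))) ?M" if x: "x \<in> vspace n" "vnorm n x < \<rho>" for x
  proof -
    have "x(k := 0) \<in> vspace n" "vnorm n (x(k := 0)) < \<rho>" using x by (auto simp: vspace_def vnorm_less_iff)
    from c(3)[OF this] show ?thesis
    proof (rule has_sum_cong[THEN iffD1, rotated])
      fix \<alpha> assume "\<alpha> \<in> ?M"
      show "c \<alpha> * mpow n (x(k := 0)) \<alpha> = c0 \<alpha> * mpow n x \<alpha>"
        using k by (simp add: c0_def prod.remove[of "{..<n}" k])
    qed
  qed
  have "pcoeffs n c0 \<rho> C" using c(2) pser_nonneg[OF f] by (auto simp: pcoeffs_def c0_def)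
  then have 1: "pser n (\<lambda>x. f (x(k := 0))) \<rho> C" unfolding pser_def using c0 c(1) by blast
  have 2: "pser n g \<rho> (C / \<rho>)" unfolding pser_def using g dC c(1) by blast
  have 3: "f x = f (x(k := 0)) + x k * g x" if x: "x \<in> vspace n" "vnorm n x < \<rho>" for x
  proof -
    have "((\<lambda>\<alpha>. (c \<alpha> - c0 \<alpha>) * mpow n x \<alpha>) has_sum f x + (- 1) * f (x(k := 0))) ?M"
      using has_sum_add[OF c(3)[OF x] has_sum_cmult_right[OF c0[OF x], of "- 1"]] by (simp add: algebra_simps)
    moreover have "((\<lambda>\<alpha>. (c \<alpha> - c0 \<alpha>) * mpow n x \<alpha>) has_sum x k * g x) ?M"
    proof -
      have "((\<lambda>\<alpha>. c (s \<alpha>) * mpow n x (s \<alpha>)) has_sum x k * g x) ?M"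
        using has_sum_cmult_right[OF g[OF x], of "x k"] by (simp add: d_def s_mono mult.left_commute)
      also have "?this \<longleftrightarrow> ((\<lambda>\<alpha>. c \<alpha> * mpow n x \<alpha>) has_sum x k * g x) {\<alpha> \<in> ?M. \<alpha> k \<noteq> 0}"
        by (rule has_sum_reindex_bij_witness[where j = s and i = "\<lambda>\<alpha>. \<alpha>(k := \<alpha> k - 1)"])
          (use k in \<open>auto simp: s_def multi_indices_def fun_eq_iff\<close>)
      also have "\<dots> \<longleftrightarrow> ((\<lambda>\<alpha>. (c \<alpha> - c0 \<alpha>) * mpow n x \<alpha>) has_sum x k * g x) ?M"
        by (rule has_sum_cong_neutral) (auto simp: c0_def)
      finally show ?thesis .
    qed
    ultimately have "f x + (- 1) * f (x(k := 0)) = x k * g x" by (rule has_sum_unique)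
    then show ?thesis by (simp add: algebra_simps)
  qed
  show ?thesis using that[OF 2 1 3] .
qed

text \<open>Hadamard's lemma, by splitting off one variable after the other. The range of variables
  is arbitrary because \<open>local_law\<close> treats the two blocks of variables of the group law
  separately.\<close>

lemma pser_hadamard:
  assumes f: "pser n f \<rho> C" and st: "s \<le> t" "t \<le> n"
  shows "\<exists>g. (\<forall>i\<in>{s..<t}. pser n (g i) \<rho> (C / \<rho>)) \<and> pser n (\<lambda>x. f (\<lambda>i. if i \<in> {s..<t} then 0 else x i)) \<rho> C \<and>
    (\<forall>x\<in>vspace n. vnorm n x < \<rho> \<longrightarrow> f x = f (\<lambda>i. if i \<in> {s..<t} then 0 else x i) + (\<Sum>i\<in>{s..<t}. x i * g i x))"
  using st
proof (induction t rule: dec_induct)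
  case base
  then show ?case using f by simp
next
  case (step t)
  let ?z = "\<lambda>t x i. if i \<in> {s..<t} then 0 else x i :: 'a padic"
  obtain g where g: "\<forall>i\<in>{s..<t}. pser n (g i) \<rho> (C / \<rho>)" "pser n (\<lambda>x. f (?z t x)) \<rho> C"
    "\<And>x. x \<in> vspace n \<Longrightarrow> vnorm n x < \<rho> \<Longrightarrow> f x = f (?z t x) + (\<Sum>i\<in>{s..<t}. x i * g i x)"
    using step.IH step.prems by auto
  obtain h where h: "pser n h \<rho> (C / \<rho>)" "pser n (\<lambda>x. f (?z t (x(t := 0)))) \<rho> C"
    "\<And>x. x \<in> vspace n \<Longrightarrow> vnorm n x < \<rho> \<Longrightarrow> f (?z t x) = f (?z t (x(t := 0))) + x t * h x"
    using pser_split[OF g(2), of t] step.prems by auto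
  have z: "?z t (x(t := 0)) = ?z (Suc t) x" for x using step.hyps by (auto simp: fun_eq_iff)
  have set: "{s..<Suc t} = insert t {s..<t}" using step.hyps by auto
  have sum: "(\<Sum>i\<in>{s..<Suc t}. x i * (g(t := h)) i x) = x t * h x + (\<Sum>i\<in>{s..<t}. x i * g i x)" for x
    unfolding set by (subst sum.insert) (auto intro!: sum.cong)
  have "f x = f (?z (Suc t) x) + (\<Sum>i\<in>{s..<Suc t}. x i * (g(t := h)) i x)"
    if "x \<in> vspace n" "vnorm n x < \<rho>" for x
    using g(3)[OF that] h(3)[OF that] unfolding sum z by (simp add: add.assoc)
  moreover have "pser n ((g(t := h)) i) \<rho> (C / \<rho>)" if "i \<in> {s..<Suc t}" for i
    using g(1) h(1) that by (auto simp: set)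
  moreover have "pser n (\<lambda>x. f (?z (Suc t) x)) \<rho> C" using h(2) by (simp only: z)
  ultimately show ?case by blast
qed

text \<open>Hadamard's lemma with centre \<open>y\<close> writes \<open>f x - f y\<close> as a
  combination of the coordinates of \<open>x - y\<close> with bounded coefficients. The factor 2
  stems from a recentred radius \<open>\<rho>'\<close> that is at least
  \<open>\<rho> / 2\<close>.\<close>

lemma pser_lipschitz:
  assumes f: "pser n f \<rho> C" and x: "x \<in> vspace n" "vnorm n x < \<rho>" and y: "y \<in> vspace n" "vnorm n y < \<rho>"
  shows "padic_norm (f x - f y) \<le> 2 * C / \<rho> * vnorm n (x - y)"
proof -
  let ?w = "x - y"
  have \<rho>: "\<rho> > 0" using f by (rule pser_pos)
  have w: "?w \<in> vspace n" "vnorm n ?w < \<rho>"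
    using x y vnorm_add_less[of n x \<rho> "- y"] by (auto intro: vspace_diff)
  define \<rho>' where "\<rho>' = (max (max (vnorm n y) (vnorm n ?w)) (\<rho> / 2) + \<rho>) / 2"
  have \<rho>': "vnorm n y < \<rho>'" "vnorm n ?w < \<rho>'" "\<rho> / 2 \<le> \<rho>'" "\<rho>' < \<rho>"
    using y w \<rho> by (auto simp: \<rho>'_def max_def)
  have C: "0 \<le> C" using f by (rule pser_nonneg)
  obtain g where g: "\<forall>i\<in>{0..<n}. pser n (g i) \<rho>' (C / \<rho>')"
    "\<forall>z\<in>vspace n. vnorm n z < \<rho>' \<longrightarrow> f (y + z) = f (y + (\<lambda>i. if i \<in> {0..<n} then 0 else z i)) + (\<Sum>i\<in>{0..<n}. z i * g i z)"
    using pser_hadamard[OF pser_recenter[OF f y(1) \<rho>'(1,4)], of 0 n] by auto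
  have 0: "(\<lambda>i. if i \<in> {0..<n} then 0 else ?w i) = 0" using w(1) by (auto simp: vspace_def fun_eq_iff)
  have "f x - f y = (\<Sum>i\<in>{0..<n}. ?w i * g i ?w)"
    using g(2)[rule_format, OF w(1) \<rho>'(2), unfolded 0] by simp
  also have "padic_norm \<dots> \<le> vnorm n ?w * (C / \<rho>')"
  proof (rule padic_norm_sum_le)
    fix i assume i: "i \<in> {0..<n}"
    show "padic_norm (?w i * g i ?w) \<le> vnorm n ?w * (C / \<rho>')"
      unfolding padic_norm_mult using i g(1) pser_bound[OF _ w(1) \<rho>'(2)] \<rho> \<rho>' C
      by (intro mult_mono padic_norm_le_vnorm) auto
  qed (use \<rho> \<rho>' C in auto)
  also have "\<dots> \<le> vnorm n ?w * (C / (\<rho> / 2))"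
    using \<rho> \<rho>' C by (intro mult_left_mono divide_left_mono mult_pos_pos) auto
  finally show ?thesis by (simp add: field_simps)
qed

lemma pser_le: "pser n f \<rho> C \<Longrightarrow> C \<le> C' \<Longrightarrow> pser n f \<rho> C'"
  using pser_mono pser_pos by blast

section \<open>Germs of analytic functions\<close>

definition lser :: "nat \<Rightarrow> ((nat \<Rightarrow> 'p::prime_card padic) \<Rightarrow> 'p padic) \<Rightarrow> (nat \<Rightarrow> 'p padic) \<Rightarrow> bool" where
  "lser n f b \<longleftrightarrow> (\<exists>\<rho> C. pser n (\<lambda>y. f (b + y)) \<rho> C)"

lemma lser_cong:
  assumes "lser n f b" "b \<in> vspace n" "r > 0"
    and "\<And>x. x \<in> vspace n \<Longrightarrow> vnorm n (x - b) < r \<Longrightarrow> g x = f x"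
  shows "lser n g b"
proof -
  obtain \<rho> C where p: "pser n (\<lambda>y. f (b + y)) \<rho> C" using assms(1) by (auto simp: lser_def)
  have "pser n (\<lambda>y. f (b + y)) (min \<rho> r) C"
    by (rule pser_mono[OF p]) (use pser_pos[OF p] assms in auto)
  then have "pser n (\<lambda>y. g (b + y)) (min \<rho> r) C"
    by (rule pser_cong) (rule assms(4); use assms in \<open>auto intro: vspace_add\<close>)
  then show ?thesis by (auto simp: lser_def)
qed

lemma lser_const: "lser n (\<lambda>x. a) b"
  unfolding lser_def using pser_const[OF zero_less_one] by blast

lemma lser_add:
  assumes "lser n f b" "lser n g b"
  shows "lser n (\<lambda>x. f x + g x) b"
proof -
  obtain \<rho> C \<rho>' C' where p: "pser n (\<lambda>y. f (b + y)) \<rho> C" "pser n (\<lambda>y. g (b + y)) \<rho>' C'"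
    using assms by (auto simp: lser_def)
  have "pser n (\<lambda>y. f (b + y)) (min \<rho> \<rho>') (max C C')" "pser n (\<lambda>y. g (b + y)) (min \<rho> \<rho>') (max C C')"
    using pser_pos[OF p(1)] pser_pos[OF p(2)] by (auto intro: pser_mono[OF p(1)] pser_mono[OF p(2)])
  then show ?thesis unfolding lser_def using pser_add by blast
qed

lemma lser_mult:
  assumes "lser n f b" "lser n g b"
  shows "lser n (\<lambda>x. f x * g x) b"
proof -
  obtain \<rho> C \<rho>' C' where p: "pser n (\<lambda>y. f (b + y)) \<rho> C" "pser n (\<lambda>y. g (b + y)) \<rho>' C'"
    using assms by (auto simp: lser_def)
  have "pser n (\<lambda>y. f (b + y)) (min \<rho> \<rho>') C" "pser n (\<lambda>y. g (b + y)) (min \<rho> \<rho>') C'"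
    using pser_pos[OF p(1)] pser_pos[OF p(2)] by (auto intro: pser_mono[OF p(1)] pser_mono[OF p(2)])
  then show ?thesis unfolding lser_def using pser_mult by blast
qed

lemma lser_coord: "i < n \<Longrightarrow> lser n (\<lambda>x. x i) b"
proof -
  assume i: "i < n"
  have "lser n (\<lambda>x. x i - b i) b"
    unfolding lser_def using pser_coord[OF zero_less_one i] by auto
  then have "lser n (\<lambda>x. x i - b i + b i) b" by (intro lser_add lser_const)
  then show ?thesis by simp
qed

lemma lser_compose:
  fixes U :: "(nat \<Rightarrow> 'p::prime_card padic) \<Rightarrow> nat \<Rightarrow> 'p padic"
  assumes f: "lser m f (U b)" and U: "\<And>i. i < m \<Longrightarrow> lser n (\<lambda>x. U x i) b" and b: "b \<in> vspace n"
    and r: "r > 0" and Um: "\<And>x. x \<in> vspace n \<Longrightarrow> vnorm n (x - b) < r \<Longrightarrow> U x \<in> vspace m"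
  shows "lser n (\<lambda>x. f (U x)) b"
proof -
  obtain R C where R: "pser m (\<lambda>z. f (U b + z)) R C" using f by (auto simp: lser_def)
  have R0: "R > 0" using R by (rule pser_pos)
  define u where "u y = U (b + y) - U b" for y
  have ub: "u 0 = 0" by (simp add: u_def)
  have "\<exists>\<rho>>0. pser n (\<lambda>y. u y i) \<rho> (R / 2)" if i: "i < m" for i
  proof -
    have "lser n (\<lambda>x. U x i + - U b i) b" by (intro lser_add lser_const U i)
    then obtain \<rho> D where p: "pser n (\<lambda>y. u y i) \<rho> D" by (auto simp: lser_def u_def)
    have D: "0 \<le> D" "\<rho> > 0" using pser_nonneg[OF p] pser_pos[OF p] by auto
    \<comment> \<open>Chosen so that the bound \<open>D * (\<rho>' / \<rho>)\<close> of
      \<open>pser_shrink\<close> is at most \<open>R / 2\<close>; \<open>D + 1\<close> guards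
      against \<open>D = 0\<close>. The constant term of \<open>u\<close> is zero.\<close>
    define \<rho>' where "\<rho>' = min \<rho> (R * \<rho> / (2 * (D + 1)))"
    have \<rho>': "0 < \<rho>'" "\<rho>' \<le> \<rho>" "\<rho>' \<le> R * \<rho> / (2 * (D + 1))" using D R0 by (auto simp: \<rho>'_def)
    have "D * (\<rho>' / \<rho>) \<le> (D + 1) * (R * \<rho> / (2 * (D + 1)) / \<rho>)"
      using D \<rho>' by (intro mult_mono divide_right_mono) auto
    also have "\<dots> = R / 2"
    proof -
      have *: "E * (R * \<rho> / (2 * E) / \<rho>) = R / 2" if "E \<noteq> 0" for E :: real using that D by simp
      show ?thesis by (rule *) (use D in simp)
    qed
    finally have "max (padic_norm (u 0 i)) (D * (\<rho>' / \<rho>)) \<le> R / 2" using R0 by (simp add: ub)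
    then have "pser n (\<lambda>y. u y i) \<rho>' (R / 2)" using pser_shrink[OF p \<rho>'(1,2)] pser_le by blast
    then show ?thesis using \<rho>' by blast
  qed
  then obtain \<rho> where \<rho>: "\<And>i. i < m \<Longrightarrow> \<rho> i > 0" "\<And>i. i < m \<Longrightarrow> pser n (\<lambda>y. u y i) (\<rho> i) (R / 2)" by metis
  define \<sigma> where "\<sigma> = Min (insert r (\<rho> ` {..<m}))"
  have \<sigma>: "\<sigma> > 0" "\<sigma> \<le> r" "\<And>i. i < m \<Longrightarrow> \<sigma> \<le> \<rho> i" using \<rho>(1) r by (auto simp: \<sigma>_def)
  have "pser n (\<lambda>y. f (U b + u y)) \<sigma> C"
  proof (rule pser_compose[OF R, where R' = "R / 2"])
    show "pser n (\<lambda>y. u y i) \<sigma> (R / 2)" if "i < m" for i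
      using \<rho>(2)[OF that] \<sigma>(1) \<sigma>(3)[OF that] by (rule pser_mono) simp
    show "u y \<in> vspace m" if y: "y \<in> vspace n" "vnorm n y < \<sigma>" for y
      unfolding u_def using y b r \<sigma> by (intro vspace_diff Um) (auto intro: vspace_add)
  qed (use R0 \<sigma> in auto)
  then show ?thesis unfolding lser_def u_def by auto
qed

lemma lser_recenter:
  assumes f: "pser n (\<lambda>y. f (a + y)) \<rho> C" and x: "x - a \<in> vspace n" "vnorm n (x - a) < \<rho>"
  shows "lser n f x"
proof -
  have \<rho>: "\<rho> > 0" using f by (rule pser_pos)
  define \<rho>' where "\<rho>' = (vnorm n (x - a) + \<rho>) / 2"
  have "vnorm n (x - a) < \<rho>'" "\<rho>' < \<rho>" using x by (auto simp: \<rho>'_def)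
  from pser_recenter[OF f x(1) this] show ?thesis
    unfolding lser_def by (auto simp: algebra_simps)
qed


section \<open>Analytic functions on a manifold\<close>

text \<open>All coordinates from \<open>n\<close> on vanish, so a product neighbourhood is decided
  by its first \<open>n\<close> factors, and the least of their radii gives a ball.\<close>

lemma openin_padic_space:
  "openin (padic_space n) U \<longleftrightarrow>
     U \<subseteq> vspace n \<and> (\<forall>a\<in>U. \<exists>r>0. \<forall>x\<in>vspace n. vnorm n (x - a) < r \<longrightarrow> x \<in> U)"
proof (intro iffI conjI ballI)
  assume "openin (padic_space n) U"
  then obtain T where T: "open T" "U = T \<inter> vspace n"
    unfolding padic_space_def vspace_def[symmetric] by (auto simp: openin_open)
  show "U \<subseteq> vspace n" using T by simp
  fix a assume a: "a \<in> U"
  have "openin (product_topology (\<lambda>i. euclidean) UNIV) T" using T(1) by (simp add: open_fun_def)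
  then have "\<exists>X. (\<forall>i. open (X i)) \<and> a \<in> Pi\<^sub>E UNIV X \<and> Pi\<^sub>E UNIV X \<subseteq> T"
    using a T(2) unfolding openin_product_topology_alt by (simp del: PiE_UNIV_domain) blast
  then obtain X where X: "\<And>i. open (X i)" "a \<in> Pi\<^sub>E UNIV X" "Pi\<^sub>E UNIV X \<subseteq> T" by blast
  have "\<exists>r>0. \<forall>y. padic_norm (y - a i) < r \<longrightarrow> y \<in> X i" for i
  proof -
    have "\<exists>e>0. \<forall>y. dist y (a i) < e \<longrightarrow> y \<in> X i" using X(1)[of i] PiE_mem[OF X(2), of i] by (simp add: open_dist)
    then show ?thesis by (simp add: dist_padic)
  qed
  then obtain r where r: "\<And>i. r i > 0" "\<And>i y. padic_norm (y - a i) < r i \<Longrightarrow> y \<in> X i" by metis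
  define s where "s = Min (insert 1 (r ` {..<n}))"
  have s: "s > 0" "\<And>i. i < n \<Longrightarrow> s \<le> r i" using r(1) by (auto simp: s_def)
  have "x \<in> U" if x: "x \<in> vspace n" "vnorm n (x - a) < s" for x
  proof -
    have "x i \<in> X i" for i
    proof (cases "i < n")
      case True
      then show ?thesis using x(2) s(2)[OF True] by (intro r(2)) (auto simp: vnorm_less_iff)
    next
      case False
      then have "x i = a i" using x a T(2) by (auto simp: vspace_def)
      then show ?thesis using PiE_mem[OF X(2), of i] by simp
    qed
    then have "x \<in> Pi\<^sub>E UNIV X" by (intro PiE_I) auto
    then show ?thesis using X(3) x T(2) by blast
  qed
  then show "\<exists>r>0. \<forall>x\<in>vspace n. vnorm n (x - a) < r \<longrightarrow> x \<in> U" using s(1) by blast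
next
  assume U: "U \<subseteq> vspace n \<and> (\<forall>a\<in>U. \<exists>r>0. \<forall>x\<in>vspace n. vnorm n (x - a) < r \<longrightarrow> x \<in> U)"
  then obtain r where r: "\<And>a. a \<in> U \<Longrightarrow> r a > 0"
    "\<And>a x. a \<in> U \<Longrightarrow> x \<in> vspace n \<Longrightarrow> vnorm n (x - a) < r a \<Longrightarrow> x \<in> U" by metis
  define T where "T = (\<Union>a\<in>U. \<Inter>i\<in>{..<n}. (\<lambda>y. y i) -` ball (a i) (r a))"
  have "open T"
    unfolding T_def
    by (intro open_UN ballI open_INT open_vimage open_ball continuous_on_product_coordinates) auto
  moreover have "U = T \<inter> vspace n"
  proof (intro equalityI subsetI)
    fix x assume "x \<in> U"
    then show "x \<in> T \<inter> vspace n" using U r(1) by (auto simp: T_def dist_padic intro!: bexI[of _ x])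
  next
    fix x assume x: "x \<in> T \<inter> vspace n"
    then obtain a where a: "a \<in> U" "\<forall>i<n. padic_norm (a i - x i) < r a" by (auto simp: T_def dist_padic)
    then have "vnorm n (a - x) < r a" using r(1) by (auto simp: vnorm_less_iff)
    then show "x \<in> U" using r(2)[OF a(1)] x vnorm_diff_commute[of n a x] by auto
  qed
  ultimately show "openin (padic_space n) U"
    unfolding padic_space_def vspace_def[symmetric] by (auto simp: openin_open)
qed

lemma null_family_bounded:
  assumes "null_family f A"
  obtains B where "\<And>a. a \<in> A \<Longrightarrow> padic_norm (f a :: 'p::prime_card padic) \<le> B"
proof -
  let ?S = "{a \<in> A. padic_norm (f a) \<ge> 1}"
  have fin: "finite ?S" using assms by (simp add: null_family_def)
  show ?thesis
  proof (rule that[of "Max (insert 1 ((\<lambda>a. padic_norm (f a)) ` ?S))"])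
    fix a assume "a \<in> A"
    then show "padic_norm (f a) \<le> Max (insert 1 ((\<lambda>a. padic_norm (f a)) ` ?S))"
      using fin by (subst Max_ge_iff) (auto simp: not_le less_imp_le)
  qed
qed

text \<open>The definition asks only for pointwise convergence near each centre. Convergence at one
  point whose first \<open>n\<close> coordinates have norm exactly \<open>\<rho>\<close> keeps the
  terms there bounded, and this is the Gauss norm bound at radius \<open>\<rho>\<close>.\<close>

lemma padic_analytic_on_iff:
  "padic_analytic_on n f U \<longleftrightarrow> openin (padic_space n) U \<and> (\<forall>b\<in>U. lser n f b)"
proof (intro iffI conjI ballI)
  assume f: "padic_analytic_on n f U"
  then show op: "openin (padic_space n) U" by (simp add: padic_analytic_on_def)
  fix a assume a: "a \<in> U"
  then obtain r c where r: "r > 0" and c: "\<And>x. x \<in> U \<Longrightarrow> (\<forall>i<n. dist (x i) (a i) < r) \<Longrightarrow>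
      ((\<lambda>\<alpha>. c \<alpha> * (\<Prod>i<n. (x i - a i) ^ \<alpha> i)) has_sum f x) (multi_indices n)"
  proof -
    have "\<exists>r>0. \<exists>c. \<forall>x\<in>U. (\<forall>i<n. dist (x i) (a i) < r) \<longrightarrow>
        ((\<lambda>\<alpha>. c \<alpha> * (\<Prod>i<n. (x i - a i) ^ \<alpha> i)) has_sum f x) (multi_indices n)"
      using f a unfolding padic_analytic_on_def by blast
    then show ?thesis using that by blast
  qed
  obtain r' where r': "r' > 0" "\<And>x. x \<in> vspace n \<Longrightarrow> vnorm n (x - a) < r' \<Longrightarrow> x \<in> U"
    using op a unfolding openin_padic_space by blast
  have av: "a \<in> vspace n" using op a unfolding openin_padic_space by blast
  obtain k where k: "padic_norm (\<pi> :: 'a padic) ^ k < min r r'"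
    using uniformizer_power_small[of "min r r'"] r r' by auto
  \<comment> \<open>The radius has to be attained by field elements, hence a power of the norm of
    \<open>\<pi>\<close>.\<close>
  define \<rho> where "\<rho> = padic_norm (\<pi> :: 'a padic) ^ k"
  have \<rho>: "0 < \<rho>" "\<rho> < r" "\<rho> < r'" using k by (auto simp: \<rho>_def)
  have sum: "((\<lambda>\<alpha>. c \<alpha> * mpow n y \<alpha>) has_sum f (a + y)) (multi_indices n)"
    if y: "y \<in> vspace n" "vnorm n y \<le> \<rho>" for y
  proof -
    have "a + y \<in> U" using y \<rho> by (intro r'(2) vspace_add av) auto
    moreover have "\<forall>i<n. dist ((a + y) i) (a i) < r" using y \<rho> by (auto simp: vnorm_le_iff dist_padic)
    ultimately show ?thesis using c[of "a + y"] by simp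
  qed
  let ?y = "\<lambda>i. if i < n then \<pi> ^ k else 0 :: 'a padic"
  have y: "?y \<in> vspace n" "vnorm n ?y \<le> \<rho>" using \<rho> by (auto simp: vspace_def vnorm_le_iff \<rho>_def padic_norm_power)
  obtain C where C: "\<And>\<alpha>. \<alpha> \<in> multi_indices n \<Longrightarrow> padic_norm (c \<alpha> * mpow n ?y \<alpha>) \<le> C"
    using null_family_bounded[OF has_sum_imp_null_family[OF sum[OF y]]] by blast
  have "padic_norm (c \<alpha> * mpow n ?y \<alpha>) = padic_norm (c \<alpha>) * \<rho> ^ mdeg n \<alpha>" for \<alpha>
    by (simp add: padic_norm_mult padic_norm_prod padic_norm_power \<rho>_def power_sum)
  then have "pcoeffs n c \<rho> C" using C by (simp add: pcoeffs_def)
  moreover have "((\<lambda>\<alpha>. c \<alpha> * mpow n y \<alpha>) has_sum f (a + y)) (multi_indices n)"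
    if "y \<in> vspace n" "vnorm n y < \<rho>" for y
    by (rule sum) (use that in auto)
  ultimately have "pser n (\<lambda>y. f (a + y)) \<rho> C" unfolding pser_def using \<rho>(1) by blast
  then show "lser n f a" unfolding lser_def by blast
next
  assume f: "openin (padic_space n) U \<and> (\<forall>b\<in>U. lser n f b)"
  show "padic_analytic_on n f U"
    unfolding padic_analytic_on_def
  proof (intro conjI ballI)
    show "openin (padic_space n) U" using f by simp
    fix a assume a: "a \<in> U"
    then obtain \<rho> C where "pser n (\<lambda>y. f (a + y)) \<rho> C" using f by (auto simp: lser_def)
    then obtain c where c: "\<rho> > 0" "\<And>x. x \<in> vspace n \<Longrightarrow> vnorm n x < \<rho> \<Longrightarrow>
        ((\<lambda>\<alpha>. c \<alpha> * mpow n x \<alpha>) has_sum f (a + x)) (multi_indices n)"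
      by (rule pserE) blast
    have "((\<lambda>\<alpha>. c \<alpha> * (\<Prod>i<n. (x i - a i) ^ \<alpha> i)) has_sum f x) (multi_indices n)"
      if x: "x \<in> U" "\<forall>i<n. dist (x i) (a i) < \<rho>" for x
    proof -
      have "x - a \<in> vspace n" using f a x by (intro vspace_diff) (auto simp: openin_padic_space)
      moreover have "vnorm n (x - a) < \<rho>" using x c(1) by (auto simp: vnorm_less_iff dist_padic)
      ultimately show ?thesis using c(2)[of "x - a"] by simp
    qed
    then show "\<exists>r>0. \<exists>c. \<forall>x\<in>U. (\<forall>i<n. dist (x i) (a i) < r) \<longrightarrow>
        ((\<lambda>\<alpha>. c \<alpha> * (\<Prod>i<n. (x i - a i) ^ \<alpha> i)) has_sum f x) (multi_indices n)" using c(1) by blast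
  qed
qed

locale padic_mfd =
  fixes M :: "('a, 'p::prime_card) padic_atlas"
  assumes mfd: "padic_manifold M"
begin

abbreviation "n \<equiv> mfd_dim M"
abbreviation "X \<equiv> mfd_top M"

lemma Hausdorff: "Hausdorff_space X"
  using mfd unfolding padic_manifold_def by (elim conjE)

lemma topspace_charts: "topspace X = (\<Union>(U, \<phi>)\<in>mfd_charts M. U)"
  using mfd unfolding padic_manifold_def by (elim conjE)

lemma all_chart_facts:
  "\<forall>(U, \<phi>)\<in>mfd_charts M. openin X U \<and> openin (padic_space n) (\<phi> ` U) \<and>
     homeomorphic_map (subtopology X U) (subtopology (padic_space n) (\<phi> ` U)) \<phi>"
  using mfd unfolding padic_manifold_def by (elim conjE)

lemma transitions_analytic:
  "\<forall>(U, \<phi>)\<in>mfd_charts M. \<forall>(V, \<psi>)\<in>mfd_charts M. \<forall>k<n.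
     padic_analytic_on n (\<lambda>v. \<psi> (inv_into U \<phi> v) k) (\<phi> ` (U \<inter> V))"
  using mfd unfolding padic_manifold_def by (elim conjE)

lemma chart_exists:
  assumes "x \<in> topspace X"
  obtains U \<phi> where "(U, \<phi>) \<in> mfd_charts M" "x \<in> U"
proof -
  have "x \<in> (\<Union>(U, \<phi>)\<in>mfd_charts M. U)" using assms unfolding topspace_charts .
  then show ?thesis using that by auto
qed

context
  fixes U \<phi> assumes chart: "(U, \<phi>) \<in> mfd_charts M"
begin

lemma chart_facts:
  "openin X U" "openin (padic_space n) (\<phi> ` U)"
  "homeomorphic_map (subtopology X U) (subtopology (padic_space n) (\<phi> ` U)) \<phi>"
  using bspec[OF all_chart_facts chart] by simp_all

lemma chart_subset: "U \<subseteq> topspace X"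
  using chart_facts(1) by (rule openin_subset)

lemma chart_vspace: "x \<in> U \<Longrightarrow> \<phi> x \<in> vspace n"
  using chart_facts(2) by (auto simp: openin_padic_space)

lemma chart_inj: "inj_on \<phi> U"
proof -
  have "topspace (subtopology X U) = U" using chart_subset by auto
  then show ?thesis using homeomorphic_imp_injective_map[OF chart_facts(3)] by simp
qed

lemma chart_inv [simp]: "x \<in> U \<Longrightarrow> inv_into U \<phi> (\<phi> x) = x"
  by (rule inv_into_f_f[OF chart_inj])

lemma chart_image_open:
  assumes "openin X W"
  shows "openin (padic_space n) (\<phi> ` (U \<inter> W))"
proof -
  have "open_map (subtopology X U) (subtopology (padic_space n) (\<phi> ` U)) \<phi>"
    using chart_facts(3) homeomorphic_imp_open_map by blast
  moreover have "openin (subtopology X U) (U \<inter> W)"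
    using assms openin_subtopology_Int2 by blast
  ultimately have "openin (subtopology (padic_space n) (\<phi> ` U)) (\<phi> ` (U \<inter> W))"
    by (simp add: open_map_def)
  then show ?thesis using chart_facts(2) by (rule openin_trans_full)
qed

lemma chart_ball:
  assumes "openin X W" "x \<in> U" "x \<in> W"
  obtains r where "r > 0"
    "\<And>v. v \<in> vspace n \<Longrightarrow> vnorm n (v - \<phi> x) < r \<Longrightarrow> \<exists>y\<in>U \<inter> W. v = \<phi> y"
proof -
  have "\<phi> x \<in> \<phi> ` (U \<inter> W)" using assms by auto
  then obtain r where "r > 0" "\<And>v. v \<in> vspace n \<Longrightarrow> vnorm n (v - \<phi> x) < r \<Longrightarrow> v \<in> \<phi> ` (U \<inter> W)"
    using chart_image_open[OF assms(1)] unfolding openin_padic_space by blast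
  then show ?thesis using that[of r] by blast
qed

lemma chart_preimage_open:
  assumes "openin (padic_space n) V"
  shows "openin X {x \<in> U. \<phi> x \<in> V}"
proof -
  have "continuous_map (subtopology X U) (subtopology (padic_space n) (\<phi> ` U)) \<phi>"
    using chart_facts(3) homeomorphic_imp_continuous_map by blast
  moreover have "openin (subtopology (padic_space n) (\<phi> ` U)) (\<phi> ` U \<inter> V)"
    using assms openin_subtopology_Int2 by blast
  ultimately have "openin (subtopology X U) {x \<in> topspace (subtopology X U). \<phi> x \<in> \<phi> ` U \<inter> V}"
    by (rule openin_continuous_map_preimage)
  moreover have "{x \<in> topspace (subtopology X U). \<phi> x \<in> \<phi> ` U \<inter> V} = {x \<in> U. \<phi> x \<in> V}"
    using chart_subset by auto
  ultimately have "openin (subtopology X U) {x \<in> U. \<phi> x \<in> V}" by simp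
  then show ?thesis using chart_facts(1) by (rule openin_trans_full)
qed

end

text \<open>Composition with the transition map, which is analytic by the definition of a manifold.
  It makes \<open>ana_at\<close> independent of the chart that witnesses it.\<close>

lemma lser_chart_change:
  assumes c: "(U, \<phi>) \<in> mfd_charts M" "(V, \<psi>) \<in> mfd_charts M" and x: "x \<in> U" "x \<in> V"
    and f: "lser n (\<lambda>v. f (inv_into U \<phi> v)) (\<phi> x)"
  shows "lser n (\<lambda>v. f (inv_into V \<psi> v)) (\<psi> x)"
proof -
  define T where "T v = \<phi> (inv_into V \<psi> v)" for v
  obtain r where r: "r > 0" "\<And>v. v \<in> vspace n \<Longrightarrow> vnorm n (v - \<psi> x) < r \<Longrightarrow> \<exists>y\<in>V \<inter> U. v = \<psi> y"
    using chart_ball[OF c(2) chart_facts(1)[OF c(1)] x(2,1)] by blast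
  have Tx: "T (\<psi> x) = \<phi> x" using x c by (simp add: T_def)
  have "lser n (\<lambda>v. T v i) (\<psi> x)" if "i < n" for i
  proof -
    have "padic_analytic_on n (\<lambda>v. \<phi> (inv_into V \<psi> v) i) (\<psi> ` (V \<inter> U))"
      using bspec[OF bspec[OF transitions_analytic c(2), unfolded case_prod_conv] c(1)] that by simp
    moreover have "\<psi> x \<in> \<psi> ` (V \<inter> U)" using x by auto
    ultimately show ?thesis unfolding T_def padic_analytic_on_iff by blast
  qed
  note T = this
  have near: "T v \<in> vspace n \<and> f (inv_into V \<psi> v) = f (inv_into U \<phi> (T v))"
    if v: "v \<in> vspace n" "vnorm n (v - \<psi> x) < r" for v
  proof -
    obtain y where y: "y \<in> V" "y \<in> U" "v = \<psi> y" using r(2)[OF v] by blast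
    then have "T v = \<phi> y" using c by (simp add: T_def)
    then show ?thesis using y chart_vspace[OF c(1) y(2)] c by simp
  qed
  have "lser n (\<lambda>v. f (inv_into U \<phi> (T v))) (\<psi> x)"
    by (rule lser_compose[where f = "\<lambda>w. f (inv_into U \<phi> w)" and U = T and m = n and r = r])
      (use f Tx r(1) T near chart_vspace[OF c(2) x(2)] in auto)
  then show ?thesis by (rule lser_cong[OF _ chart_vspace[OF c(2) x(2)] r(1)]) (use near in auto)
qed

definition ana_at :: "('a \<Rightarrow> 'p padic) \<Rightarrow> 'a \<Rightarrow> bool" where
  "ana_at f x \<longleftrightarrow> (\<exists>U \<phi>. (U, \<phi>) \<in> mfd_charts M \<and> x \<in> U \<and> lser n (\<lambda>v. f (inv_into U \<phi> v)) (\<phi> x))"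

lemma ana_atD: "ana_at f x \<Longrightarrow> (V, \<psi>) \<in> mfd_charts M \<Longrightarrow> x \<in> V \<Longrightarrow> lser n (\<lambda>v. f (inv_into V \<psi> v)) (\<psi> x)"
  unfolding ana_at_def using lser_chart_change by blast

lemma ana_atI: "(V, \<psi>) \<in> mfd_charts M \<Longrightarrow> x \<in> V \<Longrightarrow> lser n (\<lambda>v. f (inv_into V \<psi> v)) (\<psi> x) \<Longrightarrow> ana_at f x"
  unfolding ana_at_def by blast

lemma analytic_functions_iff:
  "f \<in> analytic_functions M \<longleftrightarrow> (\<forall>x. x \<notin> topspace X \<longrightarrow> f x = 0) \<and> (\<forall>x\<in>topspace X. ana_at f x)"
proof (intro iffI conjI ballI allI impI)
  assume f: "f \<in> analytic_functions M"
  then show "f x = 0" if "x \<notin> topspace X" for x using that by (simp add: analytic_functions_def)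
  fix x assume "x \<in> topspace X"
  then obtain U \<phi> where U: "(U, \<phi>) \<in> mfd_charts M" "x \<in> U" by (rule chart_exists)
  have "\<forall>(U, \<phi>)\<in>mfd_charts M. padic_analytic_on n (\<lambda>v. f (inv_into U \<phi> v)) (\<phi> ` U)"
    using f by (simp add: analytic_functions_def)
  from bspec[OF this U(1)] have "lser n (\<lambda>v. f (inv_into U \<phi> v)) (\<phi> x)"
    using U(2) by (simp add: padic_analytic_on_iff)
  then show "ana_at f x" by (rule ana_atI[OF U])
next
  assume f: "(\<forall>x. x \<notin> topspace X \<longrightarrow> f x = 0) \<and> (\<forall>x\<in>topspace X. ana_at f x)"
  have "padic_analytic_on n (\<lambda>v. f (inv_into U \<phi> v)) (\<phi> ` U)" if U: "(U, \<phi>) \<in> mfd_charts M" for U \<phi>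
    unfolding padic_analytic_on_iff
  proof (intro conjI ballI)
    show "openin (padic_space n) (\<phi> ` U)" by (rule chart_facts(2)[OF U])
    fix b assume "b \<in> \<phi> ` U"
    then obtain x where x: "x \<in> U" "b = \<phi> x" by blast
    then have "ana_at f x" using f chart_subset[OF U] by blast
    from ana_atD[OF this U x(1)] show "lser n (\<lambda>v. f (inv_into U \<phi> v)) b" using x(2) by simp
  qed
  then show "f \<in> analytic_functions M" using f unfolding analytic_functions_def by blast
qed

lemma ana_at_cong:
  assumes f: "ana_at f x" and W: "openin X W" "x \<in> W" "\<And>y. y \<in> W \<Longrightarrow> g y = f y"
  shows "ana_at g x"
proof -
  obtain U \<phi> where U: "(U, \<phi>) \<in> mfd_charts M" "x \<in> U" "lser n (\<lambda>v. f (inv_into U \<phi> v)) (\<phi> x)"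
    using f unfolding ana_at_def by blast
  obtain r where r: "r > 0" "\<And>v. v \<in> vspace n \<Longrightarrow> vnorm n (v - \<phi> x) < r \<Longrightarrow> \<exists>y\<in>U \<inter> W. v = \<phi> y"
    using chart_ball[OF U(1) W(1) U(2) W(2)] by blast
  show ?thesis
  proof (rule ana_atI[OF U(1,2)], rule lser_cong[OF U(3) chart_vspace[OF U(1,2)] r(1)])
    fix v assume "v \<in> vspace n" "vnorm n (v - \<phi> x) < r"
    then show "g (inv_into U \<phi> v) = f (inv_into U \<phi> v)" using r(2)[of v] U(1) W(3) by auto
  qed
qed

lemma ana_at_const:
  assumes "x \<in> topspace X"
  shows "ana_at (\<lambda>y. c) x"
proof -
  obtain U \<phi> where "(U, \<phi>) \<in> mfd_charts M" "x \<in> U" using assms by (rule chart_exists)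
  then show ?thesis by (rule ana_atI) (rule lser_const)
qed

lemma ana_at_add: "ana_at f x \<Longrightarrow> ana_at g x \<Longrightarrow> ana_at (\<lambda>y. f y + g y) x"
  and ana_at_mult: "ana_at f x \<Longrightarrow> ana_at g x \<Longrightarrow> ana_at (\<lambda>y. f y * g y) x"
proof -
  assume a: "ana_at f x" "ana_at g x"
  obtain U \<phi> where U: "(U, \<phi>) \<in> mfd_charts M" "x \<in> U" using a(1) unfolding ana_at_def by blast
  note l = ana_atD[OF a(1) U] ana_atD[OF a(2) U]
  show "ana_at (\<lambda>y. f y + g y) x" by (rule ana_atI[OF U]) (rule lser_add[OF l])
  show "ana_at (\<lambda>y. f y * g y) x" by (rule ana_atI[OF U]) (rule lser_mult[OF l])
qed

lemma analytic_functionsI: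
  "(\<And>x. x \<notin> topspace X \<Longrightarrow> f x = 0) \<Longrightarrow> (\<And>x. x \<in> topspace X \<Longrightarrow> ana_at f x) \<Longrightarrow> f \<in> analytic_functions M"
  unfolding analytic_functions_iff by blast

lemma analytic_functionsD:
  assumes "f \<in> analytic_functions M"
  shows "x \<notin> topspace X \<Longrightarrow> f x = 0" "x \<in> topspace X \<Longrightarrow> ana_at f x"
  using assms unfolding analytic_functions_iff by blast+

lemma analytic_functions_0: "0 \<in> analytic_functions M"
  unfolding zero_fun_def by (rule analytic_functionsI) (simp, rule ana_at_const)

lemma analytic_functions_add:
  assumes "f \<in> analytic_functions M" "g \<in> analytic_functions M"
  shows "f + g \<in> analytic_functions M"
proof (rule analytic_functionsI)
  show "(f + g) x = 0" if "x \<notin> topspace X" for x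
    using analytic_functionsD(1)[OF assms(1) that] analytic_functionsD(1)[OF assms(2) that] by simp
  show "ana_at (f + g) x" if x: "x \<in> topspace X" for x
    unfolding plus_fun_def by (rule ana_at_add[OF assms[THEN analytic_functionsD(2), OF x]])
qed

lemma analytic_functions_mult:
  assumes "f \<in> analytic_functions M" "g \<in> analytic_functions M"
  shows "f * g \<in> analytic_functions M"
proof (rule analytic_functionsI)
  show "(f * g) x = 0" if "x \<notin> topspace X" for x
    using analytic_functionsD(1)[OF assms(1) that] analytic_functionsD(1)[OF assms(2) that] by simp
  show "ana_at (f * g) x" if x: "x \<in> topspace X" for x
    unfolding times_fun_def by (rule ana_at_mult[OF assms[THEN analytic_functionsD(2), OF x]])
qed

lemma analytic_functions_cmult:
  assumes "f \<in> analytic_functions M"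
  shows "(\<lambda>x. c * f x) \<in> analytic_functions M"
proof (rule analytic_functionsI)
  show "c * f x = 0" if "x \<notin> topspace X" for x using analytic_functionsD(1)[OF assms that] by simp
  show "ana_at (\<lambda>x. c * f x) x" if x: "x \<in> topspace X" for x
    by (rule ana_at_mult[OF ana_at_const[OF x] analytic_functionsD(2)[OF assms x]])
qed

lemma analytic_functions_sum: "(\<And>i. i \<in> I \<Longrightarrow> f i \<in> analytic_functions M) \<Longrightarrow> sum f I \<in> analytic_functions M"
  by (induction I rule: infinite_finite_induct) (auto intro: analytic_functions_add analytic_functions_0)

text \<open>Analyticity is local, and both \<open>W\<close> and its complement are open. This
  produces the globally defined cut-off functions to which tangent vectors can be applied.\<close>

lemma analytic_on_clopen:
  assumes W: "openin X W" "openin X (topspace X - W)" and f: "\<And>x. x \<in> W \<Longrightarrow> ana_at f x"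
  shows "(\<lambda>x. if x \<in> W then f x else 0) \<in> analytic_functions M"
  unfolding analytic_functions_iff
proof (intro conjI ballI allI impI)
  fix x assume x: "x \<in> topspace X"
  show "ana_at (\<lambda>x. if x \<in> W then f x else 0) x"
  proof (cases "x \<in> W")
    case True
    show ?thesis by (rule ana_at_cong[OF f[OF True] W(1)]) (use True in auto)
  next
    case False
    show ?thesis by (rule ana_at_cong[OF ana_at_const[OF x, of 0] W(2)]) (use False x in auto)
  qed
qed (use openin_subset[OF W(1)] in auto)

lemma ana_at_coord:
  assumes U: "(U, \<phi>) \<in> mfd_charts M" "x \<in> U" and i: "i < n"
  shows "ana_at (\<lambda>y. \<phi> y i) x"
proof (rule ana_atI[OF U])
  obtain r where r: "r > 0" "\<And>v. v \<in> vspace n \<Longrightarrow> vnorm n (v - \<phi> x) < r \<Longrightarrow> \<exists>y\<in>U \<inter> U. v = \<phi> y"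
    using chart_ball[OF U(1) chart_facts(1)[OF U(1)] U(2) U(2)] by blast
  show "lser n (\<lambda>v. \<phi> (inv_into U \<phi> v) i) (\<phi> x)"
  proof (rule lser_cong[OF lser_coord[OF i] chart_vspace[OF U] r(1)])
    fix v assume "v \<in> vspace n" "vnorm n (v - \<phi> x) < r"
    then show "\<phi> (inv_into U \<phi> v) i = v i" using r(2)[of v] U(1) by auto
  qed
qed

text \<open>Compactness enters through regularity: a ball in a chart is closed in the chart, but in the
  manifold only if it is contained in a closed set inside the chart.\<close>

lemma clopen_balls:
  assumes comp: "compact_space X" and U: "(U, \<phi>) \<in> mfd_charts M" "e \<in> U" and N: "openin X N" "e \<in> N"
  obtains r0 where "r0 > 0"
    "\<And>v. v \<in> vspace n \<Longrightarrow> vnorm n (v - \<phi> e) < r0 \<Longrightarrow> \<exists>y\<in>U \<inter> N. v = \<phi> y"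
    "\<And>r. 0 < r \<Longrightarrow> r \<le> r0 \<Longrightarrow> openin X {x \<in> U. vnorm n (\<phi> x - \<phi> e) < r}"
    "\<And>r. 0 < r \<Longrightarrow> r \<le> r0 \<Longrightarrow> openin X (topspace X - {x \<in> U. vnorm n (\<phi> x - \<phi> e) < r})"
proof -
  have "regular_space X" using comp Hausdorff compact_Hausdorff_imp_regular_space by blast
  moreover have "openin X (U \<inter> N)" "e \<in> U \<inter> N" using N U chart_facts(1)[OF U(1)] by auto
  ultimately obtain W C where W: "openin X W" "closedin X C" "e \<in> W" "W \<subseteq> C" "C \<subseteq> U \<inter> N"
    unfolding neighbourhood_base_of_closedin[symmetric] neighbourhood_base_of by metis
  obtain r0 where r0: "r0 > 0" "\<And>v. v \<in> vspace n \<Longrightarrow> vnorm n (v - \<phi> e) < r0 \<Longrightarrow> \<exists>y\<in>U \<inter> W. v = \<phi> y"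
    using chart_ball[OF U(1) W(1) U(2) W(3)] by blast
  have e: "\<phi> e \<in> vspace n" using chart_vspace[OF U] .
  show ?thesis
  proof (rule that[OF r0(1)])
    show "\<exists>y\<in>U \<inter> N. v = \<phi> y" if "v \<in> vspace n" "vnorm n (v - \<phi> e) < r0" for v
      using r0(2)[OF that] W by blast
    fix r :: real assume r: "0 < r" "r \<le> r0"
    let ?B = "{v \<in> vspace n. vnorm n (v - \<phi> e) < r}" and ?B' = "{v \<in> vspace n. \<not> vnorm n (v - \<phi> e) < r}"
    \<comment> \<open>A move by less than \<open>r\<close> does not change membership in an
      ultrametric ball of radius \<open>r\<close>; so the ball and its complement in
      \<open>vspace n\<close> are both open.\<close>
    have stay: "vnorm n (v - \<phi> e) < r \<longleftrightarrow> vnorm n (w - \<phi> e) < r" if "vnorm n (w - v) < r" for v w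
    proof -
      have "vnorm n ((v - \<phi> e) + (w - v)) < r" if "vnorm n (v - \<phi> e) < r"
        using that \<open>vnorm n (w - v) < r\<close> by (intro vnorm_add_less)
      moreover have "vnorm n ((w - \<phi> e) + (v - w)) < r" if "vnorm n (w - \<phi> e) < r"
        using that \<open>vnorm n (w - v) < r\<close> by (intro vnorm_add_less) (auto simp: vnorm_diff_commute)
      ultimately show ?thesis by auto
    qed
    have "openin (padic_space n) ?B" "openin (padic_space n) ?B'"
      unfolding openin_padic_space using r(1) stay by blast+
    from this[THEN chart_preimage_open[OF U(1)]]
    have o: "openin X {x \<in> U. \<phi> x \<in> ?B}" "openin X {x \<in> U. \<phi> x \<in> ?B'}" .
    have eq: "{x \<in> U. vnorm n (\<phi> x - \<phi> e) < r} = {x \<in> U. \<phi> x \<in> ?B}" using chart_vspace[OF U(1)] by auto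
    then show "openin X {x \<in> U. vnorm n (\<phi> x - \<phi> e) < r}" using o(1) by simp
    have "{x \<in> U. vnorm n (\<phi> x - \<phi> e) < r} \<subseteq> W"
    proof safe
      fix x assume x: "x \<in> U" "vnorm n (\<phi> x - \<phi> e) < r"
      then obtain y where "y \<in> U \<inter> W" "\<phi> x = \<phi> y" using r0(2)[OF chart_vspace[OF U(1) x(1)]] r(2) by auto
      then show "x \<in> W" using chart_inj[OF U(1)] x(1) by (auto dest: inj_onD)
    qed
    then have "topspace X - {x \<in> U. vnorm n (\<phi> x - \<phi> e) < r} = (topspace X - C) \<union> {x \<in> U. \<phi> x \<in> ?B'}"
      using W chart_subset[OF U(1)] chart_vspace[OF U(1)] by auto
    then show "openin X (topspace X - {x \<in> U. vnorm n (\<phi> x - \<phi> e) < r})"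
      using o(2) W(2) by (simp add: openin_Un openin_diff)
  qed
qed

end

section \<open>Functionals on semisimple Lie algebras\<close>

text \<open>On a simple ideal the kernel of \<open>l\<close> is an ideal, because brackets lie in
  it, and it is not zero, because some bracket is nonzero; so it is the whole ideal. Additivity
  carries this over to the direct sum. This is the dual form of the fact that brackets span.\<close>

lemma functional_vanishing_on_brackets:
  fixes smul :: "'k::field \<Rightarrow> 'v::ab_group_add \<Rightarrow> 'v" and l :: "'v \<Rightarrow> 'k"
  assumes vs: "vector_space smul" and ss: "semisimple_lie_algebra smul br L"
    and add: "\<And>x y. l (x + y) = l x + l y" and scale: "\<And>c x. l (smul c x) = c * l x"
    and bracket: "\<And>x y. x \<in> L \<Longrightarrow> y \<in> L \<Longrightarrow> l (br x y) = 0"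
    and x: "x \<in> L"
  shows "l x = 0"
proof -
  interpret vector_space smul by (rule vs)
  from ss obtain S where S0: "finite S \<and> (\<forall>I\<in>S. lie_ideal smul br L I \<and> simple_lie_algebra smul br I) \<and>
        (\<forall>x\<in>L. \<exists>!c. c \<in> (\<Pi>\<^sub>E I\<in>S. I) \<and> x = (\<Sum>I\<in>S. c I))"
    unfolding semisimple_lie_algebra_def by (rule exE)
  then have S: "I \<in> S \<Longrightarrow> lie_ideal smul br L I" "I \<in> S \<Longrightarrow> simple_lie_algebra smul br I" for I
    by blast+
  have l0: "l 0 = 0" using scale[of 0 0] by simp
  have on_I: "l y = 0" if I: "I \<in> S" and y: "y \<in> I" for I y
  proof -
    have id: "subspace I" "I \<subseteq> L" "\<And>x y. x \<in> L \<Longrightarrow> y \<in> I \<Longrightarrow> br x y \<in> I"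
      using S(1)[OF I] unfolding lie_ideal_def by blast+
    let ?K = "{z \<in> I. l z = 0}"
    have "lie_ideal smul br I ?K"
      unfolding lie_ideal_def
    proof (intro conjI ballI)
      show "subspace ?K"
        using id(1) by (auto simp: subspace_def add scale l0)
      fix u v assume uv: "u \<in> I" "v \<in> ?K"
      then have "u \<in> L" "v \<in> L" using id(2) by auto
      then show "br u v \<in> ?K" using uv id(3) bracket by blast
    qed auto
    then have "?K = {0} \<or> ?K = I" using S(2)[OF I] unfolding simple_lie_algebra_def by blast
    moreover have "?K \<noteq> {0}"
    proof
      assume K: "?K = {0}"
      obtain u v where uv: "u \<in> I" "v \<in> I" "br u v \<noteq> 0" using S(2)[OF I] unfolding simple_lie_algebra_def by blast
      have "u \<in> L" "v \<in> L" using uv id(2) by auto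
      then have "br u v \<in> ?K" using id(3) uv(2) bracket by blast
      then show False using K uv(3) by blast
    qed
    ultimately show ?thesis using y by blast
  qed
  have l_sum: "l (sum f A) = (\<Sum>a\<in>A. l (f a))" for f :: "'v set \<Rightarrow> 'v" and A
    by (induction A rule: infinite_finite_induct) (auto simp: add l0)
  have "\<forall>x\<in>L. \<exists>!c. c \<in> (\<Pi>\<^sub>E I\<in>S. I) \<and> x = (\<Sum>I\<in>S. c I)" using S0 by (elim conjE)
  from ex1_implies_ex[OF bspec[OF this x]] obtain c where c: "c \<in> (\<Pi>\<^sub>E I\<in>S. I)" "x = (\<Sum>I\<in>S. c I)"
    by (elim exE conjE)
  have "l x = (\<Sum>I\<in>S. l (c I))" unfolding c(2) by (rule l_sum)
  also have "\<dots> = 0"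
  proof (rule sum.neutral, rule ballI)
    fix I assume I: "I \<in> S"
    show "l (c I) = 0" by (rule on_I[OF I PiE_mem[OF c(1) I]])
  qed
  finally show ?thesis .
qed


section \<open>Tangent vectors of a Lie group in coordinates\<close>

definition unit_vec :: "'p::prime_card padic \<Rightarrow> nat \<Rightarrow> nat \<Rightarrow> 'p padic" where
  "unit_vec c j = (\<lambda>i. if i = j then c else 0)"

lemma unit_vec_vspace: "j < n \<Longrightarrow> unit_vec c j \<in> vspace n"
  by (auto simp: unit_vec_def vspace_def)

lemma unit_vec_vnorm: "vnorm n (unit_vec c j) \<le> padic_norm c"
  by (auto simp: unit_vec_def vnorm_le_iff)

lemma unit_vec_vnorm_eq: "j < n \<Longrightarrow> vnorm n (unit_vec c j) = padic_norm c"
  using unit_vec_vnorm[of n c j] padic_norm_le_vnorm[of j n "unit_vec c j"] by (simp add: unit_vec_def)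

lemma unit_vec_apply [simp]: "unit_vec c j j = c" "i \<noteq> j \<Longrightarrow> unit_vec c j i = 0"
  by (auto simp: unit_vec_def)

lemma sum_unit_vec: "j < n \<Longrightarrow> (\<Sum>i<n. unit_vec c j i * g i) = c * g j"
proof -
  assume j: "j < n"
  have "(\<Sum>i<n. unit_vec c j i * g i) = (\<Sum>i<n. if i = j then c * g i else 0)"
    by (rule sum.cong) (auto simp: unit_vec_def)
  then show ?thesis using j by simp
qed

lemma uniformizer_power_tendsto_0: "(\<lambda>m. (\<pi> :: 'p::prime_card padic) ^ m) \<longlonglongrightarrow> 0"
  unfolding tendsto_padic_iff using uniformizer_power_null by (simp add: padic_norm_power)

lemma eventually_uniformizer_power: "e > 0 \<Longrightarrow> eventually (\<lambda>m. padic_norm ((\<pi> :: 'p::prime_card padic) ^ m) < e) sequentially"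
  using order_tendstoD(2)[OF uniformizer_power_null, of e] by (simp add: padic_norm_power)

lemma pser_tendsto:
  assumes f: "pser n f \<rho> C" and x: "x \<in> vspace n" "vnorm n x < \<rho>"
    and u: "\<And>m. u m \<in> vspace n" "(\<lambda>m. vnorm n (u m - x)) \<longlonglongrightarrow> 0"
  shows "(\<lambda>m. f (u m)) \<longlonglongrightarrow> f x"
  unfolding tendsto_padic_iff
proof (rule tendsto_sandwich[OF _ _ tendsto_const])
  show "(\<lambda>m. 2 * C / \<rho> * vnorm n (u m - x)) \<longlonglongrightarrow> 0"
    using tendsto_mult_left[OF u(2), of "2 * C / \<rho>"] by simp
  have "eventually (\<lambda>m. vnorm n (u m - x) < \<rho>) sequentially"
    using order_tendstoD(2)[OF u(2)] pser_pos[OF f] by blast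
  then show "eventually (\<lambda>m. padic_norm (f (u m) - f x) \<le> 2 * C / \<rho> * vnorm n (u m - x)) sequentially"
  proof (rule eventually_mono)
    fix m assume m: "vnorm n (u m - x) < \<rho>"
    have "vnorm n (u m) < \<rho>" using vnorm_add_less[OF m x(2)] by simp
    then show "padic_norm (f (u m) - f x) \<le> 2 * C / \<rho> * vnorm n (u m - x)"
      by (rule pser_lipschitz[OF f u(1) _ x])
  qed
qed simp

text \<open>Concatenation of two coordinate vectors in the order used by the charts of
  \<open>prod_mfd\<close>.\<close>

definition join :: "nat \<Rightarrow> (nat \<Rightarrow> 'p::prime_card padic) \<Rightarrow> (nat \<Rightarrow> 'p padic) \<Rightarrow> nat \<Rightarrow> 'p padic" where
  "join n x y i = (if i < n then x i else y (i - n))"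

lemma join_vspace: "y \<in> vspace m \<Longrightarrow> join n x y \<in> vspace (n + m)"
  by (auto simp: vspace_def join_def)

lemma join_apply [simp]: "i < n \<Longrightarrow> join n x y i = x i" "join n x y (n + i) = y i"
  by (auto simp: join_def)

lemma vnorm_join: "vnorm (n + m) (join n x y) = max (vnorm n x) (vnorm m y)"
proof (rule antisym)
  show "vnorm (n + m) (join n x y) \<le> max (vnorm n x) (vnorm m y)"
    using padic_norm_le_vnorm[of _ n x] padic_norm_le_vnorm[of _ m y]
    by (auto simp: vnorm_le_iff join_def intro: max.coboundedI1 max.coboundedI2)
  have "padic_norm (x i) \<le> vnorm (n + m) (join n x y)" if "i < n" for i
    using padic_norm_le_vnorm[of i "n + m" "join n x y"] that by simp
  moreover have "padic_norm (y i) \<le> vnorm (n + m) (join n x y)" if "i < m" for i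
    using padic_norm_le_vnorm[of "n + i" "n + m" "join n x y"] that by simp
  ultimately show "max (vnorm n x) (vnorm m y) \<le> vnorm (n + m) (join n x y)"
    by (auto simp: vnorm_le_iff)
qed

lemma join_diff: "join n x y - join n x' y' = join n (x - x') (y - y')"
  and join_add: "join n x y + join n x' y' = join n (x + x') (y + y')"
  and join_0: "join n 0 0 = 0"
  by (auto simp: join_def fun_eq_iff)

text \<open>A chart at the identity with a radius up to which its balls are clopen in all of
  \<open>G\<close>, as supplied by \<open>clopen_balls\<close>. Clopen balls allow coordinate
  functions to be cut off analytically.\<close>

locale lie_chart = padic_mfd M
  for M :: "('g, 'p::prime_card) padic_atlas" +
  fixes G :: "'g monoid" (structure) and V :: "'g set" and \<phi> :: "'g \<Rightarrow> nat \<Rightarrow> 'p padic" and r0 :: real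
  assumes lie: "padic_lie_group G M"
    and V: "(V, \<phi>) \<in> mfd_charts M" and one_V: "\<one>\<^bsub>G\<^esub> \<in> V" and r0: "r0 > 0"
    and ball_V: "\<And>v. v \<in> vspace n \<Longrightarrow> vnorm n (v - \<phi> \<one>\<^bsub>G\<^esub>) < r0 \<Longrightarrow> \<exists>y\<in>V. v = \<phi> y"
    and ball_open: "\<And>r. 0 < r \<Longrightarrow> r \<le> r0 \<Longrightarrow> openin X {x \<in> V. vnorm n (\<phi> x - \<phi> \<one>\<^bsub>G\<^esub>) < r}"
    and ball_closed: "\<And>r. 0 < r \<Longrightarrow> r \<le> r0 \<Longrightarrow> openin X (topspace X - {x \<in> V. vnorm n (\<phi> x - \<phi> \<one>\<^bsub>G\<^esub>) < r})"
begin

sublocale group G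
  using lie by (simp add: padic_lie_group_def)

lemma topspace_G: "topspace X = carrier G"
  using lie by (simp add: padic_lie_group_def)

lemma mult_continuous: "continuous_map (prod_topology X X) X (\<lambda>(x, y). x \<otimes>\<^bsub>G\<^esub> y)"
proof -
  have "analytic_map (prod_mfd M M) M (\<lambda>(x, y). x \<otimes>\<^bsub>G\<^esub> y)"
    using lie unfolding padic_lie_group_def by (elim conjE)
  then have "continuous_map (mfd_top (prod_mfd M M)) X (\<lambda>(x, y). x \<otimes>\<^bsub>G\<^esub> y)"
    unfolding analytic_map_def by (elim conjE)
  then show ?thesis by (simp add: prod_mfd_def)
qed

lemma inv_continuous: "continuous_map X X (\<lambda>x. inv\<^bsub>G\<^esub> x)"
proof -
  have "analytic_map M M (\<lambda>x. inv\<^bsub>G\<^esub> x)" using lie unfolding padic_lie_group_def by (elim conjE)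
  then show ?thesis unfolding analytic_map_def by (elim conjE)
qed

lemma V_carrier: "x \<in> V \<Longrightarrow> x \<in> carrier G"
  using chart_subset[OF V] topspace_G by auto

lemma left_mult_open:
  assumes "openin X W" "s \<in> carrier G"
  shows "openin X {t \<in> carrier G. s \<otimes> t \<in> W}"
proof -
  have "continuous_map X X ((\<lambda>(x, y). x \<otimes> y) \<circ> (\<lambda>t. (s, t)))"
    by (rule continuous_map_compose[OF _ mult_continuous])
      (use assms topspace_G in \<open>auto simp: continuous_map_pairwise o_def\<close>)
  from openin_continuous_map_preimage[OF this assms(1)] show ?thesis by (simp add: topspace_G)
qed

definition cd :: "'g \<Rightarrow> nat \<Rightarrow> 'p padic" where "cd x = \<phi> x - \<phi> \<one>"
text \<open>Inverse of the centred coordinates \<open>cd\<close>. It is meaningful only where the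
  chart attains its argument, in particular for vectors of norm below \<open>r0\<close>.\<close>

definition pt :: "(nat \<Rightarrow> 'p padic) \<Rightarrow> 'g" where "pt v = inv_into V \<phi> (\<phi> \<one> + v)"
definition B :: "real \<Rightarrow> 'g set" where "B r = {x \<in> V. vnorm n (cd x) < r}"

lemma cd_vspace: "x \<in> V \<Longrightarrow> cd x \<in> vspace n"
  unfolding cd_def by (intro vspace_diff chart_vspace[OF V] one_V)

lemma pt_cd [simp]: "x \<in> V \<Longrightarrow> pt (cd x) = x"
  by (simp add: pt_def cd_def chart_inv[OF V])

lemma cd_one [simp]: "cd \<one> = 0" by (simp add: cd_def)

lemma pt_0 [simp]: "pt 0 = \<one>" using pt_cd[OF one_V] by simp

lemma pt_ball:
  assumes "v \<in> vspace n" "vnorm n v < r0"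
  shows "pt v \<in> V" "cd (pt v) = v"
proof -
  have "\<phi> \<one> + v \<in> vspace n" by (intro vspace_add chart_vspace[OF V] one_V assms)
  then obtain y where y: "y \<in> V" "\<phi> \<one> + v = \<phi> y" using ball_V[of "\<phi> \<one> + v"] assms by auto
  then have "pt v = y" by (simp add: pt_def chart_inv[OF V])
  then show "pt v \<in> V" "cd (pt v) = v" using y by (auto simp: cd_def algebra_simps)
qed

lemma pt_B: "v \<in> vspace n \<Longrightarrow> vnorm n v < r \<Longrightarrow> r \<le> r0 \<Longrightarrow> pt v \<in> B r"
  using pt_ball[of v] by (auto simp: B_def)

lemma B_open: "0 < r \<Longrightarrow> r \<le> r0 \<Longrightarrow> openin X (B r)"
  and B_closed: "0 < r \<Longrightarrow> r \<le> r0 \<Longrightarrow> openin X (topspace X - B r)"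
  unfolding B_def cd_def using ball_open ball_closed by blast+

lemma B_base:
  assumes "openin X W" "\<one> \<in> W"
  obtains r where "0 < r" "r \<le> r0" "B r \<subseteq> W"
proof -
  obtain r where r: "r > 0" "\<And>v. v \<in> vspace n \<Longrightarrow> vnorm n (v - \<phi> \<one>) < r \<Longrightarrow> \<exists>y\<in>V \<inter> W. v = \<phi> y"
    using chart_ball[OF V assms(1) one_V assms(2)] by blast
  have "B (min r r0) \<subseteq> W"
  proof
    fix x assume x: "x \<in> B (min r r0)"
    then obtain y where "y \<in> V \<inter> W" "\<phi> x = \<phi> y"
      using r(2)[of "\<phi> x"] chart_vspace[OF V] by (auto simp: B_def cd_def)
    then show "x \<in> W" using chart_inj[OF V] x by (auto simp: B_def dest: inj_onD)
  qed
  then show ?thesis using that[of "min r r0"] r r0 by auto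
qed

lemma one_B: "r > 0 \<Longrightarrow> \<one> \<in> B r" by (simp add: B_def one_V)

text \<open>Tangent vectors are defined on global analytic functions only, so a coordinate function
  has to be cut off on a clopen ball.\<close>

definition kap :: "nat \<Rightarrow> 'g \<Rightarrow> 'p padic" where
  "kap i x = (if x \<in> B r0 then cd x i else 0)"

lemma kap_analytic: "i < n \<Longrightarrow> kap i \<in> analytic_functions M"
proof -
  assume i: "i < n"
  have eq: "kap i = (\<lambda>x. if x \<in> B r0 then \<phi> x i + - \<phi> \<one> i else 0)"
    by (auto simp: kap_def cd_def fun_eq_iff)
  have "ana_at (\<lambda>x. \<phi> x i + - \<phi> \<one> i) x" if "x \<in> B r0" for x
  proof -
    have x: "x \<in> V" using that by (simp add: B_def)
    have "x \<in> topspace X" using x chart_subset[OF V] by auto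
    then show ?thesis by (rule ana_at_add[OF ana_at_coord[OF V x i] ana_at_const])
  qed
  then show ?thesis
    unfolding eq using B_open[OF r0] B_closed[OF r0] by (intro analytic_on_clopen) auto
qed

lemma local_series:
  assumes "f \<in> analytic_functions M"
  obtains \<rho> C where "pser n (\<lambda>v. f (pt v)) \<rho> C"
proof -
  have "\<one> \<in> topspace X" by (simp add: topspace_G)
  then have "lser n (\<lambda>v. f (inv_into V \<phi> v)) (\<phi> \<one>)"
    using ana_atD[OF analytic_functionsD(2)[OF assms] V one_V] by simp
  then show ?thesis using that unfolding lser_def pt_def by blast
qed

text \<open>The partial derivative at the identity, as a limit along the null sequence
  \<open>\<pi> ^ m\<close>; for analytic \<open>f\<close> it exists by
  \<open>pd_tendsto\<close>.\<close>

definition pd :: "nat \<Rightarrow> ('g \<Rightarrow> 'p padic) \<Rightarrow> 'p padic" where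
  "pd j f = lim (\<lambda>m. (f (pt (unit_vec (\<pi> ^ m) j)) - f \<one>) / \<pi> ^ m)"

lemma pd_tendstoI:
  assumes "eventually (\<lambda>m. f (pt (unit_vec (\<pi> ^ m) j)) = f \<one> + \<pi> ^ m * h m) sequentially" "h \<longlonglongrightarrow> l"
  shows "(\<lambda>m. (f (pt (unit_vec (\<pi> ^ m) j)) - f \<one>) / \<pi> ^ m) \<longlonglongrightarrow> l" "pd j f = l"
proof -
  show *: "(\<lambda>m. (f (pt (unit_vec (\<pi> ^ m) j)) - f \<one>) / \<pi> ^ m) \<longlonglongrightarrow> l"
    using assms(2) by (rule Lim_transform_eventually) (use assms(1) in \<open>auto elim!: eventually_mono\<close>)
  then show "pd j f = l" unfolding pd_def by (rule limI)
qed

lemma unit_vec_tendsto: "j < n \<Longrightarrow> (\<lambda>m. vnorm n (unit_vec (\<pi> ^ m :: 'p padic) j - 0)) \<longlonglongrightarrow> 0"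
  using uniformizer_power_null by (simp add: unit_vec_vnorm_eq padic_norm_power)

text \<open>Hadamard's lemma in the chart. Along a coordinate axis only one summand survives, so the
  coefficient \<open>g j\<close> at 0 is the partial derivative.\<close>

lemma local_hadamard:
  assumes "f \<in> analytic_functions M"
  obtains \<rho> C g where "0 < \<rho>" "\<And>j. j < n \<Longrightarrow> pser n (g j) \<rho> C"
    "\<And>v. v \<in> vspace n \<Longrightarrow> vnorm n v < \<rho> \<Longrightarrow> f (pt v) = f \<one> + (\<Sum>j<n. v j * g j v)"
    "\<And>j. j < n \<Longrightarrow> (\<lambda>m. (f (pt (unit_vec (\<pi> ^ m) j)) - f \<one>) / \<pi> ^ m) \<longlonglongrightarrow> g j 0"
    "\<And>j. j < n \<Longrightarrow> pd j f = g j 0"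
proof -
  obtain \<rho> C where p: "pser n (\<lambda>v. f (pt v)) \<rho> C" by (rule local_series[OF assms])
  have \<rho>: "\<rho> > 0" using p by (rule pser_pos)
  from pser_hadamard[OF p, of 0 n] obtain g where g0: "\<forall>i\<in>{0..<n}. pser n (g i) \<rho> (C / \<rho>)"
    "\<forall>v\<in>vspace n. vnorm n v < \<rho> \<longrightarrow>
       f (pt v) = f (pt (\<lambda>i. if i \<in> {0..<n} then 0 else v i)) + (\<Sum>i\<in>{0..<n}. v i * g i v)"
    by blast
  have g: "pser n (g i) \<rho> (C / \<rho>)" if "i < n" for i using g0(1) that by simp
  have eq: "f (pt v) = f \<one> + (\<Sum>j<n. v j * g j v)" if v: "v \<in> vspace n" "vnorm n v < \<rho>" for v
  proof -
    have "(\<lambda>i. if i \<in> {0..<n} then 0 else v i) = 0" using v(1) by (auto simp: vspace_def fun_eq_iff)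
    then show ?thesis using g0(2) v by (simp add: atLeast0LessThan)
  qed
  have pdl: "(\<lambda>m. (f (pt (unit_vec (\<pi> ^ m) j)) - f \<one>) / \<pi> ^ m) \<longlonglongrightarrow> g j 0" "pd j f = g j 0" if j: "j < n" for j
  proof -
    have ev: "eventually (\<lambda>m. f (pt (unit_vec (\<pi> ^ m) j)) = f \<one> + \<pi> ^ m * g j (unit_vec (\<pi> ^ m) j)) sequentially"
      using eventually_uniformizer_power[OF \<rho>]
    proof (rule eventually_mono)
      fix m assume "padic_norm ((\<pi> :: 'p padic) ^ m) < \<rho>"
      then have "vnorm n (unit_vec (\<pi> ^ m :: 'p padic) j) < \<rho>" using unit_vec_vnorm_eq[OF j] by metis
      from eq[OF unit_vec_vspace[OF j] this] show "f (pt (unit_vec (\<pi> ^ m) j)) = f \<one> + \<pi> ^ m * g j (unit_vec (\<pi> ^ m) j)"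
        by (simp add: sum_unit_vec[OF j])
    qed
    have lim: "(\<lambda>m. g j (unit_vec (\<pi> ^ m) j)) \<longlonglongrightarrow> g j 0"
      by (rule pser_tendsto[OF g[OF j]]) (use \<rho> unit_vec_vspace[OF j] unit_vec_tendsto[OF j] in auto)
    show "(\<lambda>m. (f (pt (unit_vec (\<pi> ^ m) j)) - f \<one>) / \<pi> ^ m) \<longlonglongrightarrow> g j 0" "pd j f = g j 0"
      using pd_tendstoI[OF ev lim] by blast+
  qed
  show ?thesis by (rule that[OF \<rho> g eq pdl])
qed

lemma pd_tendsto:
  assumes "f \<in> analytic_functions M" "j < n"
  shows "(\<lambda>m. (f (pt (unit_vec (\<pi> ^ m) j)) - f \<one>) / \<pi> ^ m) \<longlonglongrightarrow> pd j f"
proof (rule local_hadamard[OF assms(1)])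
  fix g :: "nat \<Rightarrow> (nat \<Rightarrow> 'p padic) \<Rightarrow> 'p padic"
  assume "\<And>j. j < n \<Longrightarrow> (\<lambda>m. (f (pt (unit_vec (\<pi> ^ m) j)) - f \<one>) / \<pi> ^ m) \<longlonglongrightarrow> g j 0"
    "\<And>j. j < n \<Longrightarrow> pd j f = g j 0"
  then show ?thesis using assms(2) by simp
qed

definition partial :: "nat \<Rightarrow> ('g \<Rightarrow> 'p padic) \<Rightarrow> 'p padic" where
  "partial j f = (if f \<in> analytic_functions M then pd j f else 0)"

lemma partial_tangent:
  assumes j: "j < n"
  shows "partial j \<in> tangent_space M \<one>"
proof -
  let ?x = "\<lambda>m. pt (unit_vec (\<pi> ^ m) j)"
  have val: "(\<lambda>m. f (?x m)) \<longlonglongrightarrow> f \<one>" if f: "f \<in> analytic_functions M" for f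
  proof -
    have "(\<lambda>m. f \<one> + \<pi> ^ m * ((f (?x m) - f \<one>) / \<pi> ^ m)) \<longlonglongrightarrow> f \<one> + 0 * pd j f"
      by (intro tendsto_add tendsto_const tendsto_mult uniformizer_power_tendsto_0 pd_tendsto f j)
    then show ?thesis by simp
  qed
  have 1: "pd j (f + g) = pd j f + pd j g" if "f \<in> analytic_functions M" "g \<in> analytic_functions M" for f g
  proof -
    have "(\<lambda>m. ((f + g) (?x m) - (f + g) \<one>) / \<pi> ^ m) \<longlonglongrightarrow> pd j f + pd j g"
      using tendsto_add[OF pd_tendsto[OF that(1) j] pd_tendsto[OF that(2) j]]
      by (simp add: add_diff_add add_divide_distrib)
    then show ?thesis unfolding pd_def[of j "f + g"] by (rule limI)
  qed
  have 2: "pd j (\<lambda>x. c * f x) = c * pd j f" if "f \<in> analytic_functions M" for f c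
  proof -
    have "(\<lambda>m. (c * f (?x m) - c * f \<one>) / \<pi> ^ m) \<longlonglongrightarrow> c * pd j f"
      using tendsto_mult[OF tendsto_const[of c] pd_tendsto[OF that j]]
      by (simp add: right_diff_distrib)
    then show ?thesis unfolding pd_def[of j "\<lambda>x. c * f x"] by (rule limI)
  qed
  have 3: "pd j (f * g) = pd j f * g \<one> + f \<one> * pd j g"
    if "f \<in> analytic_functions M" "g \<in> analytic_functions M" for f g
  proof -
    have "(\<lambda>m. (f (?x m) - f \<one>) / \<pi> ^ m * g (?x m) + f \<one> * ((g (?x m) - g \<one>) / \<pi> ^ m))
        \<longlonglongrightarrow> pd j f * g \<one> + f \<one> * pd j g"
      by (intro tendsto_add tendsto_mult tendsto_const pd_tendsto that j val)
    also have "(\<lambda>m. (f (?x m) - f \<one>) / \<pi> ^ m * g (?x m) + f \<one> * ((g (?x m) - g \<one>) / \<pi> ^ m))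
        = (\<lambda>m. ((f * g) (?x m) - (f * g) \<one>) / \<pi> ^ m)"
      by (simp add: fun_eq_iff diff_divide_distrib left_diff_distrib right_diff_distrib)
    finally show ?thesis unfolding pd_def[of j "f * g"] by (rule limI)
  qed
  show ?thesis
    unfolding tangent_space_def
  proof (intro CollectI conjI ballI allI impI)
    fix f g c assume f: "f \<in> analytic_functions M"
    show "partial j (\<lambda>x. c * f x) = c * partial j f"
      using 2[OF f, of c] analytic_functions_cmult[OF f, of c] f by (simp only: partial_def if_True)
    assume g: "g \<in> analytic_functions M"
    show "partial j (f + g) = partial j f + partial j g"
      using 1[OF f g] analytic_functions_add[OF f g] f g by (simp only: partial_def if_True)
    show "partial j (f * g) = partial j f * g \<one> + f \<one> * partial j g"
      using 3[OF f g] analytic_functions_mult[OF f g] f g by (simp only: partial_def if_True)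
  qed (simp add: partial_def)
qed

lemma pd_kap: "i < n \<Longrightarrow> j < n \<Longrightarrow> pd j (kap i) = (if i = j then 1 else 0)"
proof (rule pd_tendstoI(2))
  assume ij: "i < n" "j < n"
  show "eventually (\<lambda>m. kap i (pt (unit_vec (\<pi> ^ m) j)) = kap i \<one> + \<pi> ^ m * (if i = j then 1 else 0)) sequentially"
    using eventually_uniformizer_power[OF r0]
  proof (rule eventually_mono)
    fix m assume "padic_norm ((\<pi> :: 'p padic) ^ m) < r0"
    then have "vnorm n (unit_vec (\<pi> ^ m :: 'p padic) j) < r0" using unit_vec_vnorm_eq[OF ij(2)] by metis
    with pt_ball[OF unit_vec_vspace[OF ij(2)] this]
    show "kap i (pt (unit_vec (\<pi> ^ m) j)) = kap i \<one> + \<pi> ^ m * (if i = j then 1 else 0)"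
      by (auto simp: kap_def B_def)
  qed
qed simp

context
  fixes D assumes D: "D \<in> tangent_space M \<one>"
begin

lemma tangent_add: "f \<in> analytic_functions M \<Longrightarrow> g \<in> analytic_functions M \<Longrightarrow> D (f + g) = D f + D g"
  and tangent_cmult: "f \<in> analytic_functions M \<Longrightarrow> D (\<lambda>x. c * f x) = c * D f"
  and tangent_mult: "f \<in> analytic_functions M \<Longrightarrow> g \<in> analytic_functions M \<Longrightarrow> D (f * g) = D f * g \<one> + f \<one> * D g"
  using D unfolding tangent_space_def by blast+

lemma tangent_0: "D 0 = 0"
proof -
  have "D 0 = D 0 + D 0" using tangent_add[OF analytic_functions_0 analytic_functions_0] by (simp only: add_0)
  then show ?thesis by (simp only: add_cancel_right_right)
qed

lemma tangent_sum: "(\<And>i. i \<in> I \<Longrightarrow> f i \<in> analytic_functions M) \<Longrightarrow> D (sum f I) = (\<Sum>i\<in>I. D (f i))"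
  by (induction I rule: infinite_finite_induct) (auto simp: tangent_0 tangent_add analytic_functions_sum)

text \<open>A point derivation kills the indicator of a clopen neighbourhood and functions vanishing
  near the identity. What remains is a combination of products \<open>kap j * h j\<close> given by
  Hadamard's lemma, where the Leibniz rule keeps only the value of \<open>h j\<close> at the
  identity. So the coordinate derivations span the tangent space.\<close>

lemma tangent_eq:
  assumes f: "f \<in> analytic_functions M"
  shows "D f = (\<Sum>j<n. D (kap j) * pd j f)"
proof -
  obtain \<rho> C and g :: "nat \<Rightarrow> (nat \<Rightarrow> 'p padic) \<Rightarrow> 'p padic"
    where \<rho>: "0 < \<rho>" and g: "\<And>j. j < n \<Longrightarrow> pser n (g j) \<rho> C"
    and fg: "\<And>v. v \<in> vspace n \<Longrightarrow> vnorm n v < \<rho> \<Longrightarrow> f (pt v) = f \<one> + (\<Sum>j<n. v j * g j v)"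
    and "\<And>j. j < n \<Longrightarrow> (\<lambda>m. (f (pt (unit_vec (\<pi> ^ m) j)) - f \<one>) / \<pi> ^ m) \<longlonglongrightarrow> g j 0"
    and pdg: "\<And>j. j < n \<Longrightarrow> pd j f = g j 0"
    by (rule local_hadamard[OF f]) (rule that)
  define r where "r = min \<rho> r0"
  have r: "0 < r" "r \<le> r0" "r \<le> \<rho>" using \<rho> r0 by (auto simp: r_def)
  define W where "W = B r"
  have W: "openin X W" "openin X (topspace X - W)" "\<one> \<in> W" "W \<subseteq> V" "W \<subseteq> B r0"
    using B_open[OF r(1,2)] B_closed[OF r(1,2)] one_B[OF r(1)] r(2) by (auto simp: W_def B_def)
  have W_top: "W \<subseteq> topspace X" using W(1) by (rule openin_subset)
  define ind where "ind = (\<lambda>x. if x \<in> W then 1 else 0 :: 'p padic)"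
  define ind' where "ind' = (\<lambda>x. if x \<in> topspace X - W then 1 else 0 :: 'p padic)"
  define f1 where "f1 = (\<lambda>x. if x \<in> W then f x else 0)"
  define f2 where "f2 = (\<lambda>x. if x \<in> topspace X - W then f x else 0)"
  define h where "h j = (\<lambda>x. if x \<in> W then g j (cd x) else 0)" for j
  have W': "openin X (topspace X - (topspace X - W))" using W(1) W_top by (simp add: double_diff)
  have f_at: "ana_at f x" if "x \<in> topspace X" for x by (rule analytic_functionsD(2)[OF f that])
  have an: "ind \<in> analytic_functions M" "f1 \<in> analytic_functions M"
    unfolding ind_def f1_def using W_top f_at ana_at_const
    by (intro analytic_on_clopen[OF W(1,2)]; blast)+
  have an': "ind' \<in> analytic_functions M" "f2 \<in> analytic_functions M"
    unfolding ind'_def f2_def using f_at ana_at_const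
    by (intro analytic_on_clopen[OF W(2) W']; blast)+
  have h_an: "h j \<in> analytic_functions M" if j: "j < n" for j
    unfolding h_def
  proof (rule analytic_on_clopen[OF W(1,2)])
    fix x assume x: "x \<in> W"
    have xV: "x \<in> V" using x W by auto
    have ls: "lser n (\<lambda>w. g j (w - \<phi> \<one>)) (\<phi> x)"
    proof (rule lser_recenter)
      show "pser n (\<lambda>y. g j (\<phi> \<one> + y - \<phi> \<one>)) \<rho> C" using g[OF j] by simp
      show "\<phi> x - \<phi> \<one> \<in> vspace n" using cd_vspace[OF xV] by (simp add: cd_def)
      show "vnorm n (\<phi> x - \<phi> \<one>) < \<rho>" using x r by (simp add: W_def B_def cd_def)
    qed
    obtain s where s: "s > 0" "\<And>v. v \<in> vspace n \<Longrightarrow> vnorm n (v - \<phi> x) < s \<Longrightarrow> \<exists>y\<in>V \<inter> V. v = \<phi> y"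
      using chart_ball[OF V chart_facts(1)[OF V] xV xV] by blast
    have "g j (cd (inv_into V \<phi> v)) = g j (v - \<phi> \<one>)" if "v \<in> vspace n" "vnorm n (v - \<phi> x) < s" for v
      using s(2)[OF that] by (auto simp: cd_def chart_inv[OF V])
    then have "lser n (\<lambda>v. g j (cd (inv_into V \<phi> v))) (\<phi> x)"
      by (rule lser_cong[OF ls chart_vspace[OF V xV] s(1)])
    then show "ana_at (\<lambda>x. g j (cd x)) x" by (rule ana_atI[OF V xV])
  qed
  \<comment> \<open>The Leibniz rule for an idempotent with value 1 at the identity shows that
    \<open>D ind\<close> equals twice itself.\<close>
  have "ind * ind = ind" by (auto simp: ind_def fun_eq_iff)
  moreover have ind1: "ind \<one> = 1" "ind' \<one> = 0" "f2 \<one> = 0" using W(3) by (auto simp: ind_def ind'_def f2_def)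
  ultimately have "D ind = D ind + D ind" using tangent_mult[OF an(1,1)] by (simp only: mult_1_left mult_1_right)
  then have D_ind: "D ind = 0" by (simp only: add_cancel_right_right)
  \<comment> \<open>Both factors vanish at the identity, so both Leibniz terms are zero.\<close>
  have "f2 * ind' = f2" by (auto simp: f2_def ind'_def fun_eq_iff)
  then have D_f2: "D f2 = 0" using tangent_mult[OF an'(2,1)] ind1 by simp
  have "f x = (f1 + f2) x" for x
    using analytic_functionsD(1)[OF f, of x] W_top by (auto simp: f1_def f2_def)
  then have "f = f1 + f2" by (simp add: fun_eq_iff)
  then have "D f = D f1" using tangent_add[OF an(2) an'(2)] D_f2 by simp
  also have "f1 = (\<lambda>x. f \<one> * ind x) + (\<Sum>j<n. kap j * h j)"
  proof
    fix x
    have "sum F I x = (\<Sum>i\<in>I. F i x)" for F :: "nat \<Rightarrow> 'g \<Rightarrow> 'p padic" and I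
      by (induction I rule: infinite_finite_induct) auto
    note sum_app = this
    show "f1 x = ((\<lambda>x. f \<one> * ind x) + (\<Sum>j<n. kap j * h j)) x"
    proof (cases "x \<in> W")
      case True
      then have "x \<in> V" "x \<in> B r0" "vnorm n (cd x) < \<rho>" using W r by (auto simp: W_def B_def)
      then show ?thesis
        using fg[OF cd_vspace] True by (simp add: f1_def ind_def sum_app h_def kap_def)
    next
      case False
      then show ?thesis by (simp add: f1_def ind_def sum_app h_def)
    qed
  qed
  also have "D \<dots> = D (\<lambda>x. f \<one> * ind x) + D (\<Sum>j<n. kap j * h j)"
    by (rule tangent_add[OF analytic_functions_cmult[OF an(1)] analytic_functions_sum])
      (simp add: analytic_functions_mult kap_analytic h_an)
  also have "D (\<lambda>x. f \<one> * ind x) = f \<one> * D ind" by (rule tangent_cmult[OF an(1)])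
  also have "D (\<Sum>j<n. kap j * h j) = (\<Sum>j<n. D (kap j * h j))"
    by (rule tangent_sum) (simp add: analytic_functions_mult kap_analytic h_an)
  finally have "D f = f \<one> * D ind + (\<Sum>j<n. D (kap j * h j))" .
  moreover have "kap j \<one> = 0" "h j \<one> = g j 0" for j using W(3) r0 by (simp_all add: kap_def h_def one_B)
  ultimately show ?thesis by (simp add: D_ind tangent_mult kap_analytic h_an pdg)
qed

end

end

lemma ball_openin_padic_space:
  assumes "r > 0"
  shows "openin (padic_space n) {v \<in> vspace n. vnorm n (v - a) < r}"
  unfolding openin_padic_space
proof (intro conjI ballI)
  fix v assume v: "v \<in> {v \<in> vspace n. vnorm n (v - a) < r}"
  have "w \<in> {v \<in> vspace n. vnorm n (v - a) < r}" if "w \<in> vspace n" "vnorm n (w - v) < r" for w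
    using vnorm_add_less[OF that(2), of "v - a"] v that by simp
  then show "\<exists>s>0. \<forall>w\<in>vspace n. vnorm n (w - v) < s \<longrightarrow> w \<in> {v \<in> vspace n. vnorm n (v - a) < r}"
    using assms by blast
qed auto

section \<open>The group law in coordinates\<close>

context lie_chart
begin

abbreviation fst_part :: "(nat \<Rightarrow> 'p padic) \<Rightarrow> nat \<Rightarrow> 'p padic" where
  "fst_part z \<equiv> (\<lambda>k. if k < n then z k else 0)"
abbreviation snd_part :: "(nat \<Rightarrow> 'p padic) \<Rightarrow> nat \<Rightarrow> 'p padic" where
  "snd_part z \<equiv> (\<lambda>k. z (k + n))"

lemma snd_part_join: "snd_part (join n x y) = y" by (auto simp: join_def)
lemma fst_part_join: "x \<in> vspace n \<Longrightarrow> fst_part (join n x y) = x"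
  by (auto simp: join_def vspace_def fun_eq_iff)

text \<open>Unfolds analyticity of the multiplication in the product chart at \<open>(s, t)\<close>.
  The charts at \<open>s\<close> and \<open>t\<close> are arbitrary because left translates have to
  be analytic on the whole group, not only near the identity.\<close>

lemma mult_lser:
  assumes U: "(U, \<theta>) \<in> mfd_charts M" "s \<in> U" and W: "(W, \<psi>) \<in> mfd_charts M" "t \<in> W"
    and st: "s \<otimes> t \<in> V" and i: "i < n"
  shows "lser (n + n) (\<lambda>z. \<phi> (inv_into U \<theta> (fst_part z) \<otimes> inv_into W \<psi> (snd_part z)) i) (join n (\<theta> s) (\<psi> t))"
proof -
  define \<Phi> where "\<Phi> = (\<lambda>(x, y) k. if k < n then \<theta> x k else \<psi> y (k - n))"
  have \<Phi>: "\<Phi> (x, y) = join n (\<theta> x) (\<psi> y)" for x y by (simp add: \<Phi>_def join_def fun_eq_iff)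
  have inj: "inj_on \<Phi> (U \<times> W)"
  proof (rule inj_onI, clarify)
    fix x y x' y' assume a: "x \<in> U" "y \<in> W" "x' \<in> U" "y' \<in> W" "\<Phi> (x, y) = \<Phi> (x', y')"
    have e: "join n (\<theta> x) (\<psi> y) = join n (\<theta> x') (\<psi> y')" using a(5) unfolding \<Phi> .
    have "\<theta> x = fst_part (join n (\<theta> x) (\<psi> y))" by (rule fst_part_join[symmetric, OF chart_vspace[OF U(1) a(1)]])
    also have "\<dots> = \<theta> x'" unfolding e by (rule fst_part_join[OF chart_vspace[OF U(1) a(3)]])
    finally have "\<theta> x = \<theta> x'" .
    moreover have "\<psi> y = \<psi> y'"
      using snd_part_join[of "\<theta> x" "\<psi> y"] snd_part_join[of "\<theta> x'" "\<psi> y'"] unfolding e by (rule trans[OF sym])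
    ultimately have "\<theta> x = \<theta> x'" "\<psi> y = \<psi> y'" by blast+
    then show "x = x' \<and> y = y'"
      using inj_onD[OF chart_inj[OF U(1)]] inj_onD[OF chart_inj[OF W(1)]] a by blast
  qed
  let ?S = "\<Phi> ` {z \<in> U \<times> W. (case z of (x, y) \<Rightarrow> x \<otimes> y) \<in> V}"
  have an: "analytic_map (prod_mfd M M) M (\<lambda>(x, y). x \<otimes>\<^bsub>G\<^esub> y)"
    using lie unfolding padic_lie_group_def by (elim conjE)
  have ch: "(U \<times> W, \<Phi>) \<in> mfd_charts (prod_mfd M M)"
    unfolding prod_mfd_def \<Phi>_def using U(1) W(1) by auto
  have "\<forall>(U, \<phi>)\<in>mfd_charts (prod_mfd M M). \<forall>(V, \<psi>)\<in>mfd_charts M. \<forall>k<mfd_dim M.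
        padic_analytic_on (mfd_dim (prod_mfd M M))
          (\<lambda>v. \<psi> ((\<lambda>(x, y). x \<otimes>\<^bsub>G\<^esub> y) (inv_into U \<phi> v)) k)
          (\<phi> ` {x \<in> U. (\<lambda>(x, y). x \<otimes>\<^bsub>G\<^esub> y) x \<in> V})"
    using an unfolding analytic_map_def by (elim conjE)
  from bspec[OF bspec[OF this ch, unfolded case_prod_conv] V, unfolded case_prod_conv, rule_format, OF i]
  have pa: "padic_analytic_on (n + n) (\<lambda>v. \<phi> (case inv_into (U \<times> W) \<Phi> v of (x, y) \<Rightarrow> x \<otimes> y) i) ?S"
    by (simp add: prod_mfd_def)
  have mem: "join n (\<theta> s) (\<psi> t) \<in> ?S"
    unfolding \<Phi>[symmetric] using U(2) W(2) st by (intro imageI) simp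
  have ls: "lser (n + n) (\<lambda>v. \<phi> (case inv_into (U \<times> W) \<Phi> v of (x, y) \<Rightarrow> x \<otimes> y) i) (join n (\<theta> s) (\<psi> t))"
    using pa mem unfolding padic_analytic_on_iff by blast
  have op: "openin (padic_space (n + n)) ?S" using pa unfolding padic_analytic_on_iff by blast
  then obtain r where r: "r > 0" "\<And>z. z \<in> vspace (n + n) \<Longrightarrow> vnorm (n + n) (z - join n (\<theta> s) (\<psi> t)) < r \<Longrightarrow> z \<in> ?S"
    using mem unfolding openin_padic_space by blast
  show ?thesis
  proof (rule lser_cong[OF ls _ r(1)])
    show "join n (\<theta> s) (\<psi> t) \<in> vspace (n + n)" by (rule join_vspace[OF chart_vspace[OF W]])
    fix z assume "z \<in> vspace (n + n)" "vnorm (n + n) (z - join n (\<theta> s) (\<psi> t)) < r"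
    from r(2)[OF this] obtain x y where xy: "x \<in> U" "y \<in> W" "z = \<Phi> (x, y)" by auto
    have "inv_into (U \<times> W) \<Phi> z = (x, y)" unfolding xy(3) using inj xy by (intro inv_into_f_f) auto
    moreover have "fst_part z = \<theta> x" "snd_part z = \<psi> y"
      unfolding xy(3) \<Phi> using fst_part_join[OF chart_vspace[OF U(1) xy(1)]] snd_part_join by blast+
    ultimately show "\<phi> (inv_into U \<theta> (fst_part z) \<otimes> inv_into W \<psi> (snd_part z)) i
        = \<phi> (case inv_into (U \<times> W) \<Phi> z of (x, y) \<Rightarrow> x \<otimes> y) i"
      using xy chart_inv[OF U(1)] chart_inv[OF W(1)] by simp
  qed
qed

lemma mult_near_one:
  obtains r where "0 < r" "r \<le> r0" "\<And>x y. x \<in> B r \<Longrightarrow> y \<in> B r \<Longrightarrow> x \<otimes> y \<in> B r0"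
proof -
  let ?S = "{z \<in> topspace (prod_topology X X). (\<lambda>(x, y). x \<otimes> y) z \<in> B r0}"
  have opS: "openin (prod_topology X X) ?S"
    by (rule openin_continuous_map_preimage[OF mult_continuous B_open[OF r0 order_refl]])
  have oneS: "(\<one>, \<one>) \<in> ?S" using one_B[OF r0] by (simp add: topspace_G)
  from iffD1[OF openin_prod_topology_alt opS, rule_format, OF oneS]
  obtain O1 O2 where O: "openin X O1" "openin X O2" "\<one> \<in> O1" "\<one> \<in> O2" "O1 \<times> O2 \<subseteq> ?S"
    by (elim exE conjE)
  obtain r1 where r1: "0 < r1" "r1 \<le> r0" "B r1 \<subseteq> O1" by (rule B_base[OF O(1,3)])
  obtain r2 where r2: "0 < r2" "r2 \<le> r0" "B r2 \<subseteq> O2" by (rule B_base[OF O(2,4)])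
  show ?thesis
  proof (rule that[of "min r1 r2"])
    fix x y assume "x \<in> B (min r1 r2)" "y \<in> B (min r1 r2)"
    then have "x \<in> B r1" "y \<in> B r2" by (auto simp: B_def)
    then have "(x, y) \<in> ?S" using O(5) r1 r2 by blast
    then show "x \<otimes> y \<in> B r0" by simp
  qed (use r1 r2 in auto)
qed

text \<open>Hadamard's lemma is applied to the first block of variables and then, for the second
  block, to the coefficients obtained. The laws for multiplication by the identity fix the terms
  that involve one block only as exactly \<open>x\<close> and \<open>y\<close>; every other term
  contains a factor from each block.\<close>

lemma local_law:
  obtains \<rho> L g where "0 < \<rho>" "\<rho> \<le> r0"
    "\<And>x y. x \<in> vspace n \<Longrightarrow> y \<in> vspace n \<Longrightarrow> vnorm n x < \<rho> \<Longrightarrow> vnorm n y < \<rho> \<Longrightarrow> pt x \<otimes> pt y \<in> B r0"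
    "\<And>x y i. x \<in> vspace n \<Longrightarrow> y \<in> vspace n \<Longrightarrow> vnorm n x < \<rho> \<Longrightarrow> vnorm n y < \<rho> \<Longrightarrow> i < n \<Longrightarrow>
       cd (pt x \<otimes> pt y) i = x i + y i + (\<Sum>j<n. x j * (\<Sum>k<n. y k * g i j k (join n x y)))"
    "\<And>i j k. i < n \<Longrightarrow> j < n \<Longrightarrow> k < n \<Longrightarrow> pser (n + n) (g i j k) \<rho> L"
proof -
  let ?a = "\<phi> \<one>"
  have a: "?a \<in> vspace n" by (rule chart_vspace[OF V one_V])
  define F where "F i z = \<phi> (inv_into V \<phi> (fst_part (join n ?a ?a + z)) \<otimes> inv_into V \<phi> (snd_part (join n ?a ?a + z))) i + - ?a i" for i z
  have F: "F i (join n x y) = cd (pt x \<otimes> pt y) i" if "x \<in> vspace n" for i x y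
  proof -
    have "a \<in> vspace n \<Longrightarrow> fst_part (join n a b) = a" for a b by (rule fst_part_join)
    then show ?thesis
      using vspace_add[OF a that] by (simp only: F_def join_add snd_part_join cd_def pt_def) simp
  qed
  obtain r where r: "0 < r" "r \<le> r0" "\<And>x y. x \<in> B r \<Longrightarrow> y \<in> B r \<Longrightarrow> x \<otimes> y \<in> B r0" by (rule mult_near_one) blast
  have "\<exists>\<rho> C. pser (n + n) (F i) \<rho> C" if "i < n" for i
  proof -
    have "lser (n + n) (\<lambda>z. \<phi> (inv_into V \<phi> (fst_part z) \<otimes> inv_into V \<phi> (snd_part z)) i + - ?a i) (join n ?a ?a)"
      by (intro lser_add lser_const mult_lser V one_V that) (simp add: one_V)
    then show ?thesis unfolding lser_def F_def .
  qed
  then obtain \<rho>' C' where pC: "\<And>i. i < n \<Longrightarrow> pser (n + n) (F i) (\<rho>' i) (C' i)" by metis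
  define \<rho> where "\<rho> = Min (insert r (\<rho>' ` {..<n}))"
  define C where "C = Max (insert 0 (C' ` {..<n}))"
  have \<rho>: "0 < \<rho>" "\<rho> \<le> r" "\<And>i. i < n \<Longrightarrow> \<rho> \<le> \<rho>' i" using r(1) pser_pos[OF pC] by (auto simp: \<rho>_def)
  have C: "C' i \<le> C" if "i < n" for i using that by (auto simp: C_def)
  have p: "pser (n + n) (F i) \<rho> C" if "i < n" for i
    by (rule pser_mono[OF pC[OF that] \<rho>(1) \<rho>(3)[OF that] C[OF that]])
  define P1 where "P1 i h \<longleftrightarrow> (\<forall>j\<in>{0..<n}. pser (n + n) (h j) \<rho> (C / \<rho>)) \<and> (\<forall>z\<in>vspace (n + n). vnorm (n + n) z < \<rho> \<longrightarrow>
      F i z = F i (\<lambda>k. if k \<in> {0..<n} then 0 else z k) + (\<Sum>j\<in>{0..<n}. z j * h j z))" for i h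
  have "\<exists>h. P1 i h" if i: "i < n" for i
    using pser_hadamard[OF p[OF i], of 0 n, OF le0 le_add1] unfolding P1_def
    by (elim exE conjE) (intro exI conjI; assumption)
  then obtain g1 where g1: "\<And>i. i < n \<Longrightarrow> P1 i (g1 i)" by metis
  have g1_pser: "pser (n + n) (g1 i j) \<rho> (C / \<rho>)" if "i < n" "j < n" for i j
    using g1[OF that(1)] that(2) unfolding P1_def by simp
  have g1_eq: "F i z = F i (\<lambda>k. if k \<in> {0..<n} then 0 else z k) + (\<Sum>j\<in>{0..<n}. z j * g1 i j z)"
    if "i < n" "z \<in> vspace (n + n)" "vnorm (n + n) z < \<rho>" for i z
    using g1[OF that(1)] that(2,3) unfolding P1_def by blast
  define P2 where "P2 i j h \<longleftrightarrow> (\<forall>k\<in>{n..<n+n}. pser (n + n) (h k) \<rho> (C / \<rho> / \<rho>)) \<and> (\<forall>z\<in>vspace (n + n). vnorm (n + n) z < \<rho> \<longrightarrow>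
      g1 i j z = g1 i j (\<lambda>k. if k \<in> {n..<n+n} then 0 else z k) + (\<Sum>k\<in>{n..<n+n}. z k * h k z))" for i j h
  have "\<exists>h. P2 i j h" if ij: "i < n" "j < n" for i j
    using pser_hadamard[OF g1_pser[OF ij], of n "n + n", OF le_add1 order_refl] unfolding P2_def
    by (elim exE conjE) (intro exI conjI; assumption)
  then obtain g2 where g2: "\<And>i j. i < n \<Longrightarrow> j < n \<Longrightarrow> P2 i j (g2 i j)" by metis
  have g2_pser: "pser (n + n) (g2 i j k) \<rho> (C / \<rho> / \<rho>)" if "i < n" "j < n" "k \<in> {n..<n+n}" for i j k
    using g2[OF that(1,2)] that(3) unfolding P2_def by blast
  have g2_eq: "g1 i j z = g1 i j (\<lambda>k. if k \<in> {n..<n+n} then 0 else z k) + (\<Sum>k\<in>{n..<n+n}. z k * g2 i j k z)"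
    if "i < n" "j < n" "z \<in> vspace (n + n)" "vnorm (n + n) z < \<rho>" for i j z
    using g2[OF that(1,2)] that(3,4) unfolding P2_def by blast
  define g where "g i j k = g2 i j (n + k)" for i j k
  have g: "pser (n + n) (g i j k) \<rho> (C / \<rho> / \<rho>)" if "i < n" "j < n" "k < n" for i j k
    using g2_pser[OF that(1,2), of "n + k"] that(3) by (simp add: g_def)
  show ?thesis
  proof (rule that[OF \<rho>(1) _ _ _ g])
    show "\<rho> \<le> r0" using \<rho> r by simp
    fix x y :: "nat \<Rightarrow> 'p padic" assume x: "x \<in> vspace n" and y: "y \<in> vspace n" and xr: "vnorm n x < \<rho>" and yr: "vnorm n y < \<rho>"
    show "pt x \<otimes> pt y \<in> B r0"
      using x y xr yr \<rho> r by (intro r(3) pt_B) auto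
    fix i assume i: "i < n"
    let ?z = "join n x y"
    have z: "?z \<in> vspace (n + n)" "vnorm (n + n) ?z < \<rho>" using join_vspace[OF y] xr yr by (auto simp: vnorm_join)
    have x0: "join n x 0 \<in> vspace (n + n)" "vnorm (n + n) (join n x 0) < \<rho>" using join_vspace[of 0 n] xr \<rho>(1) by (auto simp: vnorm_join)
    have 1: "(\<lambda>k. if k \<in> {0..<n} then 0 else ?z k) = join n 0 y" by (auto simp: join_def fun_eq_iff)
    have 2: "(\<lambda>k. if k \<in> {0..<n} then 0 else join n x 0 k) = join n 0 0" by (auto simp: join_def fun_eq_iff)
    have 3: "(\<lambda>k. if k \<in> {n..<n+n} then 0 else ?z k) = join n x 0" using y by (auto simp: join_def fun_eq_iff vspace_def)
    have one_pt: "\<one> \<otimes> pt y = pt y" "pt x \<otimes> \<one> = pt x"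
      using pt_ball[OF x] pt_ball[OF y] xr yr \<rho> r V_carrier by auto
    have Fy: "F i (join n 0 y) = y i" using F[of 0 i y] pt_ball(2)[OF y] yr \<rho> r by (simp add: one_pt)
    have Fx: "F i (join n x 0) = x i" using F[OF x, of i 0] pt_ball(2)[OF x] xr \<rho> r by (simp add: one_pt)
    have F0: "F i (join n 0 0) = 0" using F[of 0 i 0] by simp
    have "F i ?z = y i + (\<Sum>j<n. x j * g1 i j ?z)"
      using g1_eq[OF i z] unfolding 1 Fy by (simp add: atLeast0LessThan)
    also have "(\<Sum>j<n. x j * g1 i j ?z) = (\<Sum>j<n. x j * g1 i j (join n x 0)) + (\<Sum>j<n. x j * (\<Sum>k<n. y k * g i j k ?z))"
      unfolding sum.distrib[symmetric]
    proof (rule sum.cong[OF refl])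
      fix j assume "j \<in> {..<n}"
      then have j: "j < n" by simp
      have "(\<Sum>k\<in>{n..<n+n}. ?z k * g2 i j k ?z) = (\<Sum>k<n. y k * g i j k ?z)"
        by (rule sum.reindex_bij_witness[of _ "\<lambda>k. n + k" "\<lambda>k. k - n"]) (auto simp: g_def join_def)
      then have "g1 i j ?z = g1 i j (join n x 0) + (\<Sum>k<n. y k * g i j k ?z)"
        using g2_eq[OF i j z] unfolding 3 by simp
      then show "x j * g1 i j ?z = x j * g1 i j (join n x 0) + x j * (\<Sum>k<n. y k * g i j k ?z)"
        by (simp add: distrib_left)
    qed
    also have "(\<Sum>j<n. x j * g1 i j (join n x 0)) = x i"
      using g1_eq[OF i x0] unfolding 2 Fx F0 by (simp add: atLeast0LessThan)
    finally show "cd (pt x \<otimes> pt y) i = x i + y i + (\<Sum>j<n. x j * (\<Sum>k<n. y k * g i j k ?z))"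
      unfolding F[OF x] by (simp add: add_ac)
  qed
qed

end

section \<open>Left-invariant fields and structure constants\<close>

locale lie_local = lie_chart M G V \<phi> r0
  for M :: "('g, 'p::prime_card) padic_atlas" and G :: "'g monoid" (structure) and V \<phi> r0 +
  fixes \<rho> L :: real and g :: "nat \<Rightarrow> nat \<Rightarrow> nat \<Rightarrow> (nat \<Rightarrow> 'p padic) \<Rightarrow> 'p padic"
  assumes \<rho>: "0 < \<rho>" "\<rho> \<le> r0"
    and law_B: "\<And>x y. x \<in> vspace n \<Longrightarrow> y \<in> vspace n \<Longrightarrow> vnorm n x < \<rho> \<Longrightarrow> vnorm n y < \<rho> \<Longrightarrow> pt x \<otimes> pt y \<in> B r0"
    and law: "\<And>x y i. x \<in> vspace n \<Longrightarrow> y \<in> vspace n \<Longrightarrow> vnorm n x < \<rho> \<Longrightarrow> vnorm n y < \<rho> \<Longrightarrow> i < n \<Longrightarrow>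
       cd (pt x \<otimes> pt y) i = x i + y i + (\<Sum>j<n. x j * (\<Sum>k<n. y k * g i j k (join n x y)))"
    and g_pser: "\<And>i j k. i < n \<Longrightarrow> j < n \<Longrightarrow> k < n \<Longrightarrow> pser (n + n) (g i j k) \<rho> L"
begin

text \<open>The function that \<open>left_invariant_field\<close> hands to a tangent vector when it
  is applied to \<open>kap i\<close> at \<open>s\<close>.\<close>

definition left :: "'g \<Rightarrow> nat \<Rightarrow> 'g \<Rightarrow> 'p padic" where
  "left s i = (\<lambda>t. if t \<in> carrier G then kap i (s \<otimes> t) else 0)"

text \<open>Where \<open>s \<otimes> t\<close> avoids the clopen ball the translate is locally zero;
  elsewhere it is a coordinate of the product with the first factor frozen.\<close>

lemma left_analytic:
  assumes s: "s \<in> carrier G" and i: "i < n"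
  shows "left s i \<in> analytic_functions M"
proof (rule analytic_functionsI)
  show "left s i t = 0" if "t \<notin> topspace X" for t using that by (simp add: left_def topspace_G)
  fix t assume "t \<in> topspace X"
  then have t: "t \<in> carrier G" by (simp add: topspace_G)
  show "ana_at (left s i) t"
  proof (cases "s \<otimes> t \<in> B r0")
    case False
    show ?thesis
    proof (rule ana_at_cong)
      show "ana_at (\<lambda>y. 0) t" by (rule ana_at_const) (use t topspace_G in simp)
      show "openin X {t \<in> carrier G. s \<otimes> t \<in> topspace X - B r0}"
        by (rule left_mult_open[OF B_closed[OF r0 order_refl] s])
      show "t \<in> {t \<in> carrier G. s \<otimes> t \<in> topspace X - B r0}" using t s False by (simp add: topspace_G)
    qed (auto simp: left_def kap_def)
  next
    case True
    then have stV: "s \<otimes> t \<in> V" by (simp add: B_def)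
    obtain U \<theta> where U: "(U, \<theta>) \<in> mfd_charts M" "s \<in> U" using chart_exists s topspace_G by metis
    obtain W \<psi> where W: "(W, \<psi>) \<in> mfd_charts M" "t \<in> W" using chart_exists t topspace_G by metis
    let ?F = "\<lambda>z. \<phi> (inv_into U \<theta> (fst_part z) \<otimes> inv_into W \<psi> (snd_part z)) i"
    have eq: "?F (join n (\<theta> s) v) = \<phi> (s \<otimes> inv_into W \<psi> v) i" for v
      unfolding fst_part_join[OF chart_vspace[OF U]] snd_part_join chart_inv[OF U] ..
    have "lser n (\<lambda>v. ?F (join n (\<theta> s) v)) (\<psi> t)"
    proof (rule lser_compose[where f = ?F and U = "\<lambda>v. join n (\<theta> s) v" and m = "n + n" and r = 1])
      show "lser (n + n) ?F (join n (\<theta> s) (\<psi> t))" by (rule mult_lser[OF U W stV i])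
      show "lser n (\<lambda>v. join n (\<theta> s) v k) (\<psi> t)" if k: "k < n + n" for k
      proof (cases "k < n")
        case True
        then show ?thesis by (simp add: lser_const)
      next
        case False
        then have "k - n < n" using k by simp
        from lser_coord[OF this] show ?thesis using False by (simp add: join_def)
      qed
    qed (use chart_vspace[OF W] in \<open>auto intro: join_vspace\<close>)
    then have "lser n (\<lambda>v. \<phi> (s \<otimes> inv_into W \<psi> v) i) (\<psi> t)" unfolding eq .
    then have an: "ana_at (\<lambda>y. \<phi> (s \<otimes> y) i) t" by (rule ana_atI[OF W])
    show ?thesis
    proof (rule ana_at_cong)
      show "ana_at (\<lambda>y. \<phi> (s \<otimes> y) i + - \<phi> \<one> i) t"
        by (rule ana_at_add[OF an ana_at_const]) (use t topspace_G in simp)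
      show "openin X {t \<in> carrier G. s \<otimes> t \<in> B r0}" by (rule left_mult_open[OF B_open[OF r0 order_refl] s])
      show "t \<in> {t \<in> carrier G. s \<otimes> t \<in> B r0}" using True t by simp
    qed (auto simp: left_def kap_def cd_def)
  qed
qed

text \<open>The left-invariant field with value \<open>partial k\<close> at the identity, applied to
  \<open>kap i\<close>.\<close>

definition dfield :: "nat \<Rightarrow> nat \<Rightarrow> 'g \<Rightarrow> 'p padic" where
  "dfield k i s = (if s \<in> carrier G then pd k (left s i) else 0)"

lemma eventually_unit_vec_in:
  assumes "openin X W" "\<one> \<in> W" "k < n"
  shows "eventually (\<lambda>m. pt (unit_vec (\<pi> ^ m) k) \<in> W) sequentially"
proof -
  obtain r where r: "0 < r" "r \<le> r0" "B r \<subseteq> W" by (rule B_base[OF assms(1,2)])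
  show ?thesis using eventually_uniformizer_power[OF r(1)]
  proof (rule eventually_mono)
    fix m assume "padic_norm ((\<pi> :: 'p padic) ^ m) < r"
    then have "vnorm n (unit_vec (\<pi> ^ m :: 'p padic) k) < r" using unit_vec_vnorm_eq[OF assms(3)] by metis
    from pt_B[OF unit_vec_vspace[OF assms(3)] this r(2)] show "pt (unit_vec (\<pi> ^ m) k) \<in> W" using r(3) by blast
  qed
qed

text \<open>The derivative in the second factor is found without differentiating a series:
  \<open>pser_split\<close> divides the increment in the variable \<open>n + k\<close> and leaves an
  analytic quotient \<open>h\<close>; near a point of the ball, \<open>dfield k i\<close> is
  \<open>h\<close> with second argument zero.\<close>

lemma dfield_analytic:
  assumes k: "k < n" and i: "i < n"
  shows "dfield k i \<in> analytic_functions M"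
proof (rule analytic_functionsI)
  show "dfield k i t = 0" if "t \<notin> topspace X" for t using that by (simp add: dfield_def topspace_G)
  fix s0 assume "s0 \<in> topspace X"
  then have s0: "s0 \<in> carrier G" by (simp add: topspace_G)
  show "ana_at (dfield k i) s0"
  proof (cases "s0 \<in> B r0")
    case False
    show ?thesis
    proof (rule ana_at_cong)
      show "ana_at (\<lambda>y. 0) s0" by (rule ana_at_const) (use s0 topspace_G in simp)
      show "openin X (topspace X - B r0)" by (rule B_closed[OF r0 order_refl])
      show "s0 \<in> topspace X - B r0" using s0 False by (simp add: topspace_G)
      fix s assume s: "s \<in> topspace X - B r0"
      then have sG: "s \<in> carrier G" by (simp add: topspace_G)
      have s1: "left s i \<one> = 0" using s sG by (simp add: left_def kap_def)
      have "pd k (left s i) = 0"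
      proof (rule pd_tendstoI(2))
        have "eventually (\<lambda>m. pt (unit_vec (\<pi> ^ m) k) \<in> {t \<in> carrier G. s \<otimes> t \<in> topspace X - B r0}) sequentially"
          by (rule eventually_unit_vec_in[OF left_mult_open[OF B_closed[OF r0 order_refl] sG] _ k])
            (use s sG in simp)
        then show "eventually (\<lambda>m. left s i (pt (unit_vec (\<pi> ^ m) k)) = left s i \<one> + \<pi> ^ m * 0) sequentially"
          by (rule eventually_mono) (use s1 in \<open>simp add: left_def kap_def\<close>)
      qed simp
      then show "dfield k i s = 0" by (simp add: dfield_def)
    qed
  next
    case True
    then have s0V: "s0 \<otimes> \<one> \<in> V" using s0 by (simp add: B_def)
    have aV: "\<phi> \<one> \<in> vspace n" by (rule chart_vspace[OF V one_V])
    obtain U \<theta> where U: "(U, \<theta>) \<in> mfd_charts M" "s0 \<in> U" using chart_exists s0 topspace_G by metis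
    let ?F = "\<lambda>z. \<phi> (inv_into U \<theta> (fst_part z) \<otimes> inv_into V \<phi> (snd_part z)) i"
    let ?z0 = "join n (\<theta> s0) (\<phi> \<one>)"
    have "lser (n + n) ?F ?z0" by (rule mult_lser[OF U V one_V s0V i])
    then obtain r C where p: "pser (n + n) (\<lambda>z. ?F (?z0 + z)) r C" unfolding lser_def by blast
    have r: "r > 0" using p by (rule pser_pos)
    have nk: "n + k < n + n" using k by simp
    obtain h where h0: "pser (n + n) h r (C / r)" "pser (n + n) (\<lambda>z. ?F (?z0 + z(n + k := 0))) r C"
      "\<And>z. z \<in> vspace (n + n) \<Longrightarrow> vnorm (n + n) z < r \<Longrightarrow> ?F (?z0 + z) = ?F (?z0 + z(n + k := 0)) + z (n + k) * h z"
      by (rule pser_split[OF p nk]) (rule that)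
    note h = h0(1,3)
    define N where "N = {s \<in> U. \<theta> s \<in> {v \<in> vspace n. vnorm n (v - \<theta> s0) < r}} \<inter> B r0"
    have N: "openin X N" "s0 \<in> N"
      unfolding N_def using B_open[OF r0 order_refl] chart_preimage_open[OF U(1) ball_openin_padic_space[OF r]] True U r chart_vspace[OF U(1)]
      by (auto intro: openin_Int)
    have val: "dfield k i s = h (join n (\<theta> s - \<theta> s0) 0)" if s: "s \<in> N" for s
    proof -
      have sU: "s \<in> U" "s \<in> B r0" "vnorm n (\<theta> s - \<theta> s0) < r" using s by (auto simp: N_def)
      have sG: "s \<in> carrier G" using sU(2) V_carrier by (auto simp: B_def)
      let ?w = "\<theta> s - \<theta> s0"
      have w: "?w \<in> vspace n" by (intro vspace_diff chart_vspace[OF U(1)] sU U)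
      have Fs: "?F (?z0 + join n ?w u) = \<phi> (s \<otimes> pt u) i" for u
      proof -
        have e: "?z0 + join n ?w u = join n (\<theta> s) (\<phi> \<one> + u)" by (simp add: join_add)
        show ?thesis
          unfolding e fst_part_join[OF chart_vspace[OF U(1) sU(1)]] snd_part_join chart_inv[OF U(1) sU(1)] pt_def ..
      qed
      have "pd k (left s i) = h (join n ?w 0)"
      proof (rule pd_tendstoI(2))
        have "eventually (\<lambda>m. pt (unit_vec (\<pi> ^ m) k) \<in> {t \<in> carrier G. s \<otimes> t \<in> B r0}) sequentially"
          by (rule eventually_unit_vec_in[OF left_mult_open[OF B_open[OF r0 order_refl] sG] _ k])
            (use sU sG in simp)
        then show "eventually (\<lambda>m. left s i (pt (unit_vec (\<pi> ^ m) k)) = left s i \<one> + \<pi> ^ m * h (join n ?w (unit_vec (\<pi> ^ m) k))) sequentially"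
          using eventually_uniformizer_power[OF r]
        proof eventually_elim
          fix m assume m: "pt (unit_vec (\<pi> ^ m) k) \<in> {t \<in> carrier G. s \<otimes> t \<in> B r0}" "padic_norm ((\<pi> :: 'p padic) ^ m) < r"
          let ?u = "unit_vec (\<pi> ^ m) k :: nat \<Rightarrow> 'p padic"
          have "vnorm n ?u < r" using unit_vec_vnorm_eq[OF k] m(2) by metis
          then have z: "join n ?w ?u \<in> vspace (n + n)" "vnorm (n + n) (join n ?w ?u) < r"
            using join_vspace[OF unit_vec_vspace[OF k]] sU(3) by (auto simp: vnorm_join)
          have e: "(join n ?w ?u)(n + k := 0) = join n ?w 0" by (auto simp: join_def unit_vec_def fun_eq_iff)
          have "\<phi> (s \<otimes> pt ?u) i = \<phi> (s \<otimes> \<one>) i + \<pi> ^ m * h (join n ?w ?u)"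
            using h(2)[OF z] unfolding Fs e by simp
          then show "left s i (pt ?u) = left s i \<one> + \<pi> ^ m * h (join n ?w ?u)"
            using m(1) sU sG by (simp add: left_def kap_def cd_def)
        qed
        show "(\<lambda>m. h (join n ?w (unit_vec (\<pi> ^ m) k))) \<longlonglongrightarrow> h (join n ?w 0)"
        proof (rule pser_tendsto[OF h(1)])
          show "(\<lambda>m. vnorm (n + n) (join n ?w (unit_vec (\<pi> ^ m) k) - join n ?w 0)) \<longlonglongrightarrow> 0"
            using unit_vec_tendsto[OF k] by (simp add: join_diff vnorm_join)
        qed (use sU(3) r unit_vec_vspace[OF k] in \<open>auto simp: vnorm_join intro: join_vspace\<close>)
      qed
      then show ?thesis using sG by (simp add: dfield_def)
    qed
    have "ana_at (\<lambda>s. h (join n (\<theta> s - \<theta> s0) 0)) s0"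
    proof (rule ana_atI[OF U])
      have ls: "lser n (\<lambda>v. h (join n (v - \<theta> s0) 0)) (\<theta> s0)"
      proof (rule lser_compose[where f = h and U = "\<lambda>v. join n (v - \<theta> s0) 0" and m = "n + n" and r = 1])
        show "lser (n + n) h (join n (\<theta> s0 - \<theta> s0) 0)"
          unfolding lser_def using h(1) by (auto simp: join_0)
        show "lser n (\<lambda>v. join n (v - \<theta> s0) 0 j) (\<theta> s0)" if "j < n + n" for j
        proof (cases "j < n")
          case True
          have "lser n (\<lambda>v. v j + - \<theta> s0 j) (\<theta> s0)" by (intro lser_add lser_coord[OF True] lser_const)
          then show ?thesis using True by simp
        next
          case False
          then show ?thesis by (simp add: join_def lser_const)
        qed
      qed (use chart_vspace[OF U] in \<open>auto intro: join_vspace\<close>)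
      obtain q where q: "q > 0" "\<And>v. v \<in> vspace n \<Longrightarrow> vnorm n (v - \<theta> s0) < q \<Longrightarrow> \<exists>y\<in>U \<inter> U. v = \<theta> y"
        using chart_ball[OF U(1) chart_facts(1)[OF U(1)] U(2) U(2)] by blast
      have "h (join n (\<theta> (inv_into U \<theta> v) - \<theta> s0) 0) = h (join n (v - \<theta> s0) 0)"
        if "v \<in> vspace n" "vnorm n (v - \<theta> s0) < q" for v
        using q(2)[OF that] by (auto simp: chart_inv[OF U(1)])
      then show "lser n (\<lambda>v. h (join n (\<theta> (inv_into U \<theta> v) - \<theta> s0) 0)) (\<theta> s0)"
        by (rule lser_cong[OF ls chart_vspace[OF U] q(1)])
    qed
    then show ?thesis by (rule ana_at_cong[OF _ N val])
  qed
qed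

text \<open>Read off from the local law with the second factor on the k-th axis: only the part of
  the product that is linear in this factor survives in the limit.\<close>

lemma pd_left:
  assumes x: "x \<in> vspace n" "vnorm n x < \<rho>" and k: "k < n" and i: "i < n"
  shows "dfield k i (pt x) = (if i = k then 1 else 0) + (\<Sum>j<n. x j * g i j k (join n x 0))"
proof -
  have xV: "pt x \<in> V" "cd (pt x) = x" using pt_ball[OF x(1)] x(2) \<rho> by auto
  have xG: "pt x \<in> carrier G" using xV V_carrier by simp
  have xB: "pt x \<in> B r0" using pt_B[OF x(1), of r0] x(2) \<rho> by simp
  have "pd k (left (pt x) i) = (if i = k then 1 else 0) + (\<Sum>j<n. x j * g i j k (join n x 0))"
  proof (rule pd_tendstoI(2))
    show "eventually (\<lambda>m. left (pt x) i (pt (unit_vec (\<pi> ^ m) k)) = left (pt x) i \<one> +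
        \<pi> ^ m * ((if i = k then 1 else 0) + (\<Sum>j<n. x j * g i j k (join n x (unit_vec (\<pi> ^ m) k))))) sequentially"
      using eventually_uniformizer_power[OF \<rho>(1)]
    proof (rule eventually_mono)
      fix m assume "padic_norm ((\<pi> :: 'p padic) ^ m) < \<rho>"
      then have ur: "vnorm n (unit_vec (\<pi> ^ m :: 'p padic) k) < \<rho>" using unit_vec_vnorm_eq[OF k] by metis
      let ?u = "unit_vec (\<pi> ^ m) k :: nat \<Rightarrow> 'p padic"
      have u: "?u \<in> vspace n" by (rule unit_vec_vspace[OF k])
      have uG: "pt ?u \<in> carrier G" using pt_ball[OF u] ur \<rho> V_carrier by simp
      have "left (pt x) i (pt ?u) = cd (pt x \<otimes> pt ?u) i"
        using uG law_B[OF x(1) u x(2) ur] by (simp add: left_def kap_def)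
      also have "\<dots> = x i + ?u i + \<pi> ^ m * (\<Sum>j<n. x j * g i j k (join n x ?u))"
        unfolding law[OF x(1) u x(2) ur i] sum_unit_vec[OF k] by (simp add: sum_distrib_left mult.left_commute)
      also have "?u i = \<pi> ^ m * (if i = k then 1 else 0)" by (simp add: unit_vec_def)
      finally show "left (pt x) i (pt ?u) = left (pt x) i \<one> +
        \<pi> ^ m * ((if i = k then 1 else 0) + (\<Sum>j<n. x j * g i j k (join n x ?u)))"
        using xB xV(2) xG by (simp add: left_def kap_def distrib_left add.assoc)
    qed
    have gl: "(\<lambda>m. g i j k (join n x (unit_vec (\<pi> ^ m) k))) \<longlonglongrightarrow> g i j k (join n x 0)" if j: "j < n" for j
    proof (rule pser_tendsto[OF g_pser[OF i j k]])
      show "(\<lambda>m. vnorm (n + n) (join n x (unit_vec (\<pi> ^ m) k) - join n x 0)) \<longlonglongrightarrow> 0"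
        using unit_vec_tendsto[OF k] by (simp add: join_diff vnorm_join)
    qed (use x \<rho> unit_vec_vspace[OF k] in \<open>auto simp: vnorm_join intro: join_vspace\<close>)
    show "(\<lambda>m. (if i = k then 1 else 0) + (\<Sum>j<n. x j * g i j k (join n x (unit_vec (\<pi> ^ m) k))))
        \<longlonglongrightarrow> (if i = k then 1 else 0) + (\<Sum>j<n. x j * g i j k (join n x 0))"
      by (intro tendsto_add tendsto_const tendsto_sum tendsto_mult gl) auto
  qed
  then show ?thesis using xG by (simp add: dfield_def)
qed

text \<open>The mixed second derivative at the identity of the i-th coordinate of the group law, in
  the j-th variable of the first and the k-th variable of the second factor.\<close>

definition struct :: "nat \<Rightarrow> nat \<Rightarrow> nat \<Rightarrow> 'p padic" where
  "struct i j k = g i j k 0"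

lemma pd_dfield:
  assumes j: "j < n" and k: "k < n" and i: "i < n"
  shows "pd j (dfield k i) = struct i j k"
proof (rule pd_tendstoI(2))
  have 0: "dfield k i \<one> = (if i = k then 1 else 0)"
    using pd_left[of 0, OF _ _ k i] \<rho> by simp
  show "eventually (\<lambda>m. dfield k i (pt (unit_vec (\<pi> ^ m) j)) = dfield k i \<one> + \<pi> ^ m * g i j k (join n (unit_vec (\<pi> ^ m) j) 0)) sequentially"
    using eventually_uniformizer_power[OF \<rho>(1)]
  proof (rule eventually_mono)
    fix m assume "padic_norm ((\<pi> :: 'p padic) ^ m) < \<rho>"
    then have ur: "vnorm n (unit_vec (\<pi> ^ m :: 'p padic) j) < \<rho>" using unit_vec_vnorm_eq[OF j] by metis
    from pd_left[OF unit_vec_vspace[OF j] this k i]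
    show "dfield k i (pt (unit_vec (\<pi> ^ m) j)) = dfield k i \<one> + \<pi> ^ m * g i j k (join n (unit_vec (\<pi> ^ m) j) 0)"
      by (simp add: 0 sum_unit_vec[OF j])
  qed
  show "(\<lambda>m. g i j k (join n (unit_vec (\<pi> ^ m) j) 0)) \<longlonglongrightarrow> struct i j k"
    unfolding struct_def
  proof (rule pser_tendsto[OF g_pser[OF i j k]])
    show "(\<lambda>m. vnorm (n + n) (join n (unit_vec (\<pi> ^ m :: 'p padic) j) 0 - 0)) \<longlonglongrightarrow> 0"
      using unit_vec_tendsto[OF j] by (simp add: vnorm_join)
  qed (use \<rho> in \<open>auto intro: join_vspace\<close>)
qed

lemma left_invariant_field_kap:
  assumes E: "E \<in> tangent_space M \<one>" and i: "i < n"
  shows "left_invariant_field G E (kap i) = (\<Sum>k<n. (\<lambda>s. E (kap k) * dfield k i s))"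
proof
  fix s
  have sum_app: "sum F I s = (\<Sum>i\<in>I. F i s)" for F :: "nat \<Rightarrow> 'g \<Rightarrow> 'p padic" and I
    by (induction I rule: infinite_finite_induct) auto
  show "left_invariant_field G E (kap i) s = (\<Sum>k<n. (\<lambda>s. E (kap k) * dfield k i s)) s"
  proof (cases "s \<in> carrier G")
    case True
    have "left_invariant_field G E (kap i) s = E (left s i)"
      using True by (simp add: left_invariant_field_def left_def)
    also have "\<dots> = (\<Sum>k<n. E (kap k) * pd k (left s i))" by (rule tangent_eq[OF E left_analytic[OF True i]])
    finally show ?thesis using True by (simp add: sum_app dfield_def)
  next
    case False
    then show ?thesis by (simp add: sum_app dfield_def left_invariant_field_def)
  qed
qed

text \<open>\<open>tangent_eq\<close> is used twice: for \<open>E\<close> on the left translates of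
  \<open>kap i\<close>, and for \<open>D\<close> on the functions \<open>dfield k i\<close> that
  result.\<close>

lemma tangent_left_invariant_field:
  assumes D: "D \<in> tangent_space M \<one>" and E: "E \<in> tangent_space M \<one>" and i: "i < n"
  shows "D (left_invariant_field G E (kap i)) = (\<Sum>j<n. \<Sum>k<n. D (kap j) * E (kap k) * struct i j k)"
proof -
  have "D (left_invariant_field G E (kap i)) = (\<Sum>k<n. E (kap k) * D (dfield k i))"
    unfolding left_invariant_field_kap[OF E i]
    by (subst tangent_sum[OF D]) (auto intro!: sum.cong tangent_cmult[OF D] analytic_functions_cmult dfield_analytic i)
  also have "\<dots> = (\<Sum>k<n. \<Sum>j<n. D (kap j) * E (kap k) * struct i j k)"
  proof (rule sum.cong[OF refl])
    fix k assume "k \<in> {..<n}"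
    then have k: "k < n" by simp
    have "D (dfield k i) = (\<Sum>j<n. D (kap j) * struct i j k)"
      unfolding tangent_eq[OF D dfield_analytic[OF k i]] by (rule sum.cong) (auto simp: pd_dfield k i)
    then show "E (kap k) * D (dfield k i) = (\<Sum>j<n. D (kap j) * E (kap k) * struct i j k)"
      by (simp add: sum_distrib_left mult_ac)
  qed
  finally show ?thesis by (subst sum.swap)
qed

text \<open>The second-order part of the group law with coefficients frozen at the origin, set to
  zero beyond \<open>n\<close> so that its values lie in \<open>vspace n\<close>.\<close>

definition bil :: "(nat \<Rightarrow> 'p padic) \<Rightarrow> (nat \<Rightarrow> 'p padic) \<Rightarrow> nat \<Rightarrow> 'p padic" where
  "bil u v i = (if i < n then \<Sum>j<n. \<Sum>k<n. u j * v k * struct i j k else 0)"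

definition bra :: "(nat \<Rightarrow> 'p padic) \<Rightarrow> (nat \<Rightarrow> 'p padic) \<Rightarrow> nat \<Rightarrow> 'p padic" where
  "bra u v = bil u v - bil v u"

text \<open>Bridge between the two meanings of the bracket: the commutator of left-invariant fields
  is, on coordinate functions, the antisymmetrised second-order part of the group law, which is what
  commutators in the group see.\<close>

lemma lie_bracket_kap:
  assumes D: "D \<in> tangent_space M \<one>" and E: "E \<in> tangent_space M \<one>" and i: "i < n"
  shows "lie_bracket G M D E (kap i) = bra (\<lambda>j. D (kap j)) (\<lambda>j. E (kap j)) i"
  using kap_analytic[OF i] i
  by (simp add: lie_bracket_def tangent_left_invariant_field[OF D E i] tangent_left_invariant_field[OF E D i] bra_def bil_def)

lemma bil_cong: "(\<And>j. j < n \<Longrightarrow> u j = u' j) \<Longrightarrow> (\<And>j. j < n \<Longrightarrow> v j = v' j) \<Longrightarrow> bil u v = bil u' v'"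
  by (auto simp: bil_def fun_eq_iff)

text \<open>Through the values on \<open>kap\<close>, the coefficients \<open>l\<close> define a
  functional on tangent vectors that kills all brackets; so it kills \<open>partial j\<close>, whose
  coordinates form the j-th unit vector. Semisimplicity enters the proof here.\<close>

lemma perfect:
  assumes ss: "semisimple_lie_group G M"
    and l: "\<And>u v. u \<in> vspace n \<Longrightarrow> v \<in> vspace n \<Longrightarrow> (\<Sum>i<n. l i * bra u v i) = 0" and j: "j < n"
  shows "l j = 0"
proof -
  define \<Lambda> :: "(('g \<Rightarrow> 'p padic) \<Rightarrow> 'p padic) \<Rightarrow> 'p padic" where "\<Lambda> D = (\<Sum>i<n. l i * D (kap i))" for D
  have "\<Lambda> (partial j) = 0"
  proof (rule functional_vanishing_on_brackets[where l = \<Lambda>, OF vector_space_functional_smul ss[unfolded semisimple_lie_group_def]])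
    fix D E assume DE: "D \<in> tangent_space M \<one>" "E \<in> tangent_space M \<one>"
    let ?u = "\<lambda>j. if j < n then D (kap j) else 0" and ?v = "\<lambda>j. if j < n then E (kap j) else 0"
    have "bil (\<lambda>j. D (kap j)) (\<lambda>j. E (kap j)) = bil ?u ?v" "bil (\<lambda>j. E (kap j)) (\<lambda>j. D (kap j)) = bil ?v ?u"
      by (rule bil_cong; simp)+
    then have eq: "bra (\<lambda>j. D (kap j)) (\<lambda>j. E (kap j)) = bra ?u ?v" unfolding bra_def by simp
    have "\<Lambda> (lie_bracket G M D E) = (\<Sum>i<n. l i * bra ?u ?v i)"
      unfolding \<Lambda>_def eq[symmetric] by (rule sum.cong) (simp_all add: lie_bracket_kap[OF DE])
    also have "\<dots> = 0" by (rule l) (simp_all add: vspace_def)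
    finally show "\<Lambda> (lie_bracket G M D E) = 0" .
  next
    show "\<Lambda> (D + E) = \<Lambda> D + \<Lambda> E" for D E by (simp add: \<Lambda>_def sum.distrib distrib_left)
    show "\<Lambda> (\<lambda>f. c * D f) = c * \<Lambda> D" for c D by (simp add: \<Lambda>_def sum_distrib_left mult.left_commute)
    show "partial j \<in> tangent_space M \<one>" by (rule partial_tangent[OF j])
  qed
  moreover have "\<Lambda> (partial j) = (\<Sum>i<n. if i = j then l i else 0)"
    unfolding \<Lambda>_def by (rule sum.cong) (auto simp: partial_def kap_analytic pd_kap j)
  ultimately show ?thesis using j by simp
qed

end

section \<open>Convergence in \<open>\<rat>\<^sub>p\<^sup>n\<close>\<close>

text \<open>Completeness with a rate: by the ultrametric inequality the distance of a term to the
  limit obeys the same bound as the single step at this term, with no geometric series to be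
  summed.\<close>

lemma vspace_limit:
  fixes v :: "nat \<Rightarrow> nat \<Rightarrow> 'p::prime_card padic"
  assumes v: "\<And>m. v m \<in> vspace n"
    and step: "\<And>m. vnorm n (v (Suc m) - v m) \<le> R * padic_norm (\<pi> :: 'p padic) ^ m"
  obtains w where "w \<in> vspace n" "\<And>m. vnorm n (w - v m) \<le> R * padic_norm (\<pi> :: 'p padic) ^ m"
proof -
  let ?\<epsilon> = "padic_norm (\<pi> :: 'p padic)"
  have R: "0 \<le> R" using order_trans[OF vnorm_nonneg step[of 0]] by simp
  have tail: "vnorm n (v (m + k) - v m) \<le> R * ?\<epsilon> ^ m" for m k
  proof (induction k)
    case (Suc k)
    have "vnorm n (v (Suc (m + k)) - v (m + k)) \<le> R * ?\<epsilon> ^ m"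
      using R by (intro order_trans[OF step] mult_left_mono power_decreasing) (auto intro: less_imp_le)
    have e: "v (m + Suc k) - v m = (v (Suc (m + k)) - v (m + k)) + (v (m + k) - v m)" by simp
    show ?case unfolding e by (rule vnorm_add_le[OF _ Suc.IH]) fact
  qed (use R in simp)
  have close: "vnorm n (v k - v m) \<le> R * ?\<epsilon> ^ m" if "m \<le> k" for m k
    using tail[of m "k - m"] that by simp
  have "\<exists>l. (\<lambda>m. v m i) \<longlonglongrightarrow> l" if i: "i < n" for i
  proof -
    have "Cauchy (\<lambda>m. v m i)"
      unfolding Cauchy_altdef dist_padic
    proof (intro allI impI)
      fix e :: real assume e: "e > 0"
      obtain M where M: "?\<epsilon> ^ M < e / (R + 1)" using uniformizer_power_small[of "e / (R + 1)"] e R by auto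
      have small: "R * ?\<epsilon> ^ M < e"
      proof -
        have "R * ?\<epsilon> ^ M \<le> (R + 1) * ?\<epsilon> ^ M" by (intro mult_right_mono) auto
        also have "\<dots> < e" using M R by (simp add: field_simps)
        finally show ?thesis .
      qed
      have "padic_norm (v a i - v b i) < e" if "a \<ge> M" "b > a" for a b
      proof -
        have "padic_norm ((v a - v b) i) \<le> vnorm n (v a - v b)" by (rule padic_norm_le_vnorm[OF i])
        also have "\<dots> \<le> R * ?\<epsilon> ^ a" using close[of a b] that by (simp add: vnorm_diff_commute)
        also have "\<dots> \<le> R * ?\<epsilon> ^ M" using that R by (intro mult_left_mono power_decreasing) (auto intro: less_imp_le)
        finally show ?thesis using small by simp
      qed
      then show "\<exists>M. \<forall>a\<ge>M. \<forall>b>a. padic_norm (v a i - v b i) < e" by blast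
    qed
    then show ?thesis by (simp add: Cauchy_convergent_iff convergent_def)
  qed
  then obtain l where l: "\<And>i. i < n \<Longrightarrow> (\<lambda>m. v m i) \<longlonglongrightarrow> l i" by metis
  define w where "w i = (if i < n then l i else 0)" for i
  have "vnorm n (w - v m) \<le> R * ?\<epsilon> ^ m" for m
    unfolding vnorm_le_iff
  proof (intro conjI allI impI)
    show "0 \<le> R * ?\<epsilon> ^ m" using R by simp
    fix i assume i: "i < n"
    have "(\<lambda>k. padic_norm (v k i - l i)) \<longlonglongrightarrow> 0" using l[OF i] by (simp add: tendsto_padic_iff)
    have "(\<lambda>k. padic_norm (v k i - l i) + R * ?\<epsilon> ^ m) \<longlonglongrightarrow> 0 + R * ?\<epsilon> ^ m"
      by (intro tendsto_add tendsto_const) fact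
    moreover have "\<forall>\<^sub>F k in sequentially. padic_norm (l i - v m i) \<le> padic_norm (v k i - l i) + R * ?\<epsilon> ^ m"
      unfolding eventually_sequentially
    proof (intro exI allI impI)
      fix k assume k: "m \<le> k"
      have "padic_norm (v k i - v m i) \<le> R * ?\<epsilon> ^ m"
        using padic_norm_le_vnorm[OF i, of "v k - v m"] close[OF k] by simp
      then show "padic_norm (l i - v m i) \<le> padic_norm (v k i - l i) + R * ?\<epsilon> ^ m"
        using padic_norm_triangle[of "l i - v k i" "v k i - v m i"] by (simp add: padic_norm_diff_commute)
    qed
    ultimately have "padic_norm (l i - v m i) \<le> 0 + R * ?\<epsilon> ^ m"
      by (intro tendsto_lowerbound[where F = sequentially]) auto
    then show "padic_norm ((w - v m) i) \<le> R * ?\<epsilon> ^ m" using i by (simp add: w_def)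
  qed
  moreover have "w \<in> vspace n" by (simp add: w_def vspace_def)
  ultimately show ?thesis using that by blast
qed

lemma vnorm_eq_0_limit:
  fixes x :: "nat \<Rightarrow> 'p::prime_card padic"
  assumes "x \<in> vspace n" "\<And>m. vnorm n x \<le> R * padic_norm (\<pi> :: 'p padic) ^ m"
  shows "x = 0"
proof -
  have "(\<lambda>m. R * padic_norm (\<pi> :: 'p padic) ^ m) \<longlonglongrightarrow> R * 0"
    by (intro tendsto_mult tendsto_const uniformizer_power_null)
  then have "vnorm n x \<le> R * 0" by (rule LIMSEQ_le_const) (use assms(2) in auto)
  then show ?thesis using vnorm_eq_0[OF assms(1)] vnorm_nonneg[of n x] by simp
qed

text \<open>\<open>F\<close> is \<open>\<pi> ^ s\<close> times the identity up to an error smaller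
  by the factor \<open>\<epsilon>\<close>. The iteration \<open>T\<close> uses
  \<open>\<pi> ^ s\<close> in place of the true derivative and still contracts by
  \<open>\<epsilon>\<close>; dividing by \<open>\<pi> ^ s\<close> is why \<open>w\<close> must have
  norm at most \<open>\<epsilon> ^ s * \<tau>\<close>.\<close>

lemma newton_solution:
  fixes F :: "(nat \<Rightarrow> 'p::prime_card padic) \<Rightarrow> nat \<Rightarrow> 'p padic"
  defines "\<epsilon> \<equiv> padic_norm (\<pi> :: 'p padic)"
  assumes F: "\<And>z. z \<in> vspace n \<Longrightarrow> vnorm n z \<le> \<tau> \<Longrightarrow> F z \<in> vspace n" and F0: "F 0 = 0" and \<tau>: "0 \<le> \<tau>"
    and lin: "\<And>z z'. z \<in> vspace n \<Longrightarrow> z' \<in> vspace n \<Longrightarrow> vnorm n z \<le> \<tau> \<Longrightarrow> vnorm n z' \<le> \<tau> \<Longrightarrow>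
      vnorm n (F z - F z' - (\<lambda>i. \<pi> ^ s * (z - z') i)) \<le> \<epsilon> ^ Suc s * vnorm n (z - z')"
    and w: "w \<in> vspace n" "vnorm n w \<le> \<epsilon> ^ s * \<tau>"
  obtains z where "z \<in> vspace n" "vnorm n z \<le> \<tau>" "F z = w"
proof -
  have \<epsilon>: "0 < \<epsilon>" "\<epsilon> < 1" by (auto simp: \<epsilon>_def)
  define T where "T z = z + (\<lambda>i. inverse (\<pi> ^ s) * (w - F z) i)" for z
  define Z where "Z k = (T ^^ k) 0" for k
  have Z_Suc: "Z (Suc k) = T (Z k)" and Z_0: "Z 0 = 0" for k by (simp_all add: Z_def)
  have inv_norm: "padic_norm (inverse (\<pi> ^ s) :: 'p padic) = inverse (\<epsilon> ^ s)"
    by (simp add: padic_norm_inverse padic_norm_power \<epsilon>_def)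
  have T_step: "vnorm n (T z - T z') \<le> \<epsilon> * vnorm n (z - z')"
    if z: "z \<in> vspace n" "z' \<in> vspace n" "vnorm n z \<le> \<tau>" "vnorm n z' \<le> \<tau>" for z z'
  proof -
    have "T z - T z' = (\<lambda>i. - inverse (\<pi> ^ s) * (F z - F z' - (\<lambda>i. \<pi> ^ s * (z - z') i)) i)"
      by (simp add: T_def fun_eq_iff field_simps)
    then have "vnorm n (T z - T z') = inverse (\<epsilon> ^ s) * vnorm n (F z - F z' - (\<lambda>i. \<pi> ^ s * (z - z') i))"
      by (simp only: vnorm_scale padic_norm_minus inv_norm)
    also have "\<dots> \<le> inverse (\<epsilon> ^ s) * (\<epsilon> ^ Suc s * vnorm n (z - z'))"
      using \<epsilon> by (intro mult_left_mono lin z) auto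
    also have "inverse (\<epsilon> ^ s) * (\<epsilon> ^ Suc s * vnorm n (z - z')) = \<epsilon> * vnorm n (z - z')"
      using \<epsilon> by (simp add: field_simps)
    finally show ?thesis .
  qed
  have T0: "vnorm n (T 0) \<le> \<tau>"
  proof -
    have "T 0 = (\<lambda>i. inverse (\<pi> ^ s) * w i)" by (simp add: T_def F0 fun_eq_iff)
    then have "vnorm n (T 0) = inverse (\<epsilon> ^ s) * vnorm n w" by (simp only: vnorm_scale inv_norm)
    also have "\<dots> \<le> inverse (\<epsilon> ^ s) * (\<epsilon> ^ s * \<tau>)" using \<epsilon> w by (intro mult_left_mono) auto
    also have "inverse (\<epsilon> ^ s) * (\<epsilon> ^ s * \<tau>) = \<tau>" using \<epsilon> by (simp add: field_simps)
    finally show ?thesis .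
  qed
  have Z: "Z k \<in> vspace n \<and> vnorm n (Z k) \<le> \<tau>" for k
  proof (induction k)
    case (Suc k)
    have "T (Z k) \<in> vspace n" unfolding T_def using Suc w F by (intro vspace_add vspace_scale vspace_diff) auto
    moreover have "vnorm n (T (Z k) - T 0) \<le> \<epsilon> * vnorm n (Z k - 0)"
      using Suc \<tau> by (intro T_step) auto
    then have "vnorm n (T (Z k) - T 0) \<le> \<tau>"
      using Suc \<epsilon> mult_left_le_one_le[of "vnorm n (Z k)" \<epsilon>] by simp
    from vnorm_add_le[OF this T0] have "vnorm n (T (Z k)) \<le> \<tau>" by simp
    ultimately show ?case by (simp add: Z_Suc)
  qed (use \<tau> in \<open>simp add: Z_0\<close>)
  have step: "vnorm n (Z (Suc k) - Z k) \<le> \<tau> * \<epsilon> ^ k" for k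
  proof (induction k)
    case 0
    then show ?case using T0 by (simp add: Z_Suc Z_0)
  next
    case (Suc k)
    have "vnorm n (Z (Suc (Suc k)) - Z (Suc k)) \<le> \<epsilon> * vnorm n (Z (Suc k) - Z k)"
      using T_step[of "Z (Suc k)" "Z k"] Z[of k] Z[of "Suc k"] unfolding Z_Suc by blast
    also have "\<dots> \<le> \<epsilon> * (\<tau> * \<epsilon> ^ k)" by (rule mult_left_mono[OF Suc.IH]) (use \<epsilon> in simp)
    also have "\<epsilon> * (\<tau> * \<epsilon> ^ k) = \<tau> * \<epsilon> ^ Suc k" by simp
    finally show ?case .
  qed
  obtain z where z: "z \<in> vspace n" "\<And>m. vnorm n (z - Z m) \<le> \<tau> * \<epsilon> ^ m"
    using vspace_limit[of Z n \<tau>] Z step unfolding \<epsilon>_def by metis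
  have z\<tau>: "vnorm n z \<le> \<tau>" using z(2)[of 0] by (simp add: Z_0)
  have "F z - w = 0"
  proof (rule vnorm_eq_0_limit)
    show "F z - w \<in> vspace n" using F z(1) z\<tau> w by (intro vspace_diff) auto
    fix m
    have 1: "vnorm n (F z - F (Z m) - (\<lambda>i. \<pi> ^ s * (z - Z m) i)) \<le> \<tau> * padic_norm (\<pi> :: 'p padic) ^ m"
    proof -
      have "vnorm n (F z - F (Z m) - (\<lambda>i. \<pi> ^ s * (z - Z m) i)) \<le> \<epsilon> ^ Suc s * vnorm n (z - Z m)"
        using Z z z\<tau> by (intro lin) auto
      also have "\<dots> \<le> 1 * (\<tau> * \<epsilon> ^ m)" using \<epsilon> z(2) by (intro mult_mono power_le_one) auto
      finally show ?thesis by (simp add: \<epsilon>_def)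
    qed
    have le: "vnorm n (\<lambda>i. \<pi> ^ s * x i) \<le> vnorm n x" for x :: "nat \<Rightarrow> 'p padic"
    proof -
      have "padic_norm (\<pi> :: 'p padic) ^ s \<le> 1" by (rule power_le_one) (auto intro: less_imp_le)
      from mult_right_mono[OF this, of "vnorm n x"] show ?thesis by (simp add: vnorm_scale padic_norm_power)
    qed
    have 2: "vnorm n (\<lambda>i. \<pi> ^ s * (z - Z m) i) \<le> \<tau> * padic_norm (\<pi> :: 'p padic) ^ m"
      using le[of "z - Z m"] z(2)[of m] by (simp add: \<epsilon>_def)
    \<comment> \<open>By the definition of \<open>T\<close> the defect at \<open>Z m\<close> is, up
      to sign and the factor \<open>\<pi> ^ s\<close>, the next step of the iteration.\<close>
    have "F (Z m) - w = (\<lambda>i. \<pi> ^ s * (Z m - Z (Suc m)) i)"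
      by (simp add: Z_Suc T_def fun_eq_iff flip: mult.assoc)
    then have 3: "vnorm n (F (Z m) - w) \<le> \<tau> * padic_norm (\<pi> :: 'p padic) ^ m"
      using le[of "Z m - Z (Suc m)"] step[of m] by (simp add: \<epsilon>_def vnorm_diff_commute)
    have "F z - w = (F z - F (Z m) - (\<lambda>i. \<pi> ^ s * (z - Z m) i)) + (\<lambda>i. \<pi> ^ s * (z - Z m) i) + (F (Z m) - w)"
      by (simp add: fun_eq_iff)
    then show "vnorm n (F z - w) \<le> \<tau> * padic_norm (\<pi> :: 'p padic) ^ m"
      using vnorm_add_le[OF vnorm_add_le[OF 1 2] 3] by (simp only:)
  qed
  then show ?thesis using that z(1) z\<tau> by simp
qed

text \<open>Otherwise \<open>x = (x + y) - y\<close> would have norm smaller than its own. The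
  isometry statements for translations and inverses come from this.\<close>

lemma vnorm_add_eq:
  assumes "vnorm n y \<le> c * vnorm n x" "c < 1"
  shows "vnorm n (x + y) = vnorm n x"
proof (rule antisym)
  have "c * vnorm n x \<le> 1 * vnorm n x" using assms by (intro mult_right_mono) auto
  then have y: "vnorm n y \<le> vnorm n x" using assms by simp
  then show "vnorm n (x + y) \<le> vnorm n x" by (intro vnorm_add_le) auto
  show "vnorm n x \<le> vnorm n (x + y)"
  proof (rule ccontr)
    assume a: "\<not> ?thesis"
    then have "vnorm n x > 0" using vnorm_nonneg[of n "x + y"] by linarith
    then have "vnorm n y < vnorm n x" using assms by (smt (verit) mult_less_cancel_right2)
    moreover have "vnorm n (x + y) < vnorm n x" using a by simp
    ultimately show False using vnorm_add_less[of n "x + y" "vnorm n x" "- y"] by simp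
  qed
qed


section \<open>Groups with an analytic coordinate system on the unit ball\<close>

text \<open>
  The product is \<open>u + v + q\<close> in the coordinates \<open>Y\<close>, where \<open>q\<close> is divisible by \<open>p\<^sup>2\<close> and agrees with the
  bilinear form \<open>b\<close> up to terms of order three. These Lipschitz estimates are all that is used of
  analyticity.
\<close>

locale std_group = group G for G :: "'g monoid" (structure) +
  fixes n :: nat and H :: "'g set" and Y :: "'g \<Rightarrow> nat \<Rightarrow> 'p::prime_card padic"
    and b :: "(nat \<Rightarrow> 'p padic) \<Rightarrow> (nat \<Rightarrow> 'p padic) \<Rightarrow> nat \<Rightarrow> 'p padic" and \<epsilon> :: real
    and N :: "(nat \<Rightarrow> 'p padic) \<Rightarrow> real" and q :: "'g \<Rightarrow> 'g \<Rightarrow> nat \<Rightarrow> 'p padic"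
  defines "\<epsilon> \<equiv> padic_norm (\<pi> :: 'p padic)" and "N \<equiv> vnorm n" and "q \<equiv> \<lambda>g h. Y (g \<otimes> h) - Y g - Y h"
  assumes H: "subgroup H G"
    and Y_bij: "bij_betw Y H {v \<in> vspace n. vnorm n v \<le> 1}" and Y_one: "Y \<one> = 0"
    and q_lipschitz: "\<And>g g' h h'. g \<in> H \<Longrightarrow> g' \<in> H \<Longrightarrow> h \<in> H \<Longrightarrow> h' \<in> H \<Longrightarrow>
      N (q g h - q g' h') \<le> \<epsilon>\<^sup>2 * max (N (Y g - Y g') * max (N (Y h)) (N (Y h'))) (max (N (Y g)) (N (Y g')) * N (Y h - Y h'))"
    and b_add: "\<And>u v w. b (u + v) w = b u w + b v w" "\<And>u v w. b u (v + w) = b u v + b u w"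
    and b_scale: "\<And>c u v. b (\<lambda>i. c * u i) v = (\<lambda>i. c * b u v i)" "\<And>c u v. b u (\<lambda>i. c * v i) = (\<lambda>i. c * b u v i)"
    and b_norm: "\<And>u v. N (b u v) \<le> N u * N v"
    and q_right: "\<And>g h h'. g \<in> H \<Longrightarrow> h \<in> H \<Longrightarrow> h' \<in> H \<Longrightarrow>
      N (q g h - b (Y g) (Y h) - (q g h' - b (Y g) (Y h'))) \<le> N (Y g) * max (N (Y g)) (max (N (Y h)) (N (Y h'))) * N (Y h - Y h')"
    and q_left: "\<And>g h h'. g \<in> H \<Longrightarrow> h \<in> H \<Longrightarrow> h' \<in> H \<Longrightarrow>
      N (q h g - b (Y h) (Y g) - (q h' g - b (Y h') (Y g))) \<le> N (Y g) * max (N (Y g)) (max (N (Y h)) (N (Y h'))) * N (Y h - Y h')"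
begin

lemma eps: "0 < \<epsilon>" "\<epsilon> < 1" "\<epsilon>\<^sup>2 < 1" "\<epsilon>\<^sup>2 \<le> \<epsilon>"
proof -
  show *: "0 < \<epsilon>" "\<epsilon> < 1" by (auto simp: \<epsilon>_def)
  then show "\<epsilon>\<^sup>2 < 1" "\<epsilon>\<^sup>2 \<le> \<epsilon>" by (auto simp: power2_eq_square mult_less_cancel_left2 intro: mult_strict_mono[of \<epsilon> 1 \<epsilon> 1, simplified])
qed

lemma H_carrier [simp]: "g \<in> H \<Longrightarrow> g \<in> carrier G"
  using H by (rule subgroup.mem_carrier)

lemma H_one [simp]: "\<one> \<in> H" using H by (rule subgroup.one_closed)
lemma H_mult [simp]: "g \<in> H \<Longrightarrow> h \<in> H \<Longrightarrow> g \<otimes> h \<in> H" using H by (rule subgroup.m_closed)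
lemma H_inv [simp]: "g \<in> H \<Longrightarrow> inv g \<in> H" using H by (rule subgroup.m_inv_closed)
lemma H_pow [simp]: "g \<in> H \<Longrightarrow> g [^] (m :: nat) \<in> H" by (induction m) auto

lemma Y_vspace [simp]: "g \<in> H \<Longrightarrow> Y g \<in> vspace n" and Y_le_1 [simp]: "g \<in> H \<Longrightarrow> N (Y g) \<le> 1"
  using Y_bij by (auto simp: bij_betw_def N_def)

lemma Y_inj: "g \<in> H \<Longrightarrow> h \<in> H \<Longrightarrow> Y g = Y h \<Longrightarrow> g = h"
  using Y_bij by (auto simp: bij_betw_def dest: inj_onD)

lemma Y_surj:
  assumes "v \<in> vspace n" "N v \<le> 1"
  obtains g where "g \<in> H" "Y g = v"
proof -
  have "v \<in> Y ` H" using assms Y_bij by (simp add: bij_betw_def N_def)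
  then show ?thesis using that by blast
qed

lemma N_simps [simp]: "N 0 = 0" "0 \<le> N x" "N (- x) = N x" "N (0 - x) = N x"
  by (simp_all add: N_def)

lemma N_add: "N x \<le> r \<Longrightarrow> N y \<le> r \<Longrightarrow> N (x + y) \<le> r" and N_diff: "N x \<le> r \<Longrightarrow> N y \<le> r \<Longrightarrow> N (x - y) \<le> r"
  unfolding N_def by (rule vnorm_add_le vnorm_diff_le; assumption)+

lemma N_commute: "N (x - y) = N (y - x)" unfolding N_def by (rule vnorm_diff_commute)

lemma Y_mult: "Y (g \<otimes> h) = Y g + Y h + q g h" by (simp add: q_def)

lemma q_one: "g \<in> H \<Longrightarrow> q g \<one> = 0" "g \<in> H \<Longrightarrow> q \<one> g = 0" by (simp_all add: q_def Y_one)

lemma q_norm: "g \<in> H \<Longrightarrow> h \<in> H \<Longrightarrow> N (q g h) \<le> \<epsilon>\<^sup>2 * (N (Y g) * N (Y h))"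
  using q_lipschitz[of g g h \<one>] by (simp add: q_one Y_one)

text \<open>With one factor fixed, \<open>q\<close> is Lipschitz with constant at most
  \<open>\<epsilon>\<^sup>2 < 1\<close>, so it cannot change the norm of
  \<open>Y h - Y h'\<close>.\<close>

lemma isometry_left:
  assumes "g \<in> H" "h \<in> H" "h' \<in> H"
  shows "N (Y (g \<otimes> h) - Y (g \<otimes> h')) = N (Y h - Y h')"
proof -
  have "N (q g h - q g h') \<le> \<epsilon>\<^sup>2 * (N (Y g) * N (Y h - Y h'))"
    using q_lipschitz[of g g h h'] assms by simp
  also have "\<dots> \<le> \<epsilon>\<^sup>2 * (1 * N (Y h - Y h'))" using assms by (intro mult_left_mono mult_right_mono) auto
  finally have "N ((Y h - Y h') + (q g h - q g h')) = N (Y h - Y h')"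
    unfolding N_def using eps(3) by (intro vnorm_add_eq) auto
  then show ?thesis by (simp add: Y_mult algebra_simps)
qed

lemma isometry_right:
  assumes "g \<in> H" "h \<in> H" "h' \<in> H"
  shows "N (Y (h \<otimes> g) - Y (h' \<otimes> g)) = N (Y h - Y h')"
proof -
  have "N (q h g - q h' g) \<le> \<epsilon>\<^sup>2 * (N (Y h - Y h') * N (Y g))"
    using q_lipschitz[of h h' g g] assms by simp
  also have "\<dots> \<le> \<epsilon>\<^sup>2 * (N (Y h - Y h') * 1)" using assms by (intro mult_left_mono) auto
  finally have "N ((Y h - Y h') + (q h g - q h' g)) = N (Y h - Y h')"
    unfolding N_def using eps(3) by (intro vnorm_add_eq) auto
  then show ?thesis by (simp add: Y_mult algebra_simps)
qed

lemma N_inv_mult: "g \<in> H \<Longrightarrow> h \<in> H \<Longrightarrow> N (Y (inv h \<otimes> g)) = N (Y g - Y h)"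
  using isometry_left[of "inv h" g h] by (simp add: Y_one)

lemma N_mult_inv: "g \<in> H \<Longrightarrow> h \<in> H \<Longrightarrow> N (Y (g \<otimes> inv h)) = N (Y g - Y h)"
  using isometry_right[of "inv h" g h] by (simp add: Y_one)

text \<open>For \<open>r = \<epsilon> ^ j\<close> these balls play the part of congruence subgroups;
  as translations are isometries, they are closed under products.\<close>

definition lev :: "real \<Rightarrow> 'g set" where "lev r = {g \<in> H. N (Y g) \<le> r}"

lemma lev_mult: "g \<in> lev r \<Longrightarrow> h \<in> lev r \<Longrightarrow> g \<otimes> h \<in> lev r"
proof -
  assume a: "g \<in> lev r" "h \<in> lev r"
  have "N (Y (g \<otimes> h) - Y (g \<otimes> \<one>)) \<le> r" using isometry_left[of g h \<one>] a by (simp add: lev_def Y_one)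
  then have "N (Y (g \<otimes> h) - Y g + Y g) \<le> r" using a by (intro N_add) (auto simp: lev_def)
  then show ?thesis using a by (simp add: lev_def)
qed

lemma lev_one: "0 \<le> r \<Longrightarrow> \<one> \<in> lev r" by (simp add: lev_def Y_one)

lemma lev_pow: "g \<in> lev r \<Longrightarrow> g [^] (m :: nat) \<in> lev r"
proof (induction m)
  case 0
  have "0 \<le> r" using 0 order_trans[OF N_simps(2)] by (auto simp: lev_def)
  then show ?case by (simp add: lev_one)
qed (auto intro: lev_mult)

text \<open>Written as the quotient of \<open>x \<otimes> y\<close> by \<open>y \<otimes> x\<close>,
  so that by \<open>N_mult_inv\<close> its size is the distance between the two products.\<close>

definition comm :: "'g \<Rightarrow> 'g \<Rightarrow> 'g" where "comm x y = x \<otimes> y \<otimes> inv (y \<otimes> x)"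

lemma comm_H [simp]: "x \<in> H \<Longrightarrow> y \<in> H \<Longrightarrow> comm x y \<in> H" by (simp add: comm_def)

lemma comm_mult: "x \<in> H \<Longrightarrow> y \<in> H \<Longrightarrow> comm x y \<otimes> (y \<otimes> x) = x \<otimes> y"
  by (simp add: comm_def m_assoc)

lemma comm_norm:
  assumes "x \<in> H" "y \<in> H"
  shows "N (Y (comm x y)) \<le> \<epsilon>\<^sup>2 * (N (Y x) * N (Y y))"
proof -
  have "N (Y (comm x y)) = N (Y (x \<otimes> y) - Y (y \<otimes> x))" unfolding comm_def using assms by (simp add: N_mult_inv)
  also have "Y (x \<otimes> y) - Y (y \<otimes> x) = q x y - q y x" by (simp add: Y_mult)
  also have "N \<dots> \<le> \<epsilon>\<^sup>2 * (N (Y x) * N (Y y))"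
    using q_norm[OF assms] q_norm[OF assms(2,1)] by (intro N_diff) (auto simp: mult.commute)
  finally show ?thesis .
qed

definition br :: "(nat \<Rightarrow> 'p padic) \<Rightarrow> (nat \<Rightarrow> 'p padic) \<Rightarrow> nat \<Rightarrow> 'p padic" where
  "br u v = b u v - b v u"

lemma br_scale: "br (\<lambda>i. c * u i) v = (\<lambda>i. c * br u v i)" "br u (\<lambda>i. c * v i) = (\<lambda>i. c * br u v i)"
  by (simp_all add: br_def b_scale fun_eq_iff right_diff_distrib)

lemma b_minus: "b (- u) v = - b u v" "b u (- v) = - b u v"
  using b_scale(1)[of "- 1" u v] b_scale(2)[of u "- 1" v] by (simp_all add: fun_Compl_def fun_eq_iff)

lemma b_diff: "b (u - v) w = b u w - b v w" "b u (v - w) = b u v - b u w"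
  using b_add(1)[of u "- v" w] b_add(2)[of u v "- w"] by (simp_all add: b_minus)

lemma br_diff: "br (u - v) w = br u w - br v w" "br u (v - w) = br u v - br u w"
  by (simp_all add: br_def b_diff)

lemma br_norm: "N (br u v) \<le> N u * N v"
  unfolding br_def using b_norm[of u v] b_norm[of v u] by (intro N_diff) (auto simp: mult.commute)

text \<open>For \<open>z = comm x y\<close>, the identity
  \<open>z \<otimes> (y \<otimes> x) = x \<otimes> y\<close> gives
  \<open>Y z = q x y - q y x - q z (y \<otimes> x)\<close>. The first two terms vary like the
  bracket up to third order, and the last has the already quadratic \<open>z\<close> as an argument.
  The second estimate is needed to control that last term.\<close>

lemma comm_estimate:
  assumes x: "x \<in> H" and y: "y \<in> H" and y': "y' \<in> H"
    and \<mu>: "N (Y x) \<le> \<mu>" "N (Y y) \<le> \<mu>" "N (Y y') \<le> \<mu>" "\<mu> \<le> 1"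
  shows "N (Y (comm x y) - Y (comm x y') - br (Y x) (Y y - Y y')) \<le> N (Y x) * \<mu> * N (Y y - Y y')"
    and "N (Y (comm x y) - Y (comm x y')) \<le> N (Y x) * N (Y y - Y y')"
proof -
  define z z' w w' where "z = comm x y" and "z' = comm x y'" and "w = y \<otimes> x" and "w' = y' \<otimes> x"
  have mem: "z \<in> H" "z' \<in> H" "w \<in> H" "w' \<in> H" using x y y' by (auto simp: z_def z'_def w_def w'_def)
  define A where "A = (q x y - q y x) - (q x y' - q y' x)"
  define R where "R = q z w - q z' w'"
  define d where "d = N (Y y - Y y')"
  define E where "E = N (Y z - Y z')"
  define K where "K = N (Y x)"
  have nn: "0 \<le> d" "0 \<le> E" "0 \<le> K" "K \<le> 1" "0 \<le> \<mu>" using x \<mu>(1) order_trans[OF N_simps(2) \<mu>(1)] by (auto simp: d_def E_def K_def)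
  have eq: "Y z = q x y - q y x - q z w" if "z = comm x y" "w = y \<otimes> x" "x \<in> H" "y \<in> H" for x y z w
  proof -
    have "Y (z \<otimes> w) = Y (x \<otimes> y)" using that comm_mult by simp
    then show ?thesis unfolding Y_mult that(2) by (simp add: algebra_simps)
  qed
  have zz': "Y z - Y z' = A - R"
    unfolding eq[OF z_def w_def x y] eq[OF z'_def w'_def x y'] A_def R_def by simp
  have w_norm: "N (Y w) \<le> \<mu>" "N (Y w') \<le> \<mu>"
  proof -
    have "y \<in> lev \<mu>" "y' \<in> lev \<mu>" "x \<in> lev \<mu>" using x y y' \<mu> by (auto simp: lev_def)
    then have "w \<in> lev \<mu>" "w' \<in> lev \<mu>" unfolding w_def w'_def by (auto intro: lev_mult)
    then show "N (Y w) \<le> \<mu>" "N (Y w') \<le> \<mu>" by (auto simp: lev_def)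
  qed
  have ww': "N (Y w - Y w') = d" unfolding w_def w'_def d_def by (rule isometry_right[OF x y y'])
  have e1: "\<epsilon>\<^sup>2 * t \<le> t" if "0 \<le> t" for t
    using mult_right_mono[of "\<epsilon>\<^sup>2" 1 t] eps(3) that by simp
  have z_norm: "N (Y z) \<le> K * \<mu>" "N (Y z') \<le> K * \<mu>"
  proof -
    have *: "N (Y (comm x u)) \<le> K * \<mu>" if "u \<in> H" "N (Y u) \<le> \<mu>" for u
    proof -
      have "N (Y (comm x u)) \<le> \<epsilon>\<^sup>2 * (N (Y x) * N (Y u))" by (rule comm_norm[OF x that(1)])
      also have "\<dots> \<le> N (Y x) * N (Y u)" by (rule e1) simp
      also have "\<dots> \<le> K * \<mu>" unfolding K_def using that by (intro mult_left_mono) auto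
      finally show ?thesis .
    qed
    show "N (Y z) \<le> K * \<mu>" "N (Y z') \<le> K * \<mu>" unfolding z_def z'_def using * y y' \<mu> by auto
  qed
  have A_norm: "N A \<le> \<epsilon>\<^sup>2 * (K * d)"
  proof -
    have "N (q x y - q x y') \<le> \<epsilon>\<^sup>2 * (K * d)" "N (q y x - q y' x) \<le> \<epsilon>\<^sup>2 * (d * K)"
      using q_lipschitz[of x x y y'] q_lipschitz[of y y' x x] x y y' by (auto simp: K_def d_def)
    from N_diff[OF this(1) this(2)[unfolded mult.commute[of d]]] show ?thesis by (simp add: A_def algebra_simps)
  qed
  have A_br: "N (A - br (Y x) (Y y - Y y')) \<le> K * \<mu> * d"
  proof -
    have "K * max K (max (N (Y y)) (N (Y y'))) * d \<le> K * \<mu> * d"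
      using nn \<mu> by (intro mult_right_mono mult_left_mono) (auto simp: K_def)
    then have "N (q x y - b (Y x) (Y y) - (q x y' - b (Y x) (Y y'))) \<le> K * \<mu> * d"
      "N (q y x - b (Y y) (Y x) - (q y' x - b (Y y') (Y x))) \<le> K * \<mu> * d"
      using q_right[OF x y y'] q_left[OF x y y'] by (auto simp: K_def d_def)
    from N_diff[OF this] show ?thesis by (simp add: A_def br_def b_diff algebra_simps)
  qed
  have R_norm: "N R \<le> \<epsilon>\<^sup>2 * max (E * \<mu>) (K * \<mu> * d)"
  proof -
    have "max (E * max (N (Y w)) (N (Y w'))) (max (N (Y z)) (N (Y z')) * d) \<le> max (E * \<mu>) (K * \<mu> * d)"
      using nn w_norm z_norm by (intro max.mono mult_left_mono mult_right_mono) auto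
    then have "\<epsilon>\<^sup>2 * max (E * max (N (Y w)) (N (Y w'))) (max (N (Y z)) (N (Y z')) * d) \<le> \<epsilon>\<^sup>2 * max (E * \<mu>) (K * \<mu> * d)"
      by (intro mult_left_mono) auto
    then show ?thesis using q_lipschitz[OF mem(1,2,3,4)] by (simp add: R_def E_def ww')
  qed
  \<comment> \<open>Bootstrap: \<open>R\<close> is bounded through \<open>E\<close> itself, but with
    the factor \<open>\<epsilon>\<^sup>2 < 1\<close>; so \<open>E > K * d\<close> would force
    \<open>E\<close> to be at most \<open>\<epsilon>\<^sup>2 * E\<close>.\<close>
  have E_le: "E \<le> K * d"
  proof (rule ccontr)
    assume a: "\<not> E \<le> K * d"
    have "E * \<mu> \<le> E" "K * \<mu> * d \<le> E"
    proof -
      show "E * \<mu> \<le> E" using mult_left_mono[OF \<mu>(4) nn(2)] by simp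
      have "K * \<mu> * d \<le> K * 1 * d" using nn \<mu> by (intro mult_right_mono mult_left_mono) auto
      then show "K * \<mu> * d \<le> E" using a by simp
    qed
    then have "N R \<le> \<epsilon>\<^sup>2 * E" using R_norm by (intro order_trans[OF R_norm] mult_left_mono) auto
    moreover have "N A \<le> \<epsilon>\<^sup>2 * E" using a by (intro order_trans[OF A_norm] mult_left_mono) auto
    ultimately have "E \<le> \<epsilon>\<^sup>2 * E" unfolding E_def zz' by (intro N_diff)
    then have "E \<le> 0" using eps(3) nn(2) by (smt (verit) mult_less_cancel_right2)
    moreover have "0 \<le> K * d" using nn by simp
    ultimately show False using a by linarith
  qed
  then show "N (Y (comm x y) - Y (comm x y')) \<le> N (Y x) * N (Y y - Y y')"
    by (simp add: E_def K_def d_def z_def z'_def)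
  have "N R \<le> K * \<mu> * d"
  proof -
    have "E * \<mu> \<le> K * \<mu> * d" using mult_right_mono[OF E_le nn(5)] by (simp add: mult_ac)
    then have "max (E * \<mu>) (K * \<mu> * d) \<le> K * \<mu> * d" by simp
    moreover have "0 \<le> max (E * \<mu>) (K * \<mu> * d)" using nn by (simp add: le_max_iff_disj)
    ultimately show ?thesis using R_norm e1[of "max (E * \<mu>) (K * \<mu> * d)"] by linarith
  qed
  from N_diff[OF A_br this] have "N ((A - R) - br (Y x) (Y y - Y y')) \<le> K * \<mu> * d" by (simp add: algebra_simps)
  then show "N (Y (comm x y) - Y (comm x y') - br (Y x) (Y y - Y y')) \<le> N (Y x) * \<mu> * N (Y y - Y y')"
    unfolding zz'[symmetric] by (simp add: z_def z'_def K_def d_def)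
qed

section \<open>Products and powers in coordinates\<close>

primrec gprod :: "(nat \<Rightarrow> 'g) \<Rightarrow> nat \<Rightarrow> 'g" where
  "gprod z 0 = \<one>" | "gprod z (Suc k) = gprod z k \<otimes> z k"

lemma gprod_mem: "subgroup K G \<Longrightarrow> (\<And>l. l < k \<Longrightarrow> z l \<in> K) \<Longrightarrow> gprod z k \<in> K"
  by (induction k) (auto simp: subgroup.one_closed subgroup.m_closed)

lemma gprod_lev: "0 \<le> r \<Longrightarrow> (\<And>l. l < k \<Longrightarrow> z l \<in> lev r) \<Longrightarrow> gprod z k \<in> lev r"
  by (induction k) (auto intro: lev_mult lev_one)

text \<open>One more factor adds its coordinates and a value of \<open>q\<close>. The variation of
  that value is at most \<open>\<epsilon>\<^sup>2 * (\<eta> * \<zeta>)\<close>, and ultrametric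
  addition keeps this bound for any number of factors.\<close>

lemma gprod_estimate:
  assumes z: "\<And>l. l < k \<Longrightarrow> z l \<in> lev \<eta>" "\<And>l. l < k \<Longrightarrow> z' l \<in> lev \<eta>"
    and \<zeta>: "\<And>l. l < k \<Longrightarrow> N (Y (z l) - Y (z' l)) \<le> \<zeta>" and pos: "0 \<le> \<eta>" "\<eta> \<le> 1" "0 \<le> \<zeta>"
  shows "N (Y (gprod z k) - Y (gprod z' k) - (\<Sum>l<k. Y (z l) - Y (z' l))) \<le> \<epsilon>\<^sup>2 * (\<eta> * \<zeta>)"
    and "N (Y (gprod z k) - Y (gprod z' k)) \<le> \<zeta>"
proof -
  have "N (Y (gprod z k) - Y (gprod z' k) - (\<Sum>l<k. Y (z l) - Y (z' l))) \<le> \<epsilon>\<^sup>2 * (\<eta> * \<zeta>) \<and>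
    N (Y (gprod z k) - Y (gprod z' k)) \<le> \<zeta>"
    using z \<zeta>
  proof (induction k)
    case (Suc k)
    have IH: "N (Y (gprod z k) - Y (gprod z' k) - (\<Sum>l<k. Y (z l) - Y (z' l))) \<le> \<epsilon>\<^sup>2 * (\<eta> * \<zeta>)"
      "N (Y (gprod z k) - Y (gprod z' k)) \<le> \<zeta>"
      using Suc.IH[OF Suc.prems(1) Suc.prems(2) Suc.prems(3)] by (simp_all only: less_Suc_eq simp_thms)
    have lev: "gprod z k \<in> lev \<eta>" "gprod z' k \<in> lev \<eta>" "z k \<in> lev \<eta>" "z' k \<in> lev \<eta>"
      using Suc.prems pos by (auto intro!: gprod_lev)
    then have mem: "gprod z k \<in> H" "gprod z' k \<in> H" "z k \<in> H" "z' k \<in> H"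
      and le: "N (Y (gprod z k)) \<le> \<eta>" "N (Y (gprod z' k)) \<le> \<eta>" "N (Y (z k)) \<le> \<eta>" "N (Y (z' k)) \<le> \<eta>"
      by (auto simp: lev_def)
    define Q where "Q = q (gprod z k) (z k) - q (gprod z' k) (z' k)"
    have "max (N (Y (gprod z k) - Y (gprod z' k)) * max (N (Y (z k))) (N (Y (z' k))))
        (max (N (Y (gprod z k))) (N (Y (gprod z' k))) * N (Y (z k) - Y (z' k))) \<le> max (\<zeta> * \<eta>) (\<eta> * \<zeta>)"
    proof -
      have nn: "0 \<le> max (N u) (N v)" for u v using N_simps(2)[of u] by (simp add: le_max_iff_disj)
      have mx: "max (N (Y (z k))) (N (Y (z' k))) \<le> \<eta>" "max (N (Y (gprod z k))) (N (Y (gprod z' k))) \<le> \<eta>"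
        using le by auto
      show ?thesis
        by (rule max.mono[OF mult_mono[OF IH(2) mx(1) pos(3) nn] mult_mono[OF mx(2) Suc.prems(3)[OF lessI] pos(1) N_simps(2)]])
    qed
    then have "\<epsilon>\<^sup>2 * max (N (Y (gprod z k) - Y (gprod z' k)) * max (N (Y (z k))) (N (Y (z' k))))
        (max (N (Y (gprod z k))) (N (Y (gprod z' k))) * N (Y (z k) - Y (z' k))) \<le> \<epsilon>\<^sup>2 * (\<eta> * \<zeta>)"
      by (intro mult_left_mono) (auto simp: mult.commute)
    then have Q: "N Q \<le> \<epsilon>\<^sup>2 * (\<eta> * \<zeta>)" using q_lipschitz[OF mem] unfolding Q_def by linarith
    have "N (Y (gprod z (Suc k)) - Y (gprod z' (Suc k)) - (\<Sum>l<Suc k. Y (z l) - Y (z' l)))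
        = N ((Y (gprod z k) - Y (gprod z' k) - (\<Sum>l<k. Y (z l) - Y (z' l))) + Q)"
      by (simp add: Y_mult Q_def algebra_simps)
    also have "\<dots> \<le> \<epsilon>\<^sup>2 * (\<eta> * \<zeta>)" by (rule N_add[OF IH(1) Q])
    finally have 1: "N (Y (gprod z (Suc k)) - Y (gprod z' (Suc k)) - (\<Sum>l<Suc k. Y (z l) - Y (z' l))) \<le> \<epsilon>\<^sup>2 * (\<eta> * \<zeta>)" .
    have "\<epsilon>\<^sup>2 * (\<eta> * \<zeta>) \<le> 1 * (1 * \<zeta>)" using eps(3) pos by (intro mult_mono) auto
    then have "N Q \<le> \<zeta>" using Q by simp
    then have "N ((Y (gprod z k) - Y (gprod z' k)) + (Y (z k) - Y (z' k)) + Q) \<le> \<zeta>"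
      by (rule N_add[OF N_add[OF IH(2) Suc.prems(3)[OF lessI]]])
    then have "N (Y (gprod z (Suc k)) - Y (gprod z' (Suc k))) \<le> \<zeta>"
      by (simp add: Y_mult Q_def algebra_simps)
    with 1 show ?case by blast
  qed (use pos in auto)
  then show "N (Y (gprod z k) - Y (gprod z' k) - (\<Sum>l<k. Y (z l) - Y (z' l))) \<le> \<epsilon>\<^sup>2 * (\<eta> * \<zeta>)"
    "N (Y (gprod z k) - Y (gprod z' k)) \<le> \<zeta>" by blast+
qed

text \<open>Each further factor \<open>g\<close> contributes a term \<open>q\<close> of norm at most
  \<open>\<epsilon>\<^sup>2 * (N (Y g))\<^sup>2\<close>; by the ultrametric inequality the errors do
  not accumulate with the exponent.\<close>

lemma pow_estimate:
  assumes g: "g \<in> H"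
  shows "N (Y (g [^] m) - (\<lambda>i. of_nat m * Y g i)) \<le> \<epsilon>\<^sup>2 * (N (Y g))\<^sup>2"
proof (induction m)
  case 0
  have "(\<lambda>i. of_nat 0 * Y g i) = 0" by (simp add: fun_eq_iff)
  then show ?case by (simp only: nat_pow_0 Y_one) simp
next
  case (Suc m)
  have "g [^] m \<in> lev (N (Y g))" using g by (intro lev_pow) (simp add: lev_def)
  then have gm: "N (Y (g [^] m)) \<le> N (Y g)" by (simp add: lev_def)
  have "N (q (g [^] m) g) \<le> \<epsilon>\<^sup>2 * (N (Y (g [^] m)) * N (Y g))" using g by (intro q_norm) auto
  also have "\<dots> \<le> \<epsilon>\<^sup>2 * (N (Y g) * N (Y g))" using gm by (intro mult_left_mono mult_right_mono) auto
  finally have "N (q (g [^] m) g) \<le> \<epsilon>\<^sup>2 * (N (Y g))\<^sup>2" by (simp add: power2_eq_square)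
  from N_add[OF Suc this] have "N (Y (g [^] m) - (\<lambda>i. of_nat m * Y g i) + q (g [^] m) g) \<le> \<epsilon>\<^sup>2 * (N (Y g))\<^sup>2" .
  moreover have "Y (g [^] m) - (\<lambda>i. of_nat m * Y g i) + q (g [^] m) g = Y (g [^] Suc m) - (\<lambda>i. of_nat (Suc m) * Y g i)"
    by (simp add: Y_mult fun_eq_iff distrib_right)
  ultimately show ?case by (simp only:)
qed

lemma N_scale: "N (\<lambda>i. c * x i) = padic_norm c * N x"
  unfolding N_def by (rule vnorm_scale)

text \<open>Raising to the power \<open>p\<close> multiplies the coordinates by
  \<open>\<pi>\<close>, of norm \<open>\<epsilon>\<close>; the \<open>\<epsilon>\<^sup>2\<close> of
  \<open>pow_estimate\<close> makes the error smaller by one further factor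
  \<open>\<epsilon>\<close>.\<close>

lemma prime_pow_estimate:
  assumes g: "g \<in> H"
  shows "N (Y (g [^] (CARD('p) ^ m)) - (\<lambda>i. \<pi> ^ m * Y g i)) \<le> \<epsilon> ^ Suc m * N (Y g)"
    and "N (Y (g [^] (CARD('p) ^ m))) \<le> \<epsilon> ^ m * N (Y g)"
proof -
  have "N (Y (g [^] (CARD('p) ^ m)) - (\<lambda>i. \<pi> ^ m * Y g i)) \<le> \<epsilon> ^ Suc m * N (Y g) \<and>
    N (Y (g [^] (CARD('p) ^ m))) \<le> \<epsilon> ^ m * N (Y g)"
  proof (induction m)
    case 0
    have "Y (g [^] (CARD('p) ^ 0)) = Y g" using g by simp
    moreover have "Y g - (\<lambda>i. \<pi> ^ 0 * Y g i) = 0" by (simp add: fun_eq_iff)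
    ultimately show ?case using eps by (simp only: N_simps) simp
  next
    case (Suc m)
    define h where "h = g [^] (CARD('p) ^ m)"
    have h: "h \<in> H" "N (Y h - (\<lambda>i. \<pi> ^ m * Y g i)) \<le> \<epsilon> ^ Suc m * N (Y g)" "N (Y h) \<le> \<epsilon> ^ m * N (Y g)"
      unfolding h_def using Suc g H_pow by blast+
    have hp: "g [^] (CARD('p) ^ Suc m) = h [^] CARD('p)"
      using g by (simp add: h_def nat_pow_pow mult.commute)
    have 1: "N (Y (h [^] CARD('p)) - (\<lambda>i. \<pi> * Y h i)) \<le> \<epsilon> ^ Suc (Suc m) * N (Y g)"
    proof -
      have "N (Y (h [^] CARD('p)) - (\<lambda>i. \<pi> * Y h i)) \<le> \<epsilon>\<^sup>2 * (N (Y h))\<^sup>2"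
        using pow_estimate[OF h(1), of "CARD('p)"] by (simp add: uniformizer_def)
      also have "\<dots> \<le> \<epsilon>\<^sup>2 * (N (Y h) * 1)" unfolding power2_eq_square using h(1) by (intro mult_left_mono) auto
      also have "\<dots> \<le> \<epsilon>\<^sup>2 * (\<epsilon> ^ m * N (Y g))" using h(3) by (intro mult_left_mono) auto
      finally show ?thesis by (simp add: power2_eq_square mult_ac)
    qed
    have 2: "N (\<lambda>i. \<pi> * (Y h - (\<lambda>i. \<pi> ^ m * Y g i)) i) \<le> \<epsilon> ^ Suc (Suc m) * N (Y g)"
    proof -
      have "N (\<lambda>i. \<pi> * (Y h - (\<lambda>i. \<pi> ^ m * Y g i)) i) = \<epsilon> * N (Y h - (\<lambda>i. \<pi> ^ m * Y g i))"
        unfolding N_scale \<epsilon>_def ..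
      also have "\<dots> \<le> \<epsilon> * (\<epsilon> ^ Suc m * N (Y g))" using h(2) eps by (intro mult_left_mono) auto
      finally show ?thesis by (simp only: power_Suc mult.assoc)
    qed
    have "Y (h [^] CARD('p)) - (\<lambda>i. \<pi> ^ Suc m * Y g i) = (Y (h [^] CARD('p)) - (\<lambda>i. \<pi> * Y h i)) + (\<lambda>i. \<pi> * (Y h - (\<lambda>i. \<pi> ^ m * Y g i)) i)"
      by (simp add: fun_eq_iff algebra_simps)
    then have 3: "N (Y (h [^] CARD('p)) - (\<lambda>i. \<pi> ^ Suc m * Y g i)) \<le> \<epsilon> ^ Suc (Suc m) * N (Y g)"
      using N_add[OF 1 2] by (simp only:)
    have "N (\<lambda>i. \<pi> ^ Suc m * Y g i) \<le> \<epsilon> ^ Suc m * N (Y g)" unfolding N_scale by (simp add: padic_norm_power \<epsilon>_def padic_norm_mult)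
    moreover have "\<epsilon> ^ Suc (Suc m) * N (Y g) \<le> \<epsilon> ^ Suc m * N (Y g)"
      using eps by (intro mult_right_mono power_decreasing) auto
    ultimately have "N ((Y (h [^] CARD('p)) - (\<lambda>i. \<pi> ^ Suc m * Y g i)) + (\<lambda>i. \<pi> ^ Suc m * Y g i)) \<le> \<epsilon> ^ Suc m * N (Y g)"
      using 3 by (intro N_add) auto
    then have "N (Y (h [^] CARD('p))) \<le> \<epsilon> ^ Suc m * N (Y g)" by simp
    with 3 show ?case unfolding hp by blast
  qed
  then show "N (Y (g [^] (CARD('p) ^ m)) - (\<lambda>i. \<pi> ^ m * Y g i)) \<le> \<epsilon> ^ Suc m * N (Y g)"
    "N (Y (g [^] (CARD('p) ^ m))) \<le> \<epsilon> ^ m * N (Y g)" by blast+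
qed

text \<open>Successive approximation by base \<open>p\<close> digits. An element of size
  \<open>\<epsilon> ^ j\<close> is matched up to \<open>\<epsilon> ^ Suc j\<close> by an ordered
  product of powers of \<open>g i [^] (CARD('p) ^ j)\<close>. These are close to
  \<open>\<pi> ^ j\<close> times the unit vectors and lie in \<open>K\<close> because
  \<open>j\<close> is at least \<open>M\<close>.\<close>

lemma lev_subset_subgroup_mult:
  assumes K: "subgroup K G" and g: "\<And>i. i < n \<Longrightarrow> g i \<in> H" "\<And>i. i < n \<Longrightarrow> Y (g i) = unit_vec 1 i"
    and gK: "\<And>i. i < n \<Longrightarrow> g i [^] (CARD('p) ^ M) \<in> K" and h: "h \<in> lev (\<epsilon> ^ M)"
  shows "\<exists>k\<in>K. inv k \<otimes> h \<in> lev (\<epsilon> ^ (M + r))"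
proof (induction r)
  case 0
  show ?case using h subgroup.one_closed[OF K] by (intro bexI[of _ \<one>]) (auto simp: lev_def)
next
  case (Suc r)
  then obtain k where k: "k \<in> K" "inv k \<otimes> h \<in> lev (\<epsilon> ^ (M + r))" by blast
  define j where "j = M + r"
  define x where "x = inv k \<otimes> h"
  have x: "x \<in> H" "N (Y x) \<le> \<epsilon> ^ j" using k by (auto simp: lev_def x_def j_def)
  \<comment> \<open>The leading digit of the i-th coordinate, reduced modulo \<open>p\<close> to a
    natural number so that it can serve as an exponent.\<close>
  have "\<exists>a::nat. padic_norm (Y x i - of_nat a * \<pi> ^ j) \<le> \<epsilon> ^ Suc j" if i: "i < n" for i
  proof -
    have "padic_norm (Y x i) \<le> \<epsilon> ^ j" using padic_norm_le_vnorm[OF i, of "Y x"] x(2) by (simp add: N_def)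
    then have "padic_norm (Y x i / \<pi> ^ j) \<le> 1" using eps by (simp add: padic_norm_divide padic_norm_power \<epsilon>_def)
    then obtain c where c: "padic_norm (Y x i / \<pi> ^ j - of_int c) \<le> \<epsilon>"
      using padic_approx_int[of "Y x i / \<pi> ^ j"] by (auto simp: \<epsilon>_def uniformizer_norm)
    define a where "a = nat (c mod int CARD('p))"
    have "int a = c mod int CARD('p)" using prime_gt_0_nat[OF prime_card[where 'a = 'p]] by (simp add: a_def)
    then have "c = int a + int CARD('p) * (c div int CARD('p))" by simp
    then have "of_int c = (of_nat a + \<pi> * of_int (c div int CARD('p)) :: 'p padic)"
      unfolding uniformizer_def by (metis of_int_add of_int_mult of_int_of_nat_eq)
    then have "(of_int c - of_nat a :: 'p padic) = \<pi> * of_int (c div int CARD('p))" by simp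
    then have "padic_norm (of_int c - of_nat a :: 'p padic) \<le> \<epsilon> * 1"
      using padic_norm_of_int_le by (simp add: padic_norm_mult \<epsilon>_def)
    from padic_norm_add_le[OF c this[simplified]]
    have ca: "padic_norm (Y x i / \<pi> ^ j - of_nat a) \<le> \<epsilon>" by simp
    have "Y x i - of_nat a * \<pi> ^ j = \<pi> ^ j * (Y x i / \<pi> ^ j - of_nat a)" by (simp add: field_simps)
    then have "padic_norm (Y x i - of_nat a * \<pi> ^ j) = \<epsilon> ^ j * padic_norm (Y x i / \<pi> ^ j - of_nat a)"
      by (simp only: padic_norm_mult padic_norm_power \<epsilon>_def)
    also have "\<dots> \<le> \<epsilon> ^ j * \<epsilon>" using ca eps by (intro mult_left_mono) auto
    finally show ?thesis by (auto simp: mult.commute)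
  qed
  then obtain a :: "nat \<Rightarrow> nat" where a: "\<And>i. i < n \<Longrightarrow> padic_norm (Y x i - of_nat (a i) * \<pi> ^ j) \<le> \<epsilon> ^ Suc j" by metis
  define y where "y i = g i [^] (CARD('p) ^ j)" for i
  define z where "z i = y i [^] a i" for i
  have y: "y i \<in> H" "N (Y (y i) - (\<lambda>l. \<pi> ^ j * Y (g i) l)) \<le> \<epsilon> ^ Suc j" "N (Y (y i)) \<le> \<epsilon> ^ j" if i: "i < n" for i
  proof -
    show "y i \<in> H" using g(1)[OF i] by (simp add: y_def)
    have t: "t * N (Y (g i)) \<le> t" if "0 \<le> t" for t
      using mult_left_mono[OF Y_le_1[OF g(1)[OF i]] that] by simp
    show "N (Y (y i) - (\<lambda>l. \<pi> ^ j * Y (g i) l)) \<le> \<epsilon> ^ Suc j"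
      using order_trans[OF prime_pow_estimate(1)[OF g(1)[OF i], of j] t[of "\<epsilon> ^ Suc j"]] eps
      unfolding y_def by (metis less_imp_le zero_le_power)
    show "N (Y (y i)) \<le> \<epsilon> ^ j"
      using order_trans[OF prime_pow_estimate(2)[OF g(1)[OF i], of j] t[of "\<epsilon> ^ j"]] eps
      unfolding y_def by (metis less_imp_le zero_le_power)
  qed
  \<comment> \<open>The quadratic errors of powers and products are absorbed in the next level of
    the filtration; the factor \<open>\<epsilon>\<^sup>2\<close> makes this true even for
    \<open>j = 0\<close>.\<close>
  have small: "\<epsilon>\<^sup>2 * (\<epsilon> ^ j * \<epsilon> ^ j) \<le> \<epsilon> ^ Suc j"
  proof -
    have "\<epsilon>\<^sup>2 * (\<epsilon> ^ j * \<epsilon> ^ j) = \<epsilon> ^ (2 + (j + j))" by (simp only: power_add)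
    also have "\<dots> \<le> \<epsilon> ^ Suc j" using eps by (intro power_decreasing) auto
    finally show ?thesis .
  qed
  have z: "z i \<in> lev (\<epsilon> ^ j)" "N (Y (z i) - unit_vec (of_nat (a i) * \<pi> ^ j) i) \<le> \<epsilon> ^ Suc j" "z i \<in> K" if i: "i < n" for i
  proof -
    show "z i \<in> lev (\<epsilon> ^ j)" unfolding z_def using y[OF i] by (intro lev_pow) (simp add: lev_def)
    have "(N (Y (y i)))\<^sup>2 \<le> \<epsilon> ^ j * \<epsilon> ^ j" unfolding power2_eq_square using y(3)[OF i] eps by (intro mult_mono) auto
    then have "\<epsilon>\<^sup>2 * (N (Y (y i)))\<^sup>2 \<le> \<epsilon> ^ Suc j" using small mult_left_mono[of _ _ "\<epsilon>\<^sup>2"] by (meson order_trans zero_le_power2)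
    then have 1: "N (Y (z i) - (\<lambda>l. of_nat (a i) * Y (y i) l)) \<le> \<epsilon> ^ Suc j"
      using pow_estimate[OF y(1)[OF i], of "a i"] unfolding z_def by linarith
    have "N (\<lambda>l. of_nat (a i) * (Y (y i) - (\<lambda>l. \<pi> ^ j * Y (g i) l)) l) \<le> 1 * \<epsilon> ^ Suc j"
    proof -
      have "N (\<lambda>l. of_nat (a i) * (Y (y i) - (\<lambda>l. \<pi> ^ j * Y (g i) l)) l)
          = padic_norm (of_nat (a i) :: 'p padic) * N (Y (y i) - (\<lambda>l. \<pi> ^ j * Y (g i) l))"
        by (rule N_scale)
      also have "\<dots> \<le> 1 * \<epsilon> ^ Suc j" by (rule mult_mono[OF padic_norm_of_nat_le y(2)[OF i]]) auto
      finally show ?thesis .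
    qed
    then have "N (\<lambda>l. of_nat (a i) * (Y (y i) - (\<lambda>l. \<pi> ^ j * Y (g i) l)) l) \<le> \<epsilon> ^ Suc j"
      unfolding mult_1_left .
    from N_add[OF 1 this]
    have "N ((Y (z i) - (\<lambda>l. of_nat (a i) * Y (y i) l)) + (\<lambda>l. of_nat (a i) * (Y (y i) - (\<lambda>l. \<pi> ^ j * Y (g i) l)) l)) \<le> \<epsilon> ^ Suc j" .
    moreover have "(Y (z i) - (\<lambda>l. of_nat (a i) * Y (y i) l)) + (\<lambda>l. of_nat (a i) * (Y (y i) - (\<lambda>l. \<pi> ^ j * Y (g i) l)) l)
        = Y (z i) - unit_vec (of_nat (a i) * \<pi> ^ j) i"
      unfolding g(2)[OF i] by (auto simp: fun_eq_iff unit_vec_def algebra_simps)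
    ultimately show "N (Y (z i) - unit_vec (of_nat (a i) * \<pi> ^ j) i) \<le> \<epsilon> ^ Suc j" by (simp only:)
    have "y i = (g i [^] (CARD('p) ^ M)) [^] (CARD('p) ^ r)"
      using g(1)[OF i] by (simp add: y_def j_def nat_pow_pow power_add)
    then have "z i = (g i [^] (CARD('p) ^ M)) [^] (CARD('p) ^ r * a i)"
      using g(1)[OF i] by (simp add: z_def nat_pow_pow mult.assoc)
    moreover have "u [^] (m :: nat) \<in> K" if "u \<in> K" for u m
      by (induction m) (use that subgroup.one_closed[OF K] subgroup.m_closed[OF K] in auto)
    ultimately show "z i \<in> K" using gK[OF i] by simp
  qed
  define k' where "k' = gprod z n"
  have k': "k' \<in> K" "k' \<in> H"
    unfolding k'_def using gprod_mem[OF K, of n z] gprod_lev[of "\<epsilon> ^ j" n z] z eps by (auto simp: lev_def)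
  have "gprod (\<lambda>l. \<one>) m = \<one>" for m by (induction m) auto
  then have "N (Y k' - (\<Sum>l<n. Y (z l))) \<le> \<epsilon>\<^sup>2 * (\<epsilon> ^ j * \<epsilon> ^ j)"
    using gprod_estimate(1)[of n z "\<epsilon> ^ j" "\<lambda>l. \<one>" "\<epsilon> ^ j"] z(1) eps
    by (auto simp: k'_def Y_one lev_def power_le_one)
  then have 1: "N (Y k' - (\<Sum>l<n. Y (z l))) \<le> \<epsilon> ^ Suc j" using small by simp
  have 2: "N ((\<Sum>l<n. Y (z l)) - Y x) \<le> \<epsilon> ^ Suc j"
  proof -
    have Yx: "Y x = (\<Sum>l<n. unit_vec (Y x l) l)"
    proof
      fix i
      have sum_app: "sum F I i = (\<Sum>l\<in>I. F l i)" for F :: "nat \<Rightarrow> nat \<Rightarrow> 'p padic" and I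
        by (induction I rule: infinite_finite_induct) auto
      show "Y x i = (\<Sum>l<n. unit_vec (Y x l) l) i"
        using vspaceD[OF Y_vspace[OF x(1)], of i] by (simp add: sum_app unit_vec_def)
    qed
    have "(\<Sum>l<n. Y (z l)) - Y x = (\<Sum>l<n. Y (z l)) - (\<Sum>l<n. unit_vec (Y x l) l)"
      using Yx by (rule arg_cong)
    also have "\<dots> = (\<Sum>l<n. Y (z l) - unit_vec (Y x l) l)" by (rule sum_subtractf[symmetric])
    finally have e: "(\<Sum>l<n. Y (z l)) - Y x = (\<Sum>l<n. Y (z l) - unit_vec (Y x l) l)" .
    show ?thesis
      unfolding e N_def
    proof (rule vnorm_sum_le)
      fix l assume "l \<in> {..<n}"
      then have l: "l < n" by simp
      have "unit_vec (of_nat (a l) * \<pi> ^ j) l - unit_vec (Y x l) l = unit_vec (of_nat (a l) * \<pi> ^ j - Y x l) l"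
        by (auto simp: unit_vec_def fun_eq_iff)
      then have "vnorm n (unit_vec (of_nat (a l) * \<pi> ^ j) l - unit_vec (Y x l) l) \<le> \<epsilon> ^ Suc j"
        using unit_vec_vnorm[of n "of_nat (a l) * \<pi> ^ j - Y x l" l] a[OF l] by (simp add: padic_norm_diff_commute)
      from vnorm_add_le[OF z(2)[OF l, unfolded N_def] this]
      show "vnorm n (Y (z l) - unit_vec (Y x l) l) \<le> \<epsilon> ^ Suc j" by simp
    qed (use eps in simp)
  qed
  from N_add[OF 1 2] have "N (Y k' - Y x) \<le> \<epsilon> ^ Suc j" by simp
  then have "inv k' \<otimes> x \<in> lev (\<epsilon> ^ Suc j)" using x k' by (simp add: lev_def N_inv_mult N_commute)
  moreover have "h \<in> carrier G" "k \<in> carrier G" using h K k by (auto simp: lev_def subgroup.mem_carrier)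
  then have "inv (k \<otimes> k') \<otimes> h = inv k' \<otimes> x" using k' by (simp add: x_def inv_mult_group m_assoc)
  moreover have "k \<otimes> k' \<in> K" using K k k' by (simp add: subgroup.m_closed)
  ultimately show ?case by (intro bexI[of _ "k \<otimes> k'"]) (auto simp: j_def)
qed

end

section \<open>Homomorphisms into a group with a bi-invariant metric\<close>

locale invariant_hom = std_group G n H Y b \<epsilon> N q + D: group D
  for G :: "'g monoid" (structure) and n H and Y :: "'g \<Rightarrow> nat \<Rightarrow> 'p::prime_card padic" and b \<epsilon> N q
    and D :: "'d monoid" +
  fixes d :: "'d \<Rightarrow> 'd \<Rightarrow> real" and f :: "'g \<Rightarrow> 'd"
  assumes metric: "Metric_space (carrier D) d"
    and inv_left: "\<And>x y z. x \<in> carrier D \<Longrightarrow> y \<in> carrier D \<Longrightarrow> z \<in> carrier D \<Longrightarrow>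
      d (z \<otimes>\<^bsub>D\<^esub> x) (z \<otimes>\<^bsub>D\<^esub> y) = d x y"
    and inv_right: "\<And>x y z. x \<in> carrier D \<Longrightarrow> y \<in> carrier D \<Longrightarrow> z \<in> carrier D \<Longrightarrow>
      d (x \<otimes>\<^bsub>D\<^esub> z) (y \<otimes>\<^bsub>D\<^esub> z) = d x y"
    and f_hom: "f \<in> hom G D"
begin

sublocale gh: group_hom G D f
  by unfold_locales (rule f_hom)

interpretation d: Metric_space "carrier D" d by (rule metric)

text \<open>Two-sided invariance makes this a length that is unchanged by inversion and conjugation
  and determines \<open>d\<close> by \<open>d_eq_len\<close>.\<close>

definition len :: "'d \<Rightarrow> real" where "len x = d x \<one>\<^bsub>D\<^esub>"

lemma len_nonneg: "0 \<le> len x" by (simp add: len_def)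

lemma len_eq_0: "x \<in> carrier D \<Longrightarrow> len x = 0 \<longleftrightarrow> x = \<one>\<^bsub>D\<^esub>" by (simp add: len_def)

lemma len_one: "len \<one>\<^bsub>D\<^esub> = 0" by (simp add: len_def)

lemma len_mult:
  assumes "x \<in> carrier D" "y \<in> carrier D"
  shows "len (x \<otimes>\<^bsub>D\<^esub> y) \<le> len x + len y"
proof -
  have "d (x \<otimes>\<^bsub>D\<^esub> y) \<one>\<^bsub>D\<^esub> \<le> d (x \<otimes>\<^bsub>D\<^esub> y) (\<one>\<^bsub>D\<^esub> \<otimes>\<^bsub>D\<^esub> y) + d (\<one>\<^bsub>D\<^esub> \<otimes>\<^bsub>D\<^esub> y) \<one>\<^bsub>D\<^esub>"
    using assms by (intro d.triangle) auto
  moreover have "d (x \<otimes>\<^bsub>D\<^esub> y) (\<one>\<^bsub>D\<^esub> \<otimes>\<^bsub>D\<^esub> y) = d x \<one>\<^bsub>D\<^esub>" using assms by (intro inv_right) auto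
  ultimately show ?thesis using assms by (simp add: len_def)
qed

lemma len_inv:
  assumes "x \<in> carrier D"
  shows "len (inv\<^bsub>D\<^esub> x) = len x"
proof -
  have "d (x \<otimes>\<^bsub>D\<^esub> inv\<^bsub>D\<^esub> x) (x \<otimes>\<^bsub>D\<^esub> \<one>\<^bsub>D\<^esub>) = d (inv\<^bsub>D\<^esub> x) \<one>\<^bsub>D\<^esub>"
    using assms by (intro inv_left) auto
  then show ?thesis using assms by (simp add: len_def d.commute)
qed

lemma len_conj:
  assumes "x \<in> carrier D" "y \<in> carrier D"
  shows "len (x \<otimes>\<^bsub>D\<^esub> y \<otimes>\<^bsub>D\<^esub> inv\<^bsub>D\<^esub> x) = len y"
proof -
  have "d (x \<otimes>\<^bsub>D\<^esub> y \<otimes>\<^bsub>D\<^esub> inv\<^bsub>D\<^esub> x) (x \<otimes>\<^bsub>D\<^esub> inv\<^bsub>D\<^esub> x) = d (x \<otimes>\<^bsub>D\<^esub> y) x"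
    using assms by (intro inv_right) auto
  also have "\<dots> = d (x \<otimes>\<^bsub>D\<^esub> y) (x \<otimes>\<^bsub>D\<^esub> \<one>\<^bsub>D\<^esub>)" using assms by simp
  also have "\<dots> = d y \<one>\<^bsub>D\<^esub>" using assms by (intro inv_left) auto
  finally show ?thesis using assms by (simp add: len_def)
qed

lemma d_eq_len:
  assumes "x \<in> carrier D" "y \<in> carrier D"
  shows "d x y = len (inv\<^bsub>D\<^esub> y \<otimes>\<^bsub>D\<^esub> x)"
proof -
  have "d (inv\<^bsub>D\<^esub> y \<otimes>\<^bsub>D\<^esub> x) (inv\<^bsub>D\<^esub> y \<otimes>\<^bsub>D\<^esub> y) = d x y" using assms by (intro inv_left) auto
  then show ?thesis using assms by (simp add: len_def)
qed

text \<open>The commutator is \<open>x\<close> times a conjugate of its inverse, and conjugation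
  preserves length. The absence of any condition on \<open>f y\<close> is what permits free second
  entries in \<open>continuous_at_one\<close>.\<close>

lemma len_comm:
  assumes "x \<in> H" "y \<in> H"
  shows "len (f (comm x y)) \<le> 2 * len (f x)"
proof -
  have c: "f x \<in> carrier D" "f y \<in> carrier D" using assms by auto
  have "f (comm x y) = f x \<otimes>\<^bsub>D\<^esub> (f y \<otimes>\<^bsub>D\<^esub> inv\<^bsub>D\<^esub> f x \<otimes>\<^bsub>D\<^esub> inv\<^bsub>D\<^esub> f y)"
    using assms c by (simp add: comm_def D.inv_mult_group D.m_assoc)
  then have "len (f (comm x y)) \<le> len (f x) + len (f y \<otimes>\<^bsub>D\<^esub> inv\<^bsub>D\<^esub> f x \<otimes>\<^bsub>D\<^esub> inv\<^bsub>D\<^esub> f y)"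
    using c len_mult by simp
  also have "len (f y \<otimes>\<^bsub>D\<^esub> inv\<^bsub>D\<^esub> f x \<otimes>\<^bsub>D\<^esub> inv\<^bsub>D\<^esub> f y) = len (f x)"
    using c by (simp add: len_conj len_inv)
  finally show ?thesis by simp
qed

lemma len_gprod:
  assumes "\<And>l. l < k \<Longrightarrow> z l \<in> H" "\<And>l. l < k \<Longrightarrow> len (f (z l)) \<le> r"
  shows "len (f (gprod z k)) \<le> real k * r"
  using assms
proof (induction k)
  case (Suc k)
  have g: "gprod z k \<in> H" using Suc.prems by (intro gprod_mem[OF H]) auto
  have "len (f (gprod z (Suc k))) \<le> len (f (gprod z k)) + len (f (z k))"
    using len_mult[of "f (gprod z k)" "f (z k)"] g Suc.prems(1)[of k] by simp
  also have "\<dots> \<le> real k * r + r" using Suc.IH Suc.prems by (intro add_mono) auto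
  finally show ?case by (simp add: distrib_right)
qed (simp add: len_one)

lemma eventually_lev:
  assumes v: "\<And>l. l < (m::nat) \<Longrightarrow> v l \<in> vspace n"
  obtains a where "\<And>l. l < m \<Longrightarrow> N (\<lambda>i. \<pi> ^ a * v l i) \<le> 1"
proof -
  define R where "R = Max (insert 0 ((\<lambda>l. N (v l)) ` {..<m}))"
  have R: "0 \<le> R" "\<And>l. l < m \<Longrightarrow> N (v l) \<le> R" by (auto simp: R_def)
  obtain a where a: "\<epsilon> ^ a < 1 / (R + 1)"
    using uniformizer_power_small[of "1 / (R + 1)"] R(1) unfolding \<epsilon>_def by auto
  have "N (\<lambda>i. \<pi> ^ a * v l i) \<le> 1" if "l < m" for l
  proof -
    have "N (\<lambda>i. \<pi> ^ a * v l i) = \<epsilon> ^ a * N (v l)" by (simp add: N_scale padic_norm_power \<epsilon>_def)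
    also have "\<dots> \<le> 1 / (R + 1) * (R + 1)" using a R(1) R(2)[OF that] by (intro mult_mono) auto
    finally show ?thesis using R(1) by simp
  qed
  then show ?thesis using that by blast
qed

text \<open>
  The product of commutators \<open>[x\<^sub>l, y\<^sub>l]\<close> with all \<open>x\<^sub>l\<close> of small image has small image, whatever the
  \<open>y\<^sub>l\<close> are. As the \<open>x\<^sub>l\<close> may be taken close to prescribed directions, its linear part is close to a
  sum of brackets, which is onto.
\<close>

lemma continuous_at_one:
  fixes m :: nat
  assumes dense: "\<And>\<delta>. \<delta> > 0 \<Longrightarrow> \<exists>j. \<forall>g\<in>lev (\<epsilon> ^ j). \<forall>i. \<exists>w\<in>H. N (Y w - Y g) \<le> \<epsilon> ^ i \<and> len (f w) < \<delta>"
    and u: "\<And>l. l < m \<Longrightarrow> u l \<in> vspace n" and v: "\<And>l. l < m \<Longrightarrow> v l \<in> vspace n" and J: "\<And>l. l < m \<Longrightarrow> J l < n"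
    and span: "\<And>z. z \<in> vspace n \<Longrightarrow> (\<Sum>l<m. br (u l) (\<lambda>i. z (J l) * v l i)) = z"
    and e: "e > 0"
  shows "\<exists>j. \<forall>h\<in>lev (\<epsilon> ^ j). len (f h) < e"
proof -
  obtain a1 where a1: "\<And>l. l < m \<Longrightarrow> N (\<lambda>i. \<pi> ^ a1 * u l i) \<le> 1" by (rule eventually_lev[of m u]) (use u in auto)
  obtain a2 where a2: "\<And>l. l < m \<Longrightarrow> N (\<lambda>i. \<pi> ^ a2 * v l i) \<le> 1" by (rule eventually_lev[of m v]) (use v in auto)
  define u' where "u' l = (\<lambda>i. \<pi> ^ a1 * u l i)" for l
  define v' where "v' l = (\<lambda>i. \<pi> ^ a2 * v l i)" for l
  have u': "u' l \<in> vspace n" "N (u' l) \<le> 1" if "l < m" for l using u a1 that by (auto simp: u'_def vspace_scale)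
  have v': "v' l \<in> vspace n" "N (v' l) \<le> 1" if "l < m" for l using v a2 that by (auto simp: v'_def vspace_scale)
  \<comment> \<open>Scaling the vectors \<open>u l\<close> and \<open>v l\<close> into the unit ball
    costs the factor \<open>\<pi> ^ s\<close> in the bracket sum.\<close>
  define s where "s = a1 + a2"
  have span': "(\<Sum>l<m. br (u' l) (\<lambda>i. z (J l) * v' l i)) = (\<lambda>i. \<pi> ^ s * z i)" if z: "z \<in> vspace n" for z
  proof -
    have "br (u' l) (\<lambda>i. z (J l) * v' l i) = (\<lambda>i. \<pi> ^ s * br (u l) (\<lambda>i. z (J l) * v l i) i)" for l
    proof -
      have "(\<lambda>i. z (J l) * v' l i) = (\<lambda>i. \<pi> ^ a2 * (z (J l) * v l i))" by (simp add: v'_def fun_eq_iff mult_ac)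
      then show ?thesis unfolding u'_def by (simp add: br_scale s_def power_add mult_ac)
    qed
    moreover have "(\<Sum>l<m. (\<lambda>i. c * F l i)) = (\<lambda>i. c * (\<Sum>l<m. F l) i)" for c and F :: "nat \<Rightarrow> nat \<Rightarrow> 'p padic"
      by (induction m) (auto simp: fun_eq_iff distrib_left)
    ultimately show ?thesis using span[OF z] by simp
  qed
  \<comment> \<open>The images of \<open>m\<close> commutators, each of length at most
    \<open>2 * \<delta>\<close>, must add up to less than \<open>e\<close>; the extra 1 covers
    \<open>m = 0\<close>.\<close>
  define \<delta> where "\<delta> = e / (2 * real m + 1)"
  have \<delta>: "\<delta> > 0" using e by (simp add: \<delta>_def add_nonneg_pos)
  obtain j0 where j0: "\<And>g i. g \<in> lev (\<epsilon> ^ j0) \<Longrightarrow> \<exists>w\<in>H. N (Y w - Y g) \<le> \<epsilon> ^ i \<and> len (f w) < \<delta>"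
    using dense[OF \<delta>] by blast
  \<comment> \<open>\<open>k \<ge> j0\<close> places \<open>\<pi> ^ k * u' l\<close> where density
    is available; \<open>k \<ge> Suc s\<close> gives \<open>\<epsilon> ^ k \<le> \<tau>\<close>, so
    that \<open>\<tau>\<close> bounds both entries of every commutator.\<close>
  define k where "k = max j0 (Suc s)"
  \<comment> \<open>The linear part has size \<open>\<epsilon> ^ (k + s)\<close> and all errors
    carry \<open>\<epsilon> ^ k * \<tau>\<close>. This \<open>\<tau>\<close> makes them smaller by
    one factor \<open>\<epsilon>\<close>, as \<open>newton_solution\<close> requires.\<close>
  define \<tau> where "\<tau> = \<epsilon> ^ Suc s"
  have pw: "\<epsilon> ^ i \<le> \<epsilon> ^ j" if "j \<le> i" for i j using eps that by (intro power_decreasing) auto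
  have pw0: "0 \<le> \<epsilon> ^ i" "\<epsilon> ^ i \<le> 1" for i using eps by (auto intro: power_le_one)
  have \<tau>: "0 \<le> \<tau>" "\<tau> \<le> 1" unfolding \<tau>_def by (rule pw0)+
  have k: "\<epsilon> ^ k \<le> \<epsilon> ^ j0" "\<epsilon> ^ k \<le> \<tau>" unfolding \<tau>_def by (rule pw; simp add: k_def)+
  \<comment> \<open>The precision \<open>k + Suc s\<close> keeps the effect of replacing
    \<open>\<pi> ^ k * u' l\<close> by \<open>Y (x l)\<close> one factor \<open>\<epsilon>\<close>
    below the linear part.\<close>
  have "\<exists>x\<in>H. N (Y x - (\<lambda>i. \<pi> ^ k * u' l i)) \<le> \<epsilon> ^ (k + Suc s) \<and> len (f x) < \<delta>" if l: "l < m" for l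
  proof -
    have n1: "N (\<lambda>i. \<pi> ^ k * u' l i) \<le> \<epsilon> ^ k"
      using mult_left_mono[OF u'(2)[OF l] pw0(1)[of k]] by (simp add: N_scale padic_norm_power \<epsilon>_def)
    have "(\<lambda>i. \<pi> ^ k * u' l i) \<in> vspace n" by (rule vspace_scale[OF u'(1)[OF l]])
    moreover have "N (\<lambda>i. \<pi> ^ k * u' l i) \<le> 1" using n1 pw0(2)[of k] by simp
    ultimately obtain g where g: "g \<in> H" "Y g = (\<lambda>i. \<pi> ^ k * u' l i)" by (rule Y_surj)
    then have "g \<in> lev (\<epsilon> ^ j0)" using n1 k(1) by (simp add: lev_def)
    then show ?thesis using j0 g(2) by metis
  qed
  then obtain x where x: "\<And>l. l < m \<Longrightarrow> x l \<in> H" "\<And>l. l < m \<Longrightarrow> N (Y (x l) - (\<lambda>i. \<pi> ^ k * u' l i)) \<le> \<epsilon> ^ (k + Suc s)"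
    "\<And>l. l < m \<Longrightarrow> len (f (x l)) < \<delta>" by metis
  have xk: "N (Y (x l)) \<le> \<epsilon> ^ k" if l: "l < m" for l
  proof -
    have 1: "N (Y (x l) - (\<lambda>i. \<pi> ^ k * u' l i)) \<le> \<epsilon> ^ k" using x(2)[OF l] pw[of k "k + Suc s"] by simp
    have 2: "N (\<lambda>i. \<pi> ^ k * u' l i) \<le> \<epsilon> ^ k"
      using mult_left_mono[OF u'(2)[OF l] pw0(1)[of k]] by (simp add: N_scale padic_norm_power \<epsilon>_def)
    from N_add[OF 1 2] show ?thesis by simp
  qed
  define y where "y z l = (SOME g. g \<in> H \<and> Y g = (\<lambda>i. z (J l) * v' l i))" for z l
  have y: "y z l \<in> H \<and> Y (y z l) = (\<lambda>i. z (J l) * v' l i)" if z: "N z \<le> \<tau>" and l: "l < m" for z l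
  proof -
    have "padic_norm (z (J l)) \<le> 1"
      using padic_norm_le_vnorm[OF J[OF l], of z] z pw0(2)[of "Suc s"] by (simp add: N_def \<tau>_def)
    then have "N (\<lambda>i. z (J l) * v' l i) \<le> 1 * 1" unfolding N_scale using v'(2)[OF l] by (intro mult_mono) auto
    then obtain g where "g \<in> H" "Y g = (\<lambda>i. z (J l) * v' l i)"
      using Y_surj[OF vspace_scale[OF v'(1)[OF l]], of "z (J l)"] by auto
    then show ?thesis unfolding y_def by (intro someI[of "\<lambda>g. g \<in> H \<and> Y g = (\<lambda>i. z (J l) * v' l i)" g]) blast
  qed
  define c where "c z l = comm (x l) (y z l)" for z l
  define \<Theta> where "\<Theta> z = gprod (c z) m" for z
  have c_H: "c z l \<in> H" if "N z \<le> \<tau>" "l < m" for z l using x(1) y that by (simp add: c_def)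
  have \<Theta>_H: "\<Theta> z \<in> H" if "N z \<le> \<tau>" for z unfolding \<Theta>_def using c_H[OF that] by (intro gprod_mem[OF H])
  have yz: "N (\<lambda>i. z (J l) * v' l i) \<le> N z" if l: "l < m" for z l
  proof -
    have "N (\<lambda>i. z (J l) * v' l i) \<le> N z * 1"
      unfolding N_scale using v'(2)[OF l] padic_norm_le_vnorm[OF J[OF l], of z] by (intro mult_mono) (auto simp: N_def)
    then show ?thesis by simp
  qed
  have c_lev: "c z l \<in> lev (\<epsilon> ^ k * \<tau>)" if z: "N z \<le> \<tau>" and l: "l < m" for z l
  proof -
    have "N (Y (c z l)) \<le> \<epsilon>\<^sup>2 * (N (Y (x l)) * N (Y (y z l)))" unfolding c_def using x(1)[OF l] y[OF z l] by (intro comm_norm) auto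
    also have "\<dots> \<le> 1 * (\<epsilon> ^ k * \<tau>)"
      using xk[OF l] yz[OF l, of z] y[OF z l] z eps pw0 by (intro mult_mono) auto
    finally show ?thesis using c_H[OF z l] by (simp add: lev_def)
  qed
  \<comment> \<open>Three errors, each at most \<open>\<epsilon> ^ k * \<tau> * \<Delta>\<close>:
    commutator against bracket (\<open>ce\<close>), \<open>Y (x l)\<close> against
    \<open>\<pi> ^ k * u' l\<close> (\<open>bd\<close>), and product against sum
    (\<open>g1\<close>).\<close>
  have main: "vnorm n (Y (\<Theta> z) - Y (\<Theta> z') - (\<lambda>i. \<pi> ^ (k + s) * (z - z') i)) \<le> padic_norm (\<pi> :: 'p padic) ^ Suc (k + s) * vnorm n (z - z')"
    if z: "z \<in> vspace n" "z' \<in> vspace n" "vnorm n z \<le> \<tau>" "vnorm n z' \<le> \<tau>" for z z'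
  proof -
    define \<Delta> where "\<Delta> = N (z - z')"
    have zN: "N z \<le> \<tau>" "N z' \<le> \<tau>" using z by (auto simp: N_def)
    have \<Delta>0: "0 \<le> \<Delta>" by (simp add: \<Delta>_def)
    have yd: "Y (y z l) - Y (y z' l) = (\<lambda>i. (z - z') (J l) * v' l i)" if l: "l < m" for l
      using y[OF zN(1) l] y[OF zN(2) l] by (simp add: fun_eq_iff left_diff_distrib)
    have ydN: "N (Y (y z l) - Y (y z' l)) \<le> \<Delta>" if l: "l < m" for l
      unfolding yd[OF l] \<Delta>_def by (rule yz[OF l])
    have ce: "N (Y (c z l) - Y (c z' l) - br (Y (x l)) (Y (y z l) - Y (y z' l))) \<le> \<epsilon> ^ k * \<tau> * \<Delta>"
      "N (Y (c z l) - Y (c z' l)) \<le> \<epsilon> ^ k * \<Delta>" if l: "l < m" for l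
    proof -
      have mu: "N (Y (x l)) \<le> \<tau>" "N (Y (y z l)) \<le> \<tau>" "N (Y (y z' l)) \<le> \<tau>" "\<tau> \<le> 1"
        using xk[OF l] k(2) yz[OF l, of z] yz[OF l, of z'] y[OF zN(1) l] y[OF zN(2) l] zN pw0(2)[of "Suc s", folded \<tau>_def]
        by auto
      note est = comm_estimate[OF x(1)[OF l] conjunct1[OF y[OF zN(1) l]] conjunct1[OF y[OF zN(2) l]] mu]
      have t: "0 \<le> \<tau>" unfolding \<tau>_def by (rule pw0(1))
      have "N (Y (x l)) * \<tau> * N (Y (y z l) - Y (y z' l)) \<le> \<epsilon> ^ k * \<tau> * \<Delta>"
        using xk[OF l] t pw0 by (intro mult_mono ydN[OF l]) auto
      then show "N (Y (c z l) - Y (c z' l) - br (Y (x l)) (Y (y z l) - Y (y z' l))) \<le> \<epsilon> ^ k * \<tau> * \<Delta>"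
        using est(1) unfolding c_def by (rule order_trans[rotated])
      have "N (Y (x l)) * N (Y (y z l) - Y (y z' l)) \<le> \<epsilon> ^ k * \<Delta>"
        using xk[OF l] pw0 by (intro mult_mono ydN[OF l]) auto
      then show "N (Y (c z l) - Y (c z' l)) \<le> \<epsilon> ^ k * \<Delta>"
        using est(2) unfolding c_def by (rule order_trans[rotated])
    qed
    have bd: "N (br (Y (x l)) (Y (y z l) - Y (y z' l)) - (\<lambda>i. \<pi> ^ k * br (u' l) (\<lambda>i. (z - z') (J l) * v' l i) i)) \<le> \<epsilon> ^ k * \<tau> * \<Delta>"
      if l: "l < m" for l
    proof -
      have e: "br (Y (x l)) (Y (y z l) - Y (y z' l)) - (\<lambda>i. \<pi> ^ k * br (u' l) (\<lambda>i. (z - z') (J l) * v' l i) i)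
          = br (Y (x l) - (\<lambda>i. \<pi> ^ k * u' l i)) (Y (y z l) - Y (y z' l))"
        unfolding yd[OF l] br_diff(1) br_scale(1) ..
      have "N (br (Y (x l) - (\<lambda>i. \<pi> ^ k * u' l i)) (Y (y z l) - Y (y z' l)))
          \<le> N (Y (x l) - (\<lambda>i. \<pi> ^ k * u' l i)) * N (Y (y z l) - Y (y z' l))" by (rule br_norm)
      also have "\<dots> \<le> \<epsilon> ^ (k + Suc s) * \<Delta>" 
        by (rule mult_mono[OF x(2)[OF l] ydN[OF l] pw0(1) N_simps(2)])
      finally show ?thesis unfolding e by (simp only: power_add \<tau>_def)
    qed
    have g1: "N (Y (\<Theta> z) - Y (\<Theta> z') - (\<Sum>l<m. Y (c z l) - Y (c z' l))) \<le> \<epsilon> ^ k * \<tau> * \<Delta>"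
    proof -
      have kt: "0 \<le> \<epsilon> ^ k * \<tau>" "\<epsilon> ^ k * \<tau> \<le> 1" "0 \<le> \<epsilon> ^ k * \<Delta>" using pw0[of k] \<Delta>0 \<tau> by (auto intro: mult_le_one)
      have "N (Y (\<Theta> z) - Y (\<Theta> z') - (\<Sum>l<m. Y (c z l) - Y (c z' l))) \<le> \<epsilon>\<^sup>2 * (\<epsilon> ^ k * \<tau> * (\<epsilon> ^ k * \<Delta>))"
        unfolding \<Theta>_def by (rule gprod_estimate(1)[OF c_lev[OF zN(1)] c_lev[OF zN(2)] ce(2) kt])
      also have "\<dots> \<le> 1 * (\<epsilon> ^ k * \<tau> * (1 * \<Delta>))"
        using eps pw0 kt \<Delta>0 by (intro mult_mono mult_left_mono mult_right_mono) auto
      finally show ?thesis by simp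
    qed
    have g2: "N ((\<Sum>l<m. Y (c z l) - Y (c z' l)) - (\<Sum>l<m. (\<lambda>i. \<pi> ^ k * br (u' l) (\<lambda>i. (z - z') (J l) * v' l i) i))) \<le> \<epsilon> ^ k * \<tau> * \<Delta>"
      unfolding sum_subtractf[symmetric] N_def
    proof (rule vnorm_sum_le)
      fix l assume "l \<in> {..<m}"
      then have l: "l < m" by simp
      from N_add[OF ce(1)[OF l] bd[OF l]]
      show "vnorm n (Y (c z l) - Y (c z' l) - (\<lambda>i. \<pi> ^ k * br (u' l) (\<lambda>i. (z - z') (J l) * v' l i) i)) \<le> \<epsilon> ^ k * \<tau> * \<Delta>"
        by (simp only: N_def diff_add_cancel add_diff_eq)
    qed (use pw0(1)[of k] \<Delta>0 \<tau> in auto)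
    have "(\<Sum>l<m. (\<lambda>i. \<pi> ^ k * br (u' l) (\<lambda>i. (z - z') (J l) * v' l i) i)) = (\<lambda>i. \<pi> ^ k * (\<Sum>l<m. br (u' l) (\<lambda>i. (z - z') (J l) * v' l i)) i)"
      by (induction m) (auto simp: fun_eq_iff distrib_left)
    also have "\<dots> = (\<lambda>i. \<pi> ^ (k + s) * (z - z') i)"
      unfolding span'[OF vspace_diff[OF z(1,2)]] by (simp only: power_add mult.assoc)
    finally have lin: "(\<Sum>l<m. (\<lambda>i. \<pi> ^ k * br (u' l) (\<lambda>i. (z - z') (J l) * v' l i) i)) = (\<lambda>i. \<pi> ^ (k + s) * (z - z') i)" .
    from N_add[OF g1 g2[unfolded lin]]
    have "N (Y (\<Theta> z) - Y (\<Theta> z') - (\<lambda>i. \<pi> ^ (k + s) * (z - z') i)) \<le> \<epsilon> ^ k * \<tau> * \<Delta>"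
      by (simp only: diff_add_cancel add_diff_eq)
    also have "\<epsilon> ^ k * \<tau> * \<Delta> = padic_norm (\<pi> :: 'p padic) ^ Suc (k + s) * vnorm n (z - z')"
      by (simp add: \<tau>_def \<Delta>_def \<epsilon>_def N_def power_add)
    finally show ?thesis by (simp only: N_def)
  qed
  have y0: "y 0 l = \<one>" if l: "l < m" for l
  proof -
    have "N 0 \<le> \<tau>" using \<tau> by simp
    from y[OF this l] have "y 0 l \<in> H" "Y (y 0 l) = Y \<one>" by (auto simp: Y_one fun_eq_iff)
    then show ?thesis using Y_inj H_one by blast
  qed
  have "c 0 l = \<one>" if l: "l < m" for l using x(1)[OF l] by (simp add: c_def y0[OF l] comm_def)
  then have "gprod (c 0) k = \<one>" if "k \<le> m" for k using that by (induction k) auto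
  then have \<Theta>0: "Y (\<Theta> 0) = 0" by (simp add: \<Theta>_def Y_one)
  show ?thesis
  proof (intro exI[of _ "k + s + Suc s"] ballI)
    fix h assume h: "h \<in> lev (\<epsilon> ^ (k + s + Suc s))"
    have "vnorm n (Y h) \<le> padic_norm (\<pi> :: 'p padic) ^ (k + s) * \<tau>"
      using h by (simp add: lev_def \<tau>_def N_def power_add \<epsilon>_def mult_ac)
    moreover have "Y h \<in> vspace n" using h by (simp add: lev_def)
    moreover have "0 \<le> \<tau>" by (rule \<tau>)
    moreover have "Y (\<Theta> z) \<in> vspace n" if "vnorm n z \<le> \<tau>" for z using \<Theta>_H[of z] that by (simp add: N_def)
    ultimately obtain z where z: "vnorm n z \<le> \<tau>" "Y (\<Theta> z) = Y h"
      using newton_solution[of n \<tau> "\<lambda>z. Y (\<Theta> z)" "k + s" "Y h"] \<Theta>0 main by metis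
    have zN: "N z \<le> \<tau>" using z(1) by (simp add: N_def)
    have "h = \<Theta> z" using Y_inj[OF \<Theta>_H[OF zN], of h] h z(2) by (simp add: lev_def)
    moreover have "len (f (\<Theta> z)) \<le> real m * (2 * \<delta>)"
      unfolding \<Theta>_def
    proof (rule len_gprod)
      fix l assume l: "l < m"
      show "c z l \<in> H" by (rule c_H[OF zN l])
      show "len (f (c z l)) \<le> 2 * \<delta>"
        using len_comm[OF x(1)[OF l] conjunct1[OF y[OF zN l]]] x(3)[OF l] unfolding c_def by simp
    qed
    moreover have "real m * (2 * \<delta>) < e"
    proof -
      have "real m * (2 * \<delta>) = e * (2 * real m / (2 * real m + 1))" by (simp add: \<delta>_def)
      also have "\<dots> < e * 1" using e by (intro mult_strict_left_mono) auto
      finally show ?thesis by simp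
    qed
    ultimately show "len (f h) < e" by simp
  qed
qed


section \<open>p-adic powers and the kernel\<close>

lemma pow_cong_norm:
  fixes k l :: nat
  assumes g: "g \<in> H" and kl: "[k = l] (mod CARD('p) ^ m)"
  shows "N (Y (g [^] k) - Y (g [^] l)) \<le> \<epsilon> ^ m"
proof -
  have *: "N (Y (g [^] l) - Y (g [^] k)) \<le> \<epsilon> ^ m" if "k \<le> l" and kl: "[k = l] (mod CARD('p) ^ m)" for k l :: nat
  proof -
    have "CARD('p) ^ m dvd l - k" using cong_altdef_nat[OF \<open>k \<le> l\<close>] cong_sym[OF kl] by blast
    then obtain t where "l - k = CARD('p) ^ m * t" by (rule dvdE)
    then have t: "l = k + CARD('p) ^ m * t" using \<open>k \<le> l\<close> by simp
    have "g [^] l = g [^] k \<otimes> (g [^] (CARD('p) ^ m)) [^] t" using g by (simp add: t nat_pow_mult nat_pow_pow)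
    then have "N (Y (g [^] l) - Y (g [^] k)) = N (Y ((g [^] (CARD('p) ^ m)) [^] t))"
      using isometry_left[of "g [^] k" "(g [^] (CARD('p) ^ m)) [^] t" \<one>] g by (simp add: Y_one)
    moreover have "g [^] (CARD('p) ^ m) \<in> lev (\<epsilon> ^ m)"
    proof -
      have "\<epsilon> ^ m * N (Y g) \<le> \<epsilon> ^ m * 1" using eps g by (intro mult_left_mono) auto
      then show ?thesis using prime_pow_estimate(2)[OF g, of m] g by (simp add: lev_def)
    qed
    then have "N (Y ((g [^] (CARD('p) ^ m)) [^] t)) \<le> \<epsilon> ^ m" using lev_pow[of _ "\<epsilon> ^ m" t] by (simp add: lev_def)
    ultimately show ?thesis by (simp only:)
  qed
  show ?thesis
  proof (cases "k \<le> l")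
    case True
    then show ?thesis using *[OF True kl] by (simp only: N_commute)
  next
    case False
    then show ?thesis using *[of l k] cong_sym[OF kl] by simp
  qed
qed

lemma Zp_range: "x \<in> carrier (padic_integers CARD('p)) \<Longrightarrow> 0 \<le> x m \<and> x m < int CARD('p) ^ m"
  by (auto simp: padic_integers_def)

lemma Zp_Suc: "x \<in> carrier (padic_integers CARD('p)) \<Longrightarrow> [nat (x (Suc m)) = nat (x m)] (mod CARD('p) ^ m)"
proof -
  assume x: "x \<in> carrier (padic_integers CARD('p))"
  have "int (nat (x (Suc m)) mod CARD('p) ^ m) = x (Suc m) mod int CARD('p) ^ m"
    using Zp_range[OF x, of "Suc m"] by (simp add: zmod_int)
  also have "\<dots> = x m" using x by (simp add: padic_integers_def)
  also have "\<dots> = x m mod int CARD('p) ^ m" using Zp_range[OF x, of m] by simp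
  also have "\<dots> = int (nat (x m) mod CARD('p) ^ m)" using Zp_range[OF x, of m] by (simp add: zmod_int)
  finally show ?thesis unfolding cong_def by linarith
qed

text \<open>The p-adic power of \<open>g\<close>. As \<open>x m\<close> is the residue of
  \<open>x\<close> modulo \<open>p^m\<close>, the powers of \<open>g\<close> with these exponents
  form a Cauchy sequence by \<open>pow_cong_norm\<close>; the limit is singled out by its rate of
  convergence.\<close>

definition expo :: "'g \<Rightarrow> (nat \<Rightarrow> int) \<Rightarrow> 'g" where
  "expo g x = (SOME h. h \<in> H \<and> (\<forall>m. N (Y h - Y (g [^] nat (x m))) \<le> \<epsilon> ^ m))"

lemma expo:
  assumes g: "g \<in> H" and x: "x \<in> carrier (padic_integers CARD('p))"
  shows "expo g x \<in> H" "N (Y (expo g x) - Y (g [^] nat (x m))) \<le> \<epsilon> ^ m"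
proof -
  have "\<exists>h. h \<in> H \<and> (\<forall>m. N (Y h - Y (g [^] nat (x m))) \<le> \<epsilon> ^ m)"
  proof -
    have "vnorm n (Y (g [^] nat (x (Suc m))) - Y (g [^] nat (x m))) \<le> 1 * padic_norm (\<pi> :: 'p padic) ^ m" for m
      using pow_cong_norm[OF g Zp_Suc[OF x, of m]] by (simp add: N_def \<epsilon>_def)
    then obtain w where w: "w \<in> vspace n" "\<And>m. vnorm n (w - Y (g [^] nat (x m))) \<le> 1 * padic_norm (\<pi> :: 'p padic) ^ m"
      using vspace_limit[of "\<lambda>m. Y (g [^] nat (x m))" n 1] g by auto
    have "N (w - Y (g [^] nat (x 0))) \<le> 1" using w(2)[of 0] by (simp add: N_def)
    from N_add[OF this Y_le_1[OF H_pow[OF g, of "nat (x 0)"]]] have "N w \<le> 1" by simp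
    then obtain h where "h \<in> H" "Y h = w" using Y_surj[OF w(1)] by auto
    then show ?thesis using w(2) by (intro exI[of _ h]) (auto simp: N_def \<epsilon>_def)
  qed
  from someI_ex[OF this, folded expo_def]
  show "expo g x \<in> H" "N (Y (expo g x) - Y (g [^] nat (x m))) \<le> \<epsilon> ^ m" by auto
qed

lemma H_eqI:
  assumes "g \<in> H" "h \<in> H" "\<And>m. N (Y g - Y h) \<le> \<epsilon> ^ m"
  shows "g = h"
proof -
  have "Y g - Y h = 0"
    by (rule vnorm_eq_0_limit[of _ n 1]) (use assms in \<open>auto simp: N_def \<epsilon>_def intro: vspace_diff\<close>)
  then show ?thesis using Y_inj assms by simp
qed

lemma mult_close:
  assumes "g \<in> H" "g' \<in> H" "h \<in> H" "h' \<in> H" "N (Y g - Y g') \<le> r" "N (Y h - Y h') \<le> r"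
  shows "N (Y (g \<otimes> h) - Y (g' \<otimes> h')) \<le> r"
proof -
  have "N ((Y (g \<otimes> h) - Y (g' \<otimes> h)) + (Y (g' \<otimes> h) - Y (g' \<otimes> h'))) \<le> r"
    using assms by (intro N_add) (simp_all only: isometry_left isometry_right)
  then show ?thesis by simp
qed

lemma pow_close:
  assumes "g \<in> H" "h \<in> H" "N (Y g - Y h) \<le> r"
  shows "N (Y (g [^] m) - Y (h [^] (m :: nat))) \<le> r"
proof (induction m)
  case 0
  have "0 \<le> r" using order_trans[OF N_simps(2) assms(3)] .
  then show ?case by (simp only: nat_pow_0 diff_self N_simps)
next
  case (Suc m)
  show ?case
    unfolding nat_pow_Suc by (rule mult_close[OF H_pow[OF assms(1)] H_pow[OF assms(2)] assms(1,2) Suc.IH assms(3)])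
qed

lemma close_trans: "N (Y x - Y y) \<le> r \<Longrightarrow> N (Y y - Y z) \<le> r \<Longrightarrow> N (Y x - Y z) \<le> r"
  using N_add[of "Y x - Y y" r "Y y - Y z"] by simp

lemma expo_mult:
  assumes g: "g \<in> H" and x: "x \<in> carrier (padic_integers CARD('p))" and y: "y \<in> carrier (padic_integers CARD('p))" and xy: "x \<otimes>\<^bsub>padic_integers CARD('p)\<^esub> y \<in> carrier (padic_integers CARD('p))"
  shows "expo g (x \<otimes>\<^bsub>padic_integers CARD('p)\<^esub> y) = expo g x \<otimes> expo g y"
proof (rule H_eqI)
  fix m
  let ?a = "nat (x m)" and ?b = "nat (y m)" and ?c = "nat ((x \<otimes>\<^bsub>padic_integers CARD('p)\<^esub> y) m)"
  have "int ?c = (x m + y m) mod int CARD('p) ^ m"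
    using Zp_range[OF xy, of m] by (simp add: padic_integers_def)
  also have "\<dots> = int ((?a + ?b) mod CARD('p) ^ m)"
    using Zp_range[OF x, of m] Zp_range[OF y, of m] by (simp add: zmod_int)
  finally have "?c = (?a + ?b) mod CARD('p) ^ m" by (simp only: of_nat_eq_iff)
  then have "[?c = ?a + ?b] (mod CARD('p) ^ m)" by (simp only: cong_def mod_mod_trivial)
  from pow_cong_norm[OF g this] have 1: "N (Y (g [^] ?c) - Y (g [^] ?a \<otimes> g [^] ?b)) \<le> \<epsilon> ^ m"
    using g by (simp add: nat_pow_mult)
  have 2: "N (Y (g [^] ?a \<otimes> g [^] ?b) - Y (expo g x \<otimes> expo g y)) \<le> \<epsilon> ^ m"
    by (rule mult_close) (use g expo(1)[OF g x] expo(1)[OF g y] expo(2)[OF g x, of m] expo(2)[OF g y, of m] in \<open>simp_all add: N_commute[of "Y (g [^] _)"]\<close>)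
  show "N (Y (expo g (x \<otimes>\<^bsub>padic_integers CARD('p)\<^esub> y)) - Y (expo g x \<otimes> expo g y)) \<le> \<epsilon> ^ m"
    by (rule close_trans[OF expo(2)[OF g xy] close_trans[OF 1 2]])
qed (use expo(1)[OF g] x y xy in auto)

lemma Zp_mult_closed: "x \<in> carrier (padic_integers CARD('p)) \<Longrightarrow> y \<in> carrier (padic_integers CARD('p)) \<Longrightarrow> x \<otimes>\<^bsub>padic_integers CARD('p)\<^esub> y \<in> carrier (padic_integers CARD('p))"
proof -
  assume x: "x \<in> carrier (padic_integers CARD('p))" and y: "y \<in> carrier (padic_integers CARD('p))"
  have p: "0 < int CARD('p)" using prime_gt_0_nat[OF prime_card[where 'a = 'p]] by simp
  have "((x (Suc m) + y (Suc m)) mod int CARD('p) ^ Suc m) mod int CARD('p) ^ m = (x m + y m) mod int CARD('p) ^ m" for m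
  proof -
    have "((x (Suc m) + y (Suc m)) mod int CARD('p) ^ Suc m) mod int CARD('p) ^ m = (x (Suc m) + y (Suc m)) mod int CARD('p) ^ m"
      by (rule mod_mod_cancel) simp
    also have "\<dots> = (x (Suc m) mod int CARD('p) ^ m + y (Suc m) mod int CARD('p) ^ m) mod int CARD('p) ^ m"
      by (simp only: mod_add_eq)
    also have "\<dots> = (x m + y m) mod int CARD('p) ^ m" using x y by (simp add: padic_integers_def)
    finally show ?thesis .
  qed
  then show ?thesis using p by (simp add: padic_integers_def)
qed

text \<open>By the Hilbert-Smith property the continuous homomorphism \<open>f (expo g x)\<close> in
  \<open>x\<close> is not injective. If \<open>x\<close> and \<open>y\<close> have the same image,
  \<open>c\<close> is the power of \<open>g\<close> with exponent \<open>x - y = p^m t\<close>,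
  where \<open>t\<close> is a unit. With \<open>s\<close> inverse to \<open>t\<close> modulo
  \<open>p^i\<close>, the kernel element \<open>c [^] s\<close> agrees with
  \<open>g [^] (p^m)\<close> up to \<open>\<epsilon> ^ i\<close>; continuity and arbitrary
  \<open>i\<close> give the claim.\<close>

lemma kernel_contains_power:
  assumes T: "T = Metric_space.mtopology (carrier D) d" and hs: "hilbert_smith D T"
    and cont: "\<And>e. e > 0 \<Longrightarrow> \<exists>j. \<forall>h\<in>lev (\<epsilon> ^ j). len (f h) < e" and g: "g \<in> H"
  shows "\<exists>m. f (g [^] (CARD('p) ^ m)) = \<one>\<^bsub>D\<^esub>"
proof -
  let ?h = "\<lambda>x. f (expo g x)"
  have top: "topspace (padic_integers_top CARD('p)) = carrier (padic_integers CARD('p))" by (simp add: padic_integers_top_def)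
  have hom: "?h \<in> hom (padic_integers CARD('p)) D"
    unfolding hom_def using expo(1)[OF g] by (auto simp: expo_mult[OF g _ _ Zp_mult_closed])
  have "continuous_map (padic_integers_top CARD('p)) T ?h"
    unfolding T d.continuous_map_to_metric
  proof (intro ballI allI impI)
    fix x and e :: real assume "x \<in> topspace (padic_integers_top CARD('p))" and e: "e > 0"
    then have x: "x \<in> carrier (padic_integers CARD('p))" by (simp add: top)
    obtain j where j: "\<forall>h\<in>lev (\<epsilon> ^ j). len (f h) < e" using cont[OF e] by blast
    \<comment> \<open>The residue class of \<open>x\<close> modulo \<open>p^j\<close>, a basic
      neighbourhood in the inverse limit.\<close>
    let ?U = "carrier (padic_integers CARD('p)) \<inter> {y \<in> topspace (product_topology (\<lambda>n. discrete_topology UNIV) UNIV). y j \<in> {x j}}"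
    have "openin (product_topology (\<lambda>n. discrete_topology UNIV) UNIV)
        {y \<in> topspace (product_topology (\<lambda>n. discrete_topology UNIV) UNIV). y j \<in> {x j}}"
      by (rule openin_continuous_map_preimage[OF continuous_map_product_projection]) auto
    then have "openin (padic_integers_top CARD('p)) ?U"
      unfolding padic_integers_top_def by (rule openin_subtopology_Int2)
    moreover have "x \<in> ?U" using x by auto
    moreover have "?h y \<in> d.mball (?h x) e" if "y \<in> ?U" for y
    proof -
      have y: "y \<in> carrier (padic_integers CARD('p))" "y j = x j" using that by auto
      have "N (Y (expo g x) - Y (expo g y)) \<le> \<epsilon> ^ j"
        by (rule close_trans[OF expo(2)[OF g x, of j]]) (use expo(2)[OF g y(1), of j] y(2) in \<open>simp add: N_commute\<close>)
      then have "inv (expo g y) \<otimes> expo g x \<in> lev (\<epsilon> ^ j)"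
        using expo(1)[OF g x] expo(1)[OF g y(1)] by (simp add: lev_def N_inv_mult)
      then have "len (f (inv (expo g y) \<otimes> expo g x)) < e" using j by blast
      then have "d (?h x) (?h y) < e"
        using expo(1)[OF g x] expo(1)[OF g y(1)] by (simp add: d_eq_len)
      then show ?thesis using expo(1)[OF g x] expo(1)[OF g y(1)] by (simp add: d.mball_def)
    qed
    ultimately show "\<exists>U. openin (padic_integers_top CARD('p)) U \<and> x \<in> U \<and> (\<forall>y\<in>U. ?h y \<in> d.mball (?h x) e)" by blast
  qed
  with hom have "\<not> inj_on ?h (carrier (padic_integers CARD('p)))"
    using hs prime_card[where 'a = 'p] unfolding hilbert_smith_def by blast
  then obtain x y where xy: "x \<in> carrier (padic_integers CARD('p))" "y \<in> carrier (padic_integers CARD('p))" "?h x = ?h y" "x \<noteq> y" by (auto simp: inj_on_def)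
  have "\<exists>k. x k \<noteq> y k" using xy(4) by auto
  \<comment> \<open>The first level at which the residues differ. Level 0 consists of residues
    modulo 1, so \<open>M = Suc m\<close>, and \<open>m\<close> is the valuation of
    \<open>x - y\<close>.\<close>
  define M where "M = (LEAST k. x k \<noteq> y k)"
  have M: "x M \<noteq> y M" "\<And>k. k < M \<Longrightarrow> x k = y k"
    unfolding M_def using LeastI_ex[OF \<open>\<exists>k. x k \<noteq> y k\<close>] not_less_Least by blast+
  have "x 0 = y 0" using Zp_range[OF xy(1), of 0] Zp_range[OF xy(2), of 0] by simp
  then obtain m where m: "M = Suc m" using M(1) by (cases M) auto
  define c where "c = expo g x \<otimes> inv (expo g y)"
  have c: "c \<in> H" using expo(1)[OF g xy(1)] expo(1)[OF g xy(2)] by (simp add: c_def)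
  have fc: "f c = \<one>\<^bsub>D\<^esub>"
    using expo(1)[OF g xy(1)] expo(1)[OF g xy(2)] xy(3) by (simp add: c_def)
  have mod_lower: "[nat (z (i + k)) = nat (z i)] (mod CARD('p) ^ i)" if z: "z \<in> carrier (padic_integers CARD('p))" for z i k
  proof (induction k)
    case (Suc k)
    have "[nat (z (Suc (i + k))) = nat (z (i + k))] (mod CARD('p) ^ i)"
      by (rule cong_dvd_modulus_nat[OF Zp_Suc[OF z]]) (simp add: le_imp_power_dvd)
    then show ?case using Suc by (simp add: cong_def)
  qed simp
  have near: "\<exists>w\<in>H. f w = \<one>\<^bsub>D\<^esub> \<and> N (Y (g [^] (CARD('p) ^ m)) - Y w) \<le> \<epsilon> ^ i" if i: "i \<ge> M" for i
  proof -
    define a where "a = nat (x i)"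
    define bb where "bb = nat (y i)"
    \<comment> \<open>The residue of \<open>x - y\<close> modulo \<open>p^i\<close>; adding
      \<open>p^i\<close> keeps the subtraction within the naturals.\<close>
    define a' where "a' = a + CARD('p) ^ i - bb"
    have bb: "bb < CARD('p) ^ i" using Zp_range[OF xy(2), of i] by (simp add: bb_def nat_less_iff)
    have a'b: "a' + bb = a + CARD('p) ^ i" using bb by (simp add: a'_def)
    have c_near: "N (Y c - Y (g [^] a')) \<le> \<epsilon> ^ i"
    proof -
      have "c \<otimes> expo g y = expo g x" using expo(1)[OF g xy(1)] expo(1)[OF g xy(2)] by (simp add: c_def m_assoc)
      moreover have "N (Y (expo g x) - Y (g [^] (a' + bb))) \<le> \<epsilon> ^ i"
        by (rule close_trans[OF expo(2)[OF g xy(1), of i] pow_cong_norm[OF g]]) (simp add: a'b a_def cong_def)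
      moreover have "N (Y (g [^] (a' + bb)) - Y (g [^] a' \<otimes> expo g y)) \<le> \<epsilon> ^ i"
        using isometry_left[of "g [^] a'" "g [^] bb" "expo g y"] g expo(1)[OF g xy(2)] expo(2)[OF g xy(2), of i]
        by (simp add: nat_pow_mult[symmetric] bb_def N_commute)
      ultimately have "N (Y (c \<otimes> expo g y) - Y (g [^] a' \<otimes> expo g y)) \<le> \<epsilon> ^ i" using close_trans by metis
      then show ?thesis using isometry_right[of "expo g y" c "g [^] a'"] c g expo(1)[OF g xy(2)] by simp
    qed
    have "CARD('p) ^ m dvd a'" "\<not> CARD('p) ^ Suc m dvd a'"
    proof -
      have dvd_iff: "CARD('p) ^ k dvd a' \<longleftrightarrow> x k = y k" if "k \<le> i" for k
      proof -
        have "[a = nat (x k)] (mod CARD('p) ^ k)" "[bb = nat (y k)] (mod CARD('p) ^ k)"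
          using mod_lower[OF xy(1), of k "i - k"] mod_lower[OF xy(2), of k "i - k"] that by (auto simp: a_def bb_def)
        moreover have "nat (x k) < CARD('p) ^ k" "nat (y k) < CARD('p) ^ k"
          using Zp_range[OF xy(1), of k] Zp_range[OF xy(2), of k] by (auto simp: nat_less_iff)
        ultimately have ab: "a mod CARD('p) ^ k = nat (x k)" "bb mod CARD('p) ^ k = nat (y k)" by (auto simp: cong_def)
        have dv: "CARD('p) ^ k dvd CARD('p) ^ i" using that by (simp add: le_imp_power_dvd)
        have "CARD('p) ^ k dvd a' \<longleftrightarrow> [a' + bb = 0 + bb] (mod CARD('p) ^ k)" by (simp only: cong_add_rcancel_nat cong_0_iff)
        also have "\<dots> \<longleftrightarrow> [a = bb] (mod CARD('p) ^ k)" unfolding a'b using dv by (auto simp: cong_def mod_add_right_eq[symmetric] simp del: mod_add_right_eq)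
        also have "\<dots> \<longleftrightarrow> nat (x k) = nat (y k)" by (simp add: cong_def ab)
        also have "\<dots> \<longleftrightarrow> x k = y k" using Zp_range[OF xy(1), of k] Zp_range[OF xy(2), of k] by auto
        finally show ?thesis .
      qed
      show "CARD('p) ^ m dvd a'" "\<not> CARD('p) ^ Suc m dvd a'" using dvd_iff[of m] dvd_iff[of "Suc m"] M m i by auto
    qed
    then obtain t where t: "a' = CARD('p) ^ m * t" "\<not> CARD('p) dvd t" by (auto elim!: dvdE)
    have "coprime t (CARD('p) ^ i)"
    proof -
      have "coprime CARD('p) t" by (rule prime_imp_coprime[OF prime_card t(2)])
      then have "coprime t CARD('p)" by (simp only: coprime_commute)
      then show ?thesis by simp
    qed
    \<comment> \<open>Powers of \<open>g [^] a'\<close> with this exponent undo the unit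
      \<open>t\<close> up to precision \<open>i\<close>, which leaves
      \<open>g [^] (CARD('p) ^ m)\<close>.\<close>
    then obtain s where s: "[t * s = 1] (mod CARD('p) ^ i)" using cong_solve_coprime_nat[of t "CARD('p) ^ i"] by auto
    then have "[CARD('p) ^ m * (t * s) = CARD('p) ^ m * 1] (mod CARD('p) ^ i)" by (intro cong_mult cong_refl)
    then have "[a' * s = CARD('p) ^ m] (mod CARD('p) ^ i)" by (simp add: t(1) mult.assoc)
    from pow_cong_norm[OF g this] have "N (Y (g [^] (CARD('p) ^ m)) - Y ((g [^] a') [^] s)) \<le> \<epsilon> ^ i"
      using g by (simp add: nat_pow_pow N_commute)
    from close_trans[OF this] have "N (Y (g [^] (CARD('p) ^ m)) - Y (c [^] s)) \<le> \<epsilon> ^ i"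
      using pow_close[OF _ c, of "g [^] a'" "\<epsilon> ^ i" s] c_near g by (simp add: N_commute)
    moreover have "f (c [^] s) = \<one>\<^bsub>D\<^esub>" using c fc by (induction s) auto
    ultimately show ?thesis using c by (intro bexI[of _ "c [^] s"]) auto
  qed
  let ?z = "g [^] (CARD('p) ^ m)"
  have "len (f ?z) < e" if e: "e > 0" for e
  proof -
    obtain j where j: "\<forall>h\<in>lev (\<epsilon> ^ j). len (f h) < e" using cont[OF e] by blast
    obtain w where w: "w \<in> H" "f w = \<one>\<^bsub>D\<^esub>" "N (Y ?z - Y w) \<le> \<epsilon> ^ max j M" using near[of "max j M"] by auto
    have "\<epsilon> ^ max j M \<le> \<epsilon> ^ j" using eps by (intro power_decreasing) auto
    then have "inv w \<otimes> ?z \<in> lev (\<epsilon> ^ j)" using w g by (simp add: lev_def N_inv_mult)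
    then have "len (f (inv w \<otimes> ?z)) < e" using j by blast
    then show ?thesis using w g by simp
  qed
  then have "len (f ?z) \<le> 0" by (meson not_le order.irrefl)
  then have "len (f ?z) = 0" using len_nonneg[of "f ?z"] by simp
  then show ?thesis using len_eq_0[of "f ?z"] g by (intro exI[of _ m]) simp
qed

text \<open>The finitely many coordinate directions share one exponent \<open>M\<close>, so
  \<open>lev_subset_subgroup_mult\<close> approximates every element of
  \<open>lev (\<epsilon> ^ M)\<close> arbitrarily well by kernel elements; continuity then forces
  its image to have length zero.\<close>

lemma open_kernel:
  assumes T: "T = Metric_space.mtopology (carrier D) d" and hs: "hilbert_smith D T"
    and cont: "\<And>e. e > 0 \<Longrightarrow> \<exists>j. \<forall>h\<in>lev (\<epsilon> ^ j). len (f h) < e"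
  shows "\<exists>M. \<forall>h\<in>lev (\<epsilon> ^ M). f h = \<one>\<^bsub>D\<^esub>"
proof -
  have "\<exists>g m. g \<in> H \<and> Y g = unit_vec 1 i \<and> f (g [^] (CARD('p) ^ m)) = \<one>\<^bsub>D\<^esub>" if i: "i < n" for i
  proof -
    have "N (unit_vec 1 i) \<le> 1" using unit_vec_vnorm[of n "1 :: 'p padic" i] by (simp add: N_def)
    then obtain g where g: "g \<in> H" "Y g = unit_vec 1 i" using Y_surj[OF unit_vec_vspace[OF i, of 1]] by blast
    then show ?thesis using kernel_contains_power[OF T hs cont g(1)] by blast
  qed
  then obtain g m where g: "\<And>i. i < n \<Longrightarrow> g i \<in> H" "\<And>i. i < n \<Longrightarrow> Y (g i) = unit_vec 1 i"
    and m: "\<And>i. i < n \<Longrightarrow> f (g i [^] (CARD('p) ^ m i)) = \<one>\<^bsub>D\<^esub>" by metis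
  define M where "M = Max (insert 0 (m ` {..<n}))"
  have mM: "m i \<le> M" if "i < n" for i using that by (simp add: M_def)
  let ?K = "kernel G D f"
  have K: "subgroup ?K G" by (rule gh.subgroup_kernel)
  have gK: "g i [^] (CARD('p) ^ M) \<in> ?K" if i: "i < n" for i
  proof -
    have "CARD('p) ^ M = CARD('p) ^ m i * CARD('p) ^ (M - m i)" using mM[OF i] by (simp flip: power_add)
    then have "g i [^] (CARD('p) ^ M) = (g i [^] (CARD('p) ^ m i)) [^] (CARD('p) ^ (M - m i))"
      using g(1)[OF i] by (simp add: nat_pow_pow)
    moreover have "f (u [^] (k :: nat)) = \<one>\<^bsub>D\<^esub>" if "u \<in> H" "f u = \<one>\<^bsub>D\<^esub>" for u k
      using that by (induction k) auto
    ultimately show ?thesis using m[OF i] g(1)[OF i] by (simp add: kernel_def)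
  qed
  have "f h = \<one>\<^bsub>D\<^esub>" if h: "h \<in> lev (\<epsilon> ^ M)" for h
  proof -
    have hH: "h \<in> H" using h by (simp add: lev_def)
    have "len (f h) < e" if e: "e > 0" for e
    proof -
      obtain j where j: "\<forall>h\<in>lev (\<epsilon> ^ j). len (f h) < e" using cont[OF e] by blast
      obtain k where k: "k \<in> ?K" "inv k \<otimes> h \<in> lev (\<epsilon> ^ (M + j))"
        using lev_subset_subgroup_mult[OF K g gK h, of j] by blast
      have kG: "k \<in> carrier G" "f k = \<one>\<^bsub>D\<^esub>" using k(1) by (auto simp: kernel_def)
      have "\<epsilon> ^ (M + j) \<le> \<epsilon> ^ j" using eps by (intro power_decreasing) auto
      then have "inv k \<otimes> h \<in> lev (\<epsilon> ^ j)" using k(2) by (simp add: lev_def)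
      then have "len (f (inv k \<otimes> h)) < e" using j by blast
      then show ?thesis using kG hH by simp
    qed
    then have "len (f h) \<le> 0" by (meson not_le order.irrefl)
    then have "len (f h) = 0" using len_nonneg[of "f h"] by simp
    then show ?thesis using len_eq_0[of "f h"] hH by simp
  qed
  then show ?thesis by blast
qed

end

section \<open>Rescaled coordinates near the identity\<close>

definition scl :: "'p::prime_card padic \<Rightarrow> (nat \<Rightarrow> 'p padic) \<Rightarrow> nat \<Rightarrow> 'p padic" where
  "scl c u = (\<lambda>i. c * u i)"

lemma scl_simps: "vnorm n (scl c u) = padic_norm c * vnorm n u" "u \<in> vspace n \<Longrightarrow> scl c u \<in> vspace n"
    "scl c u - scl c v = scl c (u - v)" "scl c 0 = 0" "c \<noteq> 0 \<Longrightarrow> scl c (scl (inverse c) u) = u"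
    "c \<noteq> 0 \<Longrightarrow> scl (inverse c) (scl c u) = u" "scl c u i = c * u i"
  by (simp_all add: scl_def vnorm_scale vspace_scale fun_eq_iff right_diff_distrib)

text \<open>
  The second-order part \<open>F\<close> of a group law, a bilinear form whose coefficients vary with the point,
  is compared with the bilinear form \<open>F0\<close> obtained by freezing the coefficients at the origin.
\<close>

locale variable_form =
  fixes n :: nat and Gf :: "nat \<Rightarrow> nat \<Rightarrow> nat \<Rightarrow> (nat \<Rightarrow> 'p::prime_card padic) \<Rightarrow> (nat \<Rightarrow> 'p padic) \<Rightarrow> 'p padic"
    and S :: "(nat \<Rightarrow> 'p padic) set" and c :: real
  defines "S \<equiv> {v \<in> vspace n. vnorm n v \<le> 1}"
  assumes c: "0 \<le> c"
    and Gf_norm: "\<And>i j k u v. i < n \<Longrightarrow> j < n \<Longrightarrow> k < n \<Longrightarrow> u \<in> S \<Longrightarrow> v \<in> S \<Longrightarrow> padic_norm (Gf i j k u v) \<le> c"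
    and Gf_lipschitz: "\<And>i j k u v u' v'. i < n \<Longrightarrow> j < n \<Longrightarrow> k < n \<Longrightarrow> u \<in> S \<Longrightarrow> v \<in> S \<Longrightarrow> u' \<in> S \<Longrightarrow> v' \<in> S \<Longrightarrow>
      padic_norm (Gf i j k u v - Gf i j k u' v') \<le> c * max (vnorm n (u - u')) (vnorm n (v - v'))"
begin

definition F :: "(nat \<Rightarrow> 'p padic) \<Rightarrow> (nat \<Rightarrow> 'p padic) \<Rightarrow> nat \<Rightarrow> 'p padic" where
  "F u v = (\<lambda>i. if i < n then \<Sum>j<n. \<Sum>k<n. u j * v k * Gf i j k u v else 0)"

definition F0 :: "(nat \<Rightarrow> 'p padic) \<Rightarrow> (nat \<Rightarrow> 'p padic) \<Rightarrow> nat \<Rightarrow> 'p padic" where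
  "F0 u v = (\<lambda>i. if i < n then \<Sum>j<n. \<Sum>k<n. u j * v k * Gf i j k 0 0 else 0)"

text \<open>Telescoping of a triple product: \<open>u\<close>, then \<open>v\<close>, then the
  coefficient is changed. In the last change one of the factors \<open>u'\<close>, \<open>v'\<close>
  is estimated by 1, the choice depending on which argument varies more.\<close>

lemma F_lipschitz:
  assumes S: "u \<in> S" "v \<in> S" "u' \<in> S" "v' \<in> S"
  shows "vnorm n (F u v - F u' v') \<le>
    c * max (vnorm n (u - u') * max (vnorm n v) (vnorm n v')) (max (vnorm n u) (vnorm n u') * vnorm n (v - v'))"
    (is "_ \<le> c * max ?M1 ?M2")
  unfolding vnorm_le_iff
proof (intro conjI allI impI)
  have M: "0 \<le> ?M1" "0 \<le> ?M2" by (simp_all add: le_max_iff_disj)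
  then show "0 \<le> c * max ?M1 ?M2" using c by (simp add: le_max_iff_disj)
  fix i assume i: "i < n"
  have trm: "padic_norm (u j * v k * Gf i j k u v - u' j * v' k * Gf i j k u' v') \<le> c * max ?M1 ?M2"
    if j: "j < n" and k: "k < n" for j k
  proof -
    have n1: "padic_norm (u j - u' j) \<le> vnorm n (u - u')" "padic_norm (v k - v' k) \<le> vnorm n (v - v')"
      using padic_norm_le_vnorm[OF j, of "u - u'"] padic_norm_le_vnorm[OF k, of "v - v'"] by auto
    have n2: "padic_norm (v k) \<le> max (vnorm n v) (vnorm n v')" "padic_norm (u' j) \<le> max (vnorm n u) (vnorm n u')"
      "padic_norm (v' k) \<le> max (vnorm n v) (vnorm n v')"
      using padic_norm_le_vnorm[OF k, of v] padic_norm_le_vnorm[OF j, of u'] padic_norm_le_vnorm[OF k, of v'] by auto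
    have n3: "padic_norm (u' j) \<le> 1" "padic_norm (v' k) \<le> 1"
      using padic_norm_le_vnorm[OF j, of u'] padic_norm_le_vnorm[OF k, of v'] S by (auto simp: S_def)
    have mx: "0 \<le> max (vnorm n x) (vnorm n y)" for x y :: "nat \<Rightarrow> 'p padic" by (simp add: le_max_iff_disj)
    have "padic_norm ((u j - u' j) * v k * Gf i j k u v) \<le> ?M1 * c"
      unfolding padic_norm_mult using n1 n2 Gf_norm[OF i j k S(1,2)] mx by (intro mult_mono) auto
    then have 1: "padic_norm ((u j - u' j) * v k * Gf i j k u v) \<le> c * max ?M1 ?M2"
      using c by (auto intro: order_trans[OF _ mult_left_mono[OF max.cobounded1]] simp: mult.commute)
    have "padic_norm (u' j * (v k - v' k) * Gf i j k u v) \<le> ?M2 * c"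
      unfolding padic_norm_mult using n1 n2 Gf_norm[OF i j k S(1,2)] mx by (intro mult_mono) auto
    then have 2: "padic_norm (u' j * (v k - v' k) * Gf i j k u v) \<le> c * max ?M1 ?M2"
      using c by (auto intro: order_trans[OF _ mult_left_mono[OF max.cobounded2]] simp: mult.commute)
    have 3: "padic_norm (u' j * v' k * (Gf i j k u v - Gf i j k u' v')) \<le> c * max ?M1 ?M2"
    proof -
      have le: "padic_norm (u' j) * padic_norm (v' k) * max (vnorm n (u - u')) (vnorm n (v - v')) \<le> max ?M1 ?M2"
      proof (cases "vnorm n (v - v') \<le> vnorm n (u - u')")
        case True
        have "padic_norm (u' j) * padic_norm (v' k) * vnorm n (u - u') \<le> 1 * max (vnorm n v) (vnorm n v') * vnorm n (u - u')"
          using n2 n3 mx by (intro mult_mono) auto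
        then show ?thesis using True by (simp add: max_absorb1 le_max_iff_disj mult.commute)
      next
        case False
        have "padic_norm (u' j) * padic_norm (v' k) * vnorm n (v - v') \<le> max (vnorm n u) (vnorm n u') * 1 * vnorm n (v - v')"
          using n2 n3 mx by (intro mult_mono) auto
        then show ?thesis using False by (simp add: max_absorb2 le_max_iff_disj)
      qed
      have "padic_norm (u' j * v' k * (Gf i j k u v - Gf i j k u' v'))
          \<le> padic_norm (u' j) * padic_norm (v' k) * (c * max (vnorm n (u - u')) (vnorm n (v - v')))"
        unfolding padic_norm_mult by (intro mult_left_mono Gf_lipschitz[OF i j k S]) simp
      also have "\<dots> = c * (padic_norm (u' j) * padic_norm (v' k) * max (vnorm n (u - u')) (vnorm n (v - v')))" by simp
      also have "\<dots> \<le> c * max ?M1 ?M2" by (rule mult_left_mono[OF le c])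
      finally show ?thesis .
    qed
    have "u j * v k * Gf i j k u v - u' j * v' k * Gf i j k u' v' =
      (u j - u' j) * v k * Gf i j k u v + u' j * (v k - v' k) * Gf i j k u v + u' j * v' k * (Gf i j k u v - Gf i j k u' v')"
      by (simp add: algebra_simps)
    then show ?thesis using padic_norm_add_le[OF padic_norm_add_le[OF 1 2] 3] by simp
  qed
  have "(F u v - F u' v') i = (\<Sum>j<n. \<Sum>k<n. u j * v k * Gf i j k u v - u' j * v' k * Gf i j k u' v')"
    using i by (simp add: F_def sum_subtractf)
  then show "padic_norm ((F u v - F u' v') i) \<le> c * max ?M1 ?M2"
    using trm c M by (auto intro!: padic_norm_sum_le simp: le_max_iff_disj)
qed

lemma zero_S: "0 \<in> S" by (simp add: S_def)

lemma F_right: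
  assumes S: "u \<in> S" "v \<in> S" "v' \<in> S"
  shows "vnorm n (F u v - F0 u v - (F u v' - F0 u v')) \<le> c * (vnorm n u * max (vnorm n u) (max (vnorm n v) (vnorm n v')) * vnorm n (v - v'))"
    and "vnorm n (F v u - F0 v u - (F v' u - F0 v' u)) \<le> c * (vnorm n u * max (vnorm n u) (max (vnorm n v) (vnorm n v')) * vnorm n (v - v'))"
proof -
  let ?m = "max (vnorm n u) (max (vnorm n v) (vnorm n v'))"
  let ?R = "c * (vnorm n u * ?m * vnorm n (v - v'))"
  have m: "0 \<le> ?m" by (simp add: le_max_iff_disj)
  have R: "0 \<le> ?R" using c m by simp
  have bnd: "padic_norm (x * (y - y') * a) \<le> ?R" "padic_norm (x * y' * b) \<le> ?R"
    if "padic_norm x \<le> vnorm n u" "padic_norm (y - y') \<le> vnorm n (v - v')" "padic_norm y' \<le> vnorm n v'"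
      "padic_norm a \<le> c * max (vnorm n u) (vnorm n v)" "padic_norm b \<le> c * vnorm n (v - v')" for x y y' a b
  proof -
    have "padic_norm (x * (y - y') * a) \<le> vnorm n u * vnorm n (v - v') * (c * ?m)"
    proof -
      have "padic_norm a \<le> c * ?m" by (rule order_trans[OF that(4) mult_left_mono[OF _ c]]) auto
      then show ?thesis unfolding padic_norm_mult using that m c by (intro mult_mono) auto
    qed
    then show "padic_norm (x * (y - y') * a) \<le> ?R" by (simp add: mult_ac)
    have "padic_norm (x * y' * b) \<le> vnorm n u * ?m * (c * vnorm n (v - v'))"
    proof -
      have "padic_norm y' \<le> ?m" using that(3) by (auto simp: le_max_iff_disj)
      then show ?thesis unfolding padic_norm_mult using that m c by (intro mult_mono) auto
    qed
    then show "padic_norm (x * y' * b) \<le> ?R" by (simp add: mult_ac)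
  qed
  have comp: "padic_norm (u j) \<le> vnorm n u" "padic_norm (v j - v' j) \<le> vnorm n (v - v')" "padic_norm (v' j) \<le> vnorm n v'"
    if "j < n" for j
    using padic_norm_le_vnorm[OF that, of u] padic_norm_le_vnorm[OF that, of "v - v'"] padic_norm_le_vnorm[OF that, of v'] by auto
  have mx0: "max 0 (vnorm n x) = vnorm n x" "max (vnorm n x) 0 = vnorm n x" for x :: "nat \<Rightarrow> 'p padic" by (simp_all add: max_absorb2 max_absorb1)
  have nd: "vnorm n (u - u) = 0" by simp
  show "vnorm n (F u v - F0 u v - (F u v' - F0 u v')) \<le> ?R"
    unfolding vnorm_le_iff
  proof (intro conjI allI impI R)
    fix i assume i: "i < n"
    have trm: "padic_norm (u j * v k * (Gf i j k u v - Gf i j k 0 0) - u j * v' k * (Gf i j k u v' - Gf i j k 0 0)) \<le> ?R"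
      if j: "j < n" and k: "k < n" for j k
    proof -
      have "padic_norm (Gf i j k u v - Gf i j k 0 0) \<le> c * max (vnorm n u) (vnorm n v)"
        using Gf_lipschitz[OF i j k S(1,2) zero_S zero_S] by simp
      moreover have "padic_norm (Gf i j k u v - Gf i j k u v') \<le> c * vnorm n (v - v')"
        using Gf_lipschitz[OF i j k S(1,2,1,3)] unfolding nd mx0 .
      ultimately have "padic_norm (u j * (v k - v' k) * (Gf i j k u v - Gf i j k 0 0) + u j * v' k * (Gf i j k u v - Gf i j k u v')) \<le> ?R"
        using comp[OF j] comp[OF k] by (intro padic_norm_add_le bnd)
      then show ?thesis by (simp add: algebra_simps)
    qed
    have "(F u v - F0 u v - (F u v' - F0 u v')) i = (\<Sum>j<n. \<Sum>k<n. u j * v k * (Gf i j k u v - Gf i j k 0 0) - u j * v' k * (Gf i j k u v' - Gf i j k 0 0))"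
      using i by (simp add: F_def F0_def sum_subtractf right_diff_distrib)
    then show "padic_norm ((F u v - F0 u v - (F u v' - F0 u v')) i) \<le> ?R"
      using trm R by (simp only:) (intro padic_norm_sum_le; simp)
  qed
  show "vnorm n (F v u - F0 v u - (F v' u - F0 v' u)) \<le> ?R"
    unfolding vnorm_le_iff
  proof (intro conjI allI impI R)
    fix i assume i: "i < n"
    have trm: "padic_norm (v j * u k * (Gf i j k v u - Gf i j k 0 0) - v' j * u k * (Gf i j k v' u - Gf i j k 0 0)) \<le> ?R"
      if j: "j < n" and k: "k < n" for j k
    proof -
      have "padic_norm (Gf i j k v u - Gf i j k 0 0) \<le> c * max (vnorm n u) (vnorm n v)"
        using Gf_lipschitz[OF i j k S(2,1) zero_S zero_S] by (simp add: max.commute)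
      moreover have "padic_norm (Gf i j k v u - Gf i j k v' u) \<le> c * vnorm n (v - v')"
        using Gf_lipschitz[OF i j k S(2,1,3,1)] unfolding nd mx0 .
      ultimately have "padic_norm (u k * (v j - v' j) * (Gf i j k v u - Gf i j k 0 0) + u k * v' j * (Gf i j k v u - Gf i j k v' u)) \<le> ?R"
        using comp[OF j] comp[OF k] by (intro padic_norm_add_le bnd)
      then show ?thesis by (simp add: algebra_simps)
    qed
    have "(F v u - F0 v u - (F v' u - F0 v' u)) i = (\<Sum>j<n. \<Sum>k<n. v j * u k * (Gf i j k v u - Gf i j k 0 0) - v' j * u k * (Gf i j k v' u - Gf i j k 0 0))"
      using i by (simp add: F_def F0_def sum_subtractf right_diff_distrib)
    then show "padic_norm ((F v u - F0 v u - (F v' u - F0 v' u)) i) \<le> ?R"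
      using trm R by (simp only:) (intro padic_norm_sum_le; simp)
  qed
qed

lemma F0_norm: "vnorm n (F0 u v) \<le> c * (vnorm n u * vnorm n v)"
  unfolding vnorm_le_iff
proof (intro conjI allI impI)
  show "0 \<le> c * (vnorm n u * vnorm n v)" using c by simp
  fix i assume i: "i < n"
  have "padic_norm (u j * v k * Gf i j k 0 0) \<le> c * (vnorm n u * vnorm n v)" if jk: "j < n" "k < n" for j k
  proof -
    have "padic_norm (u j * v k * Gf i j k 0 0) \<le> vnorm n u * vnorm n v * c"
      unfolding padic_norm_mult using Gf_norm[OF i jk zero_S zero_S] c
      by (intro mult_mono padic_norm_le_vnorm jk) auto
    then show ?thesis by (simp add: mult_ac)
  qed
  then show "padic_norm (F0 u v i) \<le> c * (vnorm n u * vnorm n v)"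
    using i c by (simp add: F0_def) (intro padic_norm_sum_le; simp)
qed

lemma F_zero: "F 0 v = 0" "F u 0 = 0" by (auto simp: F_def fun_eq_iff)

end

text \<open>A basis of \<open>S\<close> stays independent when \<open>e\<close> is added, so a
  functional may be prescribed as 1 on \<open>e\<close> and 0 on the basis.\<close>

lemma separating_functional:
  fixes smul :: "'k::field \<Rightarrow> 'v::ab_group_add \<Rightarrow> 'v"
  assumes "vector_space smul" and S: "module.subspace smul S" and e: "e \<notin> S"
  obtains \<Lambda> where "\<And>x y. \<Lambda> (x + y) = \<Lambda> x + \<Lambda> y" "\<And>c x. \<Lambda> (smul c x) = c * \<Lambda> x" "\<And>x. x \<in> S \<Longrightarrow> \<Lambda> x = 0" "\<Lambda> e = 1"
proof -
  interpret vs: vector_space smul by (rule assms(1))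
  interpret vp: vector_space_pair smul "(*) :: 'k \<Rightarrow> 'k \<Rightarrow> 'k"
    by unfold_locales (auto simp: algebra_simps)
  obtain B where B: "B \<subseteq> S" "vs.independent B" "S \<subseteq> vs.span B" by (rule vs.maximal_independent_subset)
  have "vs.span B \<subseteq> S" using vs.span_minimal[OF B(1) S] .
  then have nB: "e \<notin> vs.span B" using e by blast
  then have eB: "e \<notin> B" using vs.span_base by blast
  with nB B(2) have ind: "vs.independent (insert e B)" by (simp add: vs.independent_insert)
  obtain \<Lambda> where \<Lambda>: "Vector_Spaces.linear smul (*) \<Lambda>" "\<forall>x\<in>insert e B. \<Lambda> x = (if x = e then 1 else 0)"
    using vp.linear_independent_extend[OF ind, of "\<lambda>x. if x = e then 1 else 0"] by blast
  interpret \<Lambda>: Vector_Spaces.linear smul "(*)" \<Lambda> by (rule \<Lambda>(1))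
  show ?thesis
  proof (rule that[of \<Lambda>])
    show "\<Lambda> x = 0" if "x \<in> S" for x
    proof (rule \<Lambda>.eq_0_on_span[of B])
      show "\<Lambda> y = 0" if "y \<in> B" for y using \<Lambda>(2) eB that by auto
    qed (use B(3) that in blast)
  qed (use \<Lambda> \<Lambda>.add \<Lambda>.scale in auto)
qed

section \<open>The rescaled chart as a standard group, and spanning brackets\<close>

context lie_local
begin

text \<open>The ball that \<open>Yk k\<close> stretches to the unit ball. Dividing coordinates by
  \<open>\<pi> ^ k\<close> multiplies the second-order part of the law by \<open>\<pi> ^ k\<close>,
  which makes it divisible by \<open>p\<close> squared once \<open>k\<close> is large.\<close>

definition Hk :: "nat \<Rightarrow> 'g set" where
  "Hk k = {x \<in> V. vnorm n (cd x) \<le> padic_norm (\<pi> ^ k :: 'p padic)}"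

definition Yk :: "nat \<Rightarrow> 'g \<Rightarrow> nat \<Rightarrow> 'p padic" where
  "Yk k x = scl (inverse (\<pi> ^ k)) (cd x)"

lemma cd_Yk: "cd x = scl (\<pi> ^ k) (Yk k x)"
  by (simp add: Yk_def scl_simps)

lemma Yk_norm: "vnorm n (Yk k x) \<le> r \<longleftrightarrow> vnorm n (cd x) \<le> padic_norm (\<pi> ^ k :: 'p padic) * r"
proof -
  have "0 < padic_norm (\<pi> ^ k :: 'p padic)" by simp
  moreover have "vnorm n (Yk k x) = vnorm n (cd x) / padic_norm (\<pi> ^ k :: 'p padic)"
    unfolding Yk_def scl_simps(1) padic_norm_inverse by (rule mult.commute[THEN trans]) (rule divide_inverse[symmetric])
  ultimately show ?thesis by (simp only: pos_divide_le_eq mult.commute)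
qed

text \<open>Assumption \<open>kL\<close> bounds the rescaled coefficients and their Lipschitz
  constants by the square of the norm of \<open>\<pi>\<close>, with \<open>2 * L / \<rho>\<close>
  coming from \<open>pser_lipschitz\<close>. Assumption \<open>inv_k\<close> places inverses in the
  chart with norm below \<open>r1\<close>; the law then shows that an element and its inverse have
  the same norm, so that \<open>Hk k\<close> is a subgroup.\<close>

lemma std_group_scaled:
  assumes k: "padic_norm (\<pi> ^ k :: 'p padic) < \<rho>"
    and kL: "padic_norm (\<pi> ^ k :: 'p padic) * max L (2 * L / \<rho> * padic_norm (\<pi> ^ k :: 'p padic)) \<le> (padic_norm (\<pi> :: 'p padic))\<^sup>2"
    and inv_k: "\<And>x. x \<in> Hk k \<Longrightarrow> inv x \<in> V \<and> vnorm n (cd (inv x)) < r1" and r1: "0 < r1" "r1 \<le> \<rho>" "L * r1 < 1"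
  shows "std_group G n (Hk k) (Yk k) (\<lambda>u v i. \<pi> ^ k * bil u v i)"
proof -
  let ?p = "\<pi> ^ k :: 'p padic"
  define \<sigma> where "\<sigma> = padic_norm ?p"
  have \<sigma>: "0 < \<sigma>" "\<sigma> < \<rho>" using k by (auto simp: \<sigma>_def)
  have \<rho>0: "0 < \<rho>" using \<rho> by simp
  have eps1: "(padic_norm (\<pi> :: 'p padic))\<^sup>2 \<le> 1" by (rule power_le_one) (auto intro: less_imp_le)
  have x: "cd x \<in> vspace n" "vnorm n (cd x) < \<rho>" "x \<in> carrier G" "pt (cd x) = x" if "x \<in> Hk k" for x
    using that \<sigma> cd_vspace V_carrier by (auto simp: Hk_def \<sigma>_def)
  \<comment> \<open>Inserting \<open>\<pi> ^ k * u\<close> and \<open>\<pi> ^ k * v\<close> into the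
    second-order term and dividing by \<open>\<pi> ^ k\<close> leaves one factor
    \<open>\<pi> ^ k\<close>.\<close>
  define Gf where "Gf i j l u v = ?p * g i j l (join n (scl ?p u) (scl ?p v))" for i j l u v
  define c where "c = (padic_norm (\<pi> :: 'p padic))\<^sup>2"
  have jn: "join n (scl ?p u) (scl ?p v) \<in> vspace (n + n)" "vnorm (n + n) (join n (scl ?p u) (scl ?p v)) < \<rho>"
    if "u \<in> vspace n" "v \<in> vspace n" "vnorm n u \<le> 1" "vnorm n v \<le> 1" for u v
  proof -
    show "join n (scl ?p u) (scl ?p v) \<in> vspace (n + n)" using that by (intro join_vspace scl_simps)
    have "\<sigma> * vnorm n u \<le> \<sigma> * 1" "\<sigma> * vnorm n v \<le> \<sigma> * 1" using that \<sigma> by (intro mult_left_mono; simp)+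
    then have "\<sigma> * vnorm n u < \<rho>" "\<sigma> * vnorm n v < \<rho>" using \<sigma> by linarith+
    then show "vnorm (n + n) (join n (scl ?p u) (scl ?p v)) < \<rho>"
      by (simp only: vnorm_join scl_simps(1) \<sigma>_def[symmetric] max_less_iff_conj)
  qed
  have L0: "0 \<le> L" if "0 < n" using pser_nonneg[OF g_pser[of 0 0 0]] that by simp
  have kL': "\<sigma> * L \<le> c" "\<sigma> * (2 * L / \<rho> * \<sigma>) \<le> c"
    using kL \<sigma> mult_left_mono[of L "max L (2 * L / \<rho> * \<sigma>)" \<sigma>] mult_left_mono[of "2 * L / \<rho> * \<sigma>" "max L (2 * L / \<rho> * \<sigma>)" \<sigma>]
    unfolding c_def \<sigma>_def[symmetric] by linarith+
  interpret vf: variable_form n Gf "{v \<in> vspace n. vnorm n v \<le> 1}" c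
  proof (unfold_locales)
    show "0 \<le> c" by (simp add: c_def)
    fix i j l and u v :: "nat \<Rightarrow> 'p padic" assume ijl: "i < n" "j < n" "l < n" and uv: "u \<in> {v \<in> vspace n. vnorm n v \<le> 1}" "v \<in> {v \<in> vspace n. vnorm n v \<le> 1}"
    have "padic_norm (g i j l (join n (scl ?p u) (scl ?p v))) \<le> L"
      by (rule pser_bound[OF g_pser[OF ijl] jn]) (use uv in auto)
    then have "padic_norm (Gf i j l u v) \<le> \<sigma> * L"
      unfolding Gf_def padic_norm_mult \<sigma>_def by (intro mult_left_mono) auto
    then show "padic_norm (Gf i j l u v) \<le> c" using kL' by linarith
    fix u' v' :: "nat \<Rightarrow> 'p padic" assume uv': "u' \<in> {v \<in> vspace n. vnorm n v \<le> 1}" "v' \<in> {v \<in> vspace n. vnorm n v \<le> 1}"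
    let ?m = "max (vnorm n (u - u')) (vnorm n (v - v'))"
    have "padic_norm (g i j l (join n (scl ?p u) (scl ?p v)) - g i j l (join n (scl ?p u') (scl ?p v')))
        \<le> 2 * L / \<rho> * vnorm (n + n) (join n (scl ?p u) (scl ?p v) - join n (scl ?p u') (scl ?p v'))"
      by (rule pser_lipschitz[OF g_pser[OF ijl] jn jn]) (use uv uv' in auto)
    also have "vnorm (n + n) (join n (scl ?p u) (scl ?p v) - join n (scl ?p u') (scl ?p v')) = \<sigma> * ?m"
      using \<sigma> by (simp add: join_diff vnorm_join scl_simps \<sigma>_def[symmetric] max_mult_distrib_left)
    finally have "\<sigma> * padic_norm (g i j l (join n (scl ?p u) (scl ?p v)) - g i j l (join n (scl ?p u') (scl ?p v'))) \<le> \<sigma> * (2 * L / \<rho> * (\<sigma> * ?m))"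
      using \<sigma> by (intro mult_left_mono) auto
    moreover have "Gf i j l u v - Gf i j l u' v' = ?p * (g i j l (join n (scl ?p u) (scl ?p v)) - g i j l (join n (scl ?p u') (scl ?p v')))"
      by (simp add: Gf_def right_diff_distrib)
    then have "padic_norm (Gf i j l u v - Gf i j l u' v') = \<sigma> * padic_norm (g i j l (join n (scl ?p u) (scl ?p v)) - g i j l (join n (scl ?p u') (scl ?p v')))"
      by (simp only: padic_norm_mult \<sigma>_def)
    moreover have "\<sigma> * (2 * L / \<rho> * \<sigma>) * ?m \<le> c * ?m" using kL' by (intro mult_right_mono) (auto simp: le_max_iff_disj)
    ultimately show "padic_norm (Gf i j l u v - Gf i j l u' v') \<le> c * ?m" by (simp add: mult.assoc)
  qed
  have Y_S: "Yk k x \<in> {v \<in> vspace n. vnorm n v \<le> 1}" if h: "x \<in> Hk k" for x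
    using h x(1)[OF h] by (simp add: Yk_norm Hk_def) (simp add: Yk_def scl_simps)
  have prod: "x \<otimes> y \<in> V" "Yk k (x \<otimes> y) - Yk k x - Yk k y = vf.F (Yk k x) (Yk k y)" if h: "x \<in> Hk k" "y \<in> Hk k" for x y
  proof -
    show xy: "x \<otimes> y \<in> V" using law_B[OF x(1)[OF h(1)] x(1)[OF h(2)] x(2)[OF h(1)] x(2)[OF h(2)]] x(4)[OF h(1)] x(4)[OF h(2)] by (simp add: B_def)
    show "Yk k (x \<otimes> y) - Yk k x - Yk k y = vf.F (Yk k x) (Yk k y)"
    proof
      fix i
      show "(Yk k (x \<otimes> y) - Yk k x - Yk k y) i = vf.F (Yk k x) (Yk k y) i"
      proof (cases "i < n")
        case True
        have "cd (x \<otimes> y) i - cd x i - cd y i = (\<Sum>j<n. cd x j * (\<Sum>l<n. cd y l * g i j l (join n (cd x) (cd y))))"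
          using law[OF x(1)[OF h(1)] x(1)[OF h(2)] x(2)[OF h(1)] x(2)[OF h(2)] True] x(4)[OF h(1)] x(4)[OF h(2)] by simp
        also have "\<dots> = ?p * (\<Sum>j<n. \<Sum>l<n. Yk k x j * Yk k y l * Gf i j l (Yk k x) (Yk k y))"
          unfolding Gf_def cd_Yk[of x k, symmetric] cd_Yk[of y k, symmetric] sum_distrib_left
        proof (intro sum.cong refl)
          fix j l
          show "cd x j * (cd y l * g i j l (join n (cd x) (cd y))) = ?p * (Yk k x j * Yk k y l * (?p * g i j l (join n (cd x) (cd y))))"
            using arg_cong[OF cd_Yk[of x k], of "\<lambda>f. f j"] arg_cong[OF cd_Yk[of y k], of "\<lambda>f. f l"] by (simp add: scl_simps)
        qed
        finally have e: "cd (x \<otimes> y) i - cd x i - cd y i = ?p * vf.F (Yk k x) (Yk k y) i" using True by (simp add: vf.F_def)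
        have "(Yk k (x \<otimes> y) - Yk k x - Yk k y) i = inverse ?p * (cd (x \<otimes> y) i - cd x i - cd y i)"
          by (simp add: Yk_def scl_simps right_diff_distrib)
        also have "\<dots> = vf.F (Yk k x) (Yk k y) i" unfolding e by (simp flip: mult.assoc)
        finally show ?thesis .
      next
        case False
        then show ?thesis using vspaceD[OF cd_vspace[OF xy], of i] vspaceD[OF x(1)[OF h(1)], of i] vspaceD[OF x(1)[OF h(2)], of i]
          by (simp add: Yk_def scl_simps vf.F_def)
      qed
    qed
  qed
  have c1: "c \<le> 1" using eps1 by (simp add: c_def)
  have mult_H: "x \<otimes> y \<in> Hk k" if h: "x \<in> Hk k" "y \<in> Hk k" for x y
  proof -
    have Yx: "vnorm n (Yk k x) \<le> 1" "vnorm n (Yk k y) \<le> 1" using Y_S h by auto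
    have "vnorm n (vf.F (Yk k x) (Yk k y) - vf.F 0 (Yk k y)) \<le> c * max (vnorm n (Yk k x - 0) * max (vnorm n (Yk k y)) (vnorm n (Yk k y))) (max (vnorm n (Yk k x)) (vnorm n (0 :: nat \<Rightarrow> 'p padic)) * vnorm n (Yk k y - Yk k y))"
      by (rule vf.F_lipschitz) (use Y_S h vf.zero_S in auto)
    also have "\<dots> = c * (vnorm n (Yk k x) * vnorm n (Yk k y))" by (simp add: max_absorb1)
    also have "\<dots> \<le> 1 * (1 * 1)" using c1 Yx by (intro mult_mono) (auto simp: c_def)
    finally have "vnorm n (vf.F (Yk k x) (Yk k y)) \<le> 1" by (simp add: vf.F_zero)
    then have "vnorm n (Yk k x + Yk k y + vf.F (Yk k x) (Yk k y)) \<le> 1" using Yx by (intro vnorm_add_le)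
    moreover have "Yk k x + Yk k y + vf.F (Yk k x) (Yk k y) = Yk k (x \<otimes> y)" using prod(2)[OF h] by (simp add: algebra_simps)
    ultimately have "vnorm n (Yk k (x \<otimes> y)) \<le> 1" by simp
    then show ?thesis using prod(1)[OF h] by (simp add: Yk_norm Hk_def)
  qed
  have inv_H: "inv x \<in> Hk k" if h: "x \<in> Hk k" for x
  proof -
    let ?y = "inv x"
    have y: "?y \<in> V" "vnorm n (cd ?y) < r1" using inv_k[OF h] by auto
    have yv: "cd ?y \<in> vspace n" "vnorm n (cd ?y) < \<rho>" using y r1 cd_vspace by auto
    \<comment> \<open>The second-order part of the law for \<open>x\<close> and its inverse. Its
      norm is at most \<open>L * r1 < 1\<close> times that of \<open>cd x\<close>, so
      \<open>cd ?y = - (cd x + Q)\<close> has the norm of \<open>cd x\<close>.\<close>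
    define Q where "Q = (\<lambda>i. if i < n then \<Sum>j<n. cd x j * (\<Sum>l<n. cd ?y l * g i j l (join n (cd x) (cd ?y))) else 0)"
    have xy: "x \<otimes> ?y = \<one>" using x(3)[OF h] by simp
    have "cd ?y = - (cd x + Q)"
    proof
      fix i
      show "cd ?y i = (- (cd x + Q)) i"
      proof (cases "i < n")
        case True
        have "0 = cd x i + cd ?y i + Q i"
          using law[OF x(1)[OF h] yv(1) x(2)[OF h] yv(2) True] x(4)[OF h] y(1) True by (simp add: xy Q_def)
        then have "cd ?y i + (cd x i + Q i) = 0" by (simp only: ac_simps)
        then show ?thesis by (simp only: eq_neg_iff_add_eq_0 fun_Compl_def plus_fun_def)
      next
        case False
        then show ?thesis using vspaceD[OF yv(1), of i] vspaceD[OF x(1)[OF h], of i] by (simp add: Q_def)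
      qed
    qed
    moreover have "vnorm n (cd x + Q) = vnorm n (cd x)"
    proof (cases "n = 0")
      case True
      then have v0: "vnorm n v = 0" for v :: "nat \<Rightarrow> 'p padic" by (intro antisym) (auto simp: vnorm_le_iff)
      show ?thesis by (simp only: v0)
    next
      case False
      then have L: "0 \<le> L" using L0 by simp
      show ?thesis
      proof (rule vnorm_add_eq[OF _ r1(3)])
        show "vnorm n Q \<le> L * r1 * vnorm n (cd x)"
          unfolding vnorm_le_iff
        proof (intro conjI allI impI)
          show pos: "0 \<le> L * r1 * vnorm n (cd x)" using L r1 by simp
          fix i assume i: "i < n"
          have "padic_norm (cd x j * (cd ?y l * g i j l (join n (cd x) (cd ?y)))) \<le> L * r1 * vnorm n (cd x)" if jl: "j < n" "l < n" for j l
          proof -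
            have "padic_norm (g i j l (join n (cd x) (cd ?y))) \<le> L"
              by (rule pser_bound[OF g_pser[OF i jl]]) (use x(1,2)[OF h] yv in \<open>auto simp: vnorm_join intro: join_vspace\<close>)
            moreover have "padic_norm (cd ?y l) \<le> r1" using padic_norm_le_vnorm[OF jl(2), of "cd ?y"] y(2) by simp
            ultimately have "padic_norm (cd x j) * (padic_norm (cd ?y l) * padic_norm (g i j l (join n (cd x) (cd ?y)))) \<le> vnorm n (cd x) * (r1 * L)"
              using L r1 by (intro mult_mono padic_norm_le_vnorm[OF jl(1)]) auto
            then show ?thesis by (simp add: padic_norm_mult mult_ac)
          qed
          then show "padic_norm (Q i) \<le> L * r1 * vnorm n (cd x)"
            using i pos by (simp add: Q_def sum_distrib_left) (intro padic_norm_sum_le; simp)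
        qed
      qed
    qed
    ultimately have "vnorm n (cd ?y) = vnorm n (cd x)" by (metis vnorm_minus)
    then show ?thesis using y(1) h by (simp add: Hk_def)
  qed
  have one_H: "\<one> \<in> Hk k" by (simp add: Hk_def one_V)
  have bij: "bij_betw (Yk k) (Hk k) {v \<in> vspace n. vnorm n v \<le> 1}"
  proof (rule bij_betwI[where g = "\<lambda>v. pt (scl ?p v)"])
    show "Yk k \<in> Hk k \<rightarrow> {v \<in> vspace n. vnorm n v \<le> 1}" using Y_S by auto
    have v: "scl ?p v \<in> vspace n" "vnorm n (scl ?p v) \<le> \<sigma>" "vnorm n (scl ?p v) < r0" if "v \<in> {v \<in> vspace n. vnorm n v \<le> 1}" for v
    proof -
      show "scl ?p v \<in> vspace n" using that by (intro scl_simps) auto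
      have "\<sigma> * vnorm n v \<le> \<sigma> * 1" using that \<sigma> by (intro mult_left_mono) auto
      then show "vnorm n (scl ?p v) \<le> \<sigma>" "vnorm n (scl ?p v) < r0"
        unfolding scl_simps(1) \<sigma>_def[symmetric] using \<sigma> \<rho> by linarith+
    qed
    show "(\<lambda>v. pt (scl ?p v)) \<in> {v \<in> vspace n. vnorm n v \<le> 1} \<rightarrow> Hk k"
      using pt_ball v by (fastforce simp: Hk_def \<sigma>_def)
    show "pt (scl ?p (Yk k x)) = x" if "x \<in> Hk k" for x using x(4)[OF that] by (simp flip: cd_Yk)
    show "Yk k (pt (scl ?p v)) = v" if "v \<in> {v \<in> vspace n. vnorm n v \<le> 1}" for v
      using pt_ball(2)[OF v(1,3)[OF that]] by (simp add: Yk_def scl_simps)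
  qed
  have F0_eq: "(\<lambda>i. ?p * bil u v i) = vf.F0 u v" for u v
    by (auto simp: bil_def vf.F0_def Gf_def struct_def scl_simps join_0 fun_eq_iff sum_distrib_left mult_ac)
  have c2: "c * t \<le> t" if "0 \<le> t" for t using mult_right_mono[OF c1 that] by simp
  have bil_add: "bil (u + v) w = bil u w + bil v w" "bil u (v + w) = bil u v + bil u w" for u v w
    by (auto simp: bil_def fun_eq_iff distrib_left distrib_right sum.distrib)
  have bil_scale: "bil (\<lambda>i. a * u i) v = (\<lambda>i. a * bil u v i)" "bil u (\<lambda>i. a * v i) = (\<lambda>i. a * bil u v i)" for a u v
    by (auto simp: bil_def fun_eq_iff sum_distrib_left mult_ac)
  show ?thesis
  proof (intro std_group.intro std_group_axioms.intro)
    show "group G" by (rule is_group)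
    show "subgroup (Hk k) G"
      by (rule subgroupI) (use one_H mult_H inv_H x(3) in auto)
    show "bij_betw (Yk k) (Hk k) {v \<in> vspace n. vnorm n v \<le> 1}" by (rule bij)
    show "Yk k \<one> = 0" by (simp add: Yk_def scl_simps)
    fix a a' h h' assume m: "a \<in> Hk k" "a' \<in> Hk k" "h \<in> Hk k" "h' \<in> Hk k"
    show "vnorm n (Yk k (a \<otimes> h) - Yk k a - Yk k h - (Yk k (a' \<otimes> h') - Yk k a' - Yk k h'))
       \<le> (padic_norm (\<pi> :: 'p padic))\<^sup>2 * max (vnorm n (Yk k a - Yk k a') * max (vnorm n (Yk k h)) (vnorm n (Yk k h')))
            (max (vnorm n (Yk k a)) (vnorm n (Yk k a')) * vnorm n (Yk k h - Yk k h'))"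
      unfolding prod(2)[OF m(1,3)] prod(2)[OF m(2,4)] c_def[symmetric]
      by (rule vf.F_lipschitz[OF Y_S Y_S Y_S Y_S]) (use m in auto)
  next
    fix a h h' assume m: "a \<in> Hk k" "h \<in> Hk k" "h' \<in> Hk k"
    let ?t = "vnorm n (Yk k a) * max (vnorm n (Yk k a)) (max (vnorm n (Yk k h)) (vnorm n (Yk k h'))) * vnorm n (Yk k h - Yk k h')"
    have t: "c * ?t \<le> ?t" by (rule c2) (simp add: le_max_iff_disj)
    show "vnorm n (Yk k (a \<otimes> h) - Yk k a - Yk k h - (\<lambda>i. ?p * bil (Yk k a) (Yk k h) i) -
        (Yk k (a \<otimes> h') - Yk k a - Yk k h' - (\<lambda>i. ?p * bil (Yk k a) (Yk k h') i))) \<le> ?t"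
      unfolding prod(2)[OF m(1,2)] prod(2)[OF m(1,3)] F0_eq
      by (rule order_trans[OF vf.F_right(1)[OF Y_S[OF m(1)] Y_S[OF m(2)] Y_S[OF m(3)]] t])
    show "vnorm n (Yk k (h \<otimes> a) - Yk k h - Yk k a - (\<lambda>i. ?p * bil (Yk k h) (Yk k a) i) -
        (Yk k (h' \<otimes> a) - Yk k h' - Yk k a - (\<lambda>i. ?p * bil (Yk k h') (Yk k a) i))) \<le> ?t"
      unfolding prod(2)[OF m(2,1)] prod(2)[OF m(3,1)] F0_eq
      by (rule order_trans[OF vf.F_right(2)[OF Y_S[OF m(1)] Y_S[OF m(2)] Y_S[OF m(3)]] t])
  next
    fix u v :: "nat \<Rightarrow> 'p padic"
    have "c * (vnorm n u * vnorm n v) \<le> vnorm n u * vnorm n v" by (rule c2) simp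
    then show "vnorm n (\<lambda>i. ?p * bil u v i) \<le> vnorm n u * vnorm n v"
      unfolding F0_eq using vf.F0_norm[of u v] by linarith
  qed (simp_all add: bil_add bil_scale fun_eq_iff distrib_left mult_ac)
qed

text \<open>The finite sums of brackets form a subspace, since a scalar can be moved into the first
  argument. A unit vector outside it would be separated from it by a functional vanishing on all
  brackets, contrary to \<open>perfect\<close>.\<close>

lemma bra_spans:
  assumes ss: "semisimple_lie_group G M" and j: "j < n"
  shows "\<exists>(m::nat) u v. (\<forall>l<m. u l \<in> vspace n \<and> v l \<in> vspace n) \<and> unit_vec 1 j = (\<Sum>l<m. bra (u l) (v l))"
proof -
  let ?sm = "functional_smul :: 'p padic \<Rightarrow> (nat \<Rightarrow> 'p padic) \<Rightarrow> nat \<Rightarrow> 'p padic"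
  define S where "S = {w. \<exists>(m::nat) u v. (\<forall>l<m. u l \<in> vspace n \<and> v l \<in> vspace n) \<and> w = (\<Sum>l<m. bra (u l) (v l))}"
  have bra_scale: "bra (\<lambda>i. a * u i) v = (\<lambda>i. a * bra u v i)" for a u v
    by (auto simp: bra_def bil_def fun_eq_iff sum_distrib_left mult_ac right_diff_distrib)
  have S_sub: "module.subspace ?sm S"
    unfolding module.subspace_def[OF iffD2[OF module_iff_vector_space vector_space_functional_smul]]
  proof (intro conjI ballI allI)
    show "0 \<in> S" unfolding S_def by (intro CollectI exI[of _ 0]) simp
    fix w w' assume "w \<in> S" "w' \<in> S"
    then obtain m u v m' u' v' where w: "\<forall>l<m::nat. u l \<in> vspace n \<and> v l \<in> vspace n" "w = (\<Sum>l<m. bra (u l) (v l))"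
      and w': "\<forall>l<m'::nat. u' l \<in> vspace n \<and> v' l \<in> vspace n" "w' = (\<Sum>l<m'. bra (u' l) (v' l))" unfolding S_def by blast
    let ?u = "\<lambda>l. if l < m then u l else u' (l - m)" and ?v = "\<lambda>l. if l < m then v l else v' (l - m)"
    have "(\<Sum>l<m + m'. bra (?u l) (?v l)) = (\<Sum>l<m. bra (?u l) (?v l)) + (\<Sum>l=m..<m + m'. bra (?u l) (?v l))"
      unfolding lessThan_atLeast0 by (rule sum.atLeastLessThan_concat[symmetric]) auto
    also have "(\<Sum>l=m..<m + m'. bra (?u l) (?v l)) = (\<Sum>l<m'. bra (u' l) (v' l))"
      by (rule sum.reindex_bij_witness[of _ "\<lambda>l. l + m" "\<lambda>l. l - m"]) auto
    also have "(\<Sum>l<m. bra (?u l) (?v l)) = (\<Sum>l<m. bra (u l) (v l))" by (rule sum.cong) auto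
    finally have "w + w' = (\<Sum>l<m + m'. bra (?u l) (?v l))" unfolding w(2) w'(2) by (rule sym)
    moreover have "\<forall>l<m + m'. ?u l \<in> vspace n \<and> ?v l \<in> vspace n" using w(1) w'(1) by auto
    ultimately show "w + w' \<in> S"
      unfolding S_def by (intro CollectI exI[of _ "m + m'"] exI[of _ ?u] exI[of _ ?v] conjI)
  next
    fix a w assume "w \<in> S"
    then obtain m u v where w: "\<forall>l<m::nat. u l \<in> vspace n \<and> v l \<in> vspace n" "w = (\<Sum>l<m. bra (u l) (v l))" unfolding S_def by blast
    have "(\<Sum>l<m. (\<lambda>i. a * bra (u l) (v l) i)) = (\<lambda>i. a * (\<Sum>l<m. bra (u l) (v l)) i)"
      by (induction m) (auto simp: fun_eq_iff distrib_left)
    then have "(\<lambda>i. a * w i) = (\<Sum>l<m. bra (\<lambda>i. a * u l i) (v l))" unfolding w(2) bra_scale by (rule sym)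
    moreover have "\<forall>l<m. (\<lambda>i. a * u l i) \<in> vspace n \<and> v l \<in> vspace n" using w by (auto intro: vspace_scale)
    ultimately show "(\<lambda>i. a * w i) \<in> S" unfolding S_def by (intro CollectI exI[of _ m] exI[of _ "\<lambda>l i. a * u l i"] exI[of _ v] conjI)
  qed
  have "unit_vec 1 j \<in> S"
  proof (rule ccontr)
    let ?e = "unit_vec 1 j :: nat \<Rightarrow> 'p padic"
    assume no: "?e \<notin> S"
    obtain \<Lambda> where \<Lambda>: "\<And>x y. \<Lambda> (x + y) = \<Lambda> x + \<Lambda> y" "\<And>c x. \<Lambda> (\<lambda>i. c * x i) = c * \<Lambda> x" "\<And>x. x \<in> S \<Longrightarrow> \<Lambda> x = 0" "\<Lambda> ?e = 1"
      by (rule separating_functional[OF vector_space_functional_smul S_sub no]) (rule that)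
    have \<Lambda>_0: "\<Lambda> 0 = 0" using \<Lambda>(1)[of 0 0] by (simp only: add_0_left add_cancel_right_right)
    have \<Lambda>_sum_set: "\<Lambda> (sum F I) = (\<Sum>i\<in>I. \<Lambda> (F i))" for F :: "nat \<Rightarrow> nat \<Rightarrow> 'p padic" and I
      by (induction I rule: infinite_finite_induct) (simp_all only: sum.infinite sum.empty sum.insert not_False_eq_True \<Lambda>(1) \<Lambda>_0)
    define l where "l i = \<Lambda> (unit_vec 1 i)" for i
    have \<Lambda>_sum: "\<Lambda> u = (\<Sum>i<n. l i * u i)" if u: "u \<in> vspace n" for u
    proof -
      have sum_app: "sum F I i = (\<Sum>l\<in>I. F l i)" for F :: "nat \<Rightarrow> nat \<Rightarrow> 'p padic" and I i
        by (induction I rule: infinite_finite_induct) auto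
      have "u = (\<Sum>i<n. (\<lambda>k. u i * unit_vec 1 i k))"
      proof
        show "u k = (\<Sum>i<n. (\<lambda>k. u i * unit_vec 1 i k)) k" for k
          using vspaceD[OF u, of k] by (simp add: sum_app unit_vec_def mult_delta_right)
      qed
      then have "\<Lambda> u = \<Lambda> (\<Sum>i<n. (\<lambda>k. u i * unit_vec 1 i k))" by (rule arg_cong)
      also have "\<dots> = (\<Sum>i<n. u i * l i)" unfolding \<Lambda>_sum_set l_def by (simp only: \<Lambda>(2))
      finally show ?thesis by (simp add: mult.commute)
    qed
    have "l j = 0"
    proof (rule perfect[OF ss _ j])
      fix u v :: "nat \<Rightarrow> 'p padic" assume uv: "u \<in> vspace n" "v \<in> vspace n"
      have "bra u v \<in> S" unfolding S_def using uv by (intro CollectI exI[of _ 1] exI[of _ "\<lambda>_. u"] exI[of _ "\<lambda>_. v"]) simp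
      then have "\<Lambda> (bra u v) = 0" by (rule \<Lambda>(3))
      moreover have "bra u v \<in> vspace n" by (auto simp: vspace_def bra_def bil_def)
      ultimately show "(\<Sum>i<n. l i * bra u v i) = 0" using \<Lambda>_sum by simp
    qed
    then show False using \<Lambda>(4) by (simp add: l_def)
  qed
  then show ?thesis unfolding S_def by blast
qed

text \<open>The bracket expressions of all unit vectors are merged into one list of \<open>m\<close>
  pairs, and \<open>J l\<close> records the unit vector to which the pair \<open>l\<close> belongs.
  Multiplying \<open>v l\<close> by \<open>z (J l)\<close> is then a linear right inverse of the sum
  of brackets, with \<open>u l\<close> fixed and only the second entries depending on
  \<open>z\<close>.\<close>

lemma bra_right_inverse:
  assumes ss: "semisimple_lie_group G M"
  obtains m :: nat and u v J where "\<And>l. l < m \<Longrightarrow> u l \<in> vspace n" "\<And>l. l < m \<Longrightarrow> v l \<in> vspace n" "\<And>l. l < m \<Longrightarrow> J l < n"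
    "\<And>z. z \<in> vspace n \<Longrightarrow> (\<Sum>l<m. bra (u l) (\<lambda>i. z (J l) * v l i)) = z"
proof -
  have "\<forall>j. \<exists>t :: nat \<times> (nat \<Rightarrow> nat \<Rightarrow> 'p padic) \<times> (nat \<Rightarrow> nat \<Rightarrow> 'p padic). j < n \<longrightarrow>
      (\<forall>l<fst t. fst (snd t) l \<in> vspace n \<and> snd (snd t) l \<in> vspace n) \<and> unit_vec 1 j = (\<Sum>l<fst t. bra (fst (snd t) l) (snd (snd t) l))"
  proof
    fix j
    show "\<exists>t :: nat \<times> (nat \<Rightarrow> nat \<Rightarrow> 'p padic) \<times> (nat \<Rightarrow> nat \<Rightarrow> 'p padic). j < n \<longrightarrow>
      (\<forall>l<fst t. fst (snd t) l \<in> vspace n \<and> snd (snd t) l \<in> vspace n) \<and> unit_vec 1 j = (\<Sum>l<fst t. bra (fst (snd t) l) (snd (snd t) l))"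
    proof (cases "j < n")
      case True
      from bra_spans[OF ss this] show ?thesis
        by (elim exE) (rule_tac x = "(m, u, v)" in exI, simp)
    qed simp
  qed
  from choice[OF this] obtain t :: "nat \<Rightarrow> nat \<times> (nat \<Rightarrow> nat \<Rightarrow> 'p padic) \<times> (nat \<Rightarrow> nat \<Rightarrow> 'p padic)" where t: "\<forall>j. j < n \<longrightarrow>
      (\<forall>l<fst (t j). fst (snd (t j)) l \<in> vspace n \<and> snd (snd (t j)) l \<in> vspace n) \<and>
      unit_vec 1 j = (\<Sum>l<fst (t j). bra (fst (snd (t j)) l) (snd (snd (t j)) l))"
    by (rule exE)
  define mj uj vj where "mj j = fst (t j)" and "uj j = fst (snd (t j))" and "vj j = snd (snd (t j))" for j
  have uv: "\<And>j l. j < n \<Longrightarrow> l < mj j \<Longrightarrow> uj j l \<in> vspace n" "\<And>j l. j < n \<Longrightarrow> l < mj j \<Longrightarrow> vj j l \<in> vspace n"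
    and e: "\<And>j. j < n \<Longrightarrow> unit_vec 1 j = (\<Sum>l<mj j. bra (uj j l) (vj j l))"
    using t unfolding mj_def uj_def vj_def by blast+
  define I where "I = Sigma {..<n} (\<lambda>j. {..<mj j})"
  have "finite I" by (simp add: I_def)
  then obtain h where h: "bij_betw h {0..<card I} I" using ex_bij_betw_nat_finite by blast
  then have h': "bij_betw h {..<card I} I" by (simp add: lessThan_atLeast0)
  have hI: "h l \<in> I" if "l < card I" for l using bij_betwE[OF h'] that by blast
  have bra_scale: "bra u (\<lambda>i. a * v i) = (\<lambda>i. a * bra u v i)" for a u v
    by (auto simp: bra_def bil_def fun_eq_iff sum_distrib_left mult_ac right_diff_distrib)
  show ?thesis
  proof (rule that[of "card I" "\<lambda>l. uj (fst (h l)) (snd (h l))" "\<lambda>l. vj (fst (h l)) (snd (h l))" "\<lambda>l. fst (h l)"])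
    fix l assume "l < card I"
    from hI[OF this] show "uj (fst (h l)) (snd (h l)) \<in> vspace n" "vj (fst (h l)) (snd (h l)) \<in> vspace n" "fst (h l) < n"
      using uv by (auto simp: I_def)
  next
    fix z :: "nat \<Rightarrow> 'p padic" assume z: "z \<in> vspace n"
    have sum_app: "sum F A i = (\<Sum>l\<in>A. F l i)" for F :: "'c \<Rightarrow> nat \<Rightarrow> 'p padic" and A i
      by (induction A rule: infinite_finite_induct) auto
    have "(\<Sum>l<card I. bra (uj (fst (h l)) (snd (h l))) (\<lambda>i. z (fst (h l)) * vj (fst (h l)) (snd (h l)) i))
        = (\<Sum>x\<in>I. bra (uj (fst x) (snd x)) (\<lambda>i. z (fst x) * vj (fst x) (snd x) i))"
      by (rule sum.reindex_bij_betw[OF h'])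
    also have "\<dots> = (\<Sum>j<n. \<Sum>l<mj j. bra (uj j l) (\<lambda>i. z j * vj j l i))"
      unfolding I_def by (subst sum.Sigma) (auto simp: case_prod_unfold)
    also have "\<dots> = (\<Sum>j<n. unit_vec (z j) j)"
    proof (rule sum.cong[OF refl])
      fix j assume "j \<in> {..<n}"
      then have j: "j < n" by simp
      show "(\<Sum>l<mj j. bra (uj j l) (\<lambda>i. z j * vj j l i)) = unit_vec (z j) j"
      proof
        fix i
        have "(\<Sum>l<mj j. bra (uj j l) (\<lambda>i. z j * vj j l i)) i = z j * (\<Sum>l<mj j. bra (uj j l) (vj j l)) i"
          by (simp only: bra_scale sum_app sum_distrib_left)
        also have "\<dots> = z j * unit_vec 1 j i" by (simp only: e[OF j])
        finally show "(\<Sum>l<mj j. bra (uj j l) (\<lambda>i. z j * vj j l i)) i = unit_vec (z j) j i"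
          by (simp add: unit_vec_def)
      qed
    qed
    also have "\<dots> = z"
    proof
      show "(\<Sum>j<n. unit_vec (z j) j) k = z k" for k
        using vspaceD[OF z, of k] by (simp add: sum_app unit_vec_def)
    qed
    finally show "(\<Sum>l<card I. bra (uj (fst (h l)) (snd (h l))) (\<lambda>i. z (fst (h l)) * vj (fst (h l)) (snd (h l)) i)) = z" .
  qed
qed

end

lemma closure_of_meets:
  assumes x: "x \<in> X closure_of S" and W: "openin X W" "x \<in> W"
  obtains y where "y \<in> S" "y \<in> W"
proof -
  have "\<forall>T. x \<in> T \<and> openin X T \<longrightarrow> (\<exists>y. y \<in> S \<and> y \<in> T)" using x unfolding in_closure_of by (rule conjunct2)
  from this[rule_format, OF conjI[OF W(2,1)]] show ?thesis using that by (elim exE conjE)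
qed

section \<open>From a somewhere dense set of small image to a finite image\<close>

context lie_local
begin

lemma scaled_coordinates_exist:
  obtains k where "padic_norm (\<pi> ^ k :: 'p padic) < \<rho>" "std_group G n (Hk k) (Yk k) (\<lambda>u v i. \<pi> ^ k * bil u v i)"
proof -
  \<comment> \<open>This bound gives \<open>L * r1 < 1\<close>. The absolute value is taken because
    the sign of \<open>L\<close> is known only for positive \<open>n\<close>.\<close>
  define r1 where "r1 = min \<rho> (1 / (\<bar>L\<bar> + 1))"
  have r1: "0 < r1" "r1 \<le> \<rho>" "r1 \<le> 1 / (\<bar>L\<bar> + 1)" using \<rho> by (simp_all add: r1_def)
  have "L * r1 \<le> \<bar>L\<bar> * (1 / (\<bar>L\<bar> + 1))" using r1 by (intro mult_mono) auto
  also have "\<dots> < 1" by (simp add: pos_divide_less_eq)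
  finally have Lr1: "L * r1 < 1" .
  let ?W = "{x \<in> topspace X. inv x \<in> B r1}"
  have "openin X ?W"
    by (rule openin_continuous_map_preimage[OF inv_continuous B_open]) (use r1 \<rho> in auto)
  moreover have "\<one> \<in> ?W" using one_B[OF r1(1)] by (simp add: topspace_G)
  ultimately obtain r where r: "0 < r" "r \<le> r0" "B r \<subseteq> ?W" by (rule B_base)
  \<comment> \<open>Dominates both entries of the maximum in \<open>std_group_scaled\<close>,
    because the power of the norm of \<open>\<pi>\<close> occurring there is at most 1.\<close>
  define K where "K = \<bar>L\<bar> + 2 * \<bar>L\<bar> / \<rho> + 1"
  have K: "0 < K" "L \<le> K" using \<rho> by (auto simp: K_def add_nonneg_pos add_pos_nonneg intro: order_trans[OF abs_ge_self])
  let ?e = "padic_norm (\<pi> :: 'p padic)"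
  have "0 < min (min \<rho> r) (?e\<^sup>2 / K)" using \<rho> r K by simp
  then obtain k where "?e ^ k < min (min \<rho> r) (?e\<^sup>2 / K)" by (rule uniformizer_power_small)
  then have k: "?e ^ k < \<rho>" "?e ^ k < r" "?e ^ k * K < ?e\<^sup>2" using K by (auto simp: pos_less_divide_eq)
  have k1: "?e ^ k \<le> 1" by (rule power_le_one) (auto intro: less_imp_le)
  show ?thesis
  proof (rule that[OF _ std_group_scaled[OF _ _ _ r1(1,2) Lr1]])
    show "padic_norm (\<pi> ^ k :: 'p padic) < \<rho>" using k by (simp add: padic_norm_power)
    then show "padic_norm (\<pi> ^ k :: 'p padic) < \<rho>" .
    show "inv x \<in> V \<and> vnorm n (cd (inv x)) < r1" if "x \<in> Hk k" for x
    proof -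
      have "x \<in> B r" using that k by (auto simp: Hk_def B_def padic_norm_power)
      then show ?thesis using r(3) by (auto simp: B_def)
    qed
    have "2 * L / \<rho> \<le> 2 * \<bar>L\<bar> / \<rho>" using \<rho> by (intro divide_right_mono) auto
    then have "2 * L / \<rho> * ?e ^ k \<le> 2 * \<bar>L\<bar> / \<rho> * 1" using k1 \<rho> by (intro mult_mono) auto
    also have "\<dots> \<le> K" by (simp add: K_def)
    finally have "max L (2 * L / \<rho> * ?e ^ k) \<le> K" using K by simp
    then have "?e ^ k * max L (2 * L / \<rho> * ?e ^ k) \<le> ?e ^ k * K" by (intro mult_left_mono) auto
    then have "?e ^ k * max L (2 * L / \<rho> * ?e ^ k) \<le> ?e\<^sup>2" using k(3) by linarith
    then show "padic_norm (\<pi> ^ k :: 'p padic) * max L (2 * L / \<rho> * padic_norm (\<pi> ^ k :: 'p padic)) \<le> ?e\<^sup>2"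
      unfolding padic_norm_power .
  qed
qed

lemma closure_meets_identity_nbhd:
  assumes S: "S \<subseteq> carrier G" and cl: "h \<in> X closure_of S" and W: "openin X W" "\<one> \<in> W"
  obtains y where "y \<in> S" "inv h \<otimes> y \<in> W"
proof -
  have h: "h \<in> carrier G" using cl closure_of_subset_topspace topspace_G by fastforce
  have "openin X {t \<in> carrier G. inv h \<otimes> t \<in> W}" by (rule left_mult_open[OF W(1)]) (use h in simp)
  moreover have "h \<in> {t \<in> carrier G. inv h \<otimes> t \<in> W}" using h W by simp
  ultimately obtain y where "y \<in> S" "y \<in> {t \<in> carrier G. inv h \<otimes> t \<in> W}" by (rule closure_of_meets[OF cl])
  then show ?thesis by (intro that) auto
qed

text \<open>Countably many translates of a small ball of \<open>D\<close> cover \<open>f G\<close>, so Baire's theorem applies to their preimages.\<close>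

lemma small_image_somewhere_dense:
  assumes comp: "compact_space X" and sep: "separable_space T"
    and met: "Metric_space (carrier D) d" "Metric_space.mtopology (carrier D) d = T"
    and f: "f \<in> hom G D" and e: "e > 0"
  obtains c W where "c \<in> carrier D" "openin X W" "W \<noteq> {}" "W \<subseteq> X closure_of {x \<in> carrier G. d (f x) c < e}"
proof -
  interpret d: Metric_space "carrier D" d by (rule met(1))
  obtain C where C: "countable C" "C \<subseteq> carrier D" "T closure_of C = carrier D"
    using sep met(2) d.topspace_mtopology unfolding separable_space_def by metis
  let ?A = "\<lambda>c. {x \<in> carrier G. d (f x) c < e}"
  let ?\<G> = "(\<lambda>c. X closure_of ?A c) ` C"
  have fD: "f x \<in> carrier D" if "x \<in> carrier G" for x using f that by (rule hom_in_carrier)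
  have "carrier G \<subseteq> \<Union>?\<G>"
  proof
    fix x assume x: "x \<in> carrier G"
    then have "f x \<in> d.mtopology closure_of C" using fD C(3) met(2) by simp
    then obtain c where c: "c \<in> C" "c \<in> d.mball (f x) e" using e unfolding d.metric_closure_of by blast
    then have "x \<in> ?A c" using x by simp
    then have "x \<in> X closure_of ?A c" using closure_of_subset[of "?A c" X] topspace_G by blast
    then show "x \<in> \<Union>?\<G>" using c(1) by blast
  qed
  then have "\<Union>?\<G> = topspace X" using closure_of_subset_topspace topspace_G by fastforce
  then have "X interior_of \<Union>?\<G> = topspace X" using interior_of_topspace[of X] by (simp only:)
  then have ne: "X interior_of \<Union>?\<G> \<noteq> {}" using one_closed unfolding topspace_G by blast
  have "\<exists>c\<in>C. X interior_of (X closure_of ?A c) \<noteq> {}"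
  proof (rule ccontr)
    assume no: "\<not> ?thesis"
    have "X interior_of \<Union>?\<G> = {}"
    proof (rule Baire_category_alt)
      show "completely_metrizable_space X \<or> locally_compact_space X \<and> regular_space X"
        using compact_imp_locally_compact_space[OF comp] compact_Hausdorff_imp_regular_space[OF comp Hausdorff] by simp
      show "countable ?\<G>" using C(1) by simp
      show "closedin X S \<and> X interior_of S = {}" if "S \<in> ?\<G>" for S using no that by auto
    qed
    then show False using ne by simp
  qed
  then obtain c where c: "c \<in> C" "X interior_of (X closure_of ?A c) \<noteq> {}" by (elim bexE)
  show ?thesis
    by (rule that[of c "X interior_of (X closure_of ?A c)"]) (use c C(2) in \<open>auto simp: interior_of_subset\<close>)
qed

text \<open>Here the parts meet: the rescaled chart, density by Baire's theorem, the right inverse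
  of the brackets, continuity at the identity and the open kernel.\<close>

lemma trivial_near_one:
  fixes D :: "'d monoid"
  assumes comp: "compact_space X" and ss: "semisimple_lie_group G M"
    and D: "invariant_group D T" and hs: "hilbert_smith D T" and f: "f \<in> hom G D"
  obtains t where "0 < t" "t \<le> r0" "\<And>x. x \<in> B t \<Longrightarrow> f x = \<one>\<^bsub>D\<^esub>"
proof -
  obtain d where d: "Metric_space (carrier D) d" "Metric_space.mtopology (carrier D) d = T"
      "\<forall>x\<in>carrier D. \<forall>y\<in>carrier D. \<forall>z\<in>carrier D.
           d (z \<otimes>\<^bsub>D\<^esub> x) (z \<otimes>\<^bsub>D\<^esub> y) = d x y \<and> d (x \<otimes>\<^bsub>D\<^esub> z) (y \<otimes>\<^bsub>D\<^esub> z) = d x y"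
    using D unfolding invariant_group_def by (elim conjE exE)
  have gD: "group D" and sep: "separable_space T"
    using D unfolding invariant_group_def topological_group_def by blast+
  obtain k where k: "padic_norm (\<pi> ^ k :: 'p padic) < \<rho>"
    and std: "std_group G n (Hk k) (Yk k) (\<lambda>u v i. \<pi> ^ k * bil u v i)" by (rule scaled_coordinates_exist)
  define \<epsilon> where "\<epsilon> = padic_norm (\<pi> :: 'p padic)"
  define \<sigma> where "\<sigma> = padic_norm (\<pi> ^ k :: 'p padic)"
  have \<sigma>0: "0 < \<sigma>" by (simp add: \<sigma>_def)
  have \<sigma>1: "\<sigma> \<le> 1" unfolding \<sigma>_def padic_norm_power by (rule power_le_one) (auto intro: less_imp_le)
  have eps: "0 < \<epsilon>" "\<epsilon> \<le> 1" by (auto simp: \<epsilon>_def intro: less_imp_le)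
  interpret S: invariant_hom G n "Hk k" "Yk k" "\<lambda>u v i. \<pi> ^ k * bil u v i" "padic_norm (\<pi> :: 'p padic)" "vnorm n"
    "\<lambda>g h. Yk k (g \<otimes> h) - Yk k g - Yk k h" D d f
    by (intro invariant_hom.intro invariant_hom_axioms.intro std gD d(1) f) (use d(3) in blast)+
  have lev: "x \<in> S.lev (\<epsilon> ^ i) \<longleftrightarrow> x \<in> Hk k \<and> vnorm n (cd x) \<le> \<sigma> * \<epsilon> ^ i" for x i
    unfolding S.lev_def \<sigma>_def by (simp add: Yk_norm)
  have B_lev: "B t \<subseteq> S.lev (\<epsilon> ^ i)" if "t \<le> \<sigma> * \<epsilon> ^ i" for t i
  proof
    fix x assume x: "x \<in> B t"
    have "\<sigma> * \<epsilon> ^ i \<le> \<sigma> * 1" using \<sigma>0 eps by (intro mult_left_mono power_le_one) auto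
    moreover have "x \<in> V" "vnorm n (cd x) \<le> \<sigma> * \<epsilon> ^ i" using x that by (auto simp: B_def)
    ultimately show "x \<in> S.lev (\<epsilon> ^ i)"
      by (intro iffD2[OF lev] conjI) (simp_all add: Hk_def \<sigma>_def[symmetric])
  qed
  have small: "\<exists>t. 0 < t \<and> t \<le> r0 \<and> B t \<subseteq> S.lev (\<epsilon> ^ i)" for i
    using r0 \<sigma>0 eps B_lev[of "min r0 (\<sigma> * \<epsilon> ^ i)" i] by (intro exI[of _ "min r0 (\<sigma> * \<epsilon> ^ i)"]) simp
  \<comment> \<open>For \<open>g\<close> near the identity \<open>a \<otimes> g\<close> lies in
    \<open>W\<close>, so some \<open>y\<close> in the small-image set is close to it. Then
    \<open>inv a \<otimes> y\<close> is close to \<open>g\<close>, and its image has length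
    \<open>d (f y) (f a) < \<delta>\<close> by the triangle inequality through the centre
    \<open>c\<close>, whence the radius \<open>\<delta> / 2\<close>.\<close>
  have dense: "\<exists>j. \<forall>g\<in>S.lev (\<epsilon> ^ j). \<forall>i. \<exists>w\<in>Hk k. vnorm n (Yk k w - Yk k g) \<le> \<epsilon> ^ i \<and> S.len (f w) < \<delta>"
    if \<delta>: "\<delta> > 0" for \<delta>
  proof -
    obtain c W where c: "c \<in> carrier D" and W: "openin X W" "W \<noteq> {}" "W \<subseteq> X closure_of {x \<in> carrier G. d (f x) c < \<delta> / 2}"
      by (rule small_image_somewhere_dense[OF comp sep d(1,2) f half_gt_zero[OF \<delta>]])
    let ?A = "{x \<in> carrier G. d (f x) c < \<delta> / 2}"
    obtain x0 where x0: "x0 \<in> W" using W(2) by blast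
    obtain a where a: "a \<in> ?A" "a \<in> W" by (rule closure_of_meets[OF subsetD[OF W(3) x0] W(1) x0])
    then have aG: "a \<in> carrier G" by simp
    have "openin X {t \<in> carrier G. a \<otimes> t \<in> W}" by (rule left_mult_open[OF W(1) aG])
    moreover have "\<one> \<in> {t \<in> carrier G. a \<otimes> t \<in> W}" using a aG by simp
    ultimately obtain r where r: "0 < r" "r \<le> r0" "B r \<subseteq> {t \<in> carrier G. a \<otimes> t \<in> W}" by (rule B_base)
    obtain j where j: "\<epsilon> ^ j < r" using uniformizer_power_small[OF r(1)] unfolding \<epsilon>_def .
    show ?thesis
    proof (intro exI[of _ j] ballI allI)
      fix g i assume g: "g \<in> S.lev (\<epsilon> ^ j)"
      have "\<sigma> * \<epsilon> ^ j \<le> 1 * \<epsilon> ^ j" using \<sigma>1 eps by (intro mult_right_mono) auto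
      moreover have "g \<in> V" "vnorm n (cd g) \<le> \<sigma> * \<epsilon> ^ j" using iffD1[OF lev g] by (auto simp: Hk_def)
      ultimately have "g \<in> B r" using j unfolding B_def by simp
      then have gG: "g \<in> carrier G" and "a \<otimes> g \<in> W" using r(3) by auto
      then have cl: "a \<otimes> g \<in> X closure_of ?A" using W(3) by blast
      obtain s where s: "0 < s" "s \<le> r0" "B s \<subseteq> S.lev (\<epsilon> ^ i)" using small by blast
      obtain y where y: "y \<in> ?A" "inv (a \<otimes> g) \<otimes> y \<in> B s"
        by (rule closure_meets_identity_nbhd[OF _ cl B_open[OF s(1,2)] one_B[OF s(1)]]) auto
      then have yG: "y \<in> carrier G" by simp
      let ?h = "inv (a \<otimes> g) \<otimes> y" and ?w = "inv a \<otimes> y"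
      have gH: "g \<in> Hk k" using g lev by blast
      have h: "?h \<in> Hk k" "vnorm n (Yk k ?h) \<le> \<epsilon> ^ i" using y(2) s(3) unfolding S.lev_def by auto
      have w: "?w = g \<otimes> ?h" using aG gG yG by (simp add: inv_mult_group m_assoc[symmetric])
      show "\<exists>w\<in>Hk k. vnorm n (Yk k w - Yk k g) \<le> \<epsilon> ^ i \<and> S.len (f w) < \<delta>"
      proof (intro bexI[of _ ?w] conjI)
        show "?w \<in> Hk k" unfolding w using gH h(1) by (rule S.H_mult)
        have "vnorm n (Yk k (g \<otimes> ?h) - Yk k (g \<otimes> \<one>)) = vnorm n (Yk k ?h - Yk k \<one>)"
          by (rule S.isometry_left[OF gH h(1) S.H_one])
        then show "vnorm n (Yk k ?w - Yk k g) \<le> \<epsilon> ^ i" unfolding w S.Y_one using h(2) gG by simp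
        have fD: "f x \<in> carrier D" if "x \<in> carrier G" for x using f that by (rule hom_in_carrier)
        have "S.len (f ?w) = d (f y) (f a)"
          using S.d_eq_len[of "f y" "f a"] fD aG yG by simp
        also have "\<dots> \<le> d (f y) c + d (f a) c"
          using Metric_space.triangle[OF d(1), of "f y" c "f a"] Metric_space.commute[OF d(1), of c "f a"] fD aG yG c by simp
        also have "\<dots> < \<delta>" using a(1) y(1) by simp
        finally show "S.len (f ?w) < \<delta>" .
      qed
    qed
  qed
  obtain m :: nat and u v J where uvJ: "\<And>l. l < m \<Longrightarrow> u l \<in> vspace n" "\<And>l. l < m \<Longrightarrow> v l \<in> vspace n" "\<And>l. l < m \<Longrightarrow> J l < n"
    and span: "\<And>z. z \<in> vspace n \<Longrightarrow> (\<Sum>l<m. bra (u l) (\<lambda>i. z (J l) * v l i)) = z"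
    by (rule bra_right_inverse[OF ss]) (rule that)
  have scl: "bil (scl c u) v i = c * bil u v i" "bil u (scl c v) i = c * bil u v i" for c u v i
    by (auto simp: bil_def scl_def sum_distrib_left mult_ac)
  \<comment> \<open>The bilinear form of the rescaled group is \<open>\<pi> ^ k\<close> times
    \<open>bil\<close>. The factor is compensated in the first argument, where
    \<open>continuous_at_one\<close> admits vectors of any norm.\<close>
  have br: "S.br (scl (inverse (\<pi> ^ k)) x) y = bra x y" for x y
    unfolding S.br_def bra_def by (simp add: fun_eq_iff scl flip: mult.assoc)
  have cont: "\<exists>j. \<forall>h\<in>S.lev (padic_norm (\<pi> :: 'p padic) ^ j). S.len (f h) < e" if e: "e > 0" for e
  proof (rule S.continuous_at_one[where m = m and u = "\<lambda>l. scl (inverse (\<pi> ^ k)) (u l)" and v = v and J = J, OF _ _ uvJ(2,3) _ e])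
    show "\<exists>j. \<forall>g\<in>S.lev (padic_norm (\<pi> :: 'p padic) ^ j). \<forall>i. \<exists>w\<in>Hk k. vnorm n (Yk k w - Yk k g) \<le> padic_norm (\<pi> :: 'p padic) ^ i \<and> S.len (f w) < \<delta>"
      if "\<delta> > 0" for \<delta> using dense[OF that] unfolding \<epsilon>_def .
    show "scl (inverse (\<pi> ^ k)) (u l) \<in> vspace n" if "l < m" for l using uvJ(1)[OF that] by (rule scl_simps)
    show "(\<Sum>l<m. S.br (scl (inverse (\<pi> ^ k)) (u l)) (\<lambda>i. z (J l) * v l i)) = z" if "z \<in> vspace n" for z
      unfolding br by (rule span[OF that])
  qed
  have "\<exists>i. \<forall>h\<in>S.lev (\<epsilon> ^ i). f h = \<one>\<^bsub>D\<^esub>"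
    unfolding \<epsilon>_def by (rule S.open_kernel[OF d(2)[symmetric] hs]) (rule cont)
  then obtain i where i: "\<forall>h\<in>S.lev (\<epsilon> ^ i). f h = \<one>\<^bsub>D\<^esub>" by (elim exE)
  obtain t where "0 < t" "t \<le> r0" "B t \<subseteq> S.lev (\<epsilon> ^ i)" using small by blast
  then show ?thesis using that i by blast
qed

text \<open>\<open>f\<close> is constant on the left translates of \<open>B t\<close>, and by
  compactness finitely many of these open sets cover the group.\<close>

lemma finite_image_if_trivial_near_one:
  assumes comp: "compact_space X" and D: "group D" and f: "f \<in> hom G D"
    and t: "0 < t" "t \<le> r0" and triv: "\<And>x. x \<in> B t \<Longrightarrow> f x = \<one>\<^bsub>D\<^esub>"
  shows "finite (f ` carrier G)"
proof -
  interpret gh: group_hom G D f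
    by (intro group_hom.intro group_hom_axioms.intro is_group D f)
  let ?U = "\<lambda>g. {x \<in> carrier G. inv g \<otimes> x \<in> B t}"
  have "\<exists>\<F>. finite \<F> \<and> \<F> \<subseteq> ?U ` carrier G \<and> topspace X \<subseteq> \<Union>\<F>"
  proof (rule compact_space_alt[THEN iffD1, OF comp, rule_format], intro conjI ballI)
    show "openin X W" if "W \<in> ?U ` carrier G" for W
      using that left_mult_open[OF B_open[OF t]] by auto
    show "topspace X \<subseteq> \<Union>(?U ` carrier G)"
      using one_B[OF t(1)] by (auto simp: topspace_G intro!: bexI)
  qed
  then obtain \<F> where \<F>: "finite \<F>" "\<F> \<subseteq> ?U ` carrier G" "topspace X \<subseteq> \<Union>\<F>" by (elim exE conjE)
  obtain F where F: "F \<subseteq> carrier G" "finite F" "\<F> = ?U ` F"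
    using finite_subset_image[OF \<F>(1,2)] by (elim exE conjE)
  have "f ` carrier G \<subseteq> f ` F"
  proof (rule image_subsetI)
    fix x assume x: "x \<in> carrier G"
    then obtain g where g: "g \<in> F" "inv g \<otimes> x \<in> B t" using \<F>(3) unfolding F(3) topspace_G by blast
    then have gG: "g \<in> carrier G" using F(1) by blast
    have "f x = f (g \<otimes> (inv g \<otimes> x))" using x gG by (simp add: m_assoc[symmetric])
    also have "\<dots> = f g" using triv[OF g(2)] x gG by simp
    finally show "f x \<in> f ` F" using g(1) by simp
  qed
  then show ?thesis using F(2) by (rule finite_subset[OF _ finite_imageI])
qed

text \<open>The points on the first coordinate axis with coordinate \<open>\<pi> ^ (m0 + m)\<close>
  have pairwise different norms.\<close>

lemma infinite_carrier:
  assumes "1 \<le> n"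
  shows "infinite (carrier G)"
proof -
  have n: "0 < n" using assms by simp
  obtain m0 where m0: "padic_norm (\<pi> :: 'p padic) ^ m0 < r0" by (rule uniformizer_power_small[OF r0])
  define x where "x m = pt (unit_vec (\<pi> ^ (m0 + m)) 0)" for m
  have u: "vnorm n (unit_vec (\<pi> ^ (m0 + m) :: 'p padic) 0) < r0" for m
  proof -
    have "padic_norm (\<pi> :: 'p padic) ^ (m0 + m) \<le> padic_norm (\<pi> :: 'p padic) ^ m0"
      by (rule power_decreasing) (auto intro: less_imp_le)
    then show ?thesis using m0 unfolding unit_vec_vnorm_eq[OF n] padic_norm_power by (rule le_less_trans)
  qed
  have x: "x m \<in> V" "cd (x m) = unit_vec (\<pi> ^ (m0 + m)) 0" for m
    unfolding x_def using pt_ball[OF unit_vec_vspace[OF n] u] by auto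
  have "inj x"
  proof (rule injI)
    fix a b assume "x a = x b"
    then have "unit_vec (\<pi> ^ (m0 + a)) 0 = (unit_vec (\<pi> ^ (m0 + b)) 0 :: nat \<Rightarrow> 'p padic)" using x(2) by metis
    then have "vnorm n (unit_vec (\<pi> ^ (m0 + a) :: 'p padic) 0) = vnorm n (unit_vec (\<pi> ^ (m0 + b) :: 'p padic) 0)" by (rule arg_cong)
    then have "padic_norm (\<pi> :: 'p padic) ^ (m0 + a) = padic_norm (\<pi> :: 'p padic) ^ (m0 + b)"
      unfolding unit_vec_vnorm_eq[OF n] padic_norm_power .
    moreover have "0 < padic_norm (\<pi> :: 'p padic)" "padic_norm (\<pi> :: 'p padic) < 1" by simp_all
    ultimately show "a = b" by (metis add_left_cancel power_inject_exp' power_strict_decreasing_iff linorder_neq_iff)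
  qed
  moreover have "range x \<subseteq> carrier G" using x(1) V_carrier by blast
  ultimately show ?thesis by (meson finite_subset range_inj_infinite)
qed

end

theorem theorem7:
  fixes G :: "'g monoid" and M :: "('g, 'p::prime_card) padic_atlas"
    and D :: "'d monoid" and T :: "'d topology" and f :: "'g \<Rightarrow> 'd"
  assumes "padic_lie_group G M"
    and "compact_space (mfd_top M)"
    and "semisimple_lie_group G M"
    and "invariant_group D T"
    and "hilbert_smith D T"
    and "f \<in> hom G D"
  shows "finite (f ` carrier G) \<and> (mfd_dim M \<ge> 1 \<longrightarrow> \<not> inj_on f (carrier G))"
proof -
  have mfd: "padic_manifold M" and gG: "group G" and top: "topspace (mfd_top M) = carrier G"
    using assms(1) unfolding padic_lie_group_def by blast+
  have gD: "group D" using assms(4) unfolding invariant_group_def topological_group_def by blast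
  interpret padic_mfd M by (rule padic_mfd.intro[OF mfd])
  have one: "\<one>\<^bsub>G\<^esub> \<in> topspace (mfd_top M)" unfolding top by (rule monoid.one_closed[OF group.is_monoid[OF gG]])
  obtain V \<phi> where V: "(V, \<phi>) \<in> mfd_charts M" "\<one>\<^bsub>G\<^esub> \<in> V" using one by (rule chart_exists)
  obtain r0 where r0: "r0 > 0"
    "\<And>v. v \<in> vspace n \<Longrightarrow> vnorm n (v - \<phi> \<one>\<^bsub>G\<^esub>) < r0 \<Longrightarrow> \<exists>y\<in>V \<inter> topspace X. v = \<phi> y"
    "\<And>r. 0 < r \<Longrightarrow> r \<le> r0 \<Longrightarrow> openin X {x \<in> V. vnorm n (\<phi> x - \<phi> \<one>\<^bsub>G\<^esub>) < r}"
    "\<And>r. 0 < r \<Longrightarrow> r \<le> r0 \<Longrightarrow> openin X (topspace X - {x \<in> V. vnorm n (\<phi> x - \<phi> \<one>\<^bsub>G\<^esub>) < r})"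
    by (rule clopen_balls[OF assms(2) V openin_topspace one]) (rule that)
  interpret lie_chart M G V \<phi> r0
  proof (intro lie_chart.intro lie_chart_axioms.intro padic_mfd.intro mfd assms(1) V r0(1,3,4))
    show "\<exists>y\<in>V. v = \<phi> y" if "v \<in> vspace n" "vnorm n (v - \<phi> \<one>\<^bsub>G\<^esub>) < r0" for v using r0(2)[OF that] by blast
  qed
  obtain \<rho> L g where "lie_local_axioms M G V \<phi> r0 \<rho> L g"
    by (rule local_law) (rule that, rule lie_local_axioms.intro; assumption)
  then interpret lie_local M G V \<phi> r0 \<rho> L g
    by (intro lie_local.intro lie_chart_axioms)
  obtain t where t: "0 < t" "t \<le> r0" "\<And>x. x \<in> B t \<Longrightarrow> f x = \<one>\<^bsub>D\<^esub>"
    by (rule trivial_near_one[OF assms(2-6)]) (rule that)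
  have fin: "finite (f ` carrier G)"
    by (rule finite_image_if_trivial_near_one[OF assms(2) gD assms(6) t])
  moreover have "\<not> inj_on f (carrier G)" if "mfd_dim M \<ge> 1"
    using infinite_carrier[OF that] fin finite_imageD by blast
  ultimately show ?thesis by blast
qed

end
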